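(* For every $n\in\mathbb{Z}$, $n\neq0$, the transmission coefficients $T_n^\nu$ can be represented as $$T^1_n=\frac{-V_0(\psi_n)V_1(\theta_{\rm in})+V_1(\psi_n)V_0(\theta_{\rm in})\,e^{ikb(\psi_n^2-\theta_{\rm in}^2)/2}}{ika\,\psi_n(\theta_{\rm in}-\psi_n)},\qquad T^2_n=-T^1_n .$$
   Context: Let $0<b<a$ and let $k\in\mathbb{C}$ with $\operatorname{Re}k>0$ and (small) $\operatorname{Im}k>0$. Put $x_{2n}=an$, $x_{2n+1}=an+b$ for $n\in\mathbb{Z}$. Let $\mathcal{R}$ be the two-sheeted branched surface over the $(x,y)$-plane with branch points of order 2 at $(x_n,0)$, $n\in\mathbb{Z}$. Cut $\mathcal{R}$ along the half-lines $x=x_n$, $y<0$, into two sheets denoted $1_*$ and $2_*$; a function on $\mathcal{R}$ is then written $f(x,y,\nu_* )$, $\nu=1,2$. Crossing a cut exchanges the sheets: continuity on $\mathcal{R}$ means $f(x_n+0,y,\nu_* )=f(x_n-0,y,(3-\nu)_* )$ for $y<0$, while $f(\cdot,\cdot,\nu_* )$ is continuous across $x=x_n$, $y>0$. Alternatively $\mathcal{R}$ is cut along the segments $y=0$, $x_{2m}<x<x_{2m+1}$, into sheets $1,2$, and the function is written $f(x,y,\nu)$; the two notations are related by $f(x,y,\nu)=f(x,y,\nu_* )$ for $y>0$ and for $y<0$, $x_{2m+1}<x<x_{2m+2}$, and $f(x,y,\nu)=f(x,y,(3-\nu)_* )$ for $y<0$, $x_{2m}<x<x_{2m+1}$. The parabolic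 operator is $L=\partial_x+(2ik)^{-1}\partial_y^2$, and its Green's function on the plane is $G(x,y)=\sqrt{\frac{k}{2\pi i x}}\,e^{iky^2/(2x)}$ for $x>0$ (principal root), $G=0$ for $x<0$. Diffraction problem. Let $\theta_{\rm in}\in\mathbb{C}$, $\operatorname{Re}\theta_{\rm in}>0$, be such that $k\theta_{\rm in}^2$ is real and positive (so $\operatorname{Im}(k\theta_{\rm in})>0$). Put $\psi_n=\sqrt{\theta_{\rm in}^2+4\pi n/(ka)}$ with the branch for which $\operatorname{Im}(k\psi_n)>0$ (it is assumed that no $\psi_n$ vanishes); $\psi_0=\theta_{\rm in}$. The incident wave, present only in the upper half-plane $y>0$ of sheet $1$, is $u_{\rm in}=e^{-ikx\theta_{\rm in}^2/2-ik\theta_{\rm in}y}$. The total field $u$ is the solution of $L[u]=0$ on $\mathcal{R}$ which is continuous on $\mathcal{R}$ (except at the branch points), bounded near the branch points, satisfies the Floquet property $u(x+a,y,\nu)=e^{-ika\theta_{\rm in}^2/2}u(x,y,\nu)$, and is such that the scattered field $u_{\rm sc}$ (equal to $u-u_{\rm in}$ in the upper half-plane of sheet $1$ and to $u$ elsewhere) tends to $0$ as $|y|\to\infty$. The transmission coefficients $T_n^\nu$ are defined by the Floquet expansion $$u_{\rm sc}(x,y,\nu)=\sum_{n=-\infty}^\infty T_n^\nu\,e^{-ikx\psi_n^2/2-ik\psi_n y}\quad (y<0).$$ Edge Green's functions. $w_n(x,y,\nu_* )$, $n\in\mathbb{Z}$, is the field on $\mathcal{R}$ satisfying $L[w_n](x,y,\nu_*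 )=(-1)^{\nu-1}\delta(x-(x_n+0))\delta(y)$ and vanishing for $x<x_n$. Explicitly: $w_n(x,y,2_* )=-w_n(x,y,1_* )$; $w_n(x,y,1_* )=0$ for $x<x_n$; $w_n(x,y,1_* )=G(x-x_n,y)$ for $x_n<x<x_{n+1}$; and for $m>n$, $x_m<x<x_{m+1}$, $w_n(x,y,1_* )=\int_{-\infty}^\infty w_n(x_m+0,y',1_* )G(x-x_m,y-y')\,dy'$, where $w_n(x_m+0,y',1_* )=\operatorname{sign}(y')\,w_n(x_m-0,y',1_* )$. Directivities. $V_n(\theta)$ is defined for $\theta>0$ by $w_n(x,y,1_* )=V_n\!\left(\frac{y}{x-x_n}\right)G(x-x_n,y)+o(G(x-x_n,y))$ in $y>0$; at complex arguments $\theta$ (with $\operatorname{Im}(k\theta)>0$) it is given by its integral representation $$V_n(\theta)=1+2\sum_{m=n+1}^{\infty}e^{ik(x_m-x_n)\theta^2/2}\int_{-\infty}^{0}w_n(x_m+0,y,1_* )e^{-ik\theta y}\,dy.$$ *)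

theory Defs
  imports "HOL-Analysis.Analysis"
begin

definition node :: "real \<Rightarrow> real \<Rightarrow> int \<Rightarrow> real" where
  "node a b n = a * of_int (n div 2) + (if even n then 0 else b)"

(* A function on the branched surface is given in the notation belonging to the vertical cuts,
   f x y nu = f(x, y, nu_* ) with nu = 1, 2.  Points of a cut x = x_n, y < 0 are attributed
   to its left bank: f(x_n, y, nu_* ) stands for f(x_n - 0, y, nu_* ).  With this convention the
   triples (x, y, nu), (x, y) not a branch point, are in bijection with the points of the surface
   other than branch points.  Values at branch points are immaterial. *)
type_synonym surface_fun = "real \<Rightarrow> real \<Rightarrow> nat \<Rightarrow> complex"

definition branch_point :: "real \<Rightarrow> real \<Rightarrow> real \<Rightarrow> real \<Rightarrow> bool" where
  "branch_point a b x y \<longleftrightarrow> y = 0 \<and> x \<in> range (node a b)"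

(* The function f near the surface point (x0, y0, nu_* ), as a function of the plane coordinates
   (x, y) close to (x0, y0): passing from x <= x0 to x > x0 below a branch point exchanges
   the sheets. *)
definition local_rep ::
    "real \<Rightarrow> real \<Rightarrow> surface_fun \<Rightarrow> real \<Rightarrow> nat \<Rightarrow> real \<Rightarrow> real \<Rightarrow> complex" where
  "local_rep a b f x0 \<nu> x y =
     (if x0 \<in> range (node a b) \<and> x0 < x \<and> y < 0 then f x y (3 - \<nu>) else f x y \<nu>)"

definition surface_continuous :: "real \<Rightarrow> real \<Rightarrow> surface_fun \<Rightarrow> bool" where
  "surface_continuous a b f \<longleftrightarrow>
     (\<forall>x y. \<forall>\<nu>\<in>{1, 2}. \<not> branch_point a b x y \<longrightarrow>
        isCont (\<lambda>p. local_rep a b f x \<nu> (fst p) (snd p)) (x, y))"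

(* f is a classical solution of L[f] = g away from the branch points,
   L = d/dx + (2ik)^(-1) d^2/dy^2, the derivatives being taken in the local coordinates (x, y)
   of the surface and being continuous on it.  In the y-derivatives x is fixed, so that
   local_rep a b f x nu x y' is f x y' nu. *)
definition parabolic_eq ::
    "real \<Rightarrow> real \<Rightarrow> complex \<Rightarrow> surface_fun \<Rightarrow> surface_fun \<Rightarrow> bool" where
  "parabolic_eq a b k f g \<longleftrightarrow>
     (\<exists>fx fy fyy.
        surface_continuous a b fx \<and> surface_continuous a b fy \<and> surface_continuous a b fyy \<and>
        (\<forall>x y. \<forall>\<nu>\<in>{1, 2}. \<not> branch_point a b x y \<longrightarrow>
           ((\<lambda>x'. local_rep a b f x \<nu> x' y) has_vector_derivative fx x y \<nu>) (at x) \<and>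
           ((\<lambda>y'. f x y' \<nu>) has_vector_derivative fy x y \<nu>) (at y) \<and>
           ((\<lambda>y'. fy x y' \<nu>) has_vector_derivative fyy x y \<nu>) (at y) \<and>
           fx x y \<nu> + fyy x y \<nu> / (2 * \<i> * k) = g x y \<nu>))"

(* Passage from the sheets 1_*, 2_* (vertical cuts) to the sheets 1, 2 (cuts along the segments
   y = 0, x_{2m} < x < x_{2m+1}).  The right end point x_{2m+1} is included because of the
   left-bank convention; on a horizontal cut itself the value is that of the upper bank. *)
definition resheet :: "real \<Rightarrow> real \<Rightarrow> surface_fun \<Rightarrow> surface_fun" where
  "resheet a b f x y \<nu> =
     (if y < 0 \<and> (\<exists>m. node a b (2 * m) < x \<and> x \<le> node a b (2 * m + 1))
      then f x y (3 - \<nu>) else f x y \<nu>)"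

definition green :: "complex \<Rightarrow> real \<Rightarrow> real \<Rightarrow> complex" where
  "green k x y =
     (if 0 < x then csqrt (k / (2 * of_real pi * \<i> * of_real x))
                    * exp (\<i> * k * of_real (y\<^sup>2) / (2 * of_real x))
      else 0)"

definition psi :: "real \<Rightarrow> complex \<Rightarrow> complex \<Rightarrow> int \<Rightarrow> complex" where
  "psi a k \<theta> n =
     (let s = csqrt (\<theta>\<^sup>2 + 4 * of_real pi * of_int n / (k * of_real a))
      in if 0 < Im (k * s) then s else - s)"

definition incident :: "complex \<Rightarrow> complex \<Rightarrow> real \<Rightarrow> real \<Rightarrow> complex" where
  "incident k \<theta> x y = exp (- \<i> * k * of_real x * \<theta>\<^sup>2 / 2 - \<i> * k * \<theta> * of_real y)"

(* In terms of the sheets 1, 2, for u given in terms of the sheets 1_*, 2_*. *)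
definition scattered ::
    "real \<Rightarrow> real \<Rightarrow> complex \<Rightarrow> complex \<Rightarrow> surface_fun \<Rightarrow> surface_fun" where
  "scattered a b k \<theta> u x y \<nu> =
     (if 0 < y \<and> \<nu> = 1 then resheet a b u x y \<nu> - incident k \<theta> x y else resheet a b u x y \<nu>)"

definition total_field ::
    "real \<Rightarrow> real \<Rightarrow> complex \<Rightarrow> complex \<Rightarrow> surface_fun \<Rightarrow> bool" where
  "total_field a b k \<theta> u \<longleftrightarrow>
     parabolic_eq a b k u (\<lambda>x y \<nu>. 0) \<and>
     surface_continuous a b u \<and>
     (\<forall>n. \<forall>\<nu>\<in>{1, 2}. Bfun (\<lambda>p. u (fst p) (snd p) \<nu>) (at (node a b n, 0))) \<and>
     (\<forall>x y. \<forall>\<nu>\<in>{1, 2}. \<not> branch_point a b x y \<longrightarrow>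
        resheet a b u (x + a) y \<nu> =
          exp (- \<i> * k * of_real a * \<theta>\<^sup>2 / 2) * resheet a b u x y \<nu>) \<and>
     (\<forall>\<nu>\<in>{1, 2}. ((\<lambda>p. scattered a b k \<theta> u (fst p) (snd p) \<nu>) \<longlongrightarrow> 0)
                   (filtercomap (\<lambda>p. \<bar>snd p\<bar>) at_top))"

definition transmission_coefficients ::
    "real \<Rightarrow> real \<Rightarrow> complex \<Rightarrow> complex \<Rightarrow> surface_fun \<Rightarrow> (nat \<Rightarrow> int \<Rightarrow> complex) \<Rightarrow> bool" where
  "transmission_coefficients a b k \<theta> u T \<longleftrightarrow>
     (\<forall>x y. \<forall>\<nu>\<in>{1, 2}. y < 0 \<longrightarrow>
        ((\<lambda>n. T \<nu> n * exp (- \<i> * k * of_real x * (psi a k \<theta> n)\<^sup>2 / 2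
                            - \<i> * k * psi a k \<theta> n * of_real y))
          has_sum scattered a b k \<theta> u x y \<nu>) UNIV)"

(* w_n(x, y, 1_* ) for x_{n+j} < x <= x_{n+j+1}; at the right end point this is the
   limit w_n(x_{n+j+1} - 0, y, 1_* ). *)
fun edge_strip ::
    "real \<Rightarrow> real \<Rightarrow> complex \<Rightarrow> int \<Rightarrow> nat \<Rightarrow> real \<Rightarrow> real \<Rightarrow> complex" where
  "edge_strip a b k n 0 x y = green k (x - node a b n) y"
| "edge_strip a b k n (Suc j) x y =
     (let xm = node a b (n + int (Suc j))
      in LINT y'|lborel. of_real (sgn y') * edge_strip a b k n j xm y' * green k (x - xm) (y - y'))"

definition edge_green :: "real \<Rightarrow> real \<Rightarrow> complex \<Rightarrow> int \<Rightarrow> surface_fun" where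
  "edge_green a b k n x y \<nu> =
     (-1) ^ (\<nu> - 1) *
     (if x \<le> node a b n then 0
      else edge_strip a b k n
             (THE j. node a b (n + int j) < x \<and> x \<le> node a b (n + int j + 1)) x y)"

(* w_n(x_m + 0, y, 1_* ) for m > n. *)
definition edge_green_right ::
    "real \<Rightarrow> real \<Rightarrow> complex \<Rightarrow> int \<Rightarrow> int \<Rightarrow> real \<Rightarrow> complex" where
  "edge_green_right a b k n m y = of_real (sgn y) * edge_green a b k n (node a b m) y 1"

definition directivity :: "real \<Rightarrow> real \<Rightarrow> complex \<Rightarrow> int \<Rightarrow> complex \<Rightarrow> complex" where
  "directivity a b k n \<theta> =
     1 + 2 * (\<Sum>j. let m = n + 1 + int j in
       exp (\<i> * k * of_real (node a b m - node a b n) * \<theta>\<^sup>2 / 2) *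
       (LINT y:{..<0}|lborel. edge_green_right a b k n m y * exp (- \<i> * k * \<theta> * of_real y)))"

end

theory Submission
 imports Defs "HOL-Probability.Distributions" "HOL-Probability.Sinc_Integral" "HOL-Real_Asymp.Real_Asymp"
begin

text \<open>
The variable \<open>x\<close> plays the role of time.  Between two nodes the field is carried by the heat operator
\<open>heat k t\<close>, the convolution with Green's function, of complex diffusivity \<open>\<i> / (2 k)\<close>; this is the
uniqueness theorem \<open>heat_representation\<close>.  At a node the two sheets are exchanged below the axis: the sum
of the sheets passes unchanged, and their difference is multiplied by the sign function \<open>sg\<close>.  The values
\<open>v0\<close>, \<open>v1\<close> of the difference at the nodes \<open>0\<close> and \<open>b\<close> therefore satisfy (\<open>slices\<close>)

 \<open>v1 = heat k b (sg v0)\<close>,  \<open>v0 = \<zeta> heat k (a - b) (sg v1)\<close>,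

where the Floquet factor \<open>\<zeta>\<close> has modulus 1, and is not 1 because no \<open>psi\<close> vanishes.  The sum of the sheets
satisfies the same recursion without the signs and is just the incident wave (\<open>comb_sum_incident\<close>); this
gives \<open>T 2 n = - T 1 n\<close>.

The analysis of the recursion rests on an energy estimate.  Since \<open>Im k > 0\<close>, the adjoint of the heat
operator times the heat operator has a real positive Gaussian kernel (\<open>green_conv_cnj\<close>), so the energy lost
in a step bounds the change of the function, and the same holds for the period operator \<open>P\<close>
(\<open>period_defect\<close>).  Consequently \<open>1 - \<zeta> P\<close> is bounded below (\<open>period_resolvent_bound\<close>), bounded solutions
are square integrable (\<open>bounded_resolvent_L2\<close>), and the numbers \<open>\<langle>P\<^sup>n f, h\<rangle>\<close> have bounded variation and
tend to zero, so that their power series converges at \<open>\<zeta>\<close> (\<open>summable_P_pow\<close>).  The directivities are such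
power series (\<open>directivity_series\<close>), with \<open>h\<close> an exponential on a half line.

The embedding formula comes from the operator \<open>\<partial>\<^sub>y + \<i> k \<theta>\<close>.  It annihilates the incident wave and commutes
with the heat flow, but differentiating \<open>sg v\<close> creates a point source of strength \<open>2 v(0)\<close>
(\<open>heat_sg_deriv\<close>).  Applied to \<open>v0\<close>, \<open>v1\<close> it produces a combination of the two edge Green's functions with
the coefficients \<open>v0(0)\<close>, \<open>v1(0)\<close>, and by the symmetry of the kernels these coefficients are themselves
directivities in the direction \<open>\<theta>\<close> (\<open>v1_at_edge\<close>).  Pairing with the exponential of direction \<open>\<psi>\<close> gives the
products of directivities in \<open>embedding_formula\<close>.

Finally, \<open>T 1 n\<close> is a Fourier coefficient of the field on a line below the axis (\<open>fourier_coefficient\<close>).  The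
conserved current between the field and a decaying mode of the adjoint equation (\<open>strip_mode_flux\<close>) expresses
it through the slices \<open>v0\<close>, \<open>v1\<close> on the upper half line, which is the quantity of the embedding formula
(\<open>mode_integral\<close>).
\<close>

section \<open>Gaussian integrals\<close>

lemma integrable_gaussian:
 fixes \<alpha> :: real assumes "0 < \<alpha>"
 shows "integrable lborel (\<lambda>s. exp (- \<alpha> * s\<^sup>2))"
proof -
 define \<sigma> where "\<sigma> = 1 / sqrt (2 * \<alpha>)"
 have s: "0 < \<sigma>" "2 * \<sigma>\<^sup>2 = 1 / \<alpha>" using assms by (auto simp: \<sigma>_def power_divide)
 have "integrable lborel (\<lambda>s. sqrt (2 * pi * \<sigma>\<^sup>2) * normal_density 0 \<sigma> s)"
  using s by (intro integrable_mult_right) simp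
 also have "(\<lambda>s. sqrt (2 * pi * \<sigma>\<^sup>2) * normal_density 0 \<sigma> s) = (\<lambda>s. exp (- \<alpha> * s\<^sup>2))"
  using s assms by (auto simp: normal_density_def field_simps)
 finally show ?thesis .
qed

lemma integrable_gaussian_exp:
 fixes \<alpha> c :: real assumes "0 < \<alpha>"
 shows "integrable lborel (\<lambda>s. exp (c * \<bar>s\<bar> - \<alpha> * s\<^sup>2))"
proof (rule Bochner_Integration.integrable_bound)
 show "integrable lborel (\<lambda>s. exp (c\<^sup>2 / (2 * \<alpha>)) * exp (- (\<alpha> / 2) * s\<^sup>2))"
  using assms by (intro integrable_mult_right integrable_gaussian) simp
 show "AE s in lborel. norm (exp (c * \<bar>s\<bar> - \<alpha> * s\<^sup>2))
     \<le> norm (exp (c\<^sup>2 / (2 * \<alpha>)) * exp (- (\<alpha> / 2) * s\<^sup>2))"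
 proof (intro AE_I2)
  fix s :: real
  have "0 \<le> (c - \<alpha> * \<bar>s\<bar>)\<^sup>2 / (2 * \<alpha>)" using assms by simp
  also have "\<dots> = c\<^sup>2 / (2 * \<alpha>) + \<alpha> / 2 * s\<^sup>2 - c * \<bar>s\<bar>"
   using assms by (simp add: power2_eq_square field_simps)
  finally show "norm (exp (c * \<bar>s\<bar> - \<alpha> * s\<^sup>2))
     \<le> norm (exp (c\<^sup>2 / (2 * \<alpha>)) * exp (- (\<alpha> / 2) * s\<^sup>2))"
   by (simp flip: exp_add)
 qed
qed measurable

lemma integrable_gaussian_bound:
 fixes \<phi> :: "real => 'a::{banach,second_countable_topology}"
 assumes "0 < \<alpha>" "\<phi> \<in> borel_measurable borel"
  and "\<And>s. norm (\<phi> s) \<le> C * exp (c * \<bar>s\<bar> - \<alpha> * s\<^sup>2)"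
 shows "integrable lborel \<phi>"
proof (rule Bochner_Integration.integrable_bound)
 show "integrable lborel (\<lambda>s. C * exp (c * \<bar>s\<bar> - \<alpha> * s\<^sup>2))"
  using assms(1) by (intro integrable_mult_right integrable_gaussian_exp)
 show "AE s in lborel. norm (\<phi> s) \<le> norm (C * exp (c * \<bar>s\<bar> - \<alpha> * s\<^sup>2))"
  using assms(3) by (intro AE_I2) (metis abs_ge_self order_trans real_norm_def)
qed (use assms(2) in auto)

lemma power_le_exp: "\<bar>s::real\<bar> ^ n \<le> fact n * exp \<bar>s\<bar>"
proof -
 have "\<bar>s\<bar> ^ n / fact n \<le> exp \<bar>s\<bar>"
 proof -
  have e: "(\<lambda>m. \<bar>s\<bar> ^ m / fact m) sums exp \<bar>s\<bar>"
   using exp_converges[of "\<bar>s\<bar>"] by (simp add: divide_inverse mult.commute)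
  have "(\<Sum>m\<in>{n}. \<bar>s\<bar> ^ m / fact m) \<le> (\<Sum>m. \<bar>s\<bar> ^ m / fact m)"
   by (rule sum_le_suminf) (use e sums_summable in auto)
  then show ?thesis using sums_unique[OF e] by simp
 qed
 then show ?thesis by (simp add: field_simps)
qed

lemma norm_integral_le:
 fixes f :: "'a => 'b::{banach,second_countable_topology}"
 assumes "f \<in> borel_measurable M" "integrable M h" "\<And>x. norm (f x) \<le> h x"
 shows "norm (integral\<^sup>L M f) \<le> integral\<^sup>L M h"
proof -
 have "integrable M f"
  using assms by (intro Bochner_Integration.integrable_bound[OF assms(2)]) (auto intro!: AE_I2 order_trans[OF assms(3)])
 then have "norm (integral\<^sup>L M f) \<le> (\<integral>x. norm (f x) \<partial>M)" by (intro integral_norm_bound)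
 also have "\<dots> \<le> integral\<^sup>L M h" using \<open>integrable M f\<close> assms by (intro integral_mono) auto
 finally show ?thesis .
qed

text \<open>Derivatives of Laplace type integrals are bounded by the explicit second order remainder of
 the exponential, so that no limit has to be exchanged with the integral.\<close>

lemma has_field_derivative_exp_integral:
 fixes \<rho> :: "real => real" and \<phi> :: "real => complex" and B :: complex and \<delta> :: real
 assumes [measurable]: "\<rho> \<in> borel_measurable borel" "\<phi> \<in> borel_measurable borel"
  and i0: "integrable lborel (\<lambda>s. exp (B * of_real (\<rho> s)) * \<phi> s)"
  and i1: "integrable lborel (\<lambda>s. of_real (\<rho> s) * (exp (B * of_real (\<rho> s)) * \<phi> s))"
  and \<delta>: "0 < \<delta>"
  and i2: "integrable lborel (\<lambda>s. (\<rho> s)\<^sup>2 * exp (\<delta> * \<bar>\<rho> s\<bar>) * norm (exp (B * of_real (\<rho> s)) * \<phi> s))"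
 shows "((\<lambda>B. LINT s|lborel. exp (B * of_real (\<rho> s)) * \<phi> s) has_field_derivative
      (LINT s|lborel. of_real (\<rho> s) * (exp (B * of_real (\<rho> s)) * \<phi> s))) (at B)"
proof -
 let ?L = "\<lambda>B. LINT s|lborel. exp (B * of_real (\<rho> s)) * \<phi> s"
 let ?D = "LINT s|lborel. of_real (\<rho> s) * (exp (B * of_real (\<rho> s)) * \<phi> s)"
 let ?M = "LINT s|lborel. (\<rho> s)\<^sup>2 * exp (\<delta> * \<bar>\<rho> s\<bar>) * norm (exp (B * of_real (\<rho> s)) * \<phi> s)"
 define g where "g s = exp (B * of_real (\<rho> s)) * \<phi> s" for s
 have key: "norm ((?L (B + h) - ?L B) / h - ?D) \<le> norm h * ?M" if h: "h \<noteq> 0" "norm h < \<delta>" for h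
 proof -
  have pt: "norm ((exp (h * of_real (\<rho> s)) - 1 - h * of_real (\<rho> s)) * g s)
        \<le> (norm h)\<^sup>2 * ((\<rho> s)\<^sup>2 * exp (\<delta> * \<bar>\<rho> s\<bar>) * norm (g s))" for s
  proof -
   have "norm (exp (h * of_real (\<rho> s)) - 1 - h * of_real (\<rho> s))
      \<le> exp (norm (h * of_real (\<rho> s))) * (norm (h * of_real (\<rho> s)))\<^sup>2"
    using Taylor_exp_field[of "h * of_real (\<rho> s)" 1] by (simp add: numeral_2_eq_2 algebra_simps)
   also have "\<dots> \<le> exp (\<delta> * \<bar>\<rho> s\<bar>) * (norm (h * of_real (\<rho> s)))\<^sup>2"
    using h by (intro mult_right_mono) (auto simp: norm_mult intro!: mult_right_mono)
   also have "\<dots> = (norm h)\<^sup>2 * ((\<rho> s)\<^sup>2 * exp (\<delta> * \<bar>\<rho> s\<bar>))"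
    by (simp add: norm_mult power_mult_distrib)
   finally have "norm (exp (h * of_real (\<rho> s)) - 1 - h * of_real (\<rho> s)) * norm (g s)
     \<le> (norm h)\<^sup>2 * ((\<rho> s)\<^sup>2 * exp (\<delta> * \<bar>\<rho> s\<bar>)) * norm (g s)"
    by (rule mult_right_mono) simp
   then show ?thesis by (simp add: norm_mult mult.assoc)
  qed
  have bnd: "integrable lborel (\<lambda>s. (norm h)\<^sup>2 * ((\<rho> s)\<^sup>2 * exp (\<delta> * \<bar>\<rho> s\<bar>) * norm (g s)))"
   using i2 by (intro integrable_mult_right) (simp add: g_def)
  have ir: "integrable lborel (\<lambda>s. (exp (h * of_real (\<rho> s)) - 1 - h * of_real (\<rho> s)) * g s)"
   by (rule Bochner_Integration.integrable_bound[OF bnd])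
     (use pt in \<open>auto intro!: AE_I2 simp: g_def\<close>)
  have i0': "integrable lborel g" and i1': "integrable lborel (\<lambda>s. of_real (\<rho> s) * g s)"
   using i0 i1 by (auto simp: g_def[abs_def])
  have e: "exp ((B + h) * of_real (\<rho> s)) * \<phi> s
    = (exp (h * of_real (\<rho> s)) - 1 - h * of_real (\<rho> s)) * g s + (g s + h * (of_real (\<rho> s) * g s))" for s
   by (simp add: g_def algebra_simps exp_add)
  have "?L (B + h) = (LINT s|lborel. (exp (h * of_real (\<rho> s)) - 1 - h * of_real (\<rho> s)) * g s)
           + (?L B + h * ?D)"
   unfolding e using ir i0' i1'
   by (simp add: g_def[symmetric])
  then have "(?L (B + h) - ?L B) / h - ?D
    = (LINT s|lborel. (exp (h * of_real (\<rho> s)) - 1 - h * of_real (\<rho> s)) * g s) / h"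
   using h by (simp add: field_simps)
  also have "norm \<dots> \<le> (norm h)\<^sup>2 * ?M / norm h"
  proof -
   have "norm (LINT s|lborel. (exp (h * of_real (\<rho> s)) - 1 - h * of_real (\<rho> s)) * g s)
     \<le> (LINT s|lborel. (norm h)\<^sup>2 * ((\<rho> s)\<^sup>2 * exp (\<delta> * \<bar>\<rho> s\<bar>) * norm (g s)))"
    using bnd pt by (intro norm_integral_le) (auto simp: g_def)
   then show ?thesis by (simp add: norm_divide g_def divide_right_mono)
  qed
  finally show ?thesis using h by (simp add: power2_eq_square)
 qed
 have "((\<lambda>h. (?L (B + h) - ?L B) / h - ?D) \<longlongrightarrow> 0) (at 0)"
 proof (rule Lim_null_comparison)
  show "\<forall>\<^sub>F h in at 0. norm ((?L (B + h) - ?L B) / h - ?D) \<le> norm h * ?M"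
   using key \<delta> by (auto simp: eventually_at intro!: exI[of _ \<delta>])
  show "((\<lambda>h. norm h * ?M) \<longlongrightarrow> 0) (at (0::complex))"
   by (auto intro!: tendsto_eq_intros)
 qed
 then show ?thesis unfolding DERIV_def by (simp add: LIM_zero_iff)
qed

text \<open>The form in which the fundamental theorem is used: no boundary terms at infinity.\<close>

lemma integral_derivative_eq_0:
 fixes F f :: "real => complex"
 assumes "\<And>x. (F has_vector_derivative f x) (at x)" "continuous_on UNIV f" "integrable lborel f"
  and "(F \<longlongrightarrow> 0) at_top" "(F \<longlongrightarrow> 0) at_bot"
 shows "(LINT x|lborel. f x) = 0"
proof -
 have "(LBINT x=-\<infinity>..\<infinity>. f x) = 0 - 0"
  using assms by (intro interval_integral_FTC_integrable[where F=F])
   (auto simp: ereal_tendsto_simps set_integrable_def einterval_def continuous_on_eq_continuous_at)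
 then show ?thesis by (simp add: interval_integral_to_infinity_eq interval_lebesgue_integral_def einterval_def set_lebesgue_integral_def)
qed

lemma integral_derivative_half_line:
 fixes F f :: "real => complex"
 assumes "\<And>x. (F has_vector_derivative f x) (at x)" "continuous_on UNIV f"
  and "set_integrable lborel {0<..} f" "(F \<longlongrightarrow> 0) at_top"
 shows "(LINT x:{0<..}|lborel. f x) = - F 0"
proof -
 have c: "continuous_on UNIV F"
  using assms(1) by (auto intro!: continuous_at_imp_continuous_on has_vector_derivative_continuous)
 have "(F \<longlongrightarrow> F 0) (at_right 0)"
  using c by (auto simp: continuous_on_eq_continuous_at isCont_def intro: tendsto_within_subset)
 then have "((F \<circ> real_of_ereal) \<longlongrightarrow> F 0) (at_right (ereal 0))"
  by (subst ereal_tendsto_simps) simp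
 then have "(LBINT x=ereal 0..\<infinity>. f x) = 0 - F 0"
  using assms by (intro interval_integral_FTC_integrable[where F=F])
   (auto simp: ereal_tendsto_simps set_integrable_def einterval_def continuous_on_eq_continuous_at greaterThan_def)
 then show ?thesis by (simp add: interval_integral_to_infinity_eq)
qed

lemma exp_quadratic_bound:
 fixes z B :: complex and s :: real
 shows "norm (exp (B * of_real s - z * of_real (s\<^sup>2))) \<le> exp (norm B * \<bar>s\<bar> - Re z * s\<^sup>2)"
proof -
 have "Re B * s \<le> norm B * \<bar>s\<bar>"
  using mult_right_mono[OF abs_Re_le_cmod[of B], of "\<bar>s\<bar>"] abs_ge_self[of "Re B * s"]
  by (simp add: abs_mult)
 then show ?thesis by (simp add: norm_exp_eq_Re)
qed

lemma power_exp_quadratic_bound: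
 fixes z B :: complex and s :: real
 shows "\<bar>s\<bar> ^ n * norm (exp (B * of_real s - z * of_real (s\<^sup>2)))
  \<le> fact n * exp ((1 + norm B) * \<bar>s\<bar> - Re z * s\<^sup>2)"
proof -
 have "\<bar>s\<bar> ^ n * norm (exp (B * of_real s - z * of_real (s\<^sup>2)))
   \<le> (fact n * exp \<bar>s\<bar>) * exp (norm B * \<bar>s\<bar> - Re z * s\<^sup>2)"
  by (intro mult_mono power_le_exp exp_quadratic_bound) auto
 also have "\<dots> = fact n * exp ((1 + norm B) * \<bar>s\<bar> - Re z * s\<^sup>2)"
  by (simp add: algebra_simps flip: exp_add)
 finally show ?thesis .
qed

lemma integrable_power_exp_quadratic:
 fixes z B :: complex
 assumes "0 < Re z"
 shows "integrable lborel (\<lambda>s. of_real s ^ n * exp (B * of_real s - z * of_real (s\<^sup>2)))"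
 by (rule integrable_gaussian_bound[where \<alpha>="Re z" and C="fact n" and c="1 + norm B"])
   (use assms power_exp_quadratic_bound in \<open>auto simp: norm_mult norm_power\<close>)

lemma filterlim_at_top_at_bot_abs:
 "filterlim (abs :: real => real) at_top at_top" "filterlim (abs :: real => real) at_top at_bot"
 by real_asymp+

lemma exp_quadratic_tendsto_0:
 fixes z B :: complex
 assumes "0 < Re z" and F: "F = at_top \<or> F = at_bot"
 shows "((\<lambda>s. of_real s ^ n * exp (B * of_real s - z * of_real (s\<^sup>2))) \<longlongrightarrow> 0) F"
proof (rule Lim_null_comparison)
 show "\<forall>\<^sub>F s in F. norm (of_real s ^ n * exp (B * of_real s - z * of_real (s\<^sup>2)))
     \<le> fact n * exp (\<bar>s\<bar> * ((1 + norm B) - Re z * \<bar>s\<bar>))"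
  using power_exp_quadratic_bound[where n=n and B=B and z=z]
  by (intro always_eventually allI) (auto simp: norm_mult norm_power power2_eq_square algebra_simps)
 have a: "filterlim abs at_top F"
  using F filterlim_at_top_at_bot_abs by blast
 have "filterlim (\<lambda>x::real. x * ((1 + norm B) - Re z * x)) at_bot at_top"
  using assms(1) by real_asymp
 then have "filterlim (\<lambda>s. \<bar>s\<bar> * ((1 + norm B) - Re z * \<bar>s\<bar>)) at_bot F"
  by (rule filterlim_compose[OF _ a])
 then have "((\<lambda>s. exp (\<bar>s\<bar> * ((1 + norm B) - Re z * \<bar>s\<bar>))) \<longlongrightarrow> 0) F"
  by (rule filterlim_compose[OF exp_at_bot])
 then show "((\<lambda>s. fact n * exp (\<bar>s\<bar> * ((1 + norm B) - Re z * \<bar>s\<bar>))) \<longlongrightarrow> 0) F"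
  by (auto intro: tendsto_mult_right_zero)
qed

definition gauss_integral :: "complex => complex => complex" where
 "gauss_integral z B = (LINT s|lborel. exp (B * of_real s - z * of_real (s\<^sup>2)))"

text \<open>Integration by parts turns the derivative under the integral into a multiple of the integral, and the
 Gaussian integrals with complex coefficients are found by solving the resulting linear differential
 equations from the real case.\<close>

lemma gauss_integral_deriv_linear:
 assumes z: "0 < Re z"
 shows "((\<lambda>B. gauss_integral z B) has_field_derivative B / (2 * z) * gauss_integral z B) (at B)"
proof -
 let ?e = "\<lambda>s::real. exp (B * of_real s - z * of_real (s\<^sup>2))"
 have z0: "z \<noteq> 0" using z by auto
 have i: "integrable lborel (\<lambda>s. of_real s ^ n * ?e s)" for n
  using integrable_power_exp_quadratic[OF z] .
 have ex: "exp (B * of_real s) * exp (- z * of_real (s\<^sup>2)) = exp (B * of_real s - z * of_real (s\<^sup>2))"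
  for s :: real and B by (simp flip: exp_add)
 have "((\<lambda>B. LINT s|lborel. exp (B * of_real s) * exp (- z * of_real (s\<^sup>2))) has_field_derivative
   (LINT s|lborel. of_real s * (exp (B * of_real s) * exp (- z * of_real (s\<^sup>2))))) (at B)"
 proof (rule has_field_derivative_exp_integral[where \<delta>=1])
  show "integrable lborel (\<lambda>s. s\<^sup>2 * exp (1 * \<bar>s\<bar>) * norm (exp (B * of_real s) * exp (- z * of_real (s\<^sup>2))))"
   unfolding ex
  proof (rule integrable_gaussian_bound[where \<alpha>="Re z" and C="fact 2" and c="2 + norm B"])
   fix s :: real
   have "exp \<bar>s\<bar> * (\<bar>s\<bar> ^ 2 * norm (?e s)) \<le> exp \<bar>s\<bar> * (fact 2 * exp ((1 + norm B) * \<bar>s\<bar> - Re z * s\<^sup>2))"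
    by (intro mult_left_mono power_exp_quadratic_bound) auto
   also have "\<dots> = fact 2 * exp ((2 + norm B) * \<bar>s\<bar> - Re z * s\<^sup>2)"
    by (simp add: algebra_simps flip: exp_add)
   finally show "norm (s\<^sup>2 * exp (1 * \<bar>s\<bar>) * norm (?e s)) \<le> fact 2 * exp ((2 + norm B) * \<bar>s\<bar> - Re z * s\<^sup>2)"
    by (simp add: mult_ac)
  qed (use z in auto)
  show "integrable lborel (\<lambda>s. exp (B * of_real s) * exp (- z * of_real (s\<^sup>2)))"
   unfolding ex using i[of 0] by simp
  show "integrable lborel (\<lambda>s. of_real s * (exp (B * of_real s) * exp (- z * of_real (s\<^sup>2))))"
   unfolding ex using i[of 1] by simp
 qed auto
 then have d: "((\<lambda>B. gauss_integral z B) has_field_derivative (LINT s|lborel. of_real s * ?e s)) (at B)"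
  unfolding ex gauss_integral_def .
 have lin: "(B - 2 * z * of_real s) * ?e s = B * ?e s - (2 * z) * (of_real s * ?e s)" for s
  by (simp add: algebra_simps)
 have "(LINT s|lborel. (B - 2 * z * of_real s) * ?e s) = 0"
 proof (rule integral_derivative_eq_0[where F = ?e])
  show "(?e has_vector_derivative (B - 2 * z * of_real x) * ?e x) (at x)" for x
   unfolding of_real_power
   by (rule has_vector_derivative_real_field[where f="\<lambda>w. exp (B * w - z * w\<^sup>2)"])
     (auto intro!: derivative_eq_intros simp: algebra_simps)
  show "integrable lborel (\<lambda>s. (B - 2 * z * of_real s) * ?e s)"
   unfolding lin using i[of 0] i[of 1] by simp
  show "(?e \<longlongrightarrow> 0) at_top" "(?e \<longlongrightarrow> 0) at_bot"
   using exp_quadratic_tendsto_0[OF z, where n=0 and B=B] by auto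
 qed (auto intro!: continuous_intros)
 also have "(LINT s|lborel. (B - 2 * z * of_real s) * ?e s) = B * gauss_integral z B - 2 * z * (LINT s|lborel. of_real s * ?e s)"
  unfolding lin using i[of 0] i[of 1] by (simp add: gauss_integral_def)
 finally show ?thesis using d z0 by (simp add: field_simps)
qed

lemma gauss_integral_deriv_quadratic:
 assumes z: "0 < Re z"
 shows "((\<lambda>z. gauss_integral z 0) has_field_derivative - gauss_integral z 0 / (2 * z)) (at z)"
proof -
 let ?e = "\<lambda>s::real. exp (- z * of_real (s\<^sup>2))"
 have z0: "z \<noteq> 0" using z by auto
 have i: "integrable lborel (\<lambda>s. of_real s ^ n * ?e s)" for n
  using integrable_power_exp_quadratic[OF z, where B=0 and n=n] by simp
 have ex: "exp (z * of_real (- (s\<^sup>2))) * 1 = exp (- z * of_real (s\<^sup>2))" for s :: real and z by simp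
 have "((\<lambda>z. LINT s|lborel. exp (z * of_real (- (s\<^sup>2))) * 1) has_field_derivative
   (LINT s|lborel. of_real (- (s\<^sup>2)) * (exp (z * of_real (- (s\<^sup>2))) * 1))) (at z)"
 proof (rule has_field_derivative_exp_integral[where \<delta>="Re z / 2"])
  show "integrable lborel (\<lambda>s. (- (s\<^sup>2))\<^sup>2 * exp (Re z / 2 * \<bar>- (s\<^sup>2)\<bar>) * norm (exp (z * of_real (- (s\<^sup>2))) * 1))"
   unfolding ex
  proof (rule integrable_gaussian_bound[where \<alpha>="Re z / 2" and C="fact 4" and c="1"])
   fix s :: real
   have "exp (Re z / 2 * s\<^sup>2) * (\<bar>s\<bar> ^ 4 * norm (?e s)) \<le> exp (Re z / 2 * s\<^sup>2) * (fact 4 * exp (\<bar>s\<bar> - Re z * s\<^sup>2))"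
    using power_exp_quadratic_bound[of s 4 0 z] by (intro mult_left_mono) auto
   also have "\<dots> = fact 4 * exp (1 * \<bar>s\<bar> - Re z / 2 * s\<^sup>2)"
    by (simp add: algebra_simps flip: exp_add)
   finally show "norm ((- (s\<^sup>2))\<^sup>2 * exp (Re z / 2 * \<bar>- (s\<^sup>2)\<bar>) * norm (?e s)) \<le> fact 4 * exp (1 * \<bar>s\<bar> - Re z / 2 * s\<^sup>2)"
    by (simp add: mult_ac)
  qed (use z in auto)
 qed (use z i[of 0] i[of 2] in \<open>auto simp: ex\<close>)
 then have d: "((\<lambda>z. gauss_integral z 0) has_field_derivative (LINT s|lborel. of_real (- (s\<^sup>2)) * ?e s)) (at z)"
  unfolding ex gauss_integral_def by simp
 have lin: "(1 - 2 * z * of_real (s\<^sup>2)) * ?e s = ?e s - (2 * z) * (of_real (s\<^sup>2) * ?e s)" for s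
  by (simp add: algebra_simps)
 have "(LINT s|lborel. (1 - 2 * z * of_real (s\<^sup>2)) * ?e s) = 0"
 proof (rule integral_derivative_eq_0[where F = "\<lambda>s. of_real s * ?e s"])
  show "((\<lambda>s. of_real s * ?e s) has_vector_derivative (1 - 2 * z * of_real (x\<^sup>2)) * ?e x) (at x)" for x
   unfolding of_real_power
   by (rule has_vector_derivative_real_field[where f="\<lambda>w. w * exp (- z * w\<^sup>2)"])
     (auto intro!: derivative_eq_intros simp: algebra_simps power2_eq_square)
  show "integrable lborel (\<lambda>s. (1 - 2 * z * of_real (s\<^sup>2)) * ?e s)"
   unfolding lin using i[of 0] i[of 2] by simp
  show "((\<lambda>s. of_real s * ?e s) \<longlongrightarrow> 0) at_top" "((\<lambda>s. of_real s * ?e s) \<longlongrightarrow> 0) at_bot"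
   using exp_quadratic_tendsto_0[OF z, where n=1 and B=0] by auto
 qed (auto intro!: continuous_intros)
 also have "(LINT s|lborel. (1 - 2 * z * of_real (s\<^sup>2)) * ?e s) = gauss_integral z 0 - 2 * z * (LINT s|lborel. of_real (s\<^sup>2) * ?e s)"
  unfolding lin using i[of 0] i[of 2] by (simp add: gauss_integral_def)
 finally have "(LINT s|lborel. of_real (s\<^sup>2) * ?e s) = gauss_integral z 0 / (2 * z)"
  using z0 by (simp add: field_simps)
 with d show ?thesis by simp
qed

lemma gauss_integral_0:
 assumes z: "0 < Re z"
 shows "csqrt (z / of_real pi) * gauss_integral z 0 = 1"
proof -
 let ?S = "{z. 0 < Re z}"
 let ?f = "\<lambda>z. csqrt (z / of_real pi) * gauss_integral z 0"
 have "\<exists>c. \<forall>z\<in>?S. ?f z = c"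
 proof (rule has_field_derivative_zero_constant)
  show "convex ?S" by (rule convex_halfspace_Re_gt)
  fix w assume w: "w \<in> ?S"
  then have w0: "w \<noteq> 0" by auto
  have np: "w / of_real pi \<notin> \<real>\<^sub>\<le>\<^sub>0"
  proof
   assume "w / of_real pi \<in> \<real>\<^sub>\<le>\<^sub>0"
   then have "Re (w / of_real pi) \<le> 0" by (auto simp: complex_nonpos_Reals_iff)
   then show False using w pi_gt_zero by (simp add: divide_le_0_iff)
  qed
  have sq: "csqrt (w / of_real pi) * csqrt (w / of_real pi) = w / of_real pi"
   by (metis power2_csqrt power2_eq_square)
  have nz: "csqrt (w / of_real pi) \<noteq> 0" using w0 by simp
  have "((\<lambda>z. csqrt (z / of_real pi)) has_field_derivative inverse (2 * csqrt (w / of_real pi)) * inverse (of_real pi)) (at w)"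
  proof (rule DERIV_chain2[where f=csqrt and g="\<lambda>z. z / of_real pi"])
   show "(csqrt has_field_derivative inverse (2 * csqrt (w / of_real pi))) (at (w / of_real pi))"
    by (rule has_field_derivative_csqrt[OF np])
   show "((\<lambda>z. z / of_real pi) has_field_derivative inverse (of_real pi)) (at w)"
    using DERIV_cdivide[OF DERIV_ident, of "of_real pi :: complex" w UNIV] by (simp only: inverse_eq_divide)
  qed
  then have dc: "((\<lambda>z. csqrt (z / of_real pi)) has_field_derivative inverse (2 * csqrt (w / of_real pi)) * (1 / of_real pi)) (at w)"
   by (simp only: inverse_eq_divide)
  have "(?f has_field_derivative (csqrt (w / of_real pi) * (- gauss_integral w 0 / (2 * w))
      + inverse (2 * csqrt (w / of_real pi)) * (1 / of_real pi) * gauss_integral w 0)) (at w)"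
   using DERIV_mult'[OF dc gauss_integral_deriv_quadratic[of w]] w by blast
  also have "csqrt (w / of_real pi) * (- gauss_integral w 0 / (2 * w))
      + inverse (2 * csqrt (w / of_real pi)) * (1 / of_real pi) * gauss_integral w 0 = 0"
  proof -
   have "inverse (2 * csqrt (w / of_real pi)) * (1 / of_real pi) = csqrt (w / of_real pi) / (2 * w)"
   proof -
    have c2: "csqrt (w / of_real pi) = w / of_real pi / csqrt (w / of_real pi)"
     using sq nz by (metis nonzero_mult_div_cancel_left)
    show ?thesis using nz w0 by (subst (2) c2) (simp add: divide_simps)
   qed
   then show ?thesis by simp
  qed
  finally show "(?f has_field_derivative 0) (at w within ?S)"
   by (rule has_field_derivative_at_within)
 qed
 then obtain c where c: "\<forall>z\<in>?S. ?f z = c" by blast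
 have "gauss_integral 1 0 = of_real (LINT s|lborel. exp (- (s\<^sup>2)))"
  by (simp add: gauss_integral_def flip: integral_complex_of_real exp_of_real)
 also have "(LINT s|lborel. exp (- (s\<^sup>2))) = sqrt pi"
  using has_bochner_integral_even_function[OF gaussian_moment_0]
  by (simp add: has_bochner_integral_iff)
 finally have "?f 1 = 1"
  by (simp add: csqrt_of_real_nonneg real_sqrt_divide flip: of_real_divide of_real_mult)
 moreover have "?f 1 = c" "?f z = c" using c z by (auto simp del: csqrt_of_real_nonneg)
 ultimately show ?thesis by simp
qed

lemma gauss_integral_eq:
 assumes z: "0 < Re z"
 shows "gauss_integral z B = gauss_integral z 0 * exp (B\<^sup>2 / (4 * z))"
proof -
 have z0: "z \<noteq> 0" using z by auto
 have "\<exists>c. \<forall>B\<in>UNIV. gauss_integral z B * exp (- (B\<^sup>2) / (4 * z)) = c"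
 proof (rule has_field_derivative_zero_constant)
  fix B
  show "((\<lambda>B. gauss_integral z B * exp (- (B\<^sup>2) / (4 * z))) has_field_derivative 0) (at B within UNIV)"
   using z0 by (auto intro!: derivative_eq_intros gauss_integral_deriv_linear[OF z] simp: field_simps)
 qed simp
 then obtain c where c: "gauss_integral z B * exp (- (B\<^sup>2) / (4 * z)) = c" for B by blast
 from c[of B] c[of 0] show ?thesis by (simp add: exp_minus field_simps)
qed

section \<open>Square integrable functions and convolution\<close>

definition L2 :: "(real => complex) => bool" where
 "L2 f \<longleftrightarrow> f \<in> borel_measurable borel \<and> integrable lborel (\<lambda>y. (cmod (f y))\<^sup>2)"

definition nsq :: "(real => complex) => real" where
 "nsq f = (LINT y|lborel. (cmod (f y))\<^sup>2)"

text \<open>The bilinear pairing, without conjugation: the heat operator is symmetric for it, although its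
 diffusivity is not real.\<close>

definition pr :: "(real => complex) => (real => complex) => complex" where
 "pr f h = (LINT y|lborel. f y * h y)"

definition conv :: "(real => complex) => (real => complex) => real => complex" where
 "conv G f y = (LINT y'|lborel. G (y - y') * f y')"

text \<open>The kernels that occur below: Green's functions, their conjugates, and real Gaussians.\<close>

definition gauss_kernel :: "(real => complex) => bool" where
 "gauss_kernel G \<longleftrightarrow> continuous_on UNIV G \<and> (\<forall>s. G (- s) = G s) \<and>
   (\<exists>C \<alpha>. 0 < \<alpha> \<and> (\<forall>s. cmod (G s) \<le> C * exp (- \<alpha> * s\<^sup>2)))"

lemma L2_measurable: "L2 f ==> f \<in> borel_measurable borel"
 by (simp add: L2_def)

lemma L2_integrable: "L2 f ==> integrable lborel (\<lambda>y. (cmod (f y))\<^sup>2)"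
 by (simp add: L2_def)

lemma nsq_nonneg [simp]: "0 \<le> nsq f"
 by (simp add: nsq_def)

lemma cmod_add_sq_le: "(cmod (x + y))\<^sup>2 \<le> 2 * (cmod x)\<^sup>2 + 2 * (cmod y)\<^sup>2"
proof -
 have "(cmod (x + y))\<^sup>2 \<le> (cmod x + cmod y)\<^sup>2"
  by (intro power_mono norm_triangle_ineq) auto
 also have "\<dots> \<le> 2 * (cmod x)\<^sup>2 + 2 * (cmod y)\<^sup>2"
  using sum_squares_bound[of "cmod x" "cmod y"] by (simp add: power2_sum)
 finally show ?thesis .
qed

lemma cmod_mult_le: "cmod (x * y) \<le> ((cmod x)\<^sup>2 + (cmod y)\<^sup>2) / 2"
 using sum_squares_bound[of "cmod x" "cmod y"] by (simp add: norm_mult)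

lemma L2_bound:
 assumes "f \<in> borel_measurable borel" "integrable lborel g" "\<And>y. (cmod (f y))\<^sup>2 \<le> g y"
 shows "L2 f"
 unfolding L2_def
 using assms(1) by (auto intro!: Bochner_Integration.integrable_bound[OF assms(2)] AE_I2 order_trans[OF assms(3)])

lemma L2_add: "L2 f ==> L2 h ==> L2 (\<lambda>y. f y + h y)"
 by (rule L2_bound[where g="\<lambda>y. 2 * (cmod (f y))\<^sup>2 + 2 * (cmod (h y))\<^sup>2"])
   (auto simp: L2_def intro!: cmod_add_sq_le)

lemma L2_cmult: "L2 f ==> L2 (\<lambda>y. c * f y)"
 by (auto simp: L2_def norm_mult power_mult_distrib)

lemma L2_diff: "L2 f ==> L2 h ==> L2 (\<lambda>y. f y - h y)"
 using L2_add[of f "\<lambda>y. (-1) * h y"] L2_cmult[of h "-1"] by simp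

lemma L2_shift: "L2 f ==> L2 (\<lambda>y. f (y - s))"
 using lborel_integrable_real_affine[of "\<lambda>y. (cmod (f y))\<^sup>2" 1 "- s"] by (auto simp: L2_def)

lemma nsq_shift: "nsq (\<lambda>y. f (y - s)) = nsq f"
 unfolding nsq_def by (subst (2) lborel_integral_real_affine[of 1 _ "- s"]) auto

lemma cnj_measurable [measurable]: "cnj \<in> borel_measurable borel"
 by (intro borel_measurable_continuous_onI continuous_intros)

lemma L2_cnj: "L2 f ==> L2 (\<lambda>y. cnj (f y))"
 by (auto simp: L2_def)

lemma L2_of_gaussian_bound:
 assumes "f \<in> borel_measurable borel" "0 < \<alpha>" "\<And>s. cmod (f s) \<le> C * exp (c * \<bar>s\<bar> - \<alpha> * s\<^sup>2)"
 shows "L2 f"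
proof (rule L2_bound[OF assms(1)])
 show "integrable lborel (\<lambda>s. C\<^sup>2 * exp ((2 * c) * \<bar>s\<bar> - (2 * \<alpha>) * s\<^sup>2))"
  using assms by (intro integrable_mult_right integrable_gaussian_exp) auto
 fix s
 have "(cmod (f s))\<^sup>2 \<le> (C * exp (c * \<bar>s\<bar> - \<alpha> * s\<^sup>2))\<^sup>2"
  by (intro power_mono assms) auto
 also have "\<dots> = C\<^sup>2 * exp ((2 * c) * \<bar>s\<bar> - (2 * \<alpha>) * s\<^sup>2)"
  by (simp add: power_mult_distrib algebra_simps flip: exp_double)
 finally show "(cmod (f s))\<^sup>2 \<le> C\<^sup>2 * exp ((2 * c) * \<bar>s\<bar> - (2 * \<alpha>) * s\<^sup>2)" .
qed

lemma nsq_add_le: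
 assumes "L2 f" "L2 h" shows "nsq (\<lambda>y. f y + h y) \<le> 2 * nsq f + 2 * nsq h"
proof -
 have "nsq (\<lambda>y. f y + h y) \<le> (LINT y|lborel. 2 * (cmod (f y))\<^sup>2 + 2 * (cmod (h y))\<^sup>2)"
  unfolding nsq_def using L2_add[OF assms] assms
  by (intro integral_mono cmod_add_sq_le) (auto simp: L2_def)
 also have "\<dots> = 2 * nsq f + 2 * nsq h" using assms by (simp add: L2_def nsq_def)
 finally show ?thesis .
qed

lemma nsq_cmult: "nsq (\<lambda>y. c * f y) = (cmod c)\<^sup>2 * nsq f"
 by (simp add: nsq_def norm_mult power_mult_distrib)

lemma nsq_diff_le:
 assumes "L2 f" "L2 h" shows "nsq (\<lambda>y. f y - h y) \<le> 2 * nsq f + 2 * nsq h"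
 using nsq_add_le[OF assms(1) L2_cmult[OF assms(2), of "-1"]] nsq_cmult[of "-1" h] by simp

lemma integrable_mult_L2:
 assumes "L2 f" "L2 h" shows "integrable lborel (\<lambda>y. f y * h y)"
proof (rule Bochner_Integration.integrable_bound)
 show "integrable lborel (\<lambda>y. ((cmod (f y))\<^sup>2 + (cmod (h y))\<^sup>2) / 2)"
  using assms by (auto simp: L2_def)
 show "AE y in lborel. norm (f y * h y) \<le> norm (((cmod (f y))\<^sup>2 + (cmod (h y))\<^sup>2) / 2)"
  using cmod_mult_le by (intro AE_I2) (auto intro: order_trans)
qed (use assms in \<open>auto simp: L2_def\<close>)

lemma pr_bound:
 assumes "L2 f" "L2 h" shows "cmod (pr f h) \<le> (nsq f + nsq h) / 2"
proof -
 have "cmod (pr f h) \<le> (LINT y|lborel. ((cmod (f y))\<^sup>2 + (cmod (h y))\<^sup>2) / 2)"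
  unfolding pr_def using assms by (intro norm_integral_le cmod_mult_le) (auto simp: L2_def)
 also have "\<dots> = (nsq f + nsq h) / 2" using assms by (simp add: L2_def nsq_def)
 finally show ?thesis .
qed

text \<open>The weight allows small multiples of the energy of one factor, as the Cauchy-Schwarz inequality
 would, without square roots.\<close>

lemma pr_bound_weighted:
 assumes "L2 f" "L2 h" "0 < l" shows "cmod (pr f h) \<le> (l * nsq f + nsq h / l) / 2"
proof -
 define r where "r = sqrt l"
 have r: "0 < r" "r\<^sup>2 = l" "\<bar>r\<bar> = r" using assms by (auto simp: r_def)
 have "pr f h = pr (\<lambda>y. of_real r * f y) (\<lambda>y. of_real (1 / r) * h y)"
  using r by (simp add: pr_def)
 also have "cmod \<dots> \<le> (nsq (\<lambda>y. of_real r * f y) + nsq (\<lambda>y. of_real (1 / r) * h y)) / 2"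
  by (intro pr_bound L2_cmult assms)
 also have "\<dots> = (l * nsq f + nsq h / l) / 2"
  unfolding nsq_cmult norm_of_real using r by (simp add: power_divide)
 finally show ?thesis .
qed

lemma pr_commute: "pr f h = pr h f"
 by (simp add: pr_def mult.commute)

lemma pr_add_left: "L2 f ==> L2 g ==> L2 h ==> pr (\<lambda>y. f y + g y) h = pr f h + pr g h"
 by (simp add: pr_def distrib_right integrable_mult_L2)

lemma pr_diff_left: "L2 f ==> L2 g ==> L2 h ==> pr (\<lambda>y. f y - g y) h = pr f h - pr g h"
 by (simp add: pr_def left_diff_distrib integrable_mult_L2)

lemma pr_cmult_left: "pr (\<lambda>y. c * f y) h = c * pr f h"
 by (simp add: pr_def mult.assoc)

lemma pr_cnj: "pr f (\<lambda>y. cnj (f y)) = of_real (nsq f)"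
 by (simp add: pr_def nsq_def complex_norm_square[symmetric] flip: of_real_power integral_complex_of_real)

subsection \<open>Convolutions with even kernels\<close>

lemma gauss_kernelE:
 assumes "gauss_kernel G"
 obtains C \<alpha> where "0 < \<alpha>" "0 \<le> C" "\<And>s. cmod (G s) \<le> C * exp (- \<alpha> * s\<^sup>2)"
proof -
 obtain C \<alpha> where *: "0 < \<alpha>" "\<And>s. cmod (G s) \<le> C * exp (- \<alpha> * s\<^sup>2)"
  using assms by (auto simp: gauss_kernel_def)
 have "0 \<le> C" using *(2)[of 0] norm_ge_zero[of "G 0"] by (simp del: norm_ge_zero)
 with * that show thesis by blast
qed

lemma gauss_kernel_measurable:
 "gauss_kernel G ==> G \<in> borel_measurable borel"
 by (auto simp: gauss_kernel_def intro: borel_measurable_continuous_onI)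

lemma gauss_kernel_integrable:
 assumes "gauss_kernel G"
 shows "integrable lborel G" "L2 G" "integrable lborel (\<lambda>s. cmod (G s))"
proof -
 obtain C \<alpha> where *: "0 < \<alpha>" "\<And>s. cmod (G s) \<le> C * exp (- \<alpha> * s\<^sup>2)"
  using assms by (rule gauss_kernelE) (rule that)
 show i: "integrable lborel G"
  by (rule integrable_gaussian_bound[of \<alpha> _ C 0]) (use * gauss_kernel_measurable[OF assms] in auto)
 then show "integrable lborel (\<lambda>s. cmod (G s))" by simp
 show "L2 G"
  by (rule L2_of_gaussian_bound[of _ \<alpha> C 0]) (use * gauss_kernel_measurable[OF assms] in auto)
qed

lemma integrable_conv_product:
 fixes g F :: "real => real"
 assumes "integrable lborel g" "integrable lborel F"
 shows "integrable (lborel \<Otimes>\<^sub>M lborel) (\<lambda>(s, y). g s * F (y - s))"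
  and "integrable (lborel \<Otimes>\<^sub>M lborel) (\<lambda>(s, y). g s * F y)"
proof -
 have [measurable]: "g \<in> borel_measurable borel" "F \<in> borel_measurable borel"
  using assms by (auto dest: borel_measurable_integrable)
 have sh: "integrable lborel (\<lambda>y. F (y - s))" for s
  using lborel_integrable_real_affine[OF assms(2), of 1 "- s"] by simp
 have shv: "(LINT y|lborel. \<bar>F (y - s)\<bar>) = (LINT y|lborel. \<bar>F y\<bar>)" for s
  by (subst (2) lborel_integral_real_affine[of 1 _ "- s"]) auto
 show "integrable (lborel \<Otimes>\<^sub>M lborel) (\<lambda>(s, y). g s * F (y - s))"
 proof (rule lborel_pair.Fubini_integrable)
  show "integrable lborel (\<lambda>x. LINT y|lborel. norm (case (x, y) of (s, y) => g s * F (y - s)))"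
   using assms by (simp add: abs_mult shv)
 qed (use sh in auto)
 show "integrable (lborel \<Otimes>\<^sub>M lborel) (\<lambda>(s, y). g s * F y)"
 proof (rule lborel_pair.Fubini_integrable)
  show "integrable lborel (\<lambda>x. LINT y|lborel. norm (case (x, y) of (s, y) => g s * F y))"
   using assms by (simp add: abs_mult)
 qed (use assms in auto)
qed

lemma conv_shift: "conv G f y = (LINT s|lborel. G s * f (y - s))"
 unfolding conv_def by (subst lborel_integral_real_affine[of "-1" _ y]) auto

lemma conv_measurable [measurable]:
 assumes [measurable]: "G \<in> borel_measurable borel" "f \<in> borel_measurable borel"
 shows "conv G f \<in> borel_measurable borel"
 unfolding conv_def[abs_def] by measurable

text \<open>Everything about the pairing of a convolution is read off from the correlation function
 \<open>s \<mapsto> \<integral>f(y - s) h(y) dy\<close> of the two functions.\<close>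

definition corr :: "(real => complex) => (real => complex) => real => complex" where
 "corr f h s = (LINT y|lborel. f (y - s) * h y)"

lemma corr_uminus: "corr h f s = corr f h (- s)"
 unfolding corr_def by (subst lborel_integral_real_affine[of 1 _ s]) (auto simp: mult.commute add.commute)

lemma pr_conv_aux:
 assumes G: "gauss_kernel G" and f: "L2 f" and h: "L2 h"
 shows "integrable (lborel \<Otimes>\<^sub>M lborel) (\<lambda>(s, y). G s * f (y - s) * h y)"
proof (rule Bochner_Integration.integrable_bound)
 have [measurable]: "G \<in> borel_measurable borel" "f \<in> borel_measurable borel" "h \<in> borel_measurable borel"
  using G f h by (auto dest: L2_measurable gauss_kernel_measurable)
 have "integrable (lborel \<Otimes>\<^sub>M lborel) (\<lambda>p. (case p of (s, y) => (cmod (G s) * (cmod (f (y - s)))\<^sup>2)) 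
     + (case p of (s, y) => cmod (G s) * (cmod (h y))\<^sup>2))"
  by (intro Bochner_Integration.integrable_add integrable_conv_product(1)[where F="\<lambda>y. (cmod (f y))\<^sup>2"] integrable_conv_product(2)
     gauss_kernel_integrable G L2_integrable f h)
 then show "integrable (lborel \<Otimes>\<^sub>M lborel) (\<lambda>p. (case p of (s, y) => (cmod (G s) * (cmod (f (y - s)))\<^sup>2)) 
     + (case p of (s, y) => cmod (G s) * (cmod (h y))\<^sup>2))" .
 show "(\<lambda>(s, y). G s * f (y - s) * h y) \<in> borel_measurable (lborel \<Otimes>\<^sub>M lborel)"
  by measurable
 have "cmod (G s * f (y - s) * h y) \<le> cmod (G s) * (cmod (f (y - s)))\<^sup>2 + cmod (G s) * (cmod (h y))\<^sup>2" for s y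
 proof -
  have "cmod (G s * f (y - s) * h y) = cmod (G s) * cmod (f (y - s) * h y)" by (simp add: norm_mult)
  also have "\<dots> \<le> cmod (G s) * (((cmod (f (y - s)))\<^sup>2 + (cmod (h y))\<^sup>2) / 2)"
   by (intro mult_left_mono cmod_mult_le) auto
  also have "\<dots> \<le> cmod (G s) * ((cmod (f (y - s)))\<^sup>2 + (cmod (h y))\<^sup>2)"
   by (intro mult_left_mono) auto
  finally show ?thesis by (simp add: distrib_left)
 qed
 then show "AE p in lborel \<Otimes>\<^sub>M lborel. norm (case p of (s, y) => G s * f (y - s) * h y)
   \<le> norm ((case p of (s, y) => (cmod (G s) * (cmod (f (y - s)))\<^sup>2)) + (case p of (s, y) => cmod (G s) * (cmod (h y))\<^sup>2))"
  by (intro AE_I2) (auto simp: split_beta)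
qed

lemma pr_conv:
 assumes "gauss_kernel G" "L2 f" "L2 h"
 shows "integrable lborel (\<lambda>s. G s * corr f h s)"
  and "pr (conv G f) h = (LINT s|lborel. G s * corr f h s)"
proof -
 note i = pr_conv_aux[OF assms]
 have e: "(LINT y|lborel. G s * f (y - s) * h y) = G s * corr f h s" for s
  by (simp add: corr_def mult.assoc)
 show "integrable lborel (\<lambda>s. G s * corr f h s)"
  using lborel_pair.integrable_fst'[OF i] by (simp add: e)
 have "pr (conv G f) h = (LINT y|lborel. LINT s|lborel. G s * f (y - s) * h y)"
  by (simp add: pr_def conv_shift)
 also have "\<dots> = (LINT s|lborel. LINT y|lborel. G s * f (y - s) * h y)"
  by (rule lborel_pair.Fubini_integral[OF i])
 finally show "pr (conv G f) h = (LINT s|lborel. G s * corr f h s)" by (simp add: e)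
qed

lemma pr_conv_swap:
 assumes "gauss_kernel G" "L2 f" "L2 h"
 shows "pr (conv G f) h = pr (conv G h) f"
proof -
 have "pr (conv G h) f = (LINT s|lborel. G s * corr f h (- s))"
  using assms by (simp add: pr_conv flip: corr_uminus[of h f])
 also have "\<dots> = (LINT s|lborel. G (- s) * corr f h s)"
  by (subst lborel_integral_real_affine[of "-1" _ 0]) auto
 also have "\<dots> = pr (conv G f) h"
  using assms by (simp add: pr_conv gauss_kernel_def)
 finally show ?thesis by simp
qed

lemma pr_conv_transpose:
 assumes "gauss_kernel G" "L2 f" "L2 h"
 shows "pr (conv G f) h = pr f (conv G h)"
 using pr_conv_swap[OF assms] by (simp add: pr_commute)

lemma L2_conv:
 assumes G: "gauss_kernel G" and f: "L2 f"
 shows "L2 (conv G f)"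
proof -
 have [measurable]: "G \<in> borel_measurable borel" "f \<in> borel_measurable borel"
  using G f by (auto dest: L2_measurable gauss_kernel_measurable)
 define M where "M = (LINT s|lborel. cmod (G s))"
 obtain C \<alpha> where C: "0 < \<alpha>" "0 \<le> C" "\<And>s. cmod (G s) \<le> C * exp (- \<alpha> * s\<^sup>2)"
  using G by (rule gauss_kernelE) (rule that)
 have GC: "cmod (G s) \<le> C" for s
 proof -
  have "C * exp (- \<alpha> * s\<^sup>2) \<le> C * 1" using C(1,2) by (intro mult_left_mono) auto
  with C(3)[of s] show ?thesis by simp
 qed
 have iG: "integrable lborel (\<lambda>s. cmod (G s))" using gauss_kernel_integrable[OF G] by simp
 have sq: "integrable lborel (\<lambda>s. (cmod (f (y - s)))\<^sup>2)" for y
  using lborel_integrable_real_affine[OF L2_integrable[OF f], of "-1" y] by simp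
 have i2: "integrable lborel (\<lambda>s. cmod (G s) * (cmod (f (y - s)))\<^sup>2)" for y
 proof (rule Bochner_Integration.integrable_bound)
  show "integrable lborel (\<lambda>s. C * (cmod (f (y - s)))\<^sup>2)" by (intro integrable_mult_right sq)
  have "cmod (G s) * (cmod (f (y - s)))\<^sup>2 \<le> C * (cmod (f (y - s)))\<^sup>2" for s
   by (intro mult_right_mono GC) auto
  then show "AE s in lborel. norm (cmod (G s) * (cmod (f (y - s)))\<^sup>2) \<le> norm (C * (cmod (f (y - s)))\<^sup>2)"
   using C(2) by (intro AE_I2) (simp add: abs_mult)
 qed measurable
 have i1: "integrable lborel (\<lambda>s. cmod (G s) * cmod (f (y - s)))" for y
 proof (rule Bochner_Integration.integrable_bound)
  show "integrable lborel (\<lambda>s. cmod (G s) + cmod (G s) * (cmod (f (y - s)))\<^sup>2)"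
   using iG i2 by auto
  have "x \<le> 1 + x\<^sup>2" for x :: real
   using zero_le_power2[of "x - 1/2"] by (simp add: power2_eq_square algebra_simps)
  then have "cmod (G s) * cmod (f (y - s)) \<le> cmod (G s) * (1 + (cmod (f (y - s)))\<^sup>2)" for s
   by (intro mult_left_mono) auto
  then show "AE s in lborel. norm (cmod (G s) * cmod (f (y - s))) \<le> norm (cmod (G s) + cmod (G s) * (cmod (f (y - s)))\<^sup>2)"
   by (intro AE_I2) (auto simp: distrib_left)
 qed measurable
 have main: "(cmod (conv G f y))\<^sup>2 \<le> M * (LINT s|lborel. cmod (G s) * (cmod (f (y - s)))\<^sup>2)" for y
 proof -
  define A where "A = (LINT s|lborel. cmod (G s) * cmod (f (y - s)))"
  define Q where "Q = (LINT s|lborel. cmod (G s) * (cmod (f (y - s)))\<^sup>2)"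
  have "cmod (conv G f y) \<le> A"
   unfolding conv_shift A_def by (intro norm_integral_le i1) (auto simp: norm_mult)
  then have 1: "(cmod (conv G f y))\<^sup>2 \<le> A\<^sup>2" by (intro power_mono) auto
  have p: "0 \<le> x\<^sup>2 * M - 2 * x * A + Q" for x
  proof -
   have "0 \<le> (LINT s|lborel. cmod (G s) * (x - cmod (f (y - s)))\<^sup>2)" by simp
   also have "\<dots> = (LINT s|lborel. x\<^sup>2 * cmod (G s) - (2 * x) * (cmod (G s) * cmod (f (y - s)))
            + cmod (G s) * (cmod (f (y - s)))\<^sup>2)"
    by (rule Bochner_Integration.integral_cong) (auto simp: power2_eq_square algebra_simps)
   also have "\<dots> = x\<^sup>2 * M - 2 * x * A + Q"
    unfolding M_def A_def Q_def using iG i1[of y] i2[of y] by simp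
   finally show ?thesis .
  qed
  have "A\<^sup>2 \<le> M * Q"
  proof (cases "M = 0")
   case True
   have "A = 0"
   proof (rule ccontr)
    assume "A \<noteq> 0"
    then show False using p[of "(Q + 1) / (2 * A)"] True by (simp add: field_simps)
   qed
   with True show ?thesis by simp
  next
   case False
   then have "0 < M" by (simp add: M_def less_le)
   then show ?thesis using p[of "A / M"] by (simp add: field_simps power2_eq_square)
  qed
  with 1 show ?thesis by (simp add: Q_def)
 qed
 show ?thesis
 proof (rule L2_bound)
  show "integrable lborel (\<lambda>y. M * (LINT s|lborel. cmod (G s) * (cmod (f (y - s)))\<^sup>2))"
   using lborel_pair.integrable_snd[OF integrable_conv_product(1)[OF iG L2_integrable[OF f]]]
   by (intro integrable_mult_right) simp
 qed (use main in auto)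
qed

text \<open>Polarised form of the identity \<open>\<integral>G(s) (\<parallel>f\<parallel>\<^sup>2 - \<langle>\<tau>\<^sub>s f, f\<rangle>) ds = 1/2 \<integral>G(s) \<parallel>f - \<tau>\<^sub>s f\<parallel>\<^sup>2 ds\<close>.\<close>

lemma conv_defect:
 assumes G: "gauss_kernel G" and f: "L2 f" and h: "L2 h"
 shows "(LINT s|lborel. G s) * pr f h - pr (conv G f) h
   = (LINT s|lborel. G s * (LINT y|lborel. (f y - f (y - s)) * (h y - h (y - s)))) / 2"
proof -
 have inner: "(LINT y|lborel. (f y - f (y - s)) * (h y - h (y - s))) = 2 * pr f h - corr f h s - corr h f s" for s
 proof -
  have i: "integrable lborel (\<lambda>y. f y * h y)" "integrable lborel (\<lambda>y. f (y - s) * h y)"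
    "integrable lborel (\<lambda>y. h (y - s) * f y)" "integrable lborel (\<lambda>y. f (y - s) * h (y - s))"
   by (intro integrable_mult_L2 L2_shift f h)+
  have sh: "(LINT y|lborel. f (y - s) * h (y - s)) = pr f h"
   unfolding pr_def by (subst (2) lborel_integral_real_affine[of 1 _ "- s"]) auto
  have "(LINT y|lborel. (f y - f (y - s)) * (h y - h (y - s)))
    = (LINT y|lborel. f y * h y - f (y - s) * h y - h (y - s) * f y + f (y - s) * h (y - s))"
   by (rule Bochner_Integration.integral_cong) (auto simp: algebra_simps)
  also have "\<dots> = pr f h - corr f h s - corr h f s + pr f h"
   using i by (simp add: sh corr_def) (simp add: pr_def)
  finally show ?thesis by simp
 qed
 have iG: "integrable lborel G" using gauss_kernel_integrable[OF G] by simp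
 have "(LINT s|lborel. G s * (2 * pr f h - corr f h s - corr h f s))
   = (LINT s|lborel. (2 * pr f h) * G s - G s * corr f h s - G s * corr h f s)"
  by (rule Bochner_Integration.integral_cong) (auto simp: algebra_simps)
 also have "\<dots> = 2 * pr f h * (LINT s|lborel. G s) - pr (conv G f) h - pr (conv G h) f"
  using iG pr_conv[OF G f h] pr_conv[OF G h f] by simp
 also have "\<dots> = 2 * (pr f h * (LINT s|lborel. G s) - pr (conv G f) h)"
  using pr_conv_swap[OF G f h] by simp
 finally show ?thesis unfolding inner by (simp add: mult.commute)
qed

section \<open>Energy loss of the heat operator\<close>

definition gauss_rate :: "complex => real => complex" where
 "gauss_rate k t = - \<i> * k / of_real (2 * t)"

definition heat :: "complex => real => (real => complex) => real => complex" where
 "heat k t = conv (green k t)"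

lemma green_measurable [measurable]: "green k t \<in> borel_measurable borel"
 unfolding green_def[abs_def] by measurable

lemma Re_gauss_rate: "Re (gauss_rate k t) = Im k / (2 * t)"
 by (simp add: gauss_rate_def Re_divide_of_real)

lemma green_eq:
 assumes "0 < t"
 shows "green k t s = csqrt (gauss_rate k t / of_real pi) * exp (- gauss_rate k t * of_real (s\<^sup>2))"
proof -
 have "k / (2 * of_real pi * \<i> * of_real t) = gauss_rate k t / of_real pi"
  using assms by (simp add: gauss_rate_def field_simps)
 moreover have "\<i> * k * of_real (s\<^sup>2) / (2 * of_real t) = - gauss_rate k t * of_real (s\<^sup>2)"
  by (simp add: gauss_rate_def)
 ultimately show ?thesis using assms by (simp add: green_def)
qed

lemma norm_green:
 assumes "0 < t"
 shows "cmod (green k t s) = sqrt (cmod (gauss_rate k t) / pi) * exp (- (Im k / (2 * t)) * s\<^sup>2)"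
 using assms by (simp add: green_eq norm_mult norm_exp_eq_Re Re_gauss_rate norm_divide)

lemma gauss_kernel_green:
 assumes "0 < t" "0 < Im k"
 shows "gauss_kernel (green k t)" "gauss_kernel (\<lambda>s. cnj (green k t s))"
proof -
 have 1: "continuous_on UNIV (green k t)"
  by (rule continuous_on_eq[of _ "\<lambda>s. csqrt (gauss_rate k t / of_real pi) * exp (- gauss_rate k t * of_real (s\<^sup>2))"])
    (use green_eq[OF assms(1)] in \<open>auto intro!: continuous_intros\<close>)
 have 2: "0 < Im k / (2 * t)" using assms by simp
 have 3: "\<forall>s. green k t (- s) = green k t s" by (simp add: green_def)
 have 4: "\<exists>C \<alpha>. 0 < \<alpha> \<and> (\<forall>s. cmod (green k t s) \<le> C * exp (- \<alpha> * s\<^sup>2))"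
  using 2 norm_green[OF assms(1), of k] order_refl by metis
 show "gauss_kernel (green k t)"
  unfolding gauss_kernel_def using 1 3 4 by blast
 then show "gauss_kernel (\<lambda>s. cnj (green k t s))"
  unfolding gauss_kernel_def by (auto intro: continuous_intros)
qed

lemma integral_green:
 assumes "0 < t" "0 < Im k"
 shows "(LINT s|lborel. green k t s) = 1"
proof -
 have "0 < Re (gauss_rate k t)" using assms by (simp add: Re_gauss_rate)
 from gauss_integral_0[OF this] show ?thesis
  using assms by (simp add: green_eq gauss_integral_def)
qed

lemma gauss_integral_of_real:
 assumes "0 < r" shows "gauss_integral (of_real r) 0 = of_real (sqrt (pi / r))"
proof -
 have "csqrt (of_real r / of_real pi) = of_real (sqrt (r / pi))"
  using assms by (simp flip: of_real_divide)
 then have "of_real (sqrt (r / pi)) * gauss_integral (of_real r) 0 = 1"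
  using gauss_integral_0[of "of_real r"] assms by simp
 moreover have "of_real (sqrt (r / pi)) * complex_of_real (sqrt (pi / r)) = 1"
  using assms by (simp flip: of_real_mult real_sqrt_mult)
 ultimately show ?thesis
  by (metis mult_cancel_left mult_zero_left zero_neq_one)
qed

text \<open>The adjoint heat operator followed by the heat operator has a real positive Gaussian
 kernel, although the diffusion coefficient is complex.  This is what makes the loss of energy a
 weighted integral of \<open>\<parallel>f - \<tau>\<^sub>s f\<parallel>\<^sup>2\<close> with positive weight.\<close>

lemma green_conv_cnj:
 assumes "0 < t" "0 < Im k"
 obtains c \<gamma> where "0 < c" "0 < \<gamma>"
  "\<And>s. conv (\<lambda>s. cnj (green k t s)) (green k t) s = of_real (c * exp (- \<gamma> * s\<^sup>2))"
  "(LINT s|lborel. c * exp (- \<gamma> * s\<^sup>2)) = 1"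
proof -
 define p where "p = gauss_rate k t"
 define A where "A = csqrt (p / of_real pi)"
 define \<gamma> where "\<gamma> = (cmod p)\<^sup>2 / (2 * Re p)"
 define c where "c = cmod p / pi * sqrt (pi / (2 * Re p))"
 have p: "0 < Re p" using assms by (simp add: p_def Re_gauss_rate)
 then have p0: "0 < cmod p" by (metis complex_eq_iff less_irrefl zero_complex.sel(1) zero_less_norm_iff)
 have A2: "A * cnj A = of_real (cmod p / pi)"
  unfolding complex_norm_square[symmetric] A_def by (simp add: norm_divide)
 have pc: "p + cnj p = of_real (2 * Re p)" by (simp add: complex_add_cnj)
 have form: "conv (\<lambda>s. cnj (green k t s)) (green k t) s = of_real (c * exp (- \<gamma> * s\<^sup>2))" for s
 proof -
  have "cnj (green k t (s - r)) * green k t r =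
    (A * cnj A * exp (- cnj p * of_real (s\<^sup>2))) * exp ((2 * cnj p * of_real s) * of_real r - (p + cnj p) * of_real (r\<^sup>2))" for r
  proof -
   have "cnj (green k t (s - r)) = cnj A * exp (- cnj p * of_real ((s - r)\<^sup>2))"
    using assms by (simp add: green_eq A_def p_def exp_cnj)
   moreover have "green k t r = A * exp (- p * of_real (r\<^sup>2))"
    using assms by (simp add: green_eq A_def p_def)
   ultimately have "cnj (green k t (s - r)) * green k t r = A * cnj A * exp (- cnj p * of_real ((s - r)\<^sup>2) + - p * of_real (r\<^sup>2))"
    unfolding exp_add by (simp only: mult_ac)
   also have "- cnj p * of_real ((s - r)\<^sup>2) + - p * of_real (r\<^sup>2)
     = - cnj p * of_real (s\<^sup>2) + ((2 * cnj p * of_real s) * of_real r - (p + cnj p) * of_real (r\<^sup>2))"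
    by (simp add: power2_eq_square algebra_simps)
   finally show ?thesis unfolding exp_add by (simp only: mult_ac)
  qed
  then have "conv (\<lambda>s. cnj (green k t s)) (green k t) s
    = (A * cnj A * exp (- cnj p * of_real (s\<^sup>2))) * gauss_integral (p + cnj p) (2 * cnj p * of_real s)"
   by (simp add: conv_def gauss_integral_def)
  also have "gauss_integral (p + cnj p) (2 * cnj p * of_real s)
    = of_real (sqrt (pi / (2 * Re p))) * exp ((2 * cnj p * of_real s)\<^sup>2 / (4 * (p + cnj p)))"
   unfolding pc using p by (subst gauss_integral_eq) (auto simp: gauss_integral_of_real simp del: of_real_mult)
  also have "A * cnj A * exp (- cnj p * of_real (s\<^sup>2)) * \<dots>
    = of_real c * (exp (- cnj p * of_real (s\<^sup>2)) * exp ((2 * cnj p * of_real s)\<^sup>2 / (4 * (p + cnj p))))"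
   unfolding A2 c_def by simp
  also have "exp (- cnj p * of_real (s\<^sup>2)) * exp ((2 * cnj p * of_real s)\<^sup>2 / (4 * (p + cnj p)))
    = exp (- cnj p * of_real (s\<^sup>2) + (2 * cnj p * of_real s)\<^sup>2 / (4 * (p + cnj p)))"
   by (simp only: exp_add)
  also have "- cnj p * of_real (s\<^sup>2) + (2 * cnj p * of_real s)\<^sup>2 / (4 * (p + cnj p)) = of_real (- \<gamma> * s\<^sup>2)"
  proof -
   have n: "p + cnj p \<noteq> 0" unfolding pc using p by simp
   have "- cnj p * of_real (s\<^sup>2) + (2 * cnj p * of_real s)\<^sup>2 / (4 * (p + cnj p))
     = of_real (s\<^sup>2) * (- cnj p + (cnj p)\<^sup>2 / (p + cnj p))"
   proof -
    have "(2 * w * z)\<^sup>2 / (4 * q) = z\<^sup>2 * (w\<^sup>2 / q)" for w z q :: complex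
     by (cases "q = 0") (auto simp: power_mult_distrib)
    then show ?thesis by (simp only: distrib_left of_real_power mult.commute)
   qed
   also have "- cnj p + (cnj p)\<^sup>2 / (p + cnj p) = - (p * cnj p) / (p + cnj p)"
    using n by (simp add: field_simps power2_eq_square)
   also have "\<dots> = of_real (- \<gamma>)"
    unfolding pc complex_norm_square[symmetric] \<gamma>_def by simp
   finally show ?thesis by simp
  qed
  finally show ?thesis by (simp flip: exp_of_real)
 qed
 have c: "0 < c" "0 < \<gamma>" using p p0 by (auto simp: c_def \<gamma>_def)
 have "complex_of_real (LINT s|lborel. c * exp (- \<gamma> * s\<^sup>2)) = of_real c * gauss_integral (of_real \<gamma>) 0"
  by (simp add: gauss_integral_def flip: integral_complex_of_real exp_of_real)
 also have "\<dots> = of_real (c * sqrt (pi / \<gamma>))" using c by (simp add: gauss_integral_of_real)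
 finally have "(LINT s|lborel. c * exp (- \<gamma> * s\<^sup>2)) = c * sqrt (pi / \<gamma>)"
  using of_real_eq_iff by blast
 also have "\<dots> = cmod p / pi * sqrt (pi / (2 * Re p) * (pi / \<gamma>))"
  unfolding c_def real_sqrt_mult by (simp only: mult.assoc)
 also have "pi / (2 * Re p) * (pi / \<gamma>) = (pi / cmod p)\<^sup>2"
  using p p0 by (simp add: \<gamma>_def power2_eq_square field_simps)
 also have "cmod p / pi * sqrt ((pi / cmod p)\<^sup>2) = 1" using p0 by simp
 finally show thesis using that c form by blast
qed

lemma conv_conv:
 assumes G1: "gauss_kernel G1" and G2: "gauss_kernel G2" and f: "L2 f"
 shows "conv G1 (conv G2 f) = conv (conv G1 G2) f"
proof
 fix y
 have [measurable]: "G1 \<in> borel_measurable borel" "G2 \<in> borel_measurable borel" "f \<in> borel_measurable borel"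
  using G1 G2 f by (auto dest: L2_measurable gauss_kernel_measurable)
 let ?F = "\<lambda>(y'', y'). G1 (y - y') * (G2 (y' - y'') * f y'')"
 have iG: "integrable lborel (\<lambda>s. cmod (G1 (y - s)))"
  using lborel_integrable_real_affine[OF gauss_kernel_integrable(3)[OF G1], of "-1" y] by simp
 have i: "integrable (lborel \<Otimes>\<^sub>M lborel) ?F"
 proof (rule Bochner_Integration.integrable_bound)
  let ?g = "\<lambda>p. (case p of (s, y') => cmod (G1 (y - s)) * (cmod (G2 (y' - s)))\<^sup>2)
    + (case p of (s, y') => cmod (G1 (y - s)) * (cmod (f y'))\<^sup>2)"
  have "integrable (lborel \<Otimes>\<^sub>M lborel) ?g"
   by (intro Bochner_Integration.integrable_add integrable_conv_product(1)[where F="\<lambda>y. (cmod (G2 y))\<^sup>2"] integrable_conv_product(2)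
     L2_integrable gauss_kernel_integrable G2 f iG)
  then have "integrable (lborel \<Otimes>\<^sub>M lborel) (\<lambda>(x, y). ?g (y, x))"
   by (rule lborel_pair.integrable_product_swap)
  then show "integrable (lborel \<Otimes>\<^sub>M lborel) (\<lambda>p. ?g (snd p, fst p))"
   by (simp add: case_prod_unfold)
  have "cmod (G1 (y - y') * (G2 (y' - y'') * f y''))
    \<le> cmod (G1 (y - y')) * (cmod (G2 (y'' - y')))\<^sup>2 + cmod (G1 (y - y')) * (cmod (f y''))\<^sup>2" for y' y''
  proof -
   have e: "G2 (y' - y'') = G2 (y'' - y')"
    using G2 unfolding gauss_kernel_def by (metis minus_diff_eq)
   have "cmod (G1 (y - y') * (G2 (y' - y'') * f y'')) = cmod (G1 (y - y')) * cmod (G2 (y'' - y') * f y'')"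
    by (simp add: norm_mult e)
   also have "\<dots> \<le> cmod (G1 (y - y')) * (((cmod (G2 (y'' - y')))\<^sup>2 + (cmod (f y''))\<^sup>2) / 2)"
    by (intro mult_left_mono cmod_mult_le) auto
   also have "\<dots> \<le> cmod (G1 (y - y')) * ((cmod (G2 (y'' - y')))\<^sup>2 + (cmod (f y''))\<^sup>2)"
    by (intro mult_left_mono) auto
   finally show ?thesis by (simp add: distrib_left)
  qed
  then show "AE p in lborel \<Otimes>\<^sub>M lborel. norm (?F p) \<le> norm (?g (snd p, fst p))"
   by (intro AE_I2) (auto simp: split_beta)
 qed measurable
 have "conv G1 (conv G2 f) y = (LINT y'|lborel. LINT y''|lborel. G1 (y - y') * (G2 (y' - y'') * f y''))"
  by (simp add: conv_def)
 also have "\<dots> = (LINT y''|lborel. LINT y'|lborel. G1 (y - y') * (G2 (y' - y'') * f y''))"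
  by (rule lborel_pair.Fubini_integral[OF i])
 also have "\<dots> = (LINT y''|lborel. (LINT r|lborel. G1 (y - y'' - r) * G2 r) * f y'')"
 proof (rule Bochner_Integration.integral_cong[OF refl])
  fix y''
  have "(LINT y'|lborel. G1 (y - y') * (G2 (y' - y'') * f y''))
    = (LINT r|lborel. G1 (y - y'' - r) * (G2 r * f y''))"
   by (subst lborel_integral_real_affine[of 1 _ y'']) (auto simp: algebra_simps)
  then show "(LINT y'|lborel. G1 (y - y') * (G2 (y' - y'') * f y'')) = (LINT r|lborel. G1 (y - y'' - r) * G2 r) * f y''"
   by (simp flip: mult.assoc)
 qed
 finally show "conv G1 (conv G2 f) y = conv (conv G1 G2) f y"
  by (simp add: conv_def)
qed

text \<open>The energy lost by diffusion is an average of this quantity over \<open>s\<close>.\<close>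

definition shift_defect :: "(real => complex) => real => real" where
 "shift_defect f s = nsq (\<lambda>y. f y - f (y - s))"

lemma shift_defect_nonneg [simp]: "0 \<le> shift_defect f s"
 by (simp add: shift_defect_def)

lemma shift_defect_measurable:
 assumes "L2 f" shows "shift_defect f \<in> borel_measurable borel"
proof -
 have [measurable]: "f \<in> borel_measurable borel" using assms by (rule L2_measurable)
 show ?thesis unfolding shift_defect_def[abs_def] nsq_def by measurable
qed

lemma shift_defect_le:
 assumes "L2 f" shows "shift_defect f s \<le> 4 * nsq f"
 unfolding shift_defect_def using nsq_diff_le[OF assms L2_shift[OF assms, of s]] by (simp add: nsq_shift)

lemma shift_defect_double:
 assumes "L2 f" shows "shift_defect f (2 * s) \<le> 4 * shift_defect f s"
proof -
 let ?g = "\<lambda>y. f y - f (y - s)"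
 have g: "L2 ?g" by (intro L2_diff L2_shift assms)
 have "shift_defect f (2 * s) = nsq (\<lambda>y. ?g y + ?g (y - s))"
  by (simp add: shift_defect_def algebra_simps)
 also have "\<dots> \<le> 2 * nsq ?g + 2 * nsq (\<lambda>y. ?g (y - s))"
  by (intro nsq_add_le g L2_shift[OF g])
 also have "nsq (\<lambda>y. ?g (y - s)) = nsq ?g" by (rule nsq_shift)
 finally show ?thesis by (simp add: shift_defect_def)
qed

lemma shift_defect_pow2:
 assumes "L2 f" shows "shift_defect f (2 ^ j * s) \<le> 4 ^ j * shift_defect f s"
proof (induction j)
 case (Suc j)
 have "shift_defect f (2 ^ Suc j * s) \<le> 4 * shift_defect f (2 ^ j * s)"
  using shift_defect_double[OF assms, of "2 ^ j * s"] by (simp add: mult.assoc)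
 also have "\<dots> \<le> 4 * (4 ^ j * shift_defect f s)" using Suc by simp
 finally show ?case by simp
qed simp

lemma integrable_gaussian_defect:
 assumes "L2 f" "integrable lborel g"
 shows "integrable lborel (\<lambda>s. g s * shift_defect f (l * s))"
proof (rule Bochner_Integration.integrable_bound)
 have [measurable]: "shift_defect f \<in> borel_measurable borel" "g \<in> borel_measurable borel"
  using assms shift_defect_measurable by (auto dest: borel_measurable_integrable)
 show "(\<lambda>s. g s * shift_defect f (l * s)) \<in> borel_measurable lborel" by measurable
 show "integrable lborel (\<lambda>s. (4 * nsq f) * g s)"
  using assms by (intro integrable_mult_right)
 have "\<bar>g s\<bar> * shift_defect f (l * s) \<le> \<bar>g s\<bar> * (4 * nsq f)" for s
  by (intro mult_left_mono shift_defect_le assms) auto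
 then show "AE s in lborel. norm (g s * shift_defect f (l * s)) \<le> norm ((4 * nsq f) * g s)"
  by (intro AE_I2) (simp add: abs_mult mult_ac)
qed

lemma L2_heat: "0 < t ==> 0 < Im k ==> L2 f ==> L2 (heat k t f)"
 unfolding heat_def by (intro L2_conv gauss_kernel_green)

lemma pr_heat:
 "0 < t ==> 0 < Im k ==> L2 f ==> L2 h ==> pr (heat k t f) h = pr f (heat k t h)"
 unfolding heat_def by (intro pr_conv_transpose gauss_kernel_green)

text \<open>Since the composition of the heat operator with its adjoint has a kernel of integral 1, the energy loss
 is the convolution defect of that kernel.\<close>

lemma heat_energy:
 assumes t: "0 < t" and k: "0 < Im k"
 obtains c \<gamma> where "0 < c" "0 < \<gamma>"
  "\<And>f. L2 f ==> nsq f - nsq (heat k t f) = (LINT s|lborel. c * exp (- \<gamma> * s\<^sup>2) * shift_defect f s) / 2"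
proof -
 let ?K = "green k t" and ?Kb = "\<lambda>s. cnj (green k t s)"
 note K = gauss_kernel_green[OF t k]
 obtain c \<gamma> where c: "0 < c" "0 < \<gamma>" and g: "\<And>s. conv ?Kb ?K s = of_real (c * exp (- \<gamma> * s\<^sup>2))"
  and int: "(LINT s|lborel. c * exp (- \<gamma> * s\<^sup>2)) = 1"
  using green_conv_cnj[OF t k] by blast
 let ?g = "\<lambda>s. complex_of_real (c * exp (- \<gamma> * s\<^sup>2))"
 have gg: "conv ?Kb ?K = ?g" using g by auto
 have "\<forall>s. cmod (?g s) \<le> c * exp (- \<gamma> * s\<^sup>2)" using c by (simp add: norm_mult)
 then have "\<exists>C \<alpha>. 0 < \<alpha> \<and> (\<forall>s. cmod (?g s) \<le> C * exp (- \<alpha> * s\<^sup>2))" using c by blast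
 then have ker: "gauss_kernel ?g"
  unfolding gauss_kernel_def by (auto intro!: continuous_intros)
 have "nsq f - nsq (heat k t f) = (LINT s|lborel. c * exp (- \<gamma> * s\<^sup>2) * shift_defect f s) / 2" if f: "L2 f" for f
 proof -
  let ?h = "\<lambda>y. cnj (f y)"
  have h: "L2 ?h" by (rule L2_cnj[OF f])
  have "pr (conv ?g f) ?h = pr (conv ?Kb (conv ?K f)) ?h"
   by (simp add: conv_conv[OF K(2) K(1) f] gg)
  also have "\<dots> = pr (conv ?K f) (conv ?Kb ?h)"
   by (intro pr_conv_transpose K h L2_conv f)
  also have "conv ?Kb ?h = (\<lambda>y. cnj (conv ?K f y))"
   by (auto simp: conv_def simp flip: Bochner_Integration.integral_cnj)
  also have "pr (conv ?K f) \<dots> = of_real (nsq (heat k t f))"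
   by (simp add: pr_cnj heat_def)
  finally have e: "pr (conv ?g f) ?h = of_real (nsq (heat k t f))" .
  have i1: "(LINT s|lborel. ?g s) = 1"
   unfolding integral_complex_of_real int by simp
  have inner: "(LINT y|lborel. (f y - f (y - s)) * (?h y - ?h (y - s))) = of_real (shift_defect f s)" for s
   using pr_cnj[of "\<lambda>y. f y - f (y - s)"] by (simp add: pr_def shift_defect_def)
  have "complex_of_real (nsq f - nsq (heat k t f)) = (LINT s|lborel. ?g s * of_real (shift_defect f s)) / 2"
   using conv_defect[OF ker f h] unfolding i1 inner e pr_cnj by simp
  also have "\<dots> = of_real ((LINT s|lborel. c * exp (- \<gamma> * s\<^sup>2) * shift_defect f s) / 2)"
   by (simp flip: integral_complex_of_real)
  finally show ?thesis using of_real_eq_iff by blast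
 qed
 then show thesis using that c by blast
qed

lemma heat_contraction:
 assumes "0 < t" "0 < Im k" "L2 f"
 shows "nsq (heat k t f) \<le> nsq f"
proof -
 obtain c \<gamma> where c: "0 < c" "0 < \<gamma>" and
  e: "\<And>f. L2 f ==> nsq f - nsq (heat k t f) = (LINT s|lborel. c * exp (- \<gamma> * s\<^sup>2) * shift_defect f s) / 2"
  using heat_energy[OF assms(1,2)] by blast
 have "0 \<le> (LINT s|lborel. c * exp (- \<gamma> * s\<^sup>2) * shift_defect f s)"
  using c by (intro Bochner_Integration.integral_nonneg) auto
 then show ?thesis using e[OF assms(3)] by simp
qed

text \<open>The kernel itself may decay more slowly than the energy weight; the doubling inequality for
 \<open>\<parallel>f - \<tau>\<^sub>s f\<parallel>\<^sup>2\<close> compensates for that by rescaling \<open>s\<close> by a power of two.\<close>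

lemma gaussian_defect_le_energy:
 assumes t: "0 < t" and k: "0 < Im k" and b: "0 < \<beta>"
 obtains C where "0 \<le> C"
  "\<And>f. L2 f ==> (LINT s|lborel. exp (- \<beta> * s\<^sup>2) * shift_defect f s) \<le> C * (nsq f - nsq (heat k t f))"
proof -
 obtain c \<gamma> where c: "0 < c" "0 < \<gamma>" and
  e: "\<And>f. L2 f ==> nsq f - nsq (heat k t f) = (LINT s|lborel. c * exp (- \<gamma> * s\<^sup>2) * shift_defect f s) / 2"
  using heat_energy[OF t k] by blast
 \<comment> \<open>after rescaling by \<open>2 ^ j\<close> the given Gaussian decays faster than the energy weight\<close>
 obtain j where j: "\<gamma> / \<beta> < 4 ^ j" using real_arch_pow[of 4 "\<gamma> / \<beta>"] by auto
 let ?m = "2 ^ j :: real"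
 have "(4::real) ^ j = ?m\<^sup>2" by (simp add: power2_eq_square flip: power_mult_distrib)
 then have gb: "\<gamma> \<le> \<beta> * ?m\<^sup>2" using j b by (simp add: field_simps)
 have "(LINT s|lborel. exp (- \<beta> * s\<^sup>2) * shift_defect f s) \<le> (2 * 8 ^ j / c) * (nsq f - nsq (heat k t f))" if f: "L2 f" for f
 proof -
  have "(LINT s|lborel. exp (- \<beta> * s\<^sup>2) * shift_defect f s)
    = ?m * (LINT s|lborel. exp (- \<beta> * (?m * s)\<^sup>2) * shift_defect f (?m * s))"
   by (subst lborel_integral_real_affine[of ?m _ 0]) auto
  also have "\<dots> \<le> ?m * (LINT s|lborel. 4 ^ j * (exp (- \<gamma> * s\<^sup>2) * shift_defect f s))"
  proof (intro mult_left_mono integral_mono)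
   have "\<beta> * ?m\<^sup>2 > 0" using b by simp
   then show "integrable lborel (\<lambda>s. exp (- \<beta> * (?m * s)\<^sup>2) * shift_defect f (?m * s))"
    using integrable_gaussian_defect[OF f integrable_gaussian[of "\<beta> * ?m\<^sup>2"], of ?m]
    by (simp add: power_mult_distrib mult.assoc)
   show "integrable lborel (\<lambda>s. 4 ^ j * (exp (- \<gamma> * s\<^sup>2) * shift_defect f s))"
    using integrable_gaussian_defect[OF f integrable_gaussian[of "\<gamma>"], of 1] c
    by (intro integrable_mult_right) simp
   fix s :: real
   have "\<gamma> * s\<^sup>2 \<le> \<beta> * ?m\<^sup>2 * s\<^sup>2" by (intro mult_right_mono gb) auto
   then have "exp (- \<beta> * (?m * s)\<^sup>2) \<le> exp (- \<gamma> * s\<^sup>2)" by (simp add: power_mult_distrib mult.assoc)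
   then have "exp (- \<beta> * (?m * s)\<^sup>2) * shift_defect f (?m * s) \<le> exp (- \<gamma> * s\<^sup>2) * (4 ^ j * shift_defect f s)"
    by (intro mult_mono shift_defect_pow2 f) auto
   then show "exp (- \<beta> * (?m * s)\<^sup>2) * shift_defect f (?m * s) \<le> 4 ^ j * (exp (- \<gamma> * s\<^sup>2) * shift_defect f s)"
    by (simp add: mult_ac)
  qed simp
  also have "\<dots> = 8 ^ j * (LINT s|lborel. exp (- \<gamma> * s\<^sup>2) * shift_defect f s)"
  proof -
   have "(8::real) ^ j = ?m * 4 ^ j" by (simp flip: power_mult_distrib)
   then show ?thesis by simp
  qed
  also have "(LINT s|lborel. exp (- \<gamma> * s\<^sup>2) * shift_defect f s) = 2 / c * (nsq f - nsq (heat k t f))"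
  proof -
   have "nsq f - nsq (heat k t f) = c * (LINT s|lborel. exp (- \<gamma> * s\<^sup>2) * shift_defect f s) / 2"
    using e[OF f] by (simp add: mult.assoc)
   moreover have "x = c * I / 2 ==> I = 2 / c * x" for x I :: real using c by (auto simp: field_simps)
   ultimately show ?thesis by blast
  qed
  finally show ?thesis by (simp add: algebra_simps diff_divide_distrib)
 qed
 then show thesis using that[of "2 * 8 ^ j / c"] c by simp
qed

text \<open>By \<open>conv_defect\<close> the left hand side is an average of products of increments of \<open>f\<close> and \<open>h\<close>; each
 factor is controlled by the energy that it loses.\<close>

lemma heat_defect_bilinear:
 assumes t: "0 < t" and k: "0 < Im k"
 obtains C where "0 < C"
  "\<And>f h l. L2 f ==> L2 h ==> 0 < l ==> cmod (pr f h - pr (heat k t f) h)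
    \<le> C * (l * (nsq f - nsq (heat k t f)) + (nsq h - nsq (heat k t h)) / l)"
proof -
 define \<beta> where "\<beta> = Im k / (2 * t)"
 define A where "A = sqrt (cmod (gauss_rate k t) / pi)"
 have b: "0 < \<beta>" using t k by (simp add: \<beta>_def)
 have A: "0 \<le> A" by (simp add: A_def)
 obtain C where C: "0 \<le> C" and
  CE: "\<And>f. L2 f ==> (LINT s|lborel. exp (- \<beta> * s\<^sup>2) * shift_defect f s) \<le> C * (nsq f - nsq (heat k t f))"
  using gaussian_defect_le_energy[OF t k b] by blast
 have main: "cmod (pr f h - pr (heat k t f) h)
    \<le> (A * C) * (l * (nsq f - nsq (heat k t f)) + (nsq h - nsq (heat k t h)) / l)"
  if f: "L2 f" and h: "L2 h" and l: "0 < l" for f h l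
 proof -
  let ?I = "\<lambda>s. LINT y|lborel. (f y - f (y - s)) * (h y - h (y - s))"
  have i: "integrable lborel (\<lambda>s. exp (- \<beta> * s\<^sup>2) * shift_defect f s)"
    "integrable lborel (\<lambda>s. exp (- \<beta> * s\<^sup>2) * shift_defect h s)"
   using integrable_gaussian_defect[OF f integrable_gaussian[OF b], of 1]
    integrable_gaussian_defect[OF h integrable_gaussian[OF b], of 1] by simp_all
  have Ib: "cmod (?I s) \<le> l * shift_defect f s + shift_defect h s / l" for s
  proof -
   have "cmod (?I s) \<le> (l * shift_defect f s + shift_defect h s / l) / 2"
    using pr_bound_weighted[OF L2_diff[OF f L2_shift[OF f]] L2_diff[OF h L2_shift[OF h]] l, of s s]
    by (simp add: pr_def shift_defect_def)
   also have "(x + z) / 2 \<le> x + z" if "0 \<le> x" "0 \<le> z" for x z :: real using that by simp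
   from this[of "l * shift_defect f s" "shift_defect h s / l"]
   have "(l * shift_defect f s + shift_defect h s / l) / 2
     \<le> l * shift_defect f s + shift_defect h s / l" using l by (simp only: shift_defect_nonneg
      mult_nonneg_nonneg divide_nonneg_pos less_imp_le)
   finally show ?thesis .
  qed
  have [measurable]: "f \<in> borel_measurable borel" "h \<in> borel_measurable borel" "green k t \<in> borel_measurable borel"
   using f h gauss_kernel_green[OF t k] by (auto dest: L2_measurable gauss_kernel_measurable)
  have "pr f h - pr (heat k t f) h = (LINT s|lborel. green k t s * ?I s) / 2"
   using conv_defect[OF gauss_kernel_green(1)[OF t k] f h] integral_green[OF t k] by (simp add: heat_def)
  then have "cmod (pr f h - pr (heat k t f) h) = cmod (LINT s|lborel. green k t s * ?I s) / 2"
   by (simp only: norm_divide norm_numeral)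
  then have "cmod (pr f h - pr (heat k t f) h) \<le> cmod (LINT s|lborel. green k t s * ?I s)"
   using norm_ge_zero[of "LINT s|lborel. green k t s * ?I s"] by linarith
  also have "\<dots> \<le> (LINT s|lborel. A * l * (exp (- \<beta> * s\<^sup>2) * shift_defect f s)
     + A / l * (exp (- \<beta> * s\<^sup>2) * shift_defect h s))"
  proof (rule norm_integral_le)
   fix s
   have "cmod (green k t s * ?I s) \<le> (A * exp (- \<beta> * s\<^sup>2)) * (l * shift_defect f s + shift_defect h s / l)"
    unfolding norm_mult norm_green[OF t] A_def[symmetric] \<beta>_def[symmetric]
    by (intro mult_left_mono Ib) (use A in auto)
   then show "cmod (green k t s * ?I s) \<le> A * l * (exp (- \<beta> * s\<^sup>2) * shift_defect f s)
     + A / l * (exp (- \<beta> * s\<^sup>2) * shift_defect h s)"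
    by (simp add: algebra_simps)
  qed (use i in auto)
  also have "\<dots> = A * (l * (LINT s|lborel. exp (- \<beta> * s\<^sup>2) * shift_defect f s)
     + (LINT s|lborel. exp (- \<beta> * s\<^sup>2) * shift_defect h s) / l)"
   using i by (simp add: algebra_simps)
  also have "\<dots> \<le> A * (l * (C * (nsq f - nsq (heat k t f))) + (C * (nsq h - nsq (heat k t h))) / l)"
   using A l CE[OF f] CE[OF h] by (intro mult_left_mono add_mono divide_right_mono) auto
  also have "\<dots> = A * C * (l * (nsq f - nsq (heat k t f)) + (nsq h - nsq (heat k t h)) / l)"
   by (simp add: algebra_simps)
  finally show ?thesis .
 qed
 show thesis
 proof (rule that[of "A * C + 1"])
  fix f h l assume f: "L2 f" and h: "L2 h" and l: "0 < (l::real)"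
  have "0 \<le> l * (nsq f - nsq (heat k t f)) + (nsq h - nsq (heat k t h)) / l"
   using heat_contraction[OF t k f] heat_contraction[OF t k h] l by auto
  then show "cmod (pr f h - pr (heat k t f) h)
    \<le> (A * C + 1) * (l * (nsq f - nsq (heat k t f)) + (nsq h - nsq (heat k t h)) / l)"
   using main[OF f h l] by (simp add: distrib_right)
 qed (use A C in \<open>simp add: add_nonneg_pos\<close>)
qed

text \<open>The bilinear estimate with \<open>h\<close> the conjugate of \<open>f - heat k t f\<close>, whose own energy loss is absorbed.\<close>

lemma heat_defect_nsq:
 assumes t: "0 < t" and k: "0 < Im k"
 obtains C where "0 < C" "\<And>f. L2 f ==> nsq (\<lambda>y. f y - heat k t f y) \<le> C * (nsq f - nsq (heat k t f))"
proof -
 obtain C where C: "0 < C" and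
  CE: "\<And>f h l. L2 f ==> L2 h ==> 0 < l ==> cmod (pr f h - pr (heat k t f) h)
    \<le> C * (l * (nsq f - nsq (heat k t f)) + (nsq h - nsq (heat k t h)) / l)"
  using heat_defect_bilinear[OF t k] by blast
 have "nsq (\<lambda>y. f y - heat k t f y) \<le> (4 * C\<^sup>2) * (nsq f - nsq (heat k t f))" if f: "L2 f" for f
 proof -
  let ?d = "\<lambda>y. f y - heat k t f y" and ?h = "\<lambda>y. cnj (f y - heat k t f y)"
  have d: "L2 ?d" and h: "L2 ?h" by (intro L2_cnj L2_diff L2_heat t k f)+
  have "nsq ?h = nsq ?d" unfolding nsq_def complex_mod_cnj ..
  have "pr f ?h - pr (heat k t f) ?h = of_real (nsq ?d)"
   using pr_diff_left[OF f L2_heat[OF t k f] h] pr_cnj[of ?d] by simp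
  then have "nsq ?d = cmod (pr f ?h - pr (heat k t f) ?h)" by simp
  also have "\<dots> \<le> C * ((2 * C) * (nsq f - nsq (heat k t f)) + (nsq ?h - nsq (heat k t ?h)) / (2 * C))"
   using C by (intro CE f h) auto
  also have "\<dots> \<le> C * ((2 * C) * (nsq f - nsq (heat k t f)) + nsq ?d / (2 * C))"
   using C \<open>nsq ?h = nsq ?d\<close> by (intro mult_left_mono add_left_mono divide_right_mono) auto
  also have "\<dots> = 2 * C\<^sup>2 * (nsq f - nsq (heat k t f)) + nsq ?d / 2"
   using C by (simp add: field_simps power2_eq_square)
  finally show ?thesis by simp
 qed
 then show thesis using that[of "4 * C\<^sup>2"] C by simp
qed

lemma integrable_exp_abs:
 fixes c :: real assumes "0 < c" shows "integrable lborel (\<lambda>y. exp (- c * \<bar>y\<bar>))"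
proof -
 have "integrable lborel (\<lambda>y::real. exp (- \<bar>y\<bar>))"
 proof (rule Bochner_Integration.integrable_bound)
  show "integrable lborel (\<lambda>y::real. 3 * inverse (1 + y\<^sup>2))"
   using integrable_inverse_1_plus_square by (simp add: set_integrable_def einterval_def)
  have "exp (- \<bar>y\<bar>) \<le> 3 * inverse (1 + y\<^sup>2)" for y :: real
  proof -
   have "1 + y\<^sup>2 \<le> 3 * exp \<bar>y\<bar>" 
   proof -
    have "y\<^sup>2 \<le> 2 * exp \<bar>y\<bar>" using power_le_exp[of y 2] by (simp add: fact_numeral)
    moreover have "1 \<le> exp \<bar>y\<bar>" by simp
    ultimately show ?thesis by linarith
   qed
   moreover have "0 < 1 + y\<^sup>2" by (simp add: add_pos_nonneg)
   ultimately show ?thesis by (simp add: exp_minus field_simps)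
  qed
  then show "AE y::real in lborel. norm (exp (- \<bar>y\<bar>)) \<le> norm (3 * inverse (1 + y\<^sup>2))"
   by (intro AE_I2) (simp add: abs_mult)
 qed measurable
 from lborel_integrable_real_affine[OF this, of c 0] assms show ?thesis by (simp add: abs_mult)
qed

lemma L2_of_exp_bound:
 assumes "f \<in> borel_measurable borel" "0 < c" "\<And>y. cmod (f y) \<le> C * exp (- c * \<bar>y\<bar>)"
 shows "L2 f"
proof (rule L2_bound[OF assms(1)])
 show "integrable lborel (\<lambda>y. C\<^sup>2 * exp (- (2 * c) * \<bar>y\<bar>))"
  using assms(2) by (intro integrable_mult_right integrable_exp_abs) simp
 fix y
 have "(cmod (f y))\<^sup>2 \<le> (C * exp (- c * \<bar>y\<bar>))\<^sup>2" by (intro power_mono assms) simp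
 also have "\<dots> = C\<^sup>2 * exp (- (2 * c) * \<bar>y\<bar>)"
  by (simp add: power_mult_distrib flip: exp_double)
 finally show "(cmod (f y))\<^sup>2 \<le> C\<^sup>2 * exp (- (2 * c) * \<bar>y\<bar>)" .
qed

lemma pr_diff_right: "L2 f ==> L2 g ==> L2 h ==> pr f (\<lambda>y. g y - h y) = pr f g - pr f h"
 by (simp add: pr_def right_diff_distrib integrable_mult_L2)

section \<open>Products of two heat operators with sign changes\<close>

definition sign_factor :: "(real => complex) => bool" where
 "sign_factor \<eta> \<longleftrightarrow> \<eta> \<in> borel_measurable borel \<and> (\<forall>y. \<eta> y = 1 \<or> \<eta> y = - 1)"

lemma sign_factor_simps:
 assumes "sign_factor \<eta>"
 shows "\<eta> \<in> borel_measurable borel" "cmod (\<eta> y) = 1" "\<eta> y * \<eta> y = 1" "\<eta> y * (\<eta> y * x) = x"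
proof -
 show "\<eta> \<in> borel_measurable borel" using assms by (simp add: sign_factor_def)
 have "\<eta> y = 1 \<or> \<eta> y = - 1" using assms by (simp add: sign_factor_def)
 then show "cmod (\<eta> y) = 1" "\<eta> y * \<eta> y = 1" "\<eta> y * (\<eta> y * x) = x" by auto
qed

lemma L2_sign: "sign_factor \<eta> ==> L2 f ==> L2 (\<lambda>y. \<eta> y * f y)"
 by (auto simp: L2_def norm_mult sign_factor_simps intro!: borel_measurable_times)

lemma nsq_sign: "sign_factor \<eta> ==> nsq (\<lambda>y. \<eta> y * f y) = nsq f"
 by (simp add: nsq_def norm_mult sign_factor_simps)

lemma pr_sign: "pr (\<lambda>y. \<eta> y * f y) h = pr f (\<lambda>y. \<eta> y * h y)"
 by (simp add: pr_def mult_ac)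

lemma pr_sign_sign: "sign_factor \<eta> ==> pr (\<lambda>y. \<eta> y * f y) (\<lambda>y. \<eta> y * h y) = pr f h"
 by (simp add: pr_sign sign_factor_simps)

text \<open>Passage through a node followed by diffusion over the distance \<open>t\<close> to the next one.\<close>

definition hstep :: "complex => (real => complex) => real => (real => complex) => real => complex" where
 "hstep k \<eta> t f = heat k t (\<lambda>y. \<eta> y * f y)"

definition period :: "complex => (real => complex) => real => real => (real => complex) => real => complex" where
 "period k \<eta> t1 t2 f = hstep k \<eta> t2 (hstep k \<eta> t1 f)"

text \<open>The transpose of the period operator for the pairing \<open>pr\<close>.\<close>

definition period_transpose :: "complex => (real => complex) => real => real => (real => complex) => real => complex" where
 "period_transpose k \<eta> t1 t2 h = (\<lambda>y. \<eta> y * hstep k \<eta> t1 (heat k t2 h) y)"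

locale two_step =
 fixes k :: complex and \<eta> :: "real => complex" and t1 t2 :: real
 assumes k: "0 < Im k" and eta: "sign_factor \<eta>" and t1: "0 < t1" and t2: "0 < t2"
begin

abbreviation "P \<equiv> period k \<eta> t1 t2"
abbreviation "PT \<equiv> period_transpose k \<eta> t1 t2"

lemma L2_hstep: "0 < t ==> L2 f ==> L2 (hstep k \<eta> t f)"
 unfolding hstep_def by (intro L2_heat k L2_sign eta)

lemma L2_P: "L2 f ==> L2 (P f)"
 unfolding period_def by (intro L2_hstep t1 t2)

lemma L2_PT: "L2 h ==> L2 (PT h)"
 unfolding period_transpose_def by (intro L2_sign eta L2_hstep t1 L2_heat t2 k)

lemma L2_P_pow: "L2 f ==> L2 ((P ^^ n) f)"
 by (induction n) (auto intro: L2_P)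

lemma L2_PT_pow: "L2 f ==> L2 ((PT ^^ n) f)"
 by (induction n) (auto intro: L2_PT)

lemma pr_hstep: "0 < t ==> L2 f ==> L2 h ==> pr (hstep k \<eta> t f) h = pr f (\<lambda>y. \<eta> y * heat k t h y)"
 unfolding hstep_def by (simp add: pr_heat k L2_sign[OF eta] pr_sign)

lemma pr_P: assumes "L2 f" "L2 h" shows "pr (P f) h = pr f (PT h)"
proof -
 have "pr (P f) h = pr (hstep k \<eta> t1 f) (\<lambda>y. \<eta> y * heat k t2 h y)"
  unfolding period_def by (intro pr_hstep t2 L2_hstep t1 assms)
 also have "\<dots> = pr f (\<lambda>y. \<eta> y * heat k t1 (\<lambda>y. \<eta> y * heat k t2 h y) y)"
  by (intro pr_hstep t1 assms L2_sign eta L2_heat t2 k)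
 finally show ?thesis by (simp add: period_transpose_def hstep_def)
qed

lemma pr_P_pow: assumes "L2 f" "L2 h" shows "pr ((P ^^ n) f) h = pr f ((PT ^^ n) h)"
 using assms(2)
proof (induction n arbitrary: h)
 case (Suc n)
 then show ?case using pr_P[OF L2_P_pow[OF assms(1)], of h n] Suc.IH[OF L2_PT]
  by (simp add: funpow_swap1)
qed simp

lemma nsq_hstep_le: "0 < t ==> L2 f ==> nsq (hstep k \<eta> t f) \<le> nsq f"
 using heat_contraction[OF _ k L2_sign[OF eta], of t f] nsq_sign[OF eta] by (simp add: hstep_def)

lemma nsq_P_le: "L2 f ==> nsq (P f) \<le> nsq f"
 unfolding period_def using nsq_hstep_le[OF t2 L2_hstep[OF t1]] nsq_hstep_le[OF t1] by (meson order_trans)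

lemma nsq_PT_le: "L2 f ==> nsq (PT f) \<le> nsq f"
 unfolding period_transpose_def nsq_sign[OF eta]
 using nsq_hstep_le[OF t1 L2_heat[OF t2 k]] heat_contraction[OF t2 k] by (meson order_trans)

text \<open>One period as the product of the contractions \<open>X = \<eta> e\<^bsup>t1\<Delta>\<^esup> \<eta>\<close> and \<open>Y = e\<^bsup>t2\<Delta>\<^esup>\<close>:
 each of them moves a function only as far as it dissipates energy.\<close>

definition X where "X f = (\<lambda>y. \<eta> y * hstep k \<eta> t1 f y)"
definition Y where "Y f = heat k t2 f"

lemma P_XY: "P f = Y (X f)" and PT_XY: "PT h = X (Y h)"
 by (simp_all add: period_def period_transpose_def X_def Y_def hstep_def)

lemma XY_bounds:
 obtains C where "0 < C"
  "\<And>f h. L2 f ==> L2 h ==> cmod (pr f h - pr (X f) h) \<le> C * ((nsq f - nsq (X f)) + (nsq h - nsq (X h)))"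
  "\<And>f h. L2 f ==> L2 h ==> cmod (pr f h - pr (Y f) h) \<le> C * ((nsq f - nsq (Y f)) + (nsq h - nsq (Y h)))"
  "\<And>f. L2 f ==> nsq (\<lambda>y. f y - X f y) \<le> C * (nsq f - nsq (X f))"
  "\<And>f. L2 f ==> nsq (\<lambda>y. f y - Y f y) \<le> C * (nsq f - nsq (Y f))"
proof -
 obtain C1 where C1: "0 < C1" "\<And>f h l. L2 f ==> L2 h ==> 0 < l ==> cmod (pr f h - pr (heat k t1 f) h)
    \<le> C1 * (l * (nsq f - nsq (heat k t1 f)) + (nsq h - nsq (heat k t1 h)) / l)"
  using heat_defect_bilinear[OF t1 k] by blast
 obtain C2 where C2: "0 < C2" "\<And>f h l. L2 f ==> L2 h ==> 0 < l ==> cmod (pr f h - pr (heat k t2 f) h)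
    \<le> C2 * (l * (nsq f - nsq (heat k t2 f)) + (nsq h - nsq (heat k t2 h)) / l)"
  using heat_defect_bilinear[OF t2 k] by blast
 obtain C3 where C3: "0 < C3" "\<And>f. L2 f ==> nsq (\<lambda>y. f y - heat k t1 f y) \<le> C3 * (nsq f - nsq (heat k t1 f))"
  using heat_defect_nsq[OF t1 k] by blast
 obtain C4 where C4: "0 < C4" "\<And>f. L2 f ==> nsq (\<lambda>y. f y - heat k t2 f y) \<le> C4 * (nsq f - nsq (heat k t2 f))"
  using heat_defect_nsq[OF t2 k] by blast
 define C where "C = C1 + C2 + C3 + C4"
 have C: "0 < C" "C1 \<le> C" "C2 \<le> C" "C3 \<le> C" "C4 \<le> C" using C1(1) C2(1) C3(1) C4(1) by (auto simp: C_def)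
 have mono: "c \<le> C ==> x \<le> c * z ==> 0 \<le> z ==> x \<le> C * z" for c x z
  by (meson mult_right_mono order_trans)
 have EX: "nsq f - nsq (X f) = nsq (\<lambda>y. \<eta> y * f y) - nsq (heat k t1 (\<lambda>y. \<eta> y * f y))" for f
  by (simp add: X_def nsq_sign[OF eta] hstep_def)
 have pos1: "0 \<le> nsq f - nsq (heat k t1 f)" and pos2: "0 \<le> nsq f - nsq (heat k t2 f)" if "L2 f" for f
  using heat_contraction[OF t1 k that] heat_contraction[OF t2 k that] by auto
 show thesis
 proof (rule that[OF C(1)])
  fix f h assume f: "L2 f" and h: "L2 h"
  let ?f = "\<lambda>y. \<eta> y * f y" and ?h = "\<lambda>y. \<eta> y * h y"
  have L: "L2 ?f" "L2 ?h" by (intro L2_sign eta f h)+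
  have e: "pr f h - pr (X f) h = pr ?f ?h - pr (heat k t1 ?f) ?h"
   by (simp add: pr_sign_sign[OF eta]) (simp add: X_def hstep_def pr_sign)
  have "cmod (pr f h - pr (X f) h) \<le> C1 * ((nsq f - nsq (X f)) + (nsq h - nsq (X h)))"
   unfolding e EX using C1(2)[OF L, of 1] by simp
  then show "cmod (pr f h - pr (X f) h) \<le> C * ((nsq f - nsq (X f)) + (nsq h - nsq (X h)))"
   by (rule mono[OF C(2)]) (unfold EX, use pos1[OF L(1)] pos1[OF L(2)] in simp)
  have "cmod (pr f h - pr (Y f) h) \<le> C2 * ((nsq f - nsq (Y f)) + (nsq h - nsq (Y h)))"
   unfolding Y_def using C2(2)[OF f h, of 1] by simp
  then show "cmod (pr f h - pr (Y f) h) \<le> C * ((nsq f - nsq (Y f)) + (nsq h - nsq (Y h)))"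
   by (rule mono[OF C(3)]) (unfold Y_def, use pos2[OF f] pos2[OF h] in simp)
 next
  fix f assume f: "L2 f"
  let ?f = "\<lambda>y. \<eta> y * f y"
  have L: "L2 ?f" by (intro L2_sign eta f)
  have "nsq (\<lambda>y. f y - X f y) = nsq (\<lambda>y. \<eta> y * (f y - X f y))" by (simp add: nsq_sign[OF eta])
  also have "(\<lambda>y. \<eta> y * (f y - X f y)) = (\<lambda>y. ?f y - heat k t1 ?f y)"
   by (simp add: X_def hstep_def right_diff_distrib sign_factor_simps[OF eta])
  also have "nsq \<dots> \<le> C3 * (nsq f - nsq (X f))" unfolding EX by (rule C3(2)[OF L])
  finally show "nsq (\<lambda>y. f y - X f y) \<le> C * (nsq f - nsq (X f))"
   by (rule mono[OF C(4)]) (unfold EX, rule pos1[OF L])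
  show "nsq (\<lambda>y. f y - Y f y) \<le> C * (nsq f - nsq (Y f))"
   unfolding Y_def by (rule mono[OF C(5) C4(2)[OF f] pos2[OF f]])
 qed
qed

lemma L2_X: "L2 f ==> L2 (X f)" and L2_Y: "L2 f ==> L2 (Y f)"
 unfolding X_def Y_def by (intro L2_sign eta L2_hstep L2_heat t1 t2 k; assumption)+

lemma nsq_X_le: "L2 f ==> nsq (X f) \<le> nsq f" and nsq_Y_le: "L2 f ==> nsq (Y f) \<le> nsq f"
 unfolding X_def Y_def nsq_sign[OF eta] by (intro nsq_hstep_le heat_contraction t1 t2 k; assumption)+

text \<open>The energy loss of \<open>PT h\<close> contains that of \<open>X\<close> at \<open>Y h\<close>, not at \<open>h\<close>.  So the defect of \<open>X\<close> at \<open>f\<close> is paired with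
 \<open>Y h\<close>; the error is the pairing of two defects, which is bounded by their square norms.\<close>

lemma period_variation:
 obtains C where "0 < C"
  "\<And>f h. L2 f ==> L2 h ==> cmod (pr f h - pr (P f) h) \<le> C * ((nsq f - nsq (P f)) + (nsq h - nsq (PT h)))"
proof -
 obtain C where C: "0 < C"
  and BX: "\<And>f h. L2 f ==> L2 h ==> cmod (pr f h - pr (X f) h) \<le> C * ((nsq f - nsq (X f)) + (nsq h - nsq (X h)))"
  and BY: "\<And>f h. L2 f ==> L2 h ==> cmod (pr f h - pr (Y f) h) \<le> C * ((nsq f - nsq (Y f)) + (nsq h - nsq (Y h)))"
  and DX: "\<And>f. L2 f ==> nsq (\<lambda>y. f y - X f y) \<le> C * (nsq f - nsq (X f))"
  and DY: "\<And>f. L2 f ==> nsq (\<lambda>y. f y - Y f y) \<le> C * (nsq f - nsq (Y f))"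
  by (rule XY_bounds) (rule that)
 have "cmod (pr f h - pr (P f) h) \<le> (2 * C) * ((nsq f - nsq (P f)) + (nsq h - nsq (PT h)))"
  if f: "L2 f" and h: "L2 h" for f h
 proof -
  note L = f h L2_X[OF f] L2_Y[OF h] L2_X[OF L2_Y[OF h]] L2_Y[OF L2_X[OF f]]
  define u where "u = pr f (Y h) - pr (X f) (Y h)"
  define v where "v = pr (\<lambda>y. f y - X f y) (\<lambda>y. h y - Y h y)"
  define w where "w = pr (X f) h - pr (Y (X f)) h"
  have v: "v = (pr f h - pr (X f) h) - (pr f (Y h) - pr (X f) (Y h))"
   unfolding v_def using L L2_diff[OF h L(4)]
   by (simp add: pr_diff_left pr_diff_right)
  have e: "pr f h - pr (P f) h = u + v + w"
   unfolding P_XY u_def w_def v by (simp only: diff_add_eq add_diff_eq diff_diff_eq2 diff_diff_eq add_diff_cancel_left' add_diff_cancel algebra_simps)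
  have "cmod (pr f h - pr (P f) h) \<le> cmod u + cmod v + cmod w"
   unfolding e using norm_triangle_ineq[of "u + v" w] norm_triangle_ineq[of u v] by linarith
  moreover have "cmod u \<le> C * ((nsq f - nsq (X f)) + (nsq (Y h) - nsq (X (Y h))))"
   unfolding u_def by (intro BX L)
  moreover have "cmod w \<le> C * ((nsq (X f) - nsq (Y (X f))) + (nsq h - nsq (Y h)))"
   unfolding w_def by (intro BY L)
  moreover have "cmod v \<le> (nsq (\<lambda>y. f y - X f y) + nsq (\<lambda>y. h y - Y h y)) / 2"
   unfolding v_def by (intro pr_bound L2_diff L)
  moreover have "\<dots> \<le> C * ((nsq f - nsq (X f)) + (nsq h - nsq (Y h)))"
  proof -
   have "0 \<le> nsq (\<lambda>y. f y - X f y)" "0 \<le> nsq (\<lambda>y. h y - Y h y)" by auto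
   moreover have "0 \<le> a ==> 0 \<le> b ==> a \<le> p ==> b \<le> q ==> (a + b) / 2 \<le> p + q" for a b p q :: real
    by simp
   ultimately show ?thesis using DX[OF f] DY[OF h] unfolding distrib_left by blast
  qed
  moreover have "0 \<le> C * (nsq (Y h) - nsq (X (Y h)))" "0 \<le> C * (nsq (X f) - nsq (Y (X f)))"
   using nsq_X_le[OF L(4)] nsq_Y_le[OF L(3)] C by auto
  moreover have "C * ((nsq f - nsq (X f)) + (nsq (Y h) - nsq (X (Y h)))) + C * ((nsq f - nsq (X f)) + (nsq h - nsq (Y h)))
    + C * ((nsq (X f) - nsq (Y (X f))) + (nsq h - nsq (Y h)))
   = 2 * C * ((nsq f - nsq (Y (X f))) + (nsq h - nsq (X (Y h))))
    - C * (nsq (Y h) - nsq (X (Y h))) - C * (nsq (X f) - nsq (Y (X f)))"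
   by (simp add: algebra_simps)
  moreover have "m \<le> a + b + c ==> a \<le> a' ==> c \<le> c' ==> b \<le> b'' ==> b'' \<le> b' ==> 0 \<le> p ==> 0 \<le> q
    ==> a' + b' + c' = T - p - q ==> m \<le> T" for m a b c a' b' b'' c' p q T :: real
   by linarith
  ultimately show ?thesis unfolding P_XY PT_XY by blast
 qed
 then show thesis using that[of "2 * C"] C by simp
qed

lemma period_defect:
 obtains C where "0 < C" "\<And>f. L2 f ==> nsq (\<lambda>y. f y - P f y) \<le> C * (nsq f - nsq (P f))"
proof -
 obtain C where C: "0 < C"
  and DX: "\<And>f. L2 f ==> nsq (\<lambda>y. f y - X f y) \<le> C * (nsq f - nsq (X f))"
  and DY: "\<And>f. L2 f ==> nsq (\<lambda>y. f y - Y f y) \<le> C * (nsq f - nsq (Y f))"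
  by (rule XY_bounds) (rule that)
 have "nsq (\<lambda>y. f y - P f y) \<le> (2 * C) * (nsq f - nsq (P f))" if f: "L2 f" for f
 proof -
  have "nsq (\<lambda>y. f y - P f y) = nsq (\<lambda>y. (f y - X f y) + (X f y - Y (X f) y))"
   by (simp add: P_XY)
  also have "\<dots> \<le> 2 * nsq (\<lambda>y. f y - X f y) + 2 * nsq (\<lambda>y. X f y - Y (X f) y)"
   by (intro nsq_add_le L2_diff f L2_X L2_Y)
  also have "\<dots> \<le> 2 * (C * (nsq f - nsq (X f))) + 2 * (C * (nsq (X f) - nsq (Y (X f))))"
   by (intro add_mono mult_left_mono DX DY f L2_X) auto
  finally show ?thesis by (simp add: P_XY algebra_simps)
 qed
 then show thesis using that[of "2 * C"] C by simp
qed

end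

lemma nsq_add_weighted_le:
 assumes f: "L2 f" and h: "L2 h" and e: "0 < (e::real)"
 shows "nsq (\<lambda>y. f y + h y) \<le> (1 + e) * nsq f + (1 + 1 / e) * nsq h"
proof -
 have pt: "(cmod (x + y))\<^sup>2 \<le> (1 + e) * (cmod x)\<^sup>2 + (1 + 1 / e) * (cmod y)\<^sup>2" for x y
 proof -
  have "(cmod (x + y))\<^sup>2 \<le> (cmod x + cmod y)\<^sup>2"
   by (intro power_mono norm_triangle_ineq) auto
  also have "\<dots> = (1 + e) * (cmod x)\<^sup>2 + (1 + 1 / e) * (cmod y)\<^sup>2 - (e * cmod x - cmod y)\<^sup>2 / e"
   using e by (simp add: power2_eq_square field_simps)
  also have "\<dots> \<le> (1 + e) * (cmod x)\<^sup>2 + (1 + 1 / e) * (cmod y)\<^sup>2" using e by simp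
  finally show ?thesis .
 qed
 have "nsq (\<lambda>y. f y + h y) \<le> (LINT y|lborel. (1 + e) * (cmod (f y))\<^sup>2 + (1 + 1 / e) * (cmod (h y))\<^sup>2)"
  unfolding nsq_def using L2_add[OF f h] f h
  by (intro integral_mono pt) (auto simp: L2_def)
 also have "\<dots> = (1 + e) * nsq f + (1 + 1 / e) * nsq h" using f h by (simp add: L2_def nsq_def)
 finally show ?thesis .
qed

context two_step
begin

text \<open>If \<open>f - \<zeta> P f\<close> is small then \<open>P f\<close> has almost the norm of \<open>f\<close>, hence is close to \<open>f\<close> by the energy
 estimate, hence \<open>(1 - \<zeta>) f\<close> is small.\<close>

lemma period_resolvent_bound:
 assumes z: "cmod \<zeta> = 1" "\<zeta> \<noteq> 1"
 obtains C where "0 < C" "\<And>f. L2 f ==> nsq f \<le> C * nsq (\<lambda>y. f y - \<zeta> * P f y)"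
proof -
 obtain C where C: "0 < C" and D: "\<And>f. L2 f ==> nsq (\<lambda>y. f y - P f y) \<le> C * (nsq f - nsq (P f))"
  using period_defect by blast
 define w where "w = (cmod (1 - \<zeta>))\<^sup>2"
 have w: "0 < w" using z(2) by (simp add: w_def)
 \<comment> \<open>small enough for \<open>nsq f\<close> on the right to be absorbed\<close>
 define e where "e = w / (4 * C)"
 have e: "0 < e" using w C by (simp add: e_def)
 define B where "B = 2 + 2 * C * (1 + 1 / e)"
 have B: "0 < B" using C e by (auto simp: B_def intro!: add_pos_pos mult_pos_pos)
 have "nsq f \<le> (2 * B / w) * nsq (\<lambda>y. f y - \<zeta> * P f y)" if f: "L2 f" for f
 proof -
  let ?q = "\<lambda>y. f y - \<zeta> * P f y"
  have L: "L2 (P f)" "L2 (\<lambda>y. \<zeta> * P f y)" "L2 ?q" "L2 (\<lambda>y. f y - P f y)" "L2 (\<lambda>y. \<zeta> * (f y - P f y))"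
   by (intro L2_P L2_cmult L2_diff f)+
  have nP: "nsq (\<lambda>y. \<zeta> * P f y) = nsq (P f)" using z by (simp add: nsq_cmult)
  have "w * nsq f = nsq (\<lambda>y. (1 - \<zeta>) * f y)" by (simp add: w_def nsq_cmult)
  also have "(\<lambda>y. (1 - \<zeta>) * f y) = (\<lambda>y. ?q y - \<zeta> * (f y - P f y))" by (simp add: algebra_simps)
  also have "nsq \<dots> \<le> 2 * nsq ?q + 2 * nsq (\<lambda>y. \<zeta> * (f y - P f y))" by (intro nsq_diff_le L)
  also have "nsq (\<lambda>y. \<zeta> * (f y - P f y)) = nsq (\<lambda>y. f y - P f y)" using z by (simp add: nsq_cmult)
  also have "\<dots> \<le> C * (nsq f - nsq (P f))" by (rule D[OF f])
  finally have 1: "w * nsq f \<le> 2 * nsq ?q + 2 * (C * (nsq f - nsq (P f)))" by simp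
  have "nsq f = nsq (\<lambda>y. \<zeta> * P f y + ?q y)" by simp
  also have "\<dots> \<le> (1 + e) * nsq (\<lambda>y. \<zeta> * P f y) + (1 + 1 / e) * nsq ?q"
   by (intro nsq_add_weighted_le L e)
  finally have "nsq f - nsq (P f) \<le> e * nsq (P f) + (1 + 1 / e) * nsq ?q" by (simp add: nP algebra_simps)
  also have "\<dots> \<le> e * nsq f + (1 + 1 / e) * nsq ?q"
   using nsq_P_le[OF f] e by (intro add_mono mult_left_mono) auto
  finally have "C * (nsq f - nsq (P f)) \<le> C * (e * nsq f + (1 + 1 / e) * nsq ?q)"
   using C by (intro mult_left_mono) auto
  moreover have "C * (e * nsq f) = w * nsq f / 4" using C by (simp add: e_def)
  moreover have "C * (e * nsq f + (1 + 1 / e) * nsq ?q) = C * (e * nsq f) + C * (1 + 1 / e) * nsq ?q"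
   by (subst distrib_left) (simp only: mult.assoc)
  ultimately have "C * (nsq f - nsq (P f)) \<le> w * nsq f / 4 + C * (1 + 1 / e) * nsq ?q"
   by (simp only:)
  then have "w * nsq f \<le> 2 * nsq ?q + 2 * (w * nsq f / 4 + C * (1 + 1 / e) * nsq ?q)"
   using 1 by (meson add_left_mono mult_left_mono order_trans zero_le_numeral)
  also have "\<dots> = w * nsq f / 2 + B * nsq ?q" by (simp add: B_def algebra_simps)
  finally have "w * nsq f \<le> w * nsq f / 2 + B * nsq ?q" .
  moreover have "x \<le> x / 2 + b ==> x / 2 \<le> b" for x b :: real by simp
  ultimately have "w * nsq f / 2 \<le> B * nsq ?q" by blast
  then show ?thesis using w by (simp add: field_simps)
 qed
 then show thesis using that[of "2 * B / w"] B w by simp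
qed

end

section \<open>Powers of the period operator\<close>

text \<open>Normalised Gaussians of width \<open>R\<close>, with square norm of order \<open>1 / R\<close>.\<close>

definition wide_gaussian :: "real => real => complex" where
 "wide_gaussian R s = of_real (exp (- (1 / R\<^sup>2) * s\<^sup>2) / (R * sqrt pi))"

lemma gauss_kernel_wide:
 assumes "0 < R" shows "gauss_kernel (wide_gaussian R)"
proof -
 have "\<forall>s. cmod (wide_gaussian R s) \<le> 1 / (R * sqrt pi) * exp (- (1 / R\<^sup>2) * s\<^sup>2)"
  using assms by (simp add: wide_gaussian_def norm_divide norm_mult)
 moreover have "0 < 1 / R\<^sup>2" using assms by simp
 ultimately have "\<exists>C \<alpha>. 0 < \<alpha> \<and> (\<forall>s. cmod (wide_gaussian R s) \<le> C * exp (- \<alpha> * s\<^sup>2))" by blast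
 moreover have "continuous_on UNIV (wide_gaussian R)"
  unfolding wide_gaussian_def[abs_def] using assms by (intro continuous_intros) auto
 ultimately show ?thesis
  unfolding gauss_kernel_def by (auto simp: wide_gaussian_def)
qed

lemma integral_wide_gaussian:
 assumes "0 < R" shows "(LINT s|lborel. wide_gaussian R s) = 1"
proof -
 have "(LINT s|lborel. wide_gaussian R s) = of_real (1 / (R * sqrt pi)) * gauss_integral (of_real (1 / R\<^sup>2)) 0"
  unfolding gauss_integral_def
  by (subst integral_mult_right_zero[symmetric], rule Bochner_Integration.integral_cong)
    (auto simp: wide_gaussian_def simp flip: exp_of_real)
 also have "gauss_integral (of_real (1 / R\<^sup>2)) 0 = of_real (sqrt pi * R)"
  using assms by (subst gauss_integral_of_real) (auto simp: real_sqrt_mult)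
 finally show ?thesis using assms by (simp flip: of_real_mult)
qed

lemma nsq_wide_gaussian:
 assumes "0 < R" shows "nsq (wide_gaussian R) = nsq (wide_gaussian 1) / R"
proof -
 have "nsq (wide_gaussian R) = R * (LINT s|lborel. (cmod (wide_gaussian R (R * s)))\<^sup>2)"
  unfolding nsq_def using assms by (subst lborel_integral_real_affine[of R _ 0]) auto
 also have "(\<lambda>s. (cmod (wide_gaussian R (R * s)))\<^sup>2) = (\<lambda>s. (cmod (wide_gaussian 1 s))\<^sup>2 / R\<^sup>2)"
  using assms by (auto simp: wide_gaussian_def norm_divide norm_mult power_mult_distrib power_divide)
 finally show ?thesis using assms by (simp add: nsq_def power2_eq_square)
qed

text \<open>A bounded sequence that loses no energy in the limit becomes translation invariant, hence
 spreads out, hence tends weakly to zero.\<close>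

lemma weak_null_of_energy_L1:
 assumes t: "0 < t" and k: "0 < Im k" and e: "\<And>n. L2 (e n)" and M: "\<And>n. nsq (e n) \<le> M"
  and E: "(\<lambda>n. nsq (e n) - nsq (heat k t (e n))) \<longlonglongrightarrow> 0"
  and h: "L2 h" and hi: "integrable lborel h"
 shows "(\<lambda>n. pr (e n) h) \<longlonglongrightarrow> 0"
proof (rule LIMSEQ_I)
 fix r' :: real assume r': "0 < r'"
 define r where "r = r' / 4"
 have r: "0 < r" using r' by (simp add: r_def)
 define A where "A = (LINT y|lborel. cmod (h y))"
 define l1 where "l1 = r / (1 + (\<bar>M\<bar> + 1) * (A + 1))"
 have A: "0 \<le> A" by (simp add: A_def)
 have "0 \<le> (\<bar>M\<bar> + 1) * (A + 1)" using A by (intro mult_nonneg_nonneg) auto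
 then have l1: "0 < l1" using r by (auto simp: l1_def intro!: divide_pos_pos)
 have l1M: "l1 * M * A \<le> r"
 proof -
  have "M * A \<le> (\<bar>M\<bar> + 1) * (A + 1)" using A by (intro mult_mono) auto
  then have "l1 * (M * A) \<le> l1 * (1 + (\<bar>M\<bar> + 1) * (A + 1))" using l1 by (intro mult_left_mono) auto
  also have "\<dots> = r" using \<open>0 \<le> (\<bar>M\<bar> + 1) * (A + 1)\<close> by (simp add: l1_def)
  finally show ?thesis by (simp add: mult.assoc)
 qed
 \<comment> \<open>wide enough for the averaged sequence to be small\<close>
 define R where "R = 1 + nsq (wide_gaussian 1) * A / (l1 * r)"
 have R: "0 < R" unfolding R_def using A l1 r by (intro add_pos_nonneg) auto
 have RA: "nsq (wide_gaussian R) / l1 * A \<le> r"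
 proof -
  have "nsq (wide_gaussian 1) * A \<le> R * (l1 * r)"
   using l1 r A by (simp add: R_def distrib_right)
  then show ?thesis using R l1 by (simp add: nsq_wide_gaussian[OF R] field_simps)
 qed
 define l2 where "l2 = (1 + nsq h) / r"
 have l2: "0 < l2" using r by (auto simp: l2_def intro!: divide_pos_pos add_pos_nonneg)
 have l2h: "nsq h / l2 \<le> r"
 proof -
  have "nsq h \<le> r * l2" using r by (simp add: l2_def)
  then show ?thesis using l2 by (simp add: divide_le_eq mult.commute)
 qed
 have b: "0 < 1 / R\<^sup>2" using R by simp
 obtain C where C: "0 \<le> C" and CE:
  "\<And>f. L2 f ==> (LINT s|lborel. exp (- (1 / R\<^sup>2) * s\<^sup>2) * shift_defect f s) \<le> C * (nsq f - nsq (heat k t f))"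
  by (rule gaussian_defect_le_energy[OF t k b]) (rule that)
 note G = gauss_kernel_wide[OF R]
 have [measurable]: "h \<in> borel_measurable borel" "wide_gaussian R \<in> borel_measurable borel"
  using h G by (auto dest: L2_measurable gauss_kernel_measurable)
 define D where "D = C / (R * sqrt pi)"
 have part1: "cmod (pr (e n) h - pr (conv (wide_gaussian R) (e n)) h) \<le> l2 * D * (nsq (e n) - nsq (heat k t (e n))) + r" for n
 proof -
  note [measurable] = L2_measurable[OF e]
  let ?I = "\<lambda>s. LINT y|lborel. (e n y - e n (y - s)) * (h y - h (y - s))"
  let ?g = "\<lambda>s. exp (- (1 / R\<^sup>2) * s\<^sup>2)"
  have Ib: "cmod (?I s) \<le> (l2 * shift_defect (e n) s + 4 * nsq h / l2) / 2" for s
  proof -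
   have "cmod (?I s) \<le> (l2 * shift_defect (e n) s + shift_defect h s / l2) / 2"
    using pr_bound_weighted[OF L2_diff[OF e L2_shift[OF e]] L2_diff[OF h L2_shift[OF h]] l2, of n n s s]
    by (simp add: pr_def shift_defect_def)
   also have "\<dots> \<le> (l2 * shift_defect (e n) s + 4 * nsq h / l2) / 2"
    using l2 shift_defect_le[OF h, of s] by (intro divide_right_mono add_left_mono) auto
   finally show ?thesis .
  qed
  have i1: "integrable lborel (\<lambda>s. ?g s * shift_defect (e n) s)"
   using integrable_gaussian_defect[OF e integrable_gaussian[OF b], of n 1] by simp
  have i2: "integrable lborel ?g" by (rule integrable_gaussian[OF b])
  have i3: "integrable lborel (\<lambda>s. l2 / (2 * (R * sqrt pi)) * (?g s * shift_defect (e n) s) + 2 * nsq h / l2 * (?g s / (R * sqrt pi)))"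
   using i1 i2 by (intro Bochner_Integration.integrable_add integrable_mult_right integrable_divide) auto
  have g1: "(LINT s|lborel. ?g s / (R * sqrt pi)) = 1"
   using integral_wide_gaussian[OF R] unfolding wide_gaussian_def integral_complex_of_real of_real_eq_1_iff .
  have "pr (e n) h - pr (conv (wide_gaussian R) (e n)) h = (LINT s|lborel. wide_gaussian R s * ?I s) / 2"
   using conv_defect[OF G e h, of n] integral_wide_gaussian[OF R] by simp
  then have "cmod (pr (e n) h - pr (conv (wide_gaussian R) (e n)) h) = cmod (LINT s|lborel. wide_gaussian R s * ?I s) / 2"
   by (simp only: norm_divide norm_numeral)
  also have "\<dots> \<le> (LINT s|lborel. l2 / (2 * (R * sqrt pi)) * (?g s * shift_defect (e n) s) + 2 * nsq h / l2 * (?g s / (R * sqrt pi))) / 2"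
  proof (intro divide_right_mono norm_integral_le i3)
   fix s
   have "cmod (wide_gaussian R s * ?I s) \<le> (?g s / (R * sqrt pi)) * ((l2 * shift_defect (e n) s + 4 * nsq h / l2) / 2)"
    unfolding norm_mult using R Ib[of s]
    by (intro mult_mono) (auto simp: wide_gaussian_def norm_divide norm_mult)
   also have "\<dots> = l2 / (2 * (R * sqrt pi)) * (?g s * shift_defect (e n) s) + 2 * nsq h / l2 * (?g s / (R * sqrt pi))"
    by (simp add: add_divide_distrib distrib_left mult_ac)
   finally show "cmod (wide_gaussian R s * ?I s) \<le> l2 / (2 * (R * sqrt pi)) * (?g s * shift_defect (e n) s) + 2 * nsq h / l2 * (?g s / (R * sqrt pi))" .
  qed auto
  also have "\<dots> = (l2 / (2 * (R * sqrt pi)) * (LINT s|lborel. ?g s * shift_defect (e n) s) + 2 * nsq h / l2) / 2"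
   using i1 i2 g1 by (subst Bochner_Integration.integral_add) auto
  also have "\<dots> \<le> (l2 / (2 * (R * sqrt pi)) * (C * (nsq (e n) - nsq (heat k t (e n)))) + 2 * nsq h / l2) / 2"
   using l2 R CE[OF e, of n] by (intro divide_right_mono add_right_mono mult_left_mono) auto
  also have "\<dots> = l2 * D * (nsq (e n) - nsq (heat k t (e n))) / 4 + nsq h / l2"
   by (simp add: D_def add_divide_distrib)
  also have "\<dots> \<le> l2 * D * (nsq (e n) - nsq (heat k t (e n))) + r"
  proof -
   have "0 \<le> l2 * D * (nsq (e n) - nsq (heat k t (e n)))"
    using l2 C R heat_contraction[OF t k e, of n] by (simp add: D_def)
   then show ?thesis using l2h by linarith
  qed
  finally show ?thesis .
 qed
 have part2: "cmod (pr (conv (wide_gaussian R) (e n)) h) \<le> r" for n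
 proof -
  note [measurable] = L2_measurable[OF e]
  have pt: "cmod (conv (wide_gaussian R) (e n) y) \<le> (l1 * M + nsq (wide_gaussian R) / l1) / 2" for y
  proof -
   have "wide_gaussian R (y - s) = wide_gaussian R (s - y)" for s
    by (simp add: wide_gaussian_def power2_commute)
   then have "conv (wide_gaussian R) (e n) y = pr (e n) (\<lambda>s. wide_gaussian R (s - y))"
    by (simp add: conv_def pr_def mult.commute)
   also have "cmod \<dots> \<le> (l1 * nsq (e n) + nsq (\<lambda>s. wide_gaussian R (s - y)) / l1) / 2"
    by (intro pr_bound_weighted e L2_shift gauss_kernel_integrable G l1)
   also have "nsq (\<lambda>s. wide_gaussian R (s - y)) = nsq (wide_gaussian R)" by (rule nsq_shift)
   also have "(l1 * nsq (e n) + nsq (wide_gaussian R) / l1) / 2 \<le> (l1 * M + nsq (wide_gaussian R) / l1) / 2"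
    using l1 M by (intro divide_right_mono add_right_mono mult_left_mono) auto
   finally show ?thesis .
  qed
  have "cmod (pr (conv (wide_gaussian R) (e n)) h) \<le> (LINT y|lborel. (l1 * M + nsq (wide_gaussian R) / l1) / 2 * cmod (h y))"
   unfolding pr_def using hi
  proof (intro norm_integral_le)
   show "cmod (conv (wide_gaussian R) (e n) y * h y) \<le> (l1 * M + nsq (wide_gaussian R) / l1) / 2 * cmod (h y)" for y
    unfolding norm_mult by (intro mult_right_mono pt) auto
  qed auto
  also have "\<dots> = (l1 * M * A + nsq (wide_gaussian R) / l1 * A) / 2"
   unfolding integral_mult_right_zero A_def[symmetric] by (simp only: add_divide_distrib distrib_right times_divide_eq_left)
  also have "\<dots> \<le> r" using l1M RA by simp
  finally show ?thesis .
 qed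
 have "(\<lambda>n. l2 * D * (nsq (e n) - nsq (heat k t (e n)))) \<longlonglongrightarrow> 0"
  using tendsto_mult_right_zero[OF E] by simp
 then obtain N where N: "\<And>n. n \<ge> N ==> norm (l2 * D * (nsq (e n) - nsq (heat k t (e n))) - 0) < r"
  using LIMSEQ_D[OF _ r] by blast
 have "norm (pr (e n) h - 0) < r'" if "n \<ge> N" for n
 proof -
  have "cmod (pr (e n) h) \<le> cmod (pr (e n) h - pr (conv (wide_gaussian R) (e n)) h) + cmod (pr (conv (wide_gaussian R) (e n)) h)"
   using norm_triangle_sub[of "pr (e n) h" "pr (conv (wide_gaussian R) (e n)) h"] by (simp add: add.commute)
  also have "\<dots> \<le> (l2 * D * (nsq (e n) - nsq (heat k t (e n))) + r) + r"
   by (intro add_mono part1 part2)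
  also have "\<dots> < r'" using N[OF that] r by (simp add: r_def)
  finally show ?thesis by simp
 qed
 then show "\<exists>no. \<forall>n\<ge>no. norm (pr (e n) h - 0) < r'" by blast
qed

lemma weak_null_of_energy:
 assumes t: "0 < t" and k: "0 < Im k" and e: "\<And>n. L2 (e n)" and M: "\<And>n. nsq (e n) \<le> M"
  and E: "(\<lambda>n. nsq (e n) - nsq (heat k t (e n))) \<longlonglongrightarrow> 0" and h: "L2 h"
 shows "(\<lambda>n. pr (e n) h) \<longlonglongrightarrow> 0"
proof (rule LIMSEQ_I)
 fix r' :: real assume r': "0 < r'"
 define r where "r = r' / 2"
 have r: "0 < r" "r + r = r'" using r' by (auto simp: r_def)
 have [measurable]: "h \<in> borel_measurable borel" using h by (rule L2_measurable)
 have M0: "0 \<le> M" using M[of 0] nsq_nonneg[of "e 0"] by linarith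
 define l where "l = r / (1 + M)"
 have l: "0 < l" using r M0 by (auto simp: l_def)
 have lM: "l * M \<le> r" using r M0 by (simp add: l_def field_simps)
 define hi where "hi m y = of_real (indicator {- real m..real m} y) * h y" for m y
 have hiL2: "L2 (hi m)" for m
  by (rule L2_bound[OF _ L2_integrable[OF h]]) (auto simp: hi_def[abs_def] norm_mult indicator_def)
 have hiI: "integrable lborel (hi m)" for m
 proof (rule Bochner_Integration.integrable_bound)
  show "integrable lborel (\<lambda>y. indicator {- real m..real m} y + (cmod (h y))\<^sup>2)"
   using L2_integrable[OF h] by (intro Bochner_Integration.integrable_add integrable_real_indicator) auto
  have "x \<le> 1 + x\<^sup>2" for x :: real
   using zero_le_power2[of "x - 1/2"] by (simp add: power2_eq_square algebra_simps)
  then show "AE y in lborel. norm (hi m y) \<le> norm (indicator {- real m..real m} y + (cmod (h y))\<^sup>2)"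
   by (intro AE_I2) (auto simp: hi_def norm_mult indicator_def)
 qed (auto simp: hi_def[abs_def])
 have "(\<lambda>m. nsq (\<lambda>y. h y - hi m y)) \<longlonglongrightarrow> (LINT y::real|lborel. 0)"
  unfolding nsq_def
 proof (rule Bochner_Integration.integral_dominated_convergence[where s="\<lambda>m y. (cmod (h y - hi m y))\<^sup>2"
    and f="\<lambda>_. 0" and w="\<lambda>y. (cmod (h y))\<^sup>2"])
  show "integrable lborel (\<lambda>y. (cmod (h y))\<^sup>2)" by (rule L2_integrable[OF h])
  show "AE y in lborel. (\<lambda>m. (cmod (h y - hi m y))\<^sup>2) \<longlonglongrightarrow> 0"
  proof (intro AE_I2 tendsto_eventually)
   fix y :: real
   obtain m0 where "\<bar>y\<bar> \<le> real m0" using real_arch_simple by blast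
   then have "(cmod (h y - hi m y))\<^sup>2 = 0" if "m \<ge> m0" for m
    using that by (auto simp: hi_def indicator_def abs_le_iff)
   then show "\<forall>\<^sub>F m in sequentially. (cmod (h y - hi m y))\<^sup>2 = 0"
    by (auto simp: eventually_sequentially)
  qed
 qed (auto simp: hi_def[abs_def] norm_mult indicator_def)
 then have "(\<lambda>m. nsq (\<lambda>y. h y - hi m y)) \<longlonglongrightarrow> 0" by simp
 from order_tendstoD(2)[OF this, of "l * r"] obtain m where m: "nsq (\<lambda>y. h y - hi m y) < l * r"
  using l r by (auto simp: eventually_sequentially)
 have "(\<lambda>n. pr (e n) (hi m)) \<longlonglongrightarrow> 0"
  by (rule weak_null_of_energy_L1[OF t k e M E hiL2 hiI])
 from LIMSEQ_D[OF this r(1)] obtain N where N: "\<And>n. n \<ge> N ==> cmod (pr (e n) (hi m)) < r" by auto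
 have " norm (pr (e n) h - 0) < r'" if "n \<ge> N" for n
 proof -
  have "pr (e n) h = pr (e n) (hi m) + pr (e n) (\<lambda>y. h y - hi m y)"
   by (simp add: pr_diff_right e h hiL2)
  also have "cmod \<dots> \<le> cmod (pr (e n) (hi m)) + cmod (pr (e n) (\<lambda>y. h y - hi m y))"
   by (rule norm_triangle_ineq)
  also have "cmod (pr (e n) (\<lambda>y. h y - hi m y)) \<le> (l * nsq (e n) + nsq (\<lambda>y. h y - hi m y) / l) / 2"
   by (intro pr_bound_weighted e L2_diff h hiL2 l)
  also have "\<dots> \<le> (r + r) / 2"
  proof (intro divide_right_mono add_mono)
   show "l * nsq (e n) \<le> r" using mult_left_mono[OF M[of n], of l] l lM by linarith
   show "nsq (\<lambda>y. h y - hi m y) / l \<le> r" using m l by (simp add: divide_le_eq mult.commute)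
  qed simp
  finally show ?thesis using N[OF that] r(2) by simp
 qed
 then show "\<exists>no. \<forall>n\<ge>no. norm (pr (e n) h - 0) < r'" by blast
qed

context two_step
begin

lemma summable_energy_loss:
 assumes "\<And>n. 0 \<le> e n" "decseq e" shows "summable (\<lambda>n. e n - e (Suc n) :: real)"
proof -
 obtain L where "e \<longlonglongrightarrow> L" using decseq_convergent[OF assms(2), of 0] assms(1) by blast
 from telescope_sums[OF this] have "(\<lambda>n. - (e (Suc n) - e n)) sums - (L - e 0)" by (rule sums_minus)
 then show ?thesis by (auto simp: sums_iff)
qed

lemma P_pow_energy:
 assumes "L2 f"
 shows "decseq (\<lambda>n. nsq ((P ^^ n) f))" "summable (\<lambda>n. nsq ((P ^^ n) f) - nsq (P ((P ^^ n) f)))"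
  and "nsq ((P ^^ n) f) \<le> nsq f"
proof -
 show d: "decseq (\<lambda>n. nsq ((P ^^ n) f))"
  by (rule decseq_SucI) (simp add: nsq_P_le L2_P_pow assms)
 from summable_energy_loss[OF _ d] show "summable (\<lambda>n. nsq ((P ^^ n) f) - nsq (P ((P ^^ n) f)))" by simp
 from decseqD[OF d, of 0 n] show "nsq ((P ^^ n) f) \<le> nsq f" by simp
qed

lemma PT_pow_energy:
 assumes "L2 h"
 shows "summable (\<lambda>n. nsq ((PT ^^ n) h) - nsq (PT ((PT ^^ n) h)))"
proof -
 have d: "decseq (\<lambda>n. nsq ((PT ^^ n) h))"
  by (rule decseq_SucI) (simp add: nsq_PT_le L2_PT_pow assms)
 from summable_energy_loss[OF _ d] show ?thesis by simp
qed

text \<open>The energies of \<open>P\<^sup>n f\<close> decrease, so their losses tend to zero.\<close>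

lemma P_pow_weak_null:
 assumes f: "L2 f" and h: "L2 h"
 shows "(\<lambda>n. pr ((P ^^ n) f) h) \<longlonglongrightarrow> 0"
proof -
 define e where "e n = (\<lambda>y. \<eta> y * (P ^^ n) f y)" for n
 have L: "L2 (e n)" for n unfolding e_def by (intro L2_sign eta L2_P_pow f)
 have ne: "nsq (e n) = nsq ((P ^^ n) f)" for n by (simp add: e_def nsq_sign[OF eta])
 have "(\<lambda>n. nsq (e n) - nsq (heat k t1 (e n))) \<longlonglongrightarrow> 0"
 proof (rule tendsto_sandwich[OF _ _ tendsto_const])
  show "(\<lambda>n. nsq ((P ^^ n) f) - nsq (P ((P ^^ n) f))) \<longlonglongrightarrow> 0"
   by (rule summable_LIMSEQ_zero[OF P_pow_energy(2)[OF f]])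
  show "\<forall>\<^sub>F n in sequentially. 0 \<le> nsq (e n) - nsq (heat k t1 (e n))"
   using heat_contraction[OF t1 k L] by simp
  show "\<forall>\<^sub>F n in sequentially. nsq (e n) - nsq (heat k t1 (e n)) \<le> nsq ((P ^^ n) f) - nsq (P ((P ^^ n) f))"
  proof (intro always_eventually allI)
   fix n
   have "nsq (P ((P ^^ n) f)) \<le> nsq (hstep k \<eta> t1 ((P ^^ n) f))"
    unfolding period_def by (intro nsq_hstep_le t2 L2_hstep t1 L2_P_pow[unfolded period_def] f)
   then show "nsq (e n) - nsq (heat k t1 (e n)) \<le> nsq ((P ^^ n) f) - nsq (P ((P ^^ n) f))"
    by (simp add: ne) (simp add: e_def hstep_def)
  qed
 qed
 from weak_null_of_energy[OF t1 k L _ this L2_sign[OF eta h], of "nsq f"]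
 have "(\<lambda>n. pr (e n) (\<lambda>y. \<eta> y * h y)) \<longlonglongrightarrow> 0"
  using P_pow_energy(3)[OF f] by (simp add: ne)
 then show ?thesis by (simp add: e_def pr_sign_sign[OF eta])
qed

lemma LIMSEQ_even_odd:
 fixes X :: "nat => 'a::real_normed_vector"
 assumes "(\<lambda>n. X (2 * n)) \<longlonglongrightarrow> L" "(\<lambda>n. X (2 * n + 1)) \<longlonglongrightarrow> L"
 shows "X \<longlonglongrightarrow> L"
proof (rule LIMSEQ_I)
 fix r :: real assume r: "0 < r"
 obtain N1 where N1: "\<And>n. n \<ge> N1 ==> norm (X (2 * n) - L) < r" using LIMSEQ_D[OF assms(1) r] by blast
 obtain N2 where N2: "\<And>n. n \<ge> N2 ==> norm (X (2 * n + 1) - L) < r" using LIMSEQ_D[OF assms(2) r] by blast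
 have "norm (X n - L) < r" if n: "n \<ge> 2 * (N1 + N2)" for n
 proof (cases "even n")
  case True
  then obtain m where m: "n = 2 * m" by blast
  show ?thesis using N1[of m] n unfolding m by simp
 next
  case False
  then obtain m where m: "n = 2 * m + 1" by (rule oddE)
  show ?thesis using N2[of m] n unfolding m by simp
 qed
 then show "\<exists>no. \<forall>n\<ge>no. norm (X n - L) < r" by blast
qed

lemma sums_even_odd:
 fixes f :: "nat => 'a::real_normed_vector"
 assumes "(\<lambda>n. f (2 * n)) sums A" "(\<lambda>n. f (2 * n + 1)) sums B"
 shows "f sums (A + B)"
proof -
 have e: "(\<Sum>i<2 * n. f i) = (\<Sum>i<n. f (2 * i)) + (\<Sum>i<n. f (2 * i + 1))" for n
  by (induction n) (simp_all add: algebra_simps)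
 have o: "(\<Sum>i<2 * n + 1. f i) = (\<Sum>i<Suc n. f (2 * i)) + (\<Sum>i<n. f (2 * i + 1))" for n
  using e[of n] by (simp add: algebra_simps)
 have "(\<lambda>n. \<Sum>i<2 * n. f i) \<longlonglongrightarrow> A + B"
  unfolding e using assms unfolding sums_def by (intro tendsto_add)
 moreover have "(\<lambda>n. \<Sum>i<2 * n + 1. f i) \<longlonglongrightarrow> A + B"
  unfolding o using assms unfolding sums_def by (intro tendsto_add LIMSEQ_Suc)
 ultimately show ?thesis unfolding sums_def by (rule LIMSEQ_even_odd)
qed

lemma summable_even_odd:
 fixes f :: "nat => 'a::real_normed_vector"
 assumes "summable (\<lambda>n. f (2 * n))" "summable (\<lambda>n. f (2 * n + 1))"
 shows "summable f"
 using assms unfolding summable_def by (blast intro: sums_even_odd)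

text \<open>The numbers \<open>c\<^sub>n = \<langle>P\<^sup>n f, h\<rangle>\<close> have bounded variation: moving half of the factors \<open>P\<close> to the
 other side, each difference is bounded by energy losses of \<open>P\<^sup>m f\<close> and of \<open>(P\<^sup>T)\<^sup>m h\<close>.\<close>

lemma P_pow_bounded_variation:
 assumes f: "L2 f" and h: "L2 h"
 shows "summable (\<lambda>n. norm (pr ((P ^^ n) f) h - pr ((P ^^ Suc n) f) h))"
proof -
 obtain C where C: "0 < C" and V: "\<And>f h. L2 f ==> L2 h ==>
   cmod (pr f h - pr (P f) h) \<le> C * ((nsq f - nsq (P f)) + (nsq h - nsq (PT h)))"
  by (rule period_variation) (rule that)
 let ?a = "\<lambda>n. nsq ((P ^^ n) f) - nsq (P ((P ^^ n) f))"
 let ?b = "\<lambda>n. nsq ((PT ^^ n) h) - nsq (PT ((PT ^^ n) h))"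
 have split: "pr ((P ^^ (m + n)) f) h = pr ((P ^^ m) f) ((PT ^^ n) h)" for m n
  using pr_P_pow[OF L2_P_pow[OF f, of m] h, of n] by (simp add: add.commute[of m] funpow_add)
 have step: "norm (pr ((P ^^ (m + n)) f) h - pr ((P ^^ Suc (m + n)) f) h) \<le> C * (?a m + ?b n)" for m n
 proof -
  have "pr ((P ^^ Suc (m + n)) f) h = pr (P ((P ^^ m) f)) ((PT ^^ n) h)"
   using split[of "Suc m" n] by simp
  then show ?thesis unfolding split by (simp add: V L2_P_pow L2_PT_pow f h)
 qed
 have a: "summable ?a" and b: "summable ?b" by (rule P_pow_energy(2)[OF f] PT_pow_energy[OF h])+
 \<comment> \<open>the powers are shared evenly between \<open>f\<close> and \<open>h\<close>\<close>
 show ?thesis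
 proof (rule summable_even_odd)
  show "summable (\<lambda>n. norm (pr ((P ^^ (2 * n)) f) h - pr ((P ^^ Suc (2 * n)) f) h))"
  proof (rule summable_comparison_test')
   show "summable (\<lambda>n. C * (?a n + ?b n))" by (intro summable_mult summable_add a b)
   show "norm (norm (pr ((P ^^ (2 * n)) f) h - pr ((P ^^ Suc (2 * n)) f) h)) \<le> C * (?a n + ?b n)" for n
    using step[of n n] by (simp add: mult_2)
  qed
  show "summable (\<lambda>n. norm (pr ((P ^^ (2 * n + 1)) f) h - pr ((P ^^ Suc (2 * n + 1)) f) h))"
  proof (rule summable_comparison_test')
   show "summable (\<lambda>n. C * (?a (Suc n) + ?b n))"
    using a b by (intro summable_mult summable_add) (simp_all add: summable_Suc_iff[of ?a, simplified])
   show "norm (norm (pr ((P ^^ (2 * n + 1)) f) h - pr ((P ^^ Suc (2 * n + 1)) f) h)) \<le> C * (?a (Suc n) + ?b n)" for n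
    using step[of "Suc n" n] by (simp add: mult_2)
  qed
 qed
qed

text \<open>Summation by parts: multiplied by \<open>1 - \<zeta>\<close> the terms become, up to a telescoping difference, the
 increments of the pairings, which are absolutely summable.\<close>

lemma summable_P_pow:
 assumes z: "cmod \<zeta> = 1" "\<zeta> \<noteq> 1" and f: "L2 f" and h: "L2 h"
 shows "summable (\<lambda>n. \<zeta> ^ n * pr ((P ^^ n) f) h)"
proof -
 let ?c = "\<lambda>n. pr ((P ^^ n) f) h" and ?a = "\<lambda>n. \<zeta> ^ n * pr ((P ^^ n) f) h"
 have "?a \<longlonglongrightarrow> 0"
  by (rule tendsto_norm_zero_cancel)
    (use P_pow_weak_null[OF f h] z in \<open>simp add: norm_mult norm_power tendsto_norm_zero\<close>)
 then have t: "summable (\<lambda>n. ?a (Suc n) - ?a n)" by (rule telescope_summable)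
 have v: "summable (\<lambda>n. \<zeta> ^ Suc n * (?c (Suc n) - ?c n))"
 proof (rule summable_norm_cancel)
  show "summable (\<lambda>n. norm (\<zeta> ^ Suc n * (?c (Suc n) - ?c n)))"
   using P_pow_bounded_variation[OF f h] z
   by (simp add: norm_mult norm_power norm_minus_commute)
 qed
 have "summable (\<lambda>n. (\<zeta> ^ Suc n * (?c (Suc n) - ?c n) - (?a (Suc n) - ?a n)) / (1 - \<zeta>))"
  by (intro summable_divide summable_diff t v)
 moreover have "(\<zeta> ^ Suc n * (?c (Suc n) - ?c n) - (?a (Suc n) - ?a n)) / (1 - \<zeta>) = ?a n" for n
 proof -
  have "\<zeta> ^ Suc n * (?c (Suc n) - ?c n) - (?a (Suc n) - ?a n) = (1 - \<zeta>) * ?a n"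
   by (simp add: algebra_simps)
  then show ?thesis using z by simp
 qed
 ultimately show ?thesis by (simp only:)
qed

lemma heat_add:
 assumes "0 < t" "L2 f" "L2 g" shows "heat k t (\<lambda>y. f y + g y) = (\<lambda>y. heat k t f y + heat k t g y)"
proof
 fix y
 have ev: "green k t (y' - y) = green k t (y - y')" for y' by (simp add: green_def power2_commute)
 have G: "L2 (\<lambda>y'. green k t (y - y'))"
  using L2_shift[OF gauss_kernel_integrable(2)[OF gauss_kernel_green(1)[OF assms(1) k]], of y]
  unfolding ev .
 show "heat k t (\<lambda>y. f y + g y) y = heat k t f y + heat k t g y"
  using integrable_mult_L2[OF G assms(2)] integrable_mult_L2[OF G assms(3)]
  by (simp add: heat_def conv_def distrib_left)
qed

lemma heat_cmult: "heat k t (\<lambda>y. c * f y) = (\<lambda>y. c * heat k t f y)"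
 by (auto simp: heat_def conv_def mult.left_commute)

lemma hstep_add:
 assumes "0 < t" "L2 f" "L2 g" shows "hstep k \<eta> t (\<lambda>y. f y + g y) = (\<lambda>y. hstep k \<eta> t f y + hstep k \<eta> t g y)"
 unfolding hstep_def distrib_left using assms by (intro heat_add L2_sign eta)

lemma hstep_cmult: "hstep k \<eta> t (\<lambda>y. c * f y) = (\<lambda>y. c * hstep k \<eta> t f y)"
 unfolding hstep_def using heat_cmult[of t c "\<lambda>y. \<eta> y * f y"] by (simp add: mult.left_commute)

lemma P_add: "L2 f ==> L2 g ==> P (\<lambda>y. f y + g y) = (\<lambda>y. P f y + P g y)"
 by (simp add: period_def hstep_add t1 t2 L2_hstep)

lemma P_cmult: "P (\<lambda>y. c * f y) = (\<lambda>y. c * P f y)"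
 by (simp add: period_def hstep_cmult)

lemma P_pow_add: "L2 f ==> L2 g ==> (P ^^ n) (\<lambda>y. f y + g y) = (\<lambda>y. (P ^^ n) f y + (P ^^ n) g y)"
 by (induction n) (simp_all add: P_add L2_P_pow)

lemma P_pow_cmult: "(P ^^ n) (\<lambda>y. c * f y) = (\<lambda>y. c * (P ^^ n) f y)"
 by (induction n) (simp_all add: P_cmult)

text \<open>The Neumann series of \<open>1 - \<zeta> P\<close> telescopes, and its remainder tends weakly to zero.\<close>

lemma resolvent_pairing:
 assumes z: "cmod \<zeta> = 1" and f: "L2 f" and s: "L2 s" and h: "L2 h"
  and fp: "f = (\<lambda>y. \<zeta> * P f y + s y)"
 shows "(\<lambda>n. \<zeta> ^ n * pr ((P ^^ n) s) h) sums pr f h"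
proof -
 have step: "pr ((P ^^ n) f) h = \<zeta> * pr ((P ^^ Suc n) f) h + pr ((P ^^ n) s) h" for n
 proof -
  have "(P ^^ n) f = (P ^^ n) (\<lambda>y. \<zeta> * P f y + s y)" using fp by simp
  also have "\<dots> = (\<lambda>y. \<zeta> * (P ^^ Suc n) f y + (P ^^ n) s y)"
   by (subst P_pow_add) (simp_all add: L2_cmult L2_P f s P_pow_cmult funpow_swap1)
  finally have "pr ((P ^^ n) f) h = pr (\<lambda>y. \<zeta> * (P ^^ Suc n) f y + (P ^^ n) s y) h" by (rule arg_cong)
  also have "\<dots> = \<zeta> * pr ((P ^^ Suc n) f) h + pr ((P ^^ n) s) h"
   proof -
   have "L2 (\<lambda>y. \<zeta> * (P ^^ Suc n) f y)" "L2 ((P ^^ n) s)" by (intro L2_cmult L2_P_pow f s)+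
   from pr_add_left[OF this h] show ?thesis by (simp only: pr_cmult_left)
  qed
  finally show ?thesis .
 qed
 have "(\<Sum>i<n. \<zeta> ^ i * pr ((P ^^ i) s) h) = pr f h - \<zeta> ^ n * pr ((P ^^ n) f) h" for n
 proof (induction n)
  case (Suc n)
  have "(\<Sum>i<Suc n. \<zeta> ^ i * pr ((P ^^ i) s) h) = pr f h - \<zeta> ^ n * (pr ((P ^^ n) f) h - pr ((P ^^ n) s) h)"
   unfolding sum.lessThan_Suc Suc by (simp only: right_diff_distrib diff_diff_eq2 diff_add_eq)
  also have "pr ((P ^^ n) f) h - pr ((P ^^ n) s) h = \<zeta> * pr ((P ^^ Suc n) f) h"
   unfolding step[of n] by (rule add_diff_cancel_right')
  finally show ?case by (simp only: power_Suc mult_ac)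
 qed simp
 moreover have "(\<lambda>n. pr f h - \<zeta> ^ n * pr ((P ^^ n) f) h) \<longlonglongrightarrow> pr f h - 0"
 proof (intro tendsto_diff tendsto_const)
  show "(\<lambda>n. \<zeta> ^ n * pr ((P ^^ n) f) h) \<longlonglongrightarrow> 0"
   by (rule tendsto_norm_zero_cancel)
     (use P_pow_weak_null[OF f h] z in \<open>simp add: norm_mult norm_power tendsto_norm_zero\<close>)
 qed
 ultimately show ?thesis by (simp add: sums_def)
qed

end

section \<open>Bounded solutions of the recursion are square integrable\<close>

lemma integrable_green_weighted:
 assumes "0 < t" "0 < Im k"
 shows "integrable lborel (\<lambda>s. cmod (green k t s) * (\<bar>s\<bar> * exp \<bar>s\<bar>))"
proof (rule integrable_gaussian_bound[where \<alpha>="Im k / (2 * t)" and C="sqrt (cmod (gauss_rate k t) / pi)" and c=2])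
 show "(\<lambda>s. cmod (green k t s) * (\<bar>s\<bar> * exp \<bar>s\<bar>)) \<in> borel_measurable borel" by measurable
 fix s :: real
 have "\<bar>s\<bar> * exp \<bar>s\<bar> \<le> exp \<bar>s\<bar> * exp \<bar>s\<bar>" using power_le_exp[of s 1] by (intro mult_right_mono) auto
 also have "\<dots> = exp (2 * \<bar>s\<bar>)" by (simp flip: exp_add)
 finally have "cmod (green k t s) * (\<bar>s\<bar> * exp \<bar>s\<bar>) \<le> cmod (green k t s) * exp (2 * \<bar>s\<bar>)"
  by (intro mult_left_mono) auto
 also have "\<dots> = sqrt (cmod (gauss_rate k t) / pi) * exp (2 * \<bar>s\<bar> - Im k / (2 * t) * s\<^sup>2)"
  by (simp add: norm_green[OF assms(1)] mult.commute flip: exp_add)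
 finally show "norm (cmod (green k t s) * (\<bar>s\<bar> * exp \<bar>s\<bar>)) \<le> sqrt (cmod (gauss_rate k t) / pi) * exp (2 * \<bar>s\<bar> - Im k / (2 * t) * s\<^sup>2)"
  by simp
qed (use assms in simp)

lemma exp_weight_difference:
 fixes \<epsilon> y s :: real
 assumes "0 \<le> \<epsilon>" "\<epsilon> \<le> 1"
 shows "\<bar>exp (- \<epsilon> * \<bar>y\<bar>) - exp (- \<epsilon> * \<bar>y - s\<bar>)\<bar> \<le> \<epsilon> * (\<bar>s\<bar> * exp \<bar>s\<bar>) * exp (- \<epsilon> * \<bar>y\<bar>)"
proof -
 define w where "w = \<epsilon> * (\<bar>y\<bar> - \<bar>y - s\<bar>)"
 have w: "\<bar>w\<bar> \<le> \<epsilon> * \<bar>s\<bar>" using assms unfolding w_def abs_mult by (intro mult_mono) auto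
 also have "\<dots> \<le> \<bar>s\<bar>" using assms by (simp add: mult_left_le_one_le)
 finally have w1: "\<bar>w\<bar> \<le> \<bar>s\<bar>" .
 have "exp (- \<epsilon> * \<bar>y - s\<bar>) = exp (- \<epsilon> * \<bar>y\<bar>) * exp w"
  by (simp add: w_def algebra_simps flip: exp_add)
 then have "\<bar>exp (- \<epsilon> * \<bar>y\<bar>) - exp (- \<epsilon> * \<bar>y - s\<bar>)\<bar> = exp (- \<epsilon> * \<bar>y\<bar>) * \<bar>exp w - 1\<bar>"
  by (metis abs_exp_cancel abs_minus_commute abs_mult mult.right_neutral right_diff_distrib)
 also have "\<bar>exp w - 1\<bar> \<le> exp \<bar>w\<bar> * \<bar>w\<bar>" using Taylor_exp_field[of w 0] by simp
 also have "\<dots> \<le> exp \<bar>s\<bar> * (\<epsilon> * \<bar>s\<bar>)" using w w1 assms by (intro mult_mono) auto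
 finally show ?thesis by (simp add: mult_ac)
qed

lemma L2_bounded_weighted:
 assumes [measurable]: "r \<in> borel_measurable borel" and "\<And>y. cmod (r y) \<le> B" "0 < \<epsilon>"
 shows "L2 (\<lambda>y. of_real (exp (- \<epsilon> * \<bar>y\<bar>)) * r y)"
proof (rule L2_of_exp_bound)
 fix y
 have "exp (- \<epsilon> * \<bar>y\<bar>) * cmod (r y) \<le> exp (- \<epsilon> * \<bar>y\<bar>) * B" by (intro mult_left_mono assms) auto
 then show "cmod (of_real (exp (- \<epsilon> * \<bar>y\<bar>)) * r y) \<le> B * exp (- \<epsilon> * \<bar>y\<bar>)"
  by (simp add: norm_mult mult.commute)
qed (use assms in auto)

lemma nsq_weighted_bound:
 assumes f: "f \<in> borel_measurable borel" and "\<And>y. cmod (f y) \<le> D * exp (- \<epsilon> * \<bar>y\<bar>)" "0 < \<epsilon>"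
 shows "nsq f \<le> D\<^sup>2 / \<epsilon> * (LINT y|lborel. exp (- 2 * \<bar>y::real\<bar>))"
proof -
 have i: "integrable lborel (\<lambda>y. D\<^sup>2 * exp (- (2 * \<epsilon>) * \<bar>y\<bar>))"
  using assms by (intro integrable_mult_right integrable_exp_abs) simp
 have pt: "(cmod (f y))\<^sup>2 \<le> D\<^sup>2 * exp (- (2 * \<epsilon>) * \<bar>y\<bar>)" for y
 proof -
  have "(cmod (f y))\<^sup>2 \<le> (D * exp (- \<epsilon> * \<bar>y\<bar>))\<^sup>2" by (intro power_mono assms) simp
  also have "\<dots> = D\<^sup>2 * exp (- (2 * \<epsilon>) * \<bar>y\<bar>)" by (simp add: power_mult_distrib flip: exp_double)
  finally show ?thesis .
 qed
 have "nsq f \<le> (LINT y|lborel. D\<^sup>2 * exp (- (2 * \<epsilon>) * \<bar>y\<bar>))"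
  unfolding nsq_def using L2_integrable[OF L2_bound[OF f i pt]] i pt by (intro integral_mono) auto
 also have "\<dots> = D\<^sup>2 * (LINT y|lborel. exp (- 2 * \<bar>\<epsilon> * y\<bar>))" using assms(3) by (simp add: abs_mult mult.assoc)
 also have "(LINT y|lborel. exp (- 2 * \<bar>\<epsilon> * y\<bar>)) = (LINT y|lborel. exp (- 2 * \<bar>y::real\<bar>)) / \<epsilon>"
  using assms(3) by (subst (2) lborel_integral_real_affine[of \<epsilon> _ 0]) auto
 finally show ?thesis by simp
qed

context two_step
begin

lemma integrable_green_bounded:
 assumes [measurable]: "r \<in> borel_measurable borel" and "\<And>y. cmod (r y) \<le> B" "0 < t"
 shows "integrable lborel (\<lambda>s. green k t s * r (y - s))"
proof (rule Bochner_Integration.integrable_bound)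
 show "(\<lambda>s. green k t s * r (y - s)) \<in> borel_measurable lborel" by measurable
 show "integrable lborel (\<lambda>s. B * cmod (green k t s))"
  by (intro integrable_mult_right gauss_kernel_integrable gauss_kernel_green assms k)
 have "cmod (green k t s) * cmod (r (y - s)) \<le> cmod (green k t s) * B" for s
  by (intro mult_left_mono assms) auto
 then show "AE s in lborel. norm (green k t s * r (y - s)) \<le> norm (B * cmod (green k t s))"
  by (intro AE_I2) (auto simp: norm_mult mult.commute intro: order_trans[OF _ abs_ge_self])
qed

lemma heat_bounded:
 assumes r: "r \<in> borel_measurable borel" and B: "\<And>y. cmod (r y) \<le> B" and t: "0 < t"
 shows "cmod (heat k t r y) \<le> B * (LINT s|lborel. cmod (green k t s))" "heat k t r \<in> borel_measurable borel"
proof -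
 have [measurable]: "green k t \<in> borel_measurable borel" "r \<in> borel_measurable borel"
  using gauss_kernel_green[OF t k] r by (auto dest: gauss_kernel_measurable)
 have "cmod (heat k t r y) \<le> (LINT s|lborel. B * cmod (green k t s))"
  unfolding heat_def conv_shift
 proof (rule norm_integral_le)
  show "cmod (green k t s * r (y - s)) \<le> B * cmod (green k t s)" for s
   unfolding norm_mult by (subst mult.commute) (intro mult_right_mono B, simp)
 qed (auto intro: gauss_kernel_integrable gauss_kernel_green t k)
 then show "cmod (heat k t r y) \<le> B * (LINT s|lborel. cmod (green k t s))" by simp
 show "heat k t r \<in> borel_measurable borel" unfolding heat_def by measurable
qed

text \<open>The logarithmic derivative of the weight is at most \<open>\<epsilon>\<close> and the kernel is integrable against
 \<open>|s| exp |s|\<close>, so damping a bounded function commutes with diffusion up to a term that vanishes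
 with \<open>\<epsilon>\<close>.\<close>

lemma heat_weight_commutator:
 assumes r: "r \<in> borel_measurable borel" and B: "\<And>y. cmod (r y) \<le> B" and t: "0 < t" and e: "0 < \<epsilon>" "\<epsilon> \<le> 1"
 shows "cmod (of_real (exp (- \<epsilon> * \<bar>y\<bar>)) * heat k t r y - heat k t (\<lambda>y. of_real (exp (- \<epsilon> * \<bar>y\<bar>)) * r y) y)
   \<le> \<epsilon> * (B * (LINT s|lborel. cmod (green k t s) * (\<bar>s\<bar> * exp \<bar>s\<bar>))) * exp (- \<epsilon> * \<bar>y\<bar>)"
proof -
 have [measurable]: "green k t \<in> borel_measurable borel" "r \<in> borel_measurable borel"
  using gauss_kernel_green[OF t k] r by (auto dest: gauss_kernel_measurable)
 let ?w = "\<lambda>y. complex_of_real (exp (- \<epsilon> * \<bar>y\<bar>))"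
 have B0: "0 \<le> B" using B[of 0] norm_ge_zero[of "r 0"] by linarith
 have wB: "cmod (?w y * r y) \<le> B" for y
 proof -
  have "exp (- \<epsilon> * \<bar>y\<bar>) * cmod (r y) \<le> 1 * B" using e by (intro mult_mono B) (auto)
  then show ?thesis by (simp add: norm_mult)
 qed
 have i: "integrable lborel (\<lambda>s. green k t s * r (y - s))" "integrable lborel (\<lambda>s. green k t s * (?w (y - s) * r (y - s)))"
  using integrable_green_bounded[OF r B t, where y=y] integrable_green_bounded[where r="\<lambda>y. ?w y * r y", OF _ wB t, where y=y] by auto
 have "?w y * heat k t r y - heat k t (\<lambda>y. ?w y * r y) y
   = (LINT s|lborel. ?w y * (green k t s * r (y - s)) - green k t s * (?w (y - s) * r (y - s)))"
  using i by (simp add: heat_def conv_shift)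
 also have "\<dots> = (LINT s|lborel. of_real (exp (- \<epsilon> * \<bar>y\<bar>) - exp (- \<epsilon> * \<bar>y - s\<bar>)) * (green k t s * r (y - s)))"
  by (rule Bochner_Integration.integral_cong) (auto simp: algebra_simps)
 finally have e1: "?w y * heat k t r y - heat k t (\<lambda>y. ?w y * r y) y
   = (LINT s|lborel. of_real (exp (- \<epsilon> * \<bar>y\<bar>) - exp (- \<epsilon> * \<bar>y - s\<bar>)) * (green k t s * r (y - s)))" .
 have "cmod (LINT s|lborel. of_real (exp (- \<epsilon> * \<bar>y\<bar>) - exp (- \<epsilon> * \<bar>y - s\<bar>)) * (green k t s * r (y - s))) \<le> (LINT s|lborel. \<epsilon> * B * exp (- \<epsilon> * \<bar>y\<bar>) * (cmod (green k t s) * (\<bar>s\<bar> * exp \<bar>s\<bar>)))"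
 proof (rule norm_integral_le)
  show "integrable lborel (\<lambda>s. \<epsilon> * B * exp (- \<epsilon> * \<bar>y\<bar>) * (cmod (green k t s) * (\<bar>s\<bar> * exp \<bar>s\<bar>)))"
   by (intro integrable_mult_right integrable_green_weighted t k)
  fix s
  have "cmod (of_real (exp (- \<epsilon> * \<bar>y\<bar>) - exp (- \<epsilon> * \<bar>y - s\<bar>)) * (green k t s * r (y - s)))
    = \<bar>exp (- \<epsilon> * \<bar>y\<bar>) - exp (- \<epsilon> * \<bar>y - s\<bar>)\<bar> * (cmod (green k t s) * cmod (r (y - s)))"
   by (simp only: norm_mult norm_of_real)
  also have "\<dots> \<le> (\<epsilon> * (\<bar>s\<bar> * exp \<bar>s\<bar>) * exp (- \<epsilon> * \<bar>y\<bar>)) * (cmod (green k t s) * B)"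
   using e B0 by (intro mult_mono exp_weight_difference B) auto
  finally show "cmod (of_real (exp (- \<epsilon> * \<bar>y\<bar>) - exp (- \<epsilon> * \<bar>y - s\<bar>)) * (green k t s * r (y - s)))
   \<le> \<epsilon> * B * exp (- \<epsilon> * \<bar>y\<bar>) * (cmod (green k t s) * (\<bar>s\<bar> * exp \<bar>s\<bar>))"
   by (simp only: mult_ac)
 qed measurable
 then show ?thesis unfolding e1 integral_mult_right_zero by (simp only: mult_ac)
qed

lemma heat_diff:
 assumes "0 < t" "L2 f" "L2 g" shows "heat k t (\<lambda>y. f y - g y) = (\<lambda>y. heat k t f y - heat k t g y)"
 using heat_add[OF assms(1,2) L2_cmult[OF assms(3), of "-1"]] heat_cmult[of t "-1" g] by simp

text \<open>The damped function \<open>exp (- \<epsilon> |y|) r\<close> satisfies the equation up to commutators whose square norms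
 are of order \<open>\<epsilon>\<close>: their amplitude is of order \<open>\<epsilon>\<close>, on a range of length \<open>1 / \<epsilon>\<close>.  The resolvent bound
 then holds uniformly, and \<open>\<epsilon>\<close> tends to zero by monotone convergence.\<close>

lemma bounded_resolvent_L2:
 assumes z: "cmod \<zeta> = 1" "\<zeta> \<noteq> 1" and r: "r \<in> borel_measurable borel" and B: "\<And>y. cmod (r y) \<le> B"
  and s: "L2 s" and eq: "\<And>y. r y = \<zeta> * P r y + s y"
 shows "L2 r" and "nsq s = 0 ==> nsq r = 0"
proof -
 have [measurable]: "r \<in> borel_measurable borel" "\<eta> \<in> borel_measurable borel" "s \<in> borel_measurable borel"
  using r s sign_factor_simps[OF eta] by (auto dest: L2_measurable)
 obtain C where C: "0 < C" and CB: "\<And>f. L2 f ==> nsq f \<le> C * nsq (\<lambda>y. f y - \<zeta> * P f y)"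
  by (rule period_resolvent_bound[OF z]) (rule that)
 define w where "w \<epsilon> y = complex_of_real (exp (- \<epsilon> * \<bar>y\<bar>))" for \<epsilon> y :: real
 have wm[measurable]: "w \<epsilon> \<in> borel_measurable borel" for \<epsilon> unfolding w_def[abs_def] by measurable
 have w1: "cmod (w \<epsilon> y) \<le> 1" if "0 < \<epsilon>" for \<epsilon> y using that by (simp add: w_def)
 define B1 where "B1 = B * (LINT s|lborel. cmod (green k t1 s))"
 define D1 where "D1 = B * (LINT s|lborel. cmod (green k t1 s) * (\<bar>s\<bar> * exp \<bar>s\<bar>))"
 define D2 where "D2 = B1 * (LINT s|lborel. cmod (green k t2 s) * (\<bar>s\<bar> * exp \<bar>s\<bar>))"
 define J where "J = (LINT y|lborel. exp (- 2 * \<bar>y::real\<bar>))"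
 define er where "er y = \<eta> y * r y" for y
 have [measurable]: "er \<in> borel_measurable borel" unfolding er_def[abs_def] by measurable
 have erB: "cmod (er y) \<le> B" for y using B[of y] by (simp add: er_def norm_mult sign_factor_simps[OF eta])
 define g where "g = heat k t1 er"
 have gm[measurable]: "g \<in> borel_measurable borel" and gB: "cmod (g y) \<le> B1" for y
  unfolding g_def B1_def using heat_bounded[of er B t1] erB t1 by auto
 define eg where "eg y = \<eta> y * g y" for y
 have [measurable]: "eg \<in> borel_measurable borel" unfolding eg_def[abs_def] by measurable
 have egB: "cmod (eg y) \<le> B1" for y using gB[of y] by (simp add: eg_def norm_mult sign_factor_simps[OF eta])
 have Pr: "P r = heat k t2 eg"
  by (simp add: period_def hstep_def g_def er_def[abs_def] eg_def[abs_def])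
 have main: "nsq (\<lambda>y. w \<epsilon> y * r y) \<le> C * (2 * nsq s + 4 * (\<epsilon> * (D1\<^sup>2 + D2\<^sup>2) * J))" if e: "0 < \<epsilon>" "\<epsilon> \<le> 1" for \<epsilon>
 proof -
  have L: "L2 (\<lambda>y. w \<epsilon> y * r y)" "L2 (\<lambda>y. w \<epsilon> y * er y)" "L2 (\<lambda>y. w \<epsilon> y * eg y)" "L2 (\<lambda>y. w \<epsilon> y * g y)"
   unfolding w_def
   by (rule L2_bounded_weighted[OF _ B e(1)] L2_bounded_weighted[OF _ erB e(1)]
    L2_bounded_weighted[OF _ egB e(1)] L2_bounded_weighted[OF _ gB e(1)]; measurable)+
  have Ls: "L2 (\<lambda>y. w \<epsilon> y * s y)"
   by (rule L2_bound[OF _ L2_integrable[OF s]])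
     (auto simp: norm_mult power_mult_distrib intro!: mult_left_le_one_le power_le_one w1 e)
  define c1 where "c1 y = w \<epsilon> y * heat k t2 eg y - heat k t2 (\<lambda>y. w \<epsilon> y * eg y) y" for y
  define d where "d y = w \<epsilon> y * g y - heat k t1 (\<lambda>y. w \<epsilon> y * er y) y" for y
  have mh: "heat k t1 (\<lambda>y. w \<epsilon> y * er y) \<in> borel_measurable borel" "heat k t2 (\<lambda>y. w \<epsilon> y * eg y) \<in> borel_measurable borel"
    "heat k t2 eg \<in> borel_measurable borel"
   using L2_measurable[OF L2_heat[OF t1 k L(2)]] L2_measurable[OF L2_heat[OF t2 k L(3)]] heat_bounded(2)[of eg B1 t2] egB t2 by auto
  have dL: "L2 d" unfolding d_def by (intro L2_diff L L2_heat t1 k)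
  have nd: "nsq d \<le> \<epsilon> * D1\<^sup>2 * J"
  proof -
   have "nsq d \<le> (\<epsilon> * D1)\<^sup>2 / \<epsilon> * J" unfolding J_def
   proof (rule nsq_weighted_bound[OF L2_measurable[OF dL] _ e(1)])
    show "cmod (d y) \<le> \<epsilon> * D1 * exp (- \<epsilon> * \<bar>y\<bar>)" for y
     unfolding d_def w_def g_def D1_def by (rule heat_weight_commutator[OF _ erB t1 e]) measurable
   qed
   then show ?thesis using e by (simp add: power2_eq_square mult_ac)
  qed
  have c1b: "cmod (c1 y) \<le> (\<epsilon> * D2) * exp (- \<epsilon> * \<bar>y\<bar>)" for y
   unfolding c1_def w_def D2_def by (rule heat_weight_commutator[OF _ egB t2 e]) measurable
  have c1m: "c1 \<in> borel_measurable borel" unfolding c1_def[abs_def] using mh by measurable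
  have c1L: "L2 c1" by (rule L2_of_exp_bound[OF c1m e(1) c1b])
  have nc1: "nsq c1 \<le> \<epsilon> * D2\<^sup>2 * J"
  proof -
   have "nsq c1 \<le> (\<epsilon> * D2)\<^sup>2 / \<epsilon> * J" unfolding J_def by (rule nsq_weighted_bound[OF c1m c1b e(1)])
   then show ?thesis using e by (simp add: power2_eq_square mult_ac)
  qed
  have Pw: "P (\<lambda>y. w \<epsilon> y * r y) = heat k t2 (\<lambda>y. \<eta> y * heat k t1 (\<lambda>y. w \<epsilon> y * er y) y)"
   by (simp add: period_def hstep_def er_def[abs_def] mult.left_commute)
  have ed: "(\<lambda>y. \<eta> y * d y) = (\<lambda>y. w \<epsilon> y * eg y - \<eta> y * heat k t1 (\<lambda>y. w \<epsilon> y * er y) y)"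
   by (auto simp: d_def eg_def algebra_simps)
  have hd: "heat k t2 (\<lambda>y. \<eta> y * d y) = (\<lambda>y. heat k t2 (\<lambda>y. w \<epsilon> y * eg y) y - P (\<lambda>y. w \<epsilon> y * r y) y)"
   unfolding ed Pw by (intro heat_diff t2 L L2_sign eta L2_heat t1 k)
  have q: "(\<lambda>y. w \<epsilon> y * r y - \<zeta> * P (\<lambda>y. w \<epsilon> y * r y) y) = (\<lambda>y. w \<epsilon> y * s y + \<zeta> * (c1 y + heat k t2 (\<lambda>y. \<eta> y * d y) y))"
  proof
   fix y
   have "w \<epsilon> y * r y = w \<epsilon> y * (\<zeta> * heat k t2 eg y + s y)" using eq[of y] by (simp add: Pr)
   then show "w \<epsilon> y * r y - \<zeta> * P (\<lambda>y. w \<epsilon> y * r y) y = w \<epsilon> y * s y + \<zeta> * (c1 y + heat k t2 (\<lambda>y. \<eta> y * d y) y)"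
    unfolding hd by (simp add: c1_def algebra_simps)
  qed
  have Lh: "L2 (heat k t2 (\<lambda>y. \<eta> y * d y))" by (intro L2_heat t2 k L2_sign eta dL)
  have "nsq (\<lambda>y. w \<epsilon> y * r y) \<le> C * nsq (\<lambda>y. w \<epsilon> y * s y + \<zeta> * (c1 y + heat k t2 (\<lambda>y. \<eta> y * d y) y))"
   using CB[OF L(1)] unfolding q .
  also have "\<dots> \<le> C * (2 * nsq (\<lambda>y. w \<epsilon> y * s y) + 2 * nsq (\<lambda>y. \<zeta> * (c1 y + heat k t2 (\<lambda>y. \<eta> y * d y) y)))"
   using C by (intro mult_left_mono nsq_add_le Ls L2_cmult L2_add c1L Lh) auto
  also have "nsq (\<lambda>y. \<zeta> * (c1 y + heat k t2 (\<lambda>y. \<eta> y * d y) y)) = nsq (\<lambda>y. c1 y + heat k t2 (\<lambda>y. \<eta> y * d y) y)"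
   using z by (simp add: nsq_cmult)
  also have "C * (2 * nsq (\<lambda>y. w \<epsilon> y * s y) + 2 * nsq (\<lambda>y. c1 y + heat k t2 (\<lambda>y. \<eta> y * d y) y))
    \<le> C * (2 * nsq s + 2 * (2 * (\<epsilon> * D2\<^sup>2 * J) + 2 * (\<epsilon> * D1\<^sup>2 * J)))"
  proof (intro mult_left_mono add_mono)
   show "nsq (\<lambda>y. w \<epsilon> y * s y) \<le> nsq s"
    unfolding nsq_def using L2_integrable[OF Ls] L2_integrable[OF s]
    by (intro integral_mono) (auto simp: norm_mult power_mult_distrib intro!: mult_left_le_one_le power_le_one w1 e)
   have "nsq (heat k t2 (\<lambda>y. \<eta> y * d y)) \<le> nsq d"
    using heat_contraction[OF t2 k L2_sign[OF eta dL]] by (simp add: nsq_sign[OF eta])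
   then show "nsq (\<lambda>y. c1 y + heat k t2 (\<lambda>y. \<eta> y * d y) y) \<le> 2 * (\<epsilon> * D2\<^sup>2 * J) + 2 * (\<epsilon> * D1\<^sup>2 * J)"
    using nsq_add_le[OF c1L Lh] nd nc1 by linarith
  qed (use C in auto)
  finally show ?thesis by (simp add: algebra_simps)
 qed
 define e where "e n = 1 / real (Suc n)" for n
 have e: "0 < e n" "e n \<le> 1" for n by (auto simp: e_def)
 define F where "F n y = (cmod (w (e n) y * r y))\<^sup>2" for n y
 define S where "S n = nsq (\<lambda>y. w (e n) y * r y)" for n
 have iF: "integrable lborel (F n)" for n
  unfolding F_def w_def using L2_bounded_weighted[OF r B e(1), of n] by (rule L2_integrable)
 have SF: "S n = integral\<^sup>L lborel (F n)" for n by (simp add: S_def F_def[abs_def] nsq_def)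
 have mF: "mono (\<lambda>n. F n y)" for y
 proof (rule monoI)
  fix m n :: nat assume "m \<le> n"
  then have "e n \<le> e m" by (simp add: e_def frac_le)
  then have "cmod (w (e m) y * r y) \<le> cmod (w (e n) y * r y)"
   by (auto simp: w_def norm_mult intro!: mult_right_mono)
  then show "F m y \<le> F n y" unfolding F_def by (intro power_mono) auto
 qed
 have bd: "S n \<le> C * (2 * nsq s + 4 * (e n * (D1\<^sup>2 + D2\<^sup>2) * J))" for n unfolding S_def by (rule main[OF e])
 have "e \<longlonglongrightarrow> 0" unfolding e_def by (rule LIMSEQ_inverse_real_of_nat[unfolded inverse_eq_divide])
 then have lim: "(\<lambda>n. C * (2 * nsq s + 4 * (e n * (D1\<^sup>2 + D2\<^sup>2) * J))) \<longlonglongrightarrow> C * (2 * nsq s + 4 * (0 * (D1\<^sup>2 + D2\<^sup>2) * J))"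
  by (intro tendsto_intros)
 have "incseq S" unfolding SF by (intro incseq_SucI integral_mono iF) (use mF in \<open>auto simp: mono_def\<close>)
 moreover have "Bseq S"
 proof -
  obtain K where K: "\<And>n. norm (C * (2 * nsq s + 4 * (e n * (D1\<^sup>2 + D2\<^sup>2) * J))) \<le> K"
   using convergent_imp_Bseq[OF convergentI[OF lim]] by (auto simp: Bseq_def)
  have "norm (S n) \<le> K" for n using bd[of n] K[of n] by (simp add: S_def)
  then show ?thesis by (rule BseqI')
 qed
 ultimately obtain L where L: "S \<longlonglongrightarrow> L"
  using Bseq_monoseq_convergent[of S] by (auto simp: convergent_def incseq_def monoseq_def)
 have Fl: "(\<lambda>n. F n y) \<longlonglongrightarrow> (cmod (r y))\<^sup>2" for y
 proof -
  have "(\<lambda>n. (exp (- e n * \<bar>y\<bar>) * cmod (r y))\<^sup>2) \<longlonglongrightarrow> (exp (- 0 * \<bar>y\<bar>) * cmod (r y))\<^sup>2"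
   using \<open>e \<longlonglongrightarrow> 0\<close> by (intro tendsto_intros)
  then show ?thesis by (simp add: F_def w_def norm_mult)
 qed
 have m1: "AE y in lborel. mono (\<lambda>n. F n y)" and m2: "AE y in lborel. (\<lambda>n. F n y) \<longlonglongrightarrow> (cmod (r y))\<^sup>2"
  and m3: "(\<lambda>n. integral\<^sup>L lborel (F n)) \<longlonglongrightarrow> L" and m4: "(\<lambda>y. (cmod (r y))\<^sup>2) \<in> borel_measurable lborel"
  using mF Fl L by (auto simp flip: SF)
 have iL: "integrable lborel (\<lambda>y. (cmod (r y))\<^sup>2)"
  by (rule integrable_monotone_convergence[OF iF m1 m2 m3 m4])
 have nL: "integral\<^sup>L lborel (\<lambda>y. (cmod (r y))\<^sup>2) = L"
  by (rule integral_monotone_convergence[OF iF m1 m2 m3 m4])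
 show "L2 r" using r iL by (simp add: L2_def)
 have "L \<le> C * (2 * nsq s + 4 * (0 * (D1\<^sup>2 + D2\<^sup>2) * J))"
  by (rule LIMSEQ_le[OF L lim]) (use bd in blast)
 then show "nsq s = 0 ==> nsq r = 0" using nL nsq_nonneg[of r] by (simp add: nsq_def)
qed

end

section \<open>Solutions in a strip\<close>

definition strip_solution ::
  "complex => real => real => (real => real => complex) => (real => real => complex) =>
   (real => real => complex) => (real => real => complex) => bool" where
 "strip_solution \<kappa> x0 x1 f fx fy fyy \<longleftrightarrow>
   (\<forall>g\<in>{f, fx, fy, fyy}. continuous_on ({x0<..<x1} \<times> UNIV) (\<lambda>p. g (fst p) (snd p))) \<and>
   (\<forall>x\<in>{x0<..<x1}. \<forall>y.
    ((\<lambda>x. f x y) has_vector_derivative fx x y) (at x) \<and>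
    ((\<lambda>y. f x y) has_vector_derivative fy x y) (at y) \<and>
    ((\<lambda>y. fy x y) has_vector_derivative fyy x y) (at y) \<and>
    fx x y = \<kappa> * fyy x y)"

lemma strip_solution_cont:
 assumes "strip_solution \<kappa> x0 x1 f fx fy fyy" "A \<subseteq> {x0<..<x1}"
 shows "continuous_on (A \<times> B) (\<lambda>p. f (fst p) (snd p))" "continuous_on (A \<times> B) (\<lambda>p. fx (fst p) (snd p))"
  "continuous_on (A \<times> B) (\<lambda>p. fy (fst p) (snd p))" "continuous_on (A \<times> B) (\<lambda>p. fyy (fst p) (snd p))"
 using assms by (auto simp: strip_solution_def intro: continuous_on_subset)

lemma continuous_on_section:
 assumes "continuous_on (A \<times> B) (\<lambda>p. g (fst p) (snd p))"
 shows "x \<in> A ==> continuous_on B (\<lambda>y. g x y)" "y \<in> B ==> continuous_on A (\<lambda>x. g x y)"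
proof -
 show "continuous_on B (\<lambda>y. g x y)" if "x \<in> A"
 proof -
  have "continuous_on B (\<lambda>y. (x, y))" by (intro continuous_intros)
  from continuous_on_compose2[OF assms this] show ?thesis using that by auto
 qed
 show "continuous_on A (\<lambda>x. g x y)" if "y \<in> B"
 proof -
  have "continuous_on A (\<lambda>x. (x, y))" by (intro continuous_intros)
  from continuous_on_compose2[OF assms this] show ?thesis using that by auto
 qed
qed

lemma strip_solution_cont_y:
 assumes "strip_solution \<kappa> x0 x1 f fx fy fyy" "x \<in> {x0<..<x1}"
 shows "continuous_on B (f x)" "continuous_on B (fx x)" "continuous_on B (fy x)" "continuous_on B (fyy x)"
 using strip_solution_cont[OF assms(1), of "{x}" B, THEN continuous_on_section(1)] assms(2) by auto

lemma strip_solution_cont_x: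
 assumes "strip_solution \<kappa> x0 x1 f fx fy fyy" "A \<subseteq> {x0<..<x1}"
 shows "continuous_on A (\<lambda>x. f x y)" "continuous_on A (\<lambda>x. fy x y)"
 using strip_solution_cont[OF assms, of UNIV, THEN continuous_on_section(2)] by auto

lemma strip_solutionD:
 assumes "strip_solution \<kappa> x0 x1 f fx fy fyy" "x \<in> {x0<..<x1}"
 shows "((\<lambda>x. f x y) has_vector_derivative fx x y) (at x)" "((\<lambda>y. f x y) has_vector_derivative fy x y) (at y)"
  "((\<lambda>y. fy x y) has_vector_derivative fyy x y) (at y)" "fx x y = \<kappa> * fyy x y"
 using assms unfolding strip_solution_def by blast+

lemma strip_solution_subset:
 assumes f: "strip_solution \<kappa> x0 x1 f fx fy fyy" and "x0 \<le> x0'" "x1' \<le> x1"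
 shows "strip_solution \<kappa> x0' x1' f fx fy fyy"
proof -
 have sub: "{x0'<..<x1'} \<subseteq> {x0<..<x1}" using assms by auto
 show ?thesis
  unfolding strip_solution_def
 proof (intro conjI ballI allI)
  fix g assume "g \<in> {f, fx, fy, fyy}"
  then show "continuous_on ({x0'<..<x1'} \<times> UNIV) (\<lambda>p. g (fst p) (snd p))"
   using strip_solution_cont[OF f sub, of UNIV] by blast
 qed (use strip_solutionD[OF f] sub in blast)+
qed

text \<open>Folding at \<open>y0\<close> makes the \<open>y\<close>-derivative vanish there, which leaves a single boundary term in the flux
 through the line \<open>y = y0\<close>.\<close>

lemma strip_solution_even_part:
 assumes f: "strip_solution \<kappa> x0 x1 f fx fy fyy"
 shows "strip_solution \<kappa> x0 x1 (\<lambda>x y. f x (y0 + y) + f x (y0 - y)) (\<lambda>x y. fx x (y0 + y) + fx x (y0 - y))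
  (\<lambda>x y. fy x (y0 + y) - fy x (y0 - y)) (\<lambda>x y. fyy x (y0 + y) + fyy x (y0 - y))"
proof -
 note c = strip_solution_cont[OF f subset_refl, of UNIV]
 have c1: "continuous_on ({x0<..<x1} \<times> UNIV) (\<lambda>p. g (fst p) (y0 + snd p))"
  and c2: "continuous_on ({x0<..<x1} \<times> UNIV) (\<lambda>p. g (fst p) (y0 - snd p))"
  if "continuous_on ({x0<..<x1} \<times> UNIV) (\<lambda>p. g (fst p) (snd p))" for g :: "real => real => complex"
 proof -
  have "continuous_on ({x0<..<x1} \<times> UNIV) (\<lambda>p. (fst p, y0 + snd p))" "continuous_on ({x0<..<x1} \<times> UNIV) (\<lambda>p. (fst p, y0 - snd p))"
   by (intro continuous_intros)+
  then show "continuous_on ({x0<..<x1} \<times> UNIV) (\<lambda>p. g (fst p) (y0 + snd p))"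
   "continuous_on ({x0<..<x1} \<times> UNIV) (\<lambda>p. g (fst p) (y0 - snd p))"
   using continuous_on_compose2[OF that] by fastforce+
 qed
 have sh: "((\<lambda>y. g (y0 + y)) has_vector_derivative g' (y0 + y)) (at y)"
   "((\<lambda>y. g (y0 - y)) has_vector_derivative - g' (y0 - y)) (at y)"
  if "\<And>y. (g has_vector_derivative g' y) (at y)" for g g' :: "real => complex" and y
 proof -
  have "((\<lambda>y. y0 + y) has_vector_derivative 1) (at y)" "((\<lambda>y. y0 - y) has_vector_derivative - 1) (at y)"
   by (auto simp: has_real_derivative_iff_has_vector_derivative[symmetric] intro!: derivative_eq_intros)
  then show "((\<lambda>y. g (y0 + y)) has_vector_derivative g' (y0 + y)) (at y)"
   "((\<lambda>y. g (y0 - y)) has_vector_derivative - g' (y0 - y)) (at y)"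
   using vector_diff_chain_at[of "\<lambda>y. y0 + y" 1 y g "g' (y0 + y)"] vector_diff_chain_at[of "\<lambda>y. y0 - y" "-1" y g "g' (y0 - y)"] that
   by (auto simp: o_def)
 qed
 have D: "((\<lambda>x. f x (y0 + y) + f x (y0 - y)) has_vector_derivative fx x (y0 + y) + fx x (y0 - y)) (at x)"
  "((\<lambda>y. f x (y0 + y) + f x (y0 - y)) has_vector_derivative fy x (y0 + y) - fy x (y0 - y)) (at y)"
  "((\<lambda>y. fy x (y0 + y) - fy x (y0 - y)) has_vector_derivative fyy x (y0 + y) + fyy x (y0 - y)) (at y)"
  if x: "x \<in> {x0<..<x1}" for x y
 proof -
  note d = strip_solutionD[OF f x]
  show "((\<lambda>x. f x (y0 + y) + f x (y0 - y)) has_vector_derivative fx x (y0 + y) + fx x (y0 - y)) (at x)"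
   by (intro has_vector_derivative_add d)
  show "((\<lambda>y. f x (y0 + y) + f x (y0 - y)) has_vector_derivative fy x (y0 + y) - fy x (y0 - y)) (at y)"
   using has_vector_derivative_add[OF sh(1)[of "f x" "fy x", OF d(2)] sh(2)[of "f x" "fy x", OF d(2)], of y] by simp
  show "((\<lambda>y. fy x (y0 + y) - fy x (y0 - y)) has_vector_derivative fyy x (y0 + y) + fyy x (y0 - y)) (at y)"
   using has_vector_derivative_diff[OF sh(1)[of "fy x" "fyy x", OF d(3)] sh(2)[of "fy x" "fyy x", OF d(3)], of y] by simp
 qed
 show ?thesis
  unfolding strip_solution_def
 proof (intro conjI ballI allI)
  fix g x y assume "g \<in> {\<lambda>x y. f x (y0 + y) + f x (y0 - y), \<lambda>x y. fx x (y0 + y) + fx x (y0 - y),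
    \<lambda>x y. fy x (y0 + y) - fy x (y0 - y), \<lambda>x y. fyy x (y0 + y) + fyy x (y0 - y)}"
  then show "continuous_on ({x0<..<x1} \<times> UNIV) (\<lambda>p. g (fst p) (snd p))"
   by (elim insertE emptyE; simp only:; intro continuous_on_add continuous_on_diff c1 c2 c)
 next
  fix x y assume x: "x \<in> {x0<..<x1}"
  show "fx x (y0 + y) + fx x (y0 - y) = \<kappa> * (fyy x (y0 + y) + fyy x (y0 - y))"
   using strip_solutionD(4)[OF f x] by (simp add: distrib_left)
 qed (use D in auto)
qed

section \<open>Energy flux through a half line\<close>

text \<open>A cut off with double zeros at \<open>\<plusminus> R\<close>; its first two derivatives are of order \<open>1 / R\<close>.\<close>

definition cutoff :: "real => real => real" where "cutoff R y = (1 - (y / R)\<^sup>2)\<^sup>2"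
definition cutoff' :: "real => real => real" where "cutoff' R y = - 4 * y / R\<^sup>2 * (1 - (y / R)\<^sup>2)"
definition cutoff'' :: "real => real => real" where "cutoff'' R y = - 4 / R\<^sup>2 + 12 * y\<^sup>2 / R ^ 4"

lemma cutoff_deriv:
 assumes "0 < R"
 shows "(cutoff R has_real_derivative cutoff' R y) (at y)" "(cutoff' R has_real_derivative cutoff'' R y) (at y)"
 unfolding cutoff_def[abs_def] cutoff'_def[abs_def] cutoff''_def
 using assms by (auto intro!: derivative_eq_intros simp: field_simps power2_eq_square power4_eq_xxxx)

lemma cutoff_bounds:
 assumes "1 \<le> R" "0 \<le> y" "y \<le> R"
 shows "0 \<le> cutoff R y" "cutoff R y \<le> 1" "\<bar>cutoff' R y\<bar> \<le> 4 / R" "\<bar>cutoff'' R y\<bar> \<le> 8 / R"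
proof -
 define q where "q = y / R"
 have q: "0 \<le> q" "q \<le> 1" using assms by (auto simp: q_def)
 have q2: "0 \<le> q\<^sup>2" "q\<^sup>2 \<le> 1" using q by (auto simp: power_le_one)
 show "0 \<le> cutoff R y" by (simp add: cutoff_def)
 show "cutoff R y \<le> 1" unfolding cutoff_def q_def[symmetric] using q2 by (intro power_le_one) auto
 have "cutoff' R y = - (4 / R) * (q * (1 - q\<^sup>2))"
  using assms by (simp add: cutoff'_def q_def power2_eq_square)
 moreover have "0 \<le> q * (1 - q\<^sup>2)" "q * (1 - q\<^sup>2) \<le> 1" using q q2 by (auto intro: mult_le_one)
 moreover have "\<bar>- (4 / R) * z\<bar> \<le> 4 / R" if "0 \<le> z" "z \<le> 1" for z
  using assms that mult_left_mono[of z 1 "4 / R"] by (simp add: abs_mult)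
 ultimately show "\<bar>cutoff' R y\<bar> \<le> 4 / R" by simp
 have e: "cutoff'' R y = (12 * q\<^sup>2 - 4) / R / R"
  using assms by (simp add: cutoff''_def q_def field_simps power2_eq_square power4_eq_xxxx)
 have "\<bar>12 * q\<^sup>2 - 4\<bar> \<le> 8" using q2 by (intro abs_leI) linarith+
 then have "\<bar>cutoff'' R y\<bar> \<le> 8 / R / R"
  unfolding e using assms by (simp add: abs_mult divide_right_mono)
 also have "\<dots> \<le> 8 / R / 1" using assms by (intro divide_left_mono) auto
 finally show "\<bar>cutoff'' R y\<bar> \<le> 8 / R" by simp
qed

text \<open>The product of a solution and an adjoint solution is a conserved density, up to the flux
 through \<open>y = 0\<close>.  Only the sizes of \<open>f Z\<close> and \<open>f Z\<^sub>y\<close> are controlled, not those of the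
 derivatives of \<open>f\<close>: in the cut off integral all derivatives are moved away from \<open>f\<close>.\<close>

lemma half_line_flux:
 assumes f: "strip_solution \<kappa> x0 x1 f fx fy fyy" and Z: "strip_solution (- \<kappa>) x0 x1 Z Zx Zy Zyy"
  and f0: "\<And>x. x \<in> {x0<..<x1} ==> fy x 0 = 0"
  and x: "x0 < x2" "x2 \<le> x3" "x3 < x1"
  and W: "set_integrable lborel {0..} W"
  and B1: "\<And>x y. x \<in> {x2..x3} ==> 0 \<le> y ==> cmod (f x y * Z x y) \<le> W y"
  and B2: "\<And>x y. x \<in> {x2..x3} ==> 0 \<le> y ==> cmod (f x y * Zy x y) \<le> W y"
 shows "(LINT y:{0..}|lborel. f x3 y * Z x3 y) - (LINT y:{0..}|lborel. f x2 y * Z x2 y)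
   = \<kappa> * integral {x2..x3} (\<lambda>x. f x 0 * Zy x 0)"
proof -
 define I where "I = (LINT y:{0..}|lborel. W y)"
 have sub: "{x2..x3} \<subseteq> {x0<..<x1}" using x by auto
 \<comment> \<open>the double zero of the cut off removes all boundary terms at \<open>y = R\<close>\<close>
 define Q where "Q R x = integral (cbox 0 R) (\<lambda>y. f x y * (of_real (cutoff R y) * Z x y))" for R x
 define G where "G x = integral {x2..x} (\<lambda>x. f x 0 * Zy x 0)" for x
 have cont0: "continuous_on {x2..x3} (\<lambda>x. f x 0 * Zy x 0)"
  by (intro continuous_on_mult strip_solution_cont_x(1)[OF f sub] strip_solution_cont_x(2)[OF Z sub])
 have ccut: "continuous_on A (\<lambda>y. complex_of_real (cutoff R y))" "continuous_on A (\<lambda>y. complex_of_real (cutoff' R y))"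
   "continuous_on A (\<lambda>y. complex_of_real (cutoff'' R y))" for A R
  unfolding cutoff_def cutoff'_def cutoff''_def by (auto simp: divide_inverse intro!: continuous_intros)
 have est: "cmod (Q R x3 - Q R x2 - \<kappa> * G x3) \<le> cmod \<kappa> * (16 / R * I) * (x3 - x2)" if R: "1 \<le> R" for R
 proof -
  have WR: "W integrable_on {0..R}" and WI: "integral {0..R} W \<le> I"
  proof -
   have s: "set_integrable lborel {0..R} W" using W by (rule set_integrable_subset) auto
   show "W integrable_on {0..R}" using set_borel_integral_eq_integral(1)[OF s] .
   have pos: "0 \<le> W y" if "0 \<le> y" for y using B1[of x2 y] that x by (auto intro: order_trans[OF norm_ge_zero])
   have "(LINT y:{0..R}|lborel. W y) \<le> I"
    unfolding I_def set_lebesgue_integral_def using s W pos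
    by (intro integral_mono) (auto simp: set_integrable_def indicator_def)
   then show "integral {0..R} W \<le> I" using set_borel_integral_eq_integral(2)[OF s] by simp
  qed
  define Er where "Er x = integral {0..R} (\<lambda>y. f x y * (of_real (cutoff'' R y) * Z x y + 2 * of_real (cutoff' R y) * Zy x y))" for x
  have Q': "(Q R has_vector_derivative \<kappa> * (f x 0 * Zy x 0) + \<kappa> * Er x) (at x within {x2..x3})" if xx: "x \<in> {x2..x3}" for x
  proof -
   have xs: "x \<in> {x0<..<x1}" using xx sub by blast
   note df = strip_solutionD[OF f] and dZ = strip_solutionD[OF Z]
   let ?q = "\<lambda>x y. f x y * (of_real (cutoff R y) * Zx x y) + fx x y * (of_real (cutoff R y) * Z x y)"
   have "(Q R has_vector_derivative integral (cbox 0 R) (?q x)) (at x within {x2..x3})"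
    unfolding Q_def
   proof (rule leibniz_rule_vector_derivative)
    fix x y assume x': "x \<in> {x2..x3}"
    then have x'': "x \<in> {x0<..<x1}" using sub by blast
    show "((\<lambda>x. f x y * (of_real (cutoff R y) * Z x y)) has_vector_derivative ?q x y) (at x within {x2..x3})"
     by (intro has_vector_derivative_at_within[OF has_vector_derivative_mult] has_vector_derivative_mult_right df dZ x'')
    show "(\<lambda>y. f x y * (of_real (cutoff R y) * Z x y)) integrable_on cbox 0 R"
     by (intro integrable_continuous continuous_on_mult ccut strip_solution_cont_y(1)[OF f x''] strip_solution_cont_y(1)[OF Z x''])
   next
    have cc: "continuous_on ({x2..x3} \<times> cbox 0 R) (\<lambda>p. complex_of_real (cutoff R (snd p)))"
     unfolding cutoff_def by (auto simp: divide_inverse intro!: continuous_intros)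
    show "continuous_on ({x2..x3} \<times> cbox 0 R) (\<lambda>(x, y). ?q x y)"
     unfolding case_prod_unfold
     by (intro continuous_on_add continuous_on_mult cc strip_solution_cont[OF f sub] strip_solution_cont[OF Z sub])
   qed (use xx in auto)
   also have "integral (cbox 0 R) (?q x) = \<kappa> * (f x 0 * Zy x 0) + \<kappa> * Er x"
   proof -
    let ?c = "\<lambda>y. complex_of_real (cutoff R y)" and ?c1 = "\<lambda>y. complex_of_real (cutoff' R y)" and ?c2 = "\<lambda>y. complex_of_real (cutoff'' R y)"
    let ?F = "\<lambda>y. fy x y * (?c y * Z x y) - f x y * (?c1 y * Z x y + ?c y * Zy x y)"
    let ?e = "\<lambda>y. f x y * (?c2 y * Z x y + 2 * ?c1 y * Zy x y)"
    have dc: "(?c has_vector_derivative ?c1 y) (at y)" "(?c1 has_vector_derivative ?c2 y) (at y)" for y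
     using cutoff_deriv[of R y] R
     by (auto intro!: has_vector_derivative_of_real simp: has_real_derivative_iff_has_vector_derivative)
    have "(?F has_vector_derivative (?c y * (fyy x y * Z x y - f x y * Zyy x y) - ?e y)) (at y)" for y
     by (rule has_vector_derivative_eq_rhs)
       (rule has_vector_derivative_diff has_vector_derivative_add has_vector_derivative_mult df(2,3)[OF xs] dZ(2,3)[OF xs] dc
       | simp add: algebra_simps)+
    then have "((\<lambda>y. ?c y * (fyy x y * Z x y - f x y * Zyy x y) - ?e y) has_integral ?F R - ?F 0) {0..R}"
     using R by (intro fundamental_theorem_of_calculus) (auto intro: has_vector_derivative_at_within)
    also have "?F R - ?F 0 = f x 0 * Zy x 0"
     using R f0[OF xs] by (simp add: cutoff_def cutoff'_def)
    finally have h1: "((\<lambda>y. ?c y * (fyy x y * Z x y - f x y * Zyy x y) - ?e y) has_integral f x 0 * Zy x 0) {0..R}" .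
    have "?e integrable_on {0..R}"
     by (intro integrable_continuous_real continuous_intros ccut strip_solution_cont_y[OF f xs] strip_solution_cont_y[OF Z xs])
    then have "(?e has_integral Er x) {0..R}" unfolding Er_def by (rule integrable_integral)
    from has_integral_add[OF h1 this]
    have "((\<lambda>y. ?c y * (fyy x y * Z x y - f x y * Zyy x y)) has_integral f x 0 * Zy x 0 + Er x) {0..R}" by simp
    from has_integral_mult_right[OF this, of \<kappa>]
    have "((\<lambda>y. \<kappa> * (?c y * (fyy x y * Z x y - f x y * Zyy x y))) has_integral \<kappa> * (f x 0 * Zy x 0 + Er x)) {0..R}" .
    also have "(\<lambda>y. \<kappa> * (?c y * (fyy x y * Z x y - f x y * Zyy x y))) = ?q x"
     using df(4)[OF xs] dZ(4)[OF xs] by (auto simp: algebra_simps)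
    finally show ?thesis by (simp add: integral_unique distrib_left)
   qed
   finally show ?thesis .
  qed
  have G': "(G has_vector_derivative f x 0 * Zy x 0) (at x within {x2..x3})" if "x \<in> {x2..x3}" for x
   unfolding G_def[abs_def] by (rule integral_has_vector_derivative[OF cont0 that])
  have D: "((\<lambda>x. Q R x - \<kappa> * G x) has_vector_derivative \<kappa> * Er x) (at x within {x2..x3})" if "x \<in> {x2..x3}" for x
   using has_vector_derivative_diff[OF Q'[OF that] has_vector_derivative_mult_right[OF G'[OF that], of \<kappa>]] by simp
  have Erb: "cmod (\<kappa> * Er x) \<le> cmod \<kappa> * (16 / R * I)" if xx: "x \<in> {x2..x3}" for x
  proof -
   have xs: "x \<in> {x0<..<x1}" using xx sub by blast
   have "cmod (Er x) \<le> integral {0..R} (\<lambda>y. 16 / R * W y)"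
    unfolding Er_def
   proof (rule integral_norm_bound_integral)
    show "(\<lambda>y. f x y * (of_real (cutoff'' R y) * Z x y + 2 * of_real (cutoff' R y) * Zy x y)) integrable_on {0..R}"
     by (intro integrable_continuous_real continuous_intros ccut strip_solution_cont_y[OF f xs] strip_solution_cont_y[OF Z xs])
    show "(\<lambda>y. 16 / R * W y) integrable_on {0..R}" by (rule integrable_on_mult_right[OF WR])
    fix y assume y: "y \<in> {0..R}"
    have "cmod (f x y * (of_real (cutoff'' R y) * Z x y + 2 * of_real (cutoff' R y) * Zy x y))
      = cmod (of_real (cutoff'' R y) * (f x y * Z x y) + of_real (2 * cutoff' R y) * (f x y * Zy x y))"
     by (simp add: algebra_simps)
    also have "\<dots> \<le> \<bar>cutoff'' R y\<bar> * cmod (f x y * Z x y) + \<bar>2 * cutoff' R y\<bar> * cmod (f x y * Zy x y)"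
     by (rule order_trans[OF norm_triangle_ineq]) (simp add: norm_mult)
    also have "\<dots> \<le> 8 / R * W y + 8 / R * W y"
     using cutoff_bounds[OF R, of y] y R by (intro add_mono mult_mono B1 B2 xx) auto
    finally show "cmod (f x y * (of_real (cutoff'' R y) * Z x y + 2 * of_real (cutoff' R y) * Zy x y)) \<le> 16 / R * W y"
     by simp
   qed
   also have "\<dots> = 16 / R * integral {0..R} W" by (rule integral_mult_right)
   also have "\<dots> \<le> 16 / R * I" using WI R by (intro mult_left_mono) auto
   finally show ?thesis unfolding norm_mult by (intro mult_left_mono) auto
  qed
  have "norm ((\<lambda>x. Q R x - \<kappa> * G x) x3 - (\<lambda>x. Q R x - \<kappa> * G x) x2) \<le> cmod \<kappa> * (16 / R * I) * norm (x3 - x2)"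
  proof (rule differentiable_bound)
   fix x assume xx: "x \<in> {x2..x3}"
   show "((\<lambda>x. Q R x - \<kappa> * G x) has_derivative (\<lambda>h. h *\<^sub>R (\<kappa> * Er x))) (at x within {x2..x3})"
    using D[OF xx] unfolding has_vector_derivative_def .
   show "onorm (\<lambda>h. h *\<^sub>R (\<kappa> * Er x)) \<le> cmod \<kappa> * (16 / R * I)"
   proof (rule onorm_bound)
    show "0 \<le> cmod \<kappa> * (16 / R * I)" using Erb[OF xx] norm_ge_zero[of "\<kappa> * Er x"] by linarith
    show "norm (h *\<^sub>R (\<kappa> * Er x)) \<le> cmod \<kappa> * (16 / R * I) * norm h" for h
     unfolding norm_scaleR real_norm_def by (subst mult.commute) (intro mult_right_mono Erb xx, simp)
   qed
  qed (use x in auto)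
  moreover have "(Q R x3 - \<kappa> * G x3) - (Q R x2 - \<kappa> * G x2) = Q R x3 - Q R x2 - \<kappa> * G x3"
   by (simp add: G_def algebra_simps)
  moreover have "norm (x3 - x2) = x3 - x2" using x by simp
  ultimately show ?thesis by (simp only:)
 qed
 have Qlim: "(\<lambda>n. Q (real (Suc n)) x) \<longlonglongrightarrow> (LINT y:{0..}|lborel. f x y * Z x y)" if xx: "x \<in> {x2..x3}" for x
 proof -
  have xs: "x \<in> {x0<..<x1}" using xx sub by blast
  have c: "continuous_on UNIV (\<lambda>y. f x y * Z x y)"
   by (intro continuous_on_mult strip_solution_cont_y(1)[OF f xs] strip_solution_cont_y(1)[OF Z xs])
  then have [measurable]: "(\<lambda>y. f x y * Z x y) \<in> borel_measurable borel" by (rule borel_measurable_continuous_onI)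
  have [measurable]: "cutoff R \<in> borel_measurable borel" for R unfolding cutoff_def[abs_def] by measurable
  have eq: "Q (real (Suc n)) x = (LINT y|lborel. indicator {0..real (Suc n)} y *\<^sub>R (of_real (cutoff (real (Suc n)) y) * (f x y * Z x y)))" for n
  proof -
   have "set_integrable lborel {0..real (Suc n)} (\<lambda>y. of_real (cutoff (real (Suc n)) y) * (f x y * Z x y))"
    by (intro borel_integrable_compact[folded set_integrable_def, unfolded] borel_integrable_atLeastAtMost' continuous_on_mult ccut continuous_on_subset[OF c]) auto
   from set_borel_integral_eq_integral(2)[OF this] show ?thesis
    by (simp add: Q_def set_lebesgue_integral_def mult_ac)
  qed
  have "(\<lambda>n. LINT y|lborel. indicator {0..real (Suc n)} y *\<^sub>R (of_real (cutoff (real (Suc n)) y) * (f x y * Z x y)))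
    \<longlonglongrightarrow> (LINT y|lborel. indicator {0..} y *\<^sub>R (f x y * Z x y))"
  proof (rule Bochner_Integration.integral_dominated_convergence)
   show "integrable lborel (\<lambda>y. indicator {0..} y *\<^sub>R W y)" using W by (simp add: set_integrable_def)
   show "AE y in lborel. (\<lambda>n. indicator {0..real (Suc n)} y *\<^sub>R (of_real (cutoff (real (Suc n)) y) * (f x y * Z x y)))
     \<longlonglongrightarrow> indicator {0..} y *\<^sub>R (f x y * Z x y)"
   proof (rule AE_I2)
    fix y :: real
    have "(\<lambda>n. y / real (Suc n)) \<longlonglongrightarrow> 0" using LIMSEQ_Suc[OF lim_const_over_n[of y]] by simp
    then have "(\<lambda>n. cutoff (real (Suc n)) y) \<longlonglongrightarrow> (1 - 0\<^sup>2)\<^sup>2" unfolding cutoff_def by (intro tendsto_intros)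
    then have 1: "(\<lambda>n. of_real (cutoff (real (Suc n)) y) * (f x y * Z x y)) \<longlonglongrightarrow> of_real 1 * (f x y * Z x y)"
     by (intro tendsto_mult tendsto_of_real tendsto_const) simp
    obtain m where m: "y \<le> real m" using real_arch_simple by blast
    have "(\<lambda>n. indicator {0..real (Suc n)} y :: real) \<longlonglongrightarrow> indicator {0..} y"
     by (rule tendsto_eventually) (use m in \<open>auto simp: eventually_sequentially indicator_def intro!: exI[of _ m]\<close>)
    from tendsto_scaleR[OF this 1]
    show "(\<lambda>n. indicator {0..real (Suc n)} y *\<^sub>R (of_real (cutoff (real (Suc n)) y) * (f x y * Z x y)))
     \<longlonglongrightarrow> indicator {0..} y *\<^sub>R (f x y * Z x y)" by simp
   qed
   fix n
   show "AE y in lborel. norm (indicator {0..real (Suc n)} y *\<^sub>R (of_real (cutoff (real (Suc n)) y) * (f x y * Z x y))) \<le> indicator {0..} y *\<^sub>R W y"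
   proof (rule AE_I2)
    fix y :: real
    show "norm (indicator {0..real (Suc n)} y *\<^sub>R (of_real (cutoff (real (Suc n)) y) * (f x y * Z x y))) \<le> indicator {0..} y *\<^sub>R W y"
    proof (cases "y \<in> {0..real (Suc n)}")
     case True
     have "\<bar>cutoff (real (Suc n)) y\<bar> * cmod (f x y * Z x y) \<le> 1 * W y"
      using True cutoff_bounds[of "real (Suc n)" y] by (intro mult_mono B1 xx) auto
     then show ?thesis using True by (simp add: norm_mult)
    next
     case False
     have "0 \<le> y ==> 0 \<le> W y" using B1[OF xx, of y] by (auto intro: order_trans[OF norm_ge_zero])
     with False show ?thesis by (auto simp: indicator_def)
    qed
   qed
  qed measurable
  then show ?thesis unfolding eq set_lebesgue_integral_def .
 qed
 have "(\<lambda>n. Q (real (Suc n)) x3 - Q (real (Suc n)) x2 - \<kappa> * G x3) \<longlonglongrightarrow> 0"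
 proof (rule Lim_null_comparison)
  show "\<forall>\<^sub>F n in sequentially. norm (Q (real (Suc n)) x3 - Q (real (Suc n)) x2 - \<kappa> * G x3) \<le> cmod \<kappa> * (16 / real (Suc n) * I) * (x3 - x2)"
   using est by (intro always_eventually allI) simp
  have "(\<lambda>n. 16 / real (Suc n)) \<longlonglongrightarrow> 0" using LIMSEQ_Suc[OF lim_const_over_n[of 16]] by simp
  then show "(\<lambda>n. cmod \<kappa> * (16 / real (Suc n) * I) * (x3 - x2)) \<longlonglongrightarrow> 0"
   by (intro tendsto_mult_left_zero tendsto_mult_right_zero)
 qed
 moreover have "(\<lambda>n. Q (real (Suc n)) x3 - Q (real (Suc n)) x2 - \<kappa> * G x3)
   \<longlonglongrightarrow> (LINT y:{0..}|lborel. f x3 y * Z x3 y) - (LINT y:{0..}|lborel. f x2 y * Z x2 y) - \<kappa> * G x3"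
  using x by (intro tendsto_diff Qlim tendsto_const) auto
 ultimately have "(LINT y:{0..}|lborel. f x3 y * Z x3 y) - (LINT y:{0..}|lborel. f x2 y * Z x2 y) - \<kappa> * G x3 = 0"
  using LIMSEQ_unique by blast
 then show ?thesis by (simp add: G_def)
qed

section \<open>Representation of solutions by the heat kernel\<close>

definition diffusivity :: "complex => complex" where "diffusivity k = \<i> / (2 * k)"

lemma exp_diff_mult: "exp (a - b) = exp a * exp (- b)" for a b :: real
 by (simp flip: exp_add)

lemma csqrt_divide_of_real:
 assumes "0 < t" shows "csqrt (z / of_real t) = csqrt z / of_real (sqrt t)"
proof (rule csqrt_unique)
 show "(csqrt z / of_real (sqrt t))\<^sup>2 = z / of_real t"
  using assms by (simp add: power_divide flip: of_real_power)
 show "0 < Re (csqrt z / of_real (sqrt t)) \<or> Re (csqrt z / of_real (sqrt t)) = 0 \<and> 0 \<le> Im (csqrt z / of_real (sqrt t))"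
 proof -
  have "0 < Re (w / of_real (sqrt t)) \<or> Re (w / of_real (sqrt t)) = 0 \<and> 0 \<le> Im (w / of_real (sqrt t))"
   if "0 < Re w \<or> Re w = 0 \<and> 0 \<le> Im w" for w
   using assms that by (auto simp: Re_divide_of_real Im_divide_of_real)
  then show ?thesis using csqrt_principal[of z] by blast
 qed
qed

lemma green_scaling:
 assumes "0 < t"
 shows "green k t s = csqrt (gauss_rate k 1 / of_real pi) / of_real (sqrt t) * exp (- gauss_rate k 1 * of_real (s\<^sup>2 / t))"
proof -
 have "gauss_rate k t = gauss_rate k 1 / of_real t" by (simp add: gauss_rate_def)
 then show ?thesis
  using assms csqrt_divide_of_real[OF assms, of "gauss_rate k 1 / of_real pi"]
  by (simp add: green_eq mult.commute)
qed

lemma green_unit_scaling: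
 assumes "0 < t" shows "of_real (sqrt t) * green k t (sqrt t * s) = green k 1 s"
 using assms by (simp add: green_scaling power_mult_distrib)

lemma green_strip_solution:
 assumes k: "k \<noteq> 0"
 defines "q \<equiv> gauss_rate k 1"
 shows "strip_solution (- diffusivity k) x0 X (\<lambda>x y. green k (X - x) y)
  (\<lambda>x y. (1 / of_real (2 * (X - x)) - q * of_real (y\<^sup>2 / (X - x)\<^sup>2)) * green k (X - x) y)
  (\<lambda>x y. - 2 * q * of_real (y / (X - x)) * green k (X - x) y)
  (\<lambda>x y. (- 2 * q / of_real (X - x) + 4 * q\<^sup>2 * of_real (y\<^sup>2 / (X - x)\<^sup>2)) * green k (X - x) y)"
proof -
 define A where "A = csqrt (q / of_real pi)"
 define g where "g x y = A / of_real (sqrt (X - x)) * exp (- q * of_real (y\<^sup>2 / (X - x)))" for x y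
 have gg: "green k (X - x) y = g x y" if "x < X" for x y
  using that by (simp add: green_scaling g_def A_def q_def)
 have kq: "diffusivity k * q = 1 / 4" using k by (simp add: diffusivity_def q_def gauss_rate_def)
 have cg: "continuous_on ({x0<..<X} \<times> UNIV) (\<lambda>p. g (fst p) (snd p))"
  unfolding g_def by (auto intro!: continuous_intros)
 have c: "continuous_on ({x0<..<X} \<times> UNIV) (\<lambda>p. green k (X - fst p) (snd p))"
  by (rule continuous_on_eq[OF cg]) (auto simp: gg)
 have dx: "((\<lambda>x. green k (X - x) y) has_vector_derivative (1 / of_real (2 * (X - x)) - q * of_real (y\<^sup>2 / (X - x)\<^sup>2)) * green k (X - x) y) (at x)"
  and dy: "((\<lambda>y. green k (X - x) y) has_vector_derivative - 2 * q * of_real (y / (X - x)) * green k (X - x) y) (at y)"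
  if x: "x < X" for x y
 proof -
  define e where "e x = exp (- q * complex_of_real (y\<^sup>2 / (X - x)))" for x
  have e': "(e has_vector_derivative - q * of_real (y\<^sup>2 / (X - x)\<^sup>2) * e x) (at x)"
  proof -
   have "((\<lambda>x. y\<^sup>2 / (X - x)) has_real_derivative y\<^sup>2 / (X - x)\<^sup>2) (at x)"
    using x by (auto intro!: derivative_eq_intros simp: power2_eq_square field_simps)
   then have "((\<lambda>x. complex_of_real (y\<^sup>2 / (X - x))) has_vector_derivative of_real (y\<^sup>2 / (X - x)\<^sup>2)) (at x)"
    by (intro has_vector_derivative_of_real) (simp add: has_real_derivative_iff_has_vector_derivative)
   then have "((\<lambda>x. - q * complex_of_real (y\<^sup>2 / (X - x))) has_vector_derivative - q * of_real (y\<^sup>2 / (X - x)\<^sup>2)) (at x)"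
    by (rule has_vector_derivative_mult_right)
   from field_vector_diff_chain_at[OF this DERIV_exp]
   show ?thesis by (simp add: e_def[abs_def] o_def mult_ac)
  qed
  have r': "((\<lambda>x. complex_of_real (1 / sqrt (X - x))) has_vector_derivative of_real (1 / (2 * (X - x)) * (1 / sqrt (X - x)))) (at x)"
  proof (rule has_vector_derivative_of_real)
   show "((\<lambda>x. 1 / sqrt (X - x)) has_real_derivative 1 / (2 * (X - x)) * (1 / sqrt (X - x))) (at x)"
    using x by (auto intro!: derivative_eq_intros simp: field_simps)
  qed
  have "((\<lambda>x. A * (complex_of_real (1 / sqrt (X - x)) * e x)) has_vector_derivative
    A * (of_real (1 / sqrt (X - x)) * (- q * of_real (y\<^sup>2 / (X - x)\<^sup>2) * e x) + of_real (1 / (2 * (X - x)) * (1 / sqrt (X - x))) * e x)) (at x)"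
   by (intro has_vector_derivative_mult_right has_vector_derivative_mult e' r')
  moreover have "A * (complex_of_real (1 / sqrt (X - x)) * e x) = g x y" for x by (simp add: g_def e_def)
  moreover have "A * (of_real (1 / sqrt (X - x)) * (- q * of_real (y\<^sup>2 / (X - x)\<^sup>2) * e x) + of_real (1 / (2 * (X - x)) * (1 / sqrt (X - x))) * e x)
   = (1 / of_real (2 * (X - x)) - q * of_real (y\<^sup>2 / (X - x)\<^sup>2)) * g x y"
   by (simp add: g_def e_def algebra_simps)
  ultimately have d: "((\<lambda>x. g x y) has_vector_derivative (1 / of_real (2 * (X - x)) - q * of_real (y\<^sup>2 / (X - x)\<^sup>2)) * g x y) (at x)" by simp
  show "((\<lambda>x. green k (X - x) y) has_vector_derivative (1 / of_real (2 * (X - x)) - q * of_real (y\<^sup>2 / (X - x)\<^sup>2)) * green k (X - x) y) (at x)"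
   unfolding gg[OF x]
   by (rule has_vector_derivative_transform_within_open[OF d, of "{..<X}"]) (use x gg in auto)
  have "((\<lambda>y. complex_of_real (y\<^sup>2 / (X - x))) has_vector_derivative of_real (2 * y / (X - x))) (at y)"
  proof (rule has_vector_derivative_of_real)
   show "((\<lambda>y. y\<^sup>2 / (X - x)) has_real_derivative 2 * y / (X - x)) (at y)"
    using x by (auto intro!: derivative_eq_intros)
  qed
  then have "((\<lambda>y. - q * complex_of_real (y\<^sup>2 / (X - x))) has_vector_derivative - q * of_real (2 * y / (X - x))) (at y)"
   by (rule has_vector_derivative_mult_right)
  from has_vector_derivative_mult_right[OF field_vector_diff_chain_at[OF this DERIV_exp], of "A / of_real (sqrt (X - x))"]
  have "((\<lambda>y. g x y) has_vector_derivative - 2 * q * of_real (y / (X - x)) * g x y) (at y)"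
   by (simp add: g_def o_def mult_ac)
  then show "((\<lambda>y. green k (X - x) y) has_vector_derivative - 2 * q * of_real (y / (X - x)) * green k (X - x) y) (at y)"
   by (simp add: gg[OF x])
 qed
 have dyy: "((\<lambda>y. - 2 * q * of_real (y / (X - x)) * green k (X - x) y) has_vector_derivative
   (- 2 * q / of_real (X - x) + 4 * q\<^sup>2 * of_real (y\<^sup>2 / (X - x)\<^sup>2)) * green k (X - x) y) (at y)" if x: "x < X" for x y
 proof -
  have "((\<lambda>y. complex_of_real (y / (X - x))) has_vector_derivative of_real (1 / (X - x))) (at y)"
  proof (rule has_vector_derivative_of_real)
   show "((\<lambda>y. y / (X - x)) has_real_derivative 1 / (X - x)) (at y)"
    using x by (auto intro!: derivative_eq_intros)
  qed
  from has_vector_derivative_mult[OF has_vector_derivative_mult_right[OF this, of "- 2 * q"] dy[OF x]]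
  show ?thesis by (rule has_vector_derivative_eq_rhs) (simp add: algebra_simps power2_eq_square)
 qed
 show ?thesis
  unfolding strip_solution_def
 proof (intro conjI ballI allI)
  fix h x y
  assume "h \<in> {\<lambda>x y. green k (X - x) y,
   \<lambda>x y. (1 / of_real (2 * (X - x)) - q * of_real (y\<^sup>2 / (X - x)\<^sup>2)) * green k (X - x) y,
   \<lambda>x y. - 2 * q * of_real (y / (X - x)) * green k (X - x) y,
   \<lambda>x y. (- 2 * q / of_real (X - x) + 4 * q\<^sup>2 * of_real (y\<^sup>2 / (X - x)\<^sup>2)) * green k (X - x) y}"
  then show "continuous_on ({x0<..<X} \<times> UNIV) (\<lambda>p. h (fst p) (snd p))"
   by (elim insertE emptyE; simp only:; intro continuous_intros c; auto)
 next
  fix x y assume "x \<in> {x0<..<X}"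
  then have "x < X" by simp
  define t where "t = complex_of_real (X - x)"
  have t: "t \<noteq> 0" using \<open>x < X\<close> by (simp add: t_def)
  have "- diffusivity k * ((- 2 * q / t + 4 * q\<^sup>2 * (of_real y)\<^sup>2 / t\<^sup>2) * green k (X - x) y)
    = (diffusivity k * q) * (2 / t - 4 * q * (of_real y)\<^sup>2 / t\<^sup>2) * green k (X - x) y"
   by (simp add: algebra_simps power2_eq_square)
  also have "\<dots> = (1 / (2 * t) - q * (of_real y)\<^sup>2 / t\<^sup>2) * green k (X - x) y"
   unfolding kq using t by (simp add: algebra_simps)
  finally show "(1 / of_real (2 * (X - x)) - q * of_real (y\<^sup>2 / (X - x)\<^sup>2)) * green k (X - x) y
    = - diffusivity k * ((- 2 * q / of_real (X - x) + 4 * q\<^sup>2 * of_real (y\<^sup>2 / (X - x)\<^sup>2)) * green k (X - x) y)"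
   by (simp add: t_def)
 qed (use dx dy dyy in auto)
qed

lemma fold_even_kernel:
 fixes F G :: "real => complex"
 assumes G: "\<And>s. G (- s) = G s" and i: "integrable lborel (\<lambda>s. F (Y - s) * G s)"
 shows "(LINT y:{0..}|lborel. (F (Y + y) + F (Y - y)) * G y) = (LINT s|lborel. F (Y - s) * G s)"
proof -
 let ?h = "\<lambda>s. F (Y - s) * G s"
 have i2: "integrable lborel (\<lambda>s. ?h (- s))"
  using lborel_integrable_real_affine[OF i, of "-1" 0] by simp
 have s1: "set_integrable lborel {0..} ?h" and s2: "set_integrable lborel {0..} (\<lambda>s. ?h (- s))" and s3: "set_integrable lborel {..<0} ?h"
  unfolding set_integrable_def by (intro integrable_mult_indicator i i2; simp)+
 have m: "(LINT y:{0..}|lborel. ?h (- y)) = (LINT y:{..<0}|lborel. ?h y)"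
 proof -
  have "(LINT y:{0..}|lborel. ?h (- y)) = (LINT y|lborel. indicator {..0} y *\<^sub>R ?h y)"
   unfolding set_lebesgue_integral_def
   by (subst lborel_integral_real_affine[of "-1" _ 0]) (auto simp: indicator_def intro!: Bochner_Integration.integral_cong)
  also have "\<dots> = (LINT y|lborel. indicator {..<0} y *\<^sub>R ?h y)"
  proof (rule integral_cong_AE)
   show "AE y in lborel. indicator {..0} y *\<^sub>R ?h y = indicator {..<0} y *\<^sub>R ?h y"
    using AE_lborel_singleton[of 0] by eventually_elim (auto simp: indicator_def)
  qed (use borel_measurable_integrable[OF i] in auto)
  finally show ?thesis by (simp add: set_lebesgue_integral_def)
 qed
 have "(LINT y:{0..}|lborel. (F (Y + y) + F (Y - y)) * G y) = (LINT y:{0..}|lborel. ?h (- y) + ?h y)"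
  by (simp add: G distrib_right)
 also have "\<dots> = (LINT y:{..<0}|lborel. ?h y) + (LINT y:{0..}|lborel. ?h y)"
  using set_integral_add(2)[OF s2 s1] m by simp
 also have "\<dots> = (LINT y:{..<0} \<union> {0..}|lborel. ?h y)"
  by (rule set_integral_Un[symmetric, OF _ s3 s1]) auto
 also have "{..<0} \<union> {0..} = (UNIV :: real set)" by auto
 finally show ?thesis by (simp add: set_lebesgue_integral_def)
qed

text \<open>Uniqueness for the parabolic equation in the class of exponentially bounded functions:
 the convolution of \<open>f x\<close> with the kernel for the remaining time \<open>X - x\<close> does not depend on \<open>x\<close>.\<close>

lemma heat_representation:
 assumes k: "0 < Im k" and f: "strip_solution (diffusivity k) x0 x1 f fx fy fyy"
  and c: "0 \<le> c" and B: "\<And>x y. x \<in> {x0<..<x1} ==> cmod (f x y) \<le> B * exp (c * \<bar>y\<bar>)"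
  and f0: "f0 \<in> borel_measurable borel" "\<And>y. y \<noteq> 0 ==> ((\<lambda>x. f x y) \<longlongrightarrow> f0 y) (at_right x0)"
  and X: "X \<in> {x0<..<x1}"
 shows "f X Y = heat k (X - x0) f0 Y"
proof -
 let ?K = "B * exp (c * \<bar>Y\<bar>)"
 have k0: "k \<noteq> 0" using k by auto
 define q where "q = gauss_rate k 1"
 have q: "Re q = Im k / 2" by (simp add: q_def Re_gauss_rate)
 define A where "A = sqrt (cmod q / pi)"
 have A: "0 \<le> A" by (simp add: A_def)
 have ng: "cmod (green k t s) = A / sqrt t * exp (- (Im k / 2) * s\<^sup>2 / t)" if "0 < t" for t s
 proof -
  have "cmod (gauss_rate k t) = cmod q / t" using that by (simp add: q_def gauss_rate_def norm_divide norm_mult)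
  then have "cmod (green k t s) = sqrt (cmod q / t / pi) * exp (- (Im k / (2 * t)) * s\<^sup>2)"
   using norm_green[OF that, of k s] by simp
  also have "sqrt (cmod q / t / pi) = A / sqrt t" by (simp add: A_def real_sqrt_divide divide_divide_eq_left real_sqrt_mult mult.commute)
  finally show ?thesis by simp
 qed
 have B0: "0 \<le> B"
 proof -
  have "0 \<le> B * exp (c * \<bar>0\<bar>)" using B[OF X, of 0] norm_ge_zero[of "f X 0"] by linarith
  then show ?thesis by simp
 qed
 let ?f = "\<lambda>x y. f x (Y + y) + f x (Y - y)"
 let ?Z = "\<lambda>x y. green k (X - x) y"
 let ?Zy = "\<lambda>x y. - 2 * q * of_real (y / (X - x)) * green k (X - x) y"
 have f': "strip_solution (diffusivity k) x0 X f fx fy fyy"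
  using f by (rule strip_solution_subset) (use X in auto)
 note fe = strip_solution_even_part[OF f', of Y]
 note Z = green_strip_solution[OF k0, of x0 X, folded q_def]
 define J where "J x = (LINT y:{0..}|lborel. ?f x y * ?Z x y)" for x
 have shiftB: "cmod (f x (Y + s)) \<le> ?K * exp (c * \<bar>s\<bar>)" "cmod (f x (Y - s)) \<le> ?K * exp (c * \<bar>s\<bar>)"
  if "x \<in> {x0<..<x1}" for x s
 proof -
  have "exp (c * \<bar>Y + s\<bar>) \<le> exp (c * \<bar>Y\<bar>) * exp (c * \<bar>s\<bar>)" "exp (c * \<bar>Y - s\<bar>) \<le> exp (c * \<bar>Y\<bar>) * exp (c * \<bar>s\<bar>)"
   using c by (auto simp flip: exp_add distrib_left intro!: mult_left_mono)
  then have "B * exp (c * \<bar>Y + s\<bar>) \<le> B * (exp (c * \<bar>Y\<bar>) * exp (c * \<bar>s\<bar>))" "B * exp (c * \<bar>Y - s\<bar>) \<le> B * (exp (c * \<bar>Y\<bar>) * exp (c * \<bar>s\<bar>))"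
   using B0 by (auto intro: mult_left_mono)
  then show "cmod (f x (Y + s)) \<le> ?K * exp (c * \<bar>s\<bar>)" "cmod (f x (Y - s)) \<le> ?K * exp (c * \<bar>s\<bar>)"
   using B[OF that, of "Y + s"] B[OF that, of "Y - s"] by (auto simp: mult.assoc)
 qed
 have fb: "cmod (?f x y) \<le> 2 * ?K * exp (c * y)" if "x \<in> {x0<..<x1}" "0 \<le> y" for x y
  using norm_triangle_ineq[of "f x (Y + y)" "f x (Y - y)"] shiftB[OF that(1), of y] that(2) by simp
 have const: "J x3 = J x2" if x: "x0 < x2" "x2 \<le> x3" "x3 < X" for x2 x3
 proof -
  define tm tp where "tm = X - x3" and "tp = X - x2"
  have t: "0 < tm" "tm \<le> tp" using x by (auto simp: tm_def tp_def)
  define \<alpha> where "\<alpha> = Im k / 2 / tp"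
  have al: "0 < \<alpha>" using k t by (simp add: \<alpha>_def)
  define D where "D = 2 * ?K * (1 + 2 * cmod q / tm) * (A / sqrt tm)"
  define W where "W y = D * exp ((c + 1) * \<bar>y\<bar> - \<alpha> * y\<^sup>2)" for y :: real
  have D: "0 \<le> D" unfolding D_def using B0 A t by (intro mult_nonneg_nonneg add_nonneg_nonneg divide_nonneg_nonneg) auto
  have gb: "cmod (?Z x y) \<le> A / sqrt tm * exp (- \<alpha> * y\<^sup>2)" if "x \<in> {x2..x3}" for x y
  proof -
   have tt: "tm \<le> X - x" "X - x \<le> tp" using that by (auto simp: tm_def tp_def)
   have "A / sqrt (X - x) \<le> A / sqrt tm" using tt t A by (intro divide_left_mono mult_pos_pos) auto
   moreover have "exp (- (Im k / 2) * y\<^sup>2 / (X - x)) \<le> exp (- \<alpha> * y\<^sup>2)"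
   proof -
    have "Im k / 2 * y\<^sup>2 / tp \<le> Im k / 2 * y\<^sup>2 / (X - x)" using tt t k by (intro divide_left_mono mult_pos_pos) auto
    then show ?thesis by (simp add: \<alpha>_def)
   qed
   moreover have "0 < X - x" using tt t by linarith
   ultimately show ?thesis unfolding ng[OF \<open>0 < X - x\<close>] using t A by (intro mult_mono) auto
  qed
  have ye: "y \<le> exp y" "1 \<le> exp y" if "0 \<le> y" for y :: real
   using power_le_exp[of y 1] that by auto
  have "J x3 - J x2 = diffusivity k * integral {x2..x3} (\<lambda>x. ?f x 0 * ?Zy x 0)"
   unfolding J_def
  proof (rule half_line_flux[OF fe Z _ x(1,2) x(3)])
   show "set_integrable lborel {0..} W"
    unfolding set_integrable_def W_def
    by (intro integrable_mult_indicator integrable_mult_right integrable_gaussian_exp al) simp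
   fix x y assume xy: "x \<in> {x2..x3}" "0 \<le> (y::real)"
   have xs: "x \<in> {x0<..<x1}" using xy x X by auto
   have tt: "tm \<le> X - x" using xy by (auto simp: tm_def)
   have ee: "exp (c * y) * exp (- \<alpha> * y\<^sup>2) * exp y = exp ((c + 1) * \<bar>y\<bar> - \<alpha> * y\<^sup>2)"
    using xy by (simp add: algebra_simps flip: exp_add)
   have Q0: "0 \<le> 2 * ?K" using B0 by simp
   have "cmod (?f x y * ?Z x y) \<le> (2 * ?K * exp (c * y)) * (A / sqrt tm * exp (- \<alpha> * y\<^sup>2))"
    unfolding norm_mult by (intro mult_mono fb gb xs xy) (use Q0 in auto)
   also have "\<dots> \<le> (2 * ?K * exp (c * y)) * (A / sqrt tm * exp (- \<alpha> * y\<^sup>2)) * ((1 + 2 * cmod q / tm) * exp y)"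
   proof -
    have "1 * 1 \<le> (1 + 2 * cmod q / tm) * exp y" using t xy by (intro mult_mono ye) auto
    moreover have "0 \<le> (2 * ?K * exp (c * y)) * (A / sqrt tm * exp (- \<alpha> * y\<^sup>2))" using B0 A t by auto
    ultimately show ?thesis using mult_left_mono by fastforce
   qed
   also have "\<dots> = W y" unfolding W_def D_def ee[symmetric] by (simp only: mult_ac)
   finally show "cmod (?f x y * ?Z x y) \<le> W y" .
   have "cmod (?Zy x y) = 2 * cmod q * (y / (X - x)) * cmod (?Z x y)"
   proof -
    have "\<bar>y / (X - x)\<bar> = y / (X - x)" using tt t xy by simp
    then show ?thesis unfolding norm_mult norm_of_real by simp
   qed
   also have "\<dots> \<le> 2 * cmod q * (y / tm) * (A / sqrt tm * exp (- \<alpha> * y\<^sup>2))"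
    using tt t xy A by (intro mult_mono gb divide_left_mono mult_left_mono mult_pos_pos) auto
   also have "\<dots> = (2 * cmod q / tm) * y * (A / sqrt tm * exp (- \<alpha> * y\<^sup>2))" by simp
   also have "\<dots> \<le> (1 + 2 * cmod q / tm) * exp y * (A / sqrt tm * exp (- \<alpha> * y\<^sup>2))"
    using t A xy by (intro mult_right_mono mult_mono ye) auto
   finally have Zyb: "cmod (?Zy x y) \<le> (1 + 2 * cmod q / tm) * exp y * (A / sqrt tm * exp (- \<alpha> * y\<^sup>2))" .
   have "cmod (?f x y * ?Zy x y) \<le> (2 * ?K * exp (c * y)) * ((1 + 2 * cmod q / tm) * exp y * (A / sqrt tm * exp (- \<alpha> * y\<^sup>2)))"
    unfolding norm_mult[of "?f x y"] by (intro mult_mono fb Zyb xs xy) (use Q0 in auto)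
   also have "\<dots> = W y" unfolding W_def D_def ee[symmetric] by (simp only: mult_ac)
   finally show "cmod (?f x y * ?Zy x y) \<le> W y" .
  qed simp
  then show ?thesis by simp
 qed
 have J: "J x = (LINT s|lborel. f x (Y - s) * green k (X - x) s)" if x: "x0 < x" "x < X" for x
  unfolding J_def
 proof (rule fold_even_kernel)
  show "green k (X - x) (- s) = green k (X - x) s" for s by (simp add: green_def)
  have xs: "x \<in> {x0<..<x1}" using x X by auto
  have t: "0 < X - x" using x by simp
  show "integrable lborel (\<lambda>s. f x (Y - s) * green k (X - x) s)"
  proof (rule integrable_gaussian_bound)
   show "0 < Im k / 2 / (X - x)" using t k by simp
   have [measurable]: "f x \<in> borel_measurable borel" "green k (X - x) \<in> borel_measurable borel"
    using strip_solution_cont_y(1)[OF f xs] gauss_kernel_green[OF t k]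
    by (auto intro: borel_measurable_continuous_onI dest: gauss_kernel_measurable)
   show "(\<lambda>s. f x (Y - s) * green k (X - x) s) \<in> borel_measurable borel" by measurable
   fix s
   have "cmod (f x (Y - s) * green k (X - x) s) \<le> (?K * exp (c * \<bar>s\<bar>)) * (A / sqrt (X - x) * exp (- (Im k / 2) * s\<^sup>2 / (X - x)))"
    unfolding norm_mult ng[OF t] by (intro mult_right_mono shiftB xs) (use A t in auto)
   also have "\<dots> = (?K * (A / sqrt (X - x))) * exp (c * \<bar>s\<bar> - Im k / 2 / (X - x) * s\<^sup>2)"
    by (simp add: exp_diff_mult)
   finally show "cmod (f x (Y - s) * green k (X - x) s) \<le> (?K * (A / sqrt (X - x))) * exp (c * \<bar>s\<bar> - Im k / 2 / (X - x) * s\<^sup>2)" .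
  qed
 qed
 have gm[measurable]: "green k t \<in> borel_measurable borel" if "0 < t" for t
  using gauss_kernel_green[OF that k] by (auto dest: gauss_kernel_measurable)
 have fm[measurable]: "f x \<in> borel_measurable borel" if "x \<in> {x0<..<x1}" for x
  using strip_solution_cont_y(1)[OF f that] by (rule borel_measurable_continuous_onI)
 define d where "d = X - x0"
 have d: "0 < d" using X by (simp add: d_def)
 \<comment> \<open>both ends of the interval are approached from its interior\<close>
 define en where "en n = d / (real n + 2)" for n
 have en: "0 < en n" "en n < d" "en n \<le> d / 2" for n
 proof -
  show "0 < en n" using d by (simp add: en_def add_nonneg_pos)
  show "en n \<le> d / 2" unfolding en_def using d by (intro divide_left_mono) auto
  then show "en n < d" using d by linarith
 qed
 have ennz: "en n \<noteq> 0" for n using en(1)[of n] by simp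
 have en0: "en \<longlonglongrightarrow> 0" unfolding en_def by real_asymp
 have J1: "(\<lambda>n. J (x0 + en n)) \<longlonglongrightarrow> (LINT s|lborel. f0 (Y - s) * green k d s)"
 proof -
  have "(\<lambda>n. LINT s|lborel. f (x0 + en n) (Y - s) * green k (d - en n) s) \<longlonglongrightarrow> (LINT s|lborel. f0 (Y - s) * green k d s)"
  proof (rule Bochner_Integration.integral_dominated_convergence)
   let ?w = "\<lambda>s. (?K * (A / sqrt (d / 2))) * exp (c * \<bar>s\<bar> - Im k / 2 / d * s\<^sup>2)"
   show "integrable lborel ?w" using k d by (intro integrable_mult_right integrable_gaussian_exp) auto
   show "(\<lambda>s. f0 (Y - s) * green k d s) \<in> borel_measurable lborel" using f0(1) gm[OF d] by measurable
   have "f (x0 + en n) \<in> borel_measurable borel" "green k (d - en n) \<in> borel_measurable borel" for n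
    using en[of n] d X by (auto intro!: fm gm simp: d_def)
   then show "(\<lambda>s. f (x0 + en n) (Y - s) * green k (d - en n) s) \<in> borel_measurable lborel" for n by measurable
   show "AE s in lborel. (\<lambda>n. f (x0 + en n) (Y - s) * green k (d - en n) s) \<longlonglongrightarrow> f0 (Y - s) * green k d s"
    using AE_lborel_singleton[of Y]
   proof eventually_elim
    fix s assume "s \<noteq> Y"
    have "filterlim (\<lambda>n. x0 + en n) (at_right x0) sequentially"
     unfolding filterlim_at using en(1) ennz tendsto_add[OF tendsto_const[of x0] en0] by auto
    with f0(2)[of "Y - s"] \<open>s \<noteq> Y\<close> have 1: "(\<lambda>n. f (x0 + en n) (Y - s)) \<longlonglongrightarrow> f0 (Y - s)"
     by (auto intro: filterlim_compose)
    have "continuous_on {x0 - 1<..<X} (\<lambda>x. green k (X - x) s)"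
     by (rule strip_solution_cont_x(1)[OF green_strip_solution[OF k0]]) auto
    then have "isCont (\<lambda>x. green k (X - x) s) x0" using X by (auto simp: continuous_on_eq_continuous_at)
    moreover have "(\<lambda>n. x0 + en n) \<longlonglongrightarrow> x0" using tendsto_add[OF tendsto_const[of x0] en0] by simp
    ultimately have "(\<lambda>n. green k (X - (x0 + en n)) s) \<longlonglongrightarrow> green k (X - x0) s" by (rule isCont_tendsto_compose)
    then have 2: "(\<lambda>n. green k (d - en n) s) \<longlonglongrightarrow> green k d s" by (simp add: d_def algebra_simps)
    from tendsto_mult[OF 1 2] show "(\<lambda>n. f (x0 + en n) (Y - s) * green k (d - en n) s) \<longlonglongrightarrow> f0 (Y - s) * green k d s" .
   qed
   show "AE s in lborel. norm (f (x0 + en n) (Y - s) * green k (d - en n) s) \<le> ?w s" for n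
   proof (rule AE_I2)
    fix s :: real
    have t: "0 < d - en n" "d / 2 \<le> d - en n" "d - en n \<le> d" using en[of n] by auto
    have xs: "x0 + en n \<in> {x0<..<x1}" using en[of n] X by (auto simp: d_def)
    have "A / sqrt (d - en n) \<le> A / sqrt (d / 2)" using t d A by (intro divide_left_mono mult_pos_pos) auto
    moreover have "exp (- (Im k / 2) * s\<^sup>2 / (d - en n)) \<le> exp (- (Im k / 2 / d * s\<^sup>2))"
    proof -
     have "Im k / 2 * s\<^sup>2 / d \<le> Im k / 2 * s\<^sup>2 / (d - en n)" using t k by (intro divide_left_mono mult_pos_pos) auto
     then show ?thesis by simp
    qed
    ultimately have "cmod (green k (d - en n) s) \<le> A / sqrt (d / 2) * exp (- (Im k / 2 / d * s\<^sup>2))"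
     unfolding ng[OF t(1)] using t A by (intro mult_mono) auto
    then have "norm (f (x0 + en n) (Y - s) * green k (d - en n) s)
      \<le> (?K * exp (c * \<bar>s\<bar>)) * (A / sqrt (d / 2) * exp (- (Im k / 2 / d * s\<^sup>2)))"
     unfolding norm_mult using B0 by (intro mult_mono shiftB xs) auto
    also have "\<dots> = ?w s" by (simp add: exp_diff_mult)
    finally show "norm (f (x0 + en n) (Y - s) * green k (d - en n) s) \<le> ?w s" .
   qed
  qed
  moreover have "J (x0 + en n) = (LINT s|lborel. f (x0 + en n) (Y - s) * green k (d - en n) s)" for n
   using J[of "x0 + en n"] en[of n] by (simp add: d_def algebra_simps)
  ultimately show ?thesis by simp
 qed
 \<comment> \<open>close to \<open>X\<close> the kernel is rescaled to unit width\<close>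
 have J2: "(\<lambda>n. J (X - en n)) \<longlonglongrightarrow> f X Y"
 proof -
  have "(\<lambda>n. LINT s|lborel. f (X - en n) (Y - sqrt (en n) * s) * green k 1 s) \<longlonglongrightarrow> (LINT s|lborel. f X Y * green k 1 s)"
  proof (rule Bochner_Integration.integral_dominated_convergence)
   let ?w = "\<lambda>s. (?K * A) * exp (c * sqrt d * \<bar>s\<bar> - Im k / 2 * s\<^sup>2)"
   show "integrable lborel ?w" using k by (intro integrable_mult_right integrable_gaussian_exp) auto
   have g1: "green k 1 \<in> borel_measurable borel" by (rule gm) simp
   then show "(\<lambda>s. f X Y * green k 1 s) \<in> borel_measurable lborel" by measurable
   have "f (X - en n) \<in> borel_measurable borel" for n
    using en[of n] d X by (auto intro!: fm simp: d_def)
   then show "(\<lambda>s. f (X - en n) (Y - sqrt (en n) * s) * green k 1 s) \<in> borel_measurable lborel" for n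
    using g1 by measurable
   show "AE s in lborel. (\<lambda>n. f (X - en n) (Y - sqrt (en n) * s) * green k 1 s) \<longlonglongrightarrow> f X Y * green k 1 s"
   proof (intro AE_I2 tendsto_mult tendsto_const)
    fix s :: real
    have "(\<lambda>n. (X - en n, Y - sqrt (en n) * s)) \<longlonglongrightarrow> (X - 0, Y - sqrt 0 * s)"
     by (intro tendsto_intros en0)
    moreover have "isCont (\<lambda>p. f (fst p) (snd p)) (X, Y)"
    proof -
     have "open ({x0<..<x1} \<times> (UNIV :: real set))" by (intro open_Times) auto
     then show ?thesis using strip_solution_cont(1)[OF f subset_refl, of UNIV] X
      by (auto simp: continuous_on_eq_continuous_at)
    qed
    ultimately show "(\<lambda>n. f (X - en n) (Y - sqrt (en n) * s)) \<longlonglongrightarrow> f X Y"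
     using isCont_tendsto_compose[of "(X, Y)" "\<lambda>p. f (fst p) (snd p)"] by fastforce
   qed
   show "AE s in lborel. norm (f (X - en n) (Y - sqrt (en n) * s) * green k 1 s) \<le> ?w s" for n
   proof (rule AE_I2)
    fix s :: real
    have xs: "X - en n \<in> {x0<..<x1}" using en[of n] X by (auto simp: d_def)
    have "\<bar>sqrt (en n) * s\<bar> \<le> sqrt d * \<bar>s\<bar>"
     using en[of n] d by (auto simp: abs_mult intro!: mult_right_mono)
    then have "exp (c * \<bar>sqrt (en n) * s\<bar>) \<le> exp (c * sqrt d * \<bar>s\<bar>)"
     using c by (auto simp: mult.assoc intro!: mult_left_mono)
    then have "?K * exp (c * \<bar>sqrt (en n) * s\<bar>) \<le> ?K * exp (c * sqrt d * \<bar>s\<bar>)"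
     using B0 by (intro mult_left_mono) auto
    then have "cmod (f (X - en n) (Y - sqrt (en n) * s)) \<le> ?K * exp (c * sqrt d * \<bar>s\<bar>)"
     using shiftB(2)[OF xs, of "sqrt (en n) * s"] by linarith
    then have "norm (f (X - en n) (Y - sqrt (en n) * s) * green k 1 s)
      \<le> (?K * exp (c * sqrt d * \<bar>s\<bar>)) * (A * exp (- (Im k / 2) * s\<^sup>2))"
     unfolding norm_mult using ng[of 1 s] A by (intro mult_mono) (use B0 in auto)
    also have "\<dots> = ?w s" by (simp add: exp_diff_mult)
    finally show "norm (f (X - en n) (Y - sqrt (en n) * s) * green k 1 s) \<le> ?w s" .
   qed
  qed
  moreover have "J (X - en n) = (LINT s|lborel. f (X - en n) (Y - sqrt (en n) * s) * green k 1 s)" for n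
  proof -
   have "J (X - en n) = (LINT s|lborel. f (X - en n) (Y - s) * green k (en n) s)"
    using J[of "X - en n"] en[of n] by (simp add: d_def)
   also have "\<dots> = sqrt (en n) *\<^sub>R (LINT s|lborel. f (X - en n) (Y - sqrt (en n) * s) * green k (en n) (sqrt (en n) * s))"
    using en(1)[of n] by (subst lborel_integral_real_affine[of "sqrt (en n)" _ 0]) auto
   also have "\<dots> = (LINT s|lborel. f (X - en n) (Y - sqrt (en n) * s) * (of_real (sqrt (en n)) * green k (en n) (sqrt (en n) * s)))"
    unfolding integral_scaleR_right[symmetric] by (simp add: scaleR_conv_of_real mult_ac)
   finally show ?thesis unfolding green_unit_scaling[OF en(1)] .
  qed
  ultimately show ?thesis using integral_green[of 1 k] k by simp
 qed
 have "J (x0 + en n) = J (X - en n)" for n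
  using const[of "x0 + en n" "X - en n"] en[of n] by (auto simp: d_def)
 with J1 J2 have "f X Y = (LINT s|lborel. f0 (Y - s) * green k d s)"
  using LIMSEQ_unique by simp
 then show ?thesis unfolding heat_def conv_shift d_def by (simp add: mult.commute)
qed

section \<open>Flux of a single mode\<close>

text \<open>The modes of the adjoint equation have the form \<open>xphase k \<psi> x * exp (\<plusminus> \<i> k \<psi> y)\<close>.\<close>

definition xphase :: "complex => complex => real => complex" where
 "xphase k \<psi> x = exp (\<i> * k * of_real x * \<psi>\<^sup>2 / 2)"

definition decaying :: "complex => complex => real => complex" where
 "decaying k \<psi> s = exp (\<i> * k * \<psi> * of_real \<bar>s\<bar>)"

lemma norm_decaying: "cmod (decaying k \<psi> s) = exp (- Im (k * \<psi>) * \<bar>s\<bar>)"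
 by (simp add: decaying_def norm_exp_eq_Re)

lemma decaying_measurable [measurable]: "decaying k \<psi> \<in> borel_measurable borel"
 unfolding decaying_def[abs_def] by measurable

lemma exp_strip_solution:
 assumes A: "A = \<kappa> * D\<^sup>2"
 shows "strip_solution \<kappa> x0 x1 (\<lambda>x y. exp (A * of_real x + D * of_real y))
  (\<lambda>x y. A * exp (A * of_real x + D * of_real y)) (\<lambda>x y. D * exp (A * of_real x + D * of_real y))
  (\<lambda>x y. D\<^sup>2 * exp (A * of_real x + D * of_real y))"
proof -
 let ?e = "\<lambda>x y. exp (A * complex_of_real x + D * complex_of_real y)"
 have c: "continuous_on ({x0<..<x1} \<times> UNIV) (\<lambda>p. ?e (fst p) (snd p))"
  by (intro continuous_intros)
 have dy: "((\<lambda>y. ?e x y) has_vector_derivative D * ?e x y) (at y)" for x y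
  by (rule has_vector_derivative_real_field[where f="\<lambda>w. exp (A * of_real x + D * w)"])
    (auto intro!: derivative_eq_intros)
 have dyy: "((\<lambda>y. D * ?e x y) has_vector_derivative D\<^sup>2 * ?e x y) (at y)" for x y
  by (rule has_vector_derivative_eq_rhs[OF has_vector_derivative_mult_right[OF dy]]) (simp add: power2_eq_square mult_ac)
 have dx: "((\<lambda>x. ?e x y) has_vector_derivative A * ?e x y) (at x)" for x y
  by (rule has_vector_derivative_real_field[where f="\<lambda>w. exp (A * w + D * of_real y)"])
    (auto intro!: derivative_eq_intros)
 show ?thesis
  unfolding strip_solution_def
 proof (intro conjI ballI allI)
  fix h assume "h \<in> {?e, \<lambda>x y. A * ?e x y, \<lambda>x y. D * ?e x y, \<lambda>x y. D\<^sup>2 * ?e x y}"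
  then show "continuous_on ({x0<..<x1} \<times> UNIV) (\<lambda>p. h (fst p) (snd p))"
   by (elim insertE emptyE; simp only:; intro continuous_on_mult[OF continuous_on_const] c)
 next
  show "A * ?e x y = \<kappa> * (D\<^sup>2 * ?e x y)" for x y by (simp add: A)
 qed (rule dx dy dyy)+
qed

lemma mode_strip_solution:
 assumes k: "k \<noteq> 0"
 shows "strip_solution (- diffusivity k) x0 x1 (\<lambda>x y. xphase k \<psi> x * exp (\<i> * k * \<psi> * of_real y))
  (\<lambda>x y. \<i> * k * \<psi>\<^sup>2 / 2 * (xphase k \<psi> x * exp (\<i> * k * \<psi> * of_real y)))
  (\<lambda>x y. \<i> * k * \<psi> * (xphase k \<psi> x * exp (\<i> * k * \<psi> * of_real y)))
  (\<lambda>x y. (\<i> * k * \<psi>)\<^sup>2 * (xphase k \<psi> x * exp (\<i> * k * \<psi> * of_real y)))"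
proof -
 have e: "xphase k \<psi> x * exp (\<i> * k * \<psi> * of_real y) = exp (\<i> * k * \<psi>\<^sup>2 / 2 * of_real x + \<i> * k * \<psi> * of_real y)" for x y
  by (simp add: xphase_def exp_add mult_ac)
 have "\<i> * k * \<psi>\<^sup>2 / 2 = - diffusivity k * (\<i> * k * \<psi>)\<^sup>2"
  using k by (simp add: diffusivity_def power2_eq_square field_simps)
 from exp_strip_solution[OF this, of x0 x1] show ?thesis unfolding e .
qed

text \<open>The flux identity for the folded solution and a decaying adjoint mode.  The initial and final values
 need only be attained for \<open>y \<noteq> 0\<close>, which is how the exceptional branch points disappear.\<close>

lemma strip_mode_flux:
 assumes k: "0 < Im k" and f: "strip_solution (diffusivity k) x0 x1 f fx fy fyy" and x01: "x0 < x1"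
  and B: "\<And>x y. x \<in> {x0<..<x1} ==> cmod (f x y) \<le> B"
  and f0: "f0 \<in> borel_measurable borel" "\<And>y. y \<noteq> 0 ==> ((\<lambda>x. f x y) \<longlongrightarrow> f0 y) (at_right x0)"
  and f1: "f1 \<in> borel_measurable borel" "\<And>y. y \<noteq> 0 ==> ((\<lambda>x. f x y) \<longlongrightarrow> f1 y) (at_left x1)"
  and \<psi>: "0 < Im (k * \<psi>)"
 shows "- \<psi> * (LINT x:{x0<..<x1}|lborel. xphase k \<psi> x * f x y0)
   = xphase k \<psi> x1 * (LINT s|lborel. f1 (y0 - s) * decaying k \<psi> s)
    - xphase k \<psi> x0 * (LINT s|lborel. f0 (y0 - s) * decaying k \<psi> s)"
proof -
 let ?g = "\<lambda>x. indicator {x0<..<x1} x *\<^sub>R (xphase k \<psi> x * f x y0)"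
 have k0: "k \<noteq> 0" using k by auto
 have B0: "0 \<le> B" using B[of "(x0 + x1) / 2" 0] x01 by (auto intro: order_trans[OF norm_ge_zero])
 define \<beta> where "\<beta> = Im (k * \<psi>)"
 have cE: "continuous_on A (xphase k \<psi>)" for A unfolding xphase_def by (intro continuous_intros) auto
 obtain M where M: "\<And>x. x \<in> {x0..x1} ==> cmod (xphase k \<psi> x) \<le> M"
  using compact_imp_bounded[OF compact_continuous_image[OF cE compact_Icc]] unfolding bounded_iff by blast
 have M0: "0 \<le> M" using M[of x0] x01 by (auto intro: order_trans[OF norm_ge_zero])
 let ?f = "\<lambda>x y. f x (y0 + y) + f x (y0 - y)"
 let ?Z = "\<lambda>x y. xphase k \<psi> x * exp (\<i> * k * \<psi> * of_real y)"
 note fe = strip_solution_even_part[OF f, of y0]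
 note Z = mode_strip_solution[OF k0, of x0 x1 \<psi>]
 define L where "L x = (LINT y:{0..}|lborel. ?f x y * ?Z x y)" for x
 have fm[measurable]: "f x \<in> borel_measurable borel" if "x \<in> {x0<..<x1}" for x
  using strip_solution_cont_y(1)[OF f that] by (rule borel_measurable_continuous_onI)
 have dbeta: "cmod (decaying k \<psi> s) = exp (- \<beta> * \<bar>s\<bar>)" for s by (simp add: norm_decaying \<beta>_def)
 have flux: "L x3 - L x2 = - \<psi> * integral {x2..x3} (\<lambda>x. xphase k \<psi> x * f x y0)"
  if x: "x0 < x2" "x2 \<le> x3" "x3 < x1" for x2 x3
 proof -
  define D where "D = 2 * B * M * (1 + cmod (k * \<psi>))"
  define W where "W y = D * exp (- \<beta> * \<bar>y\<bar>)" for y :: real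
  have "L x3 - L x2 = diffusivity k * integral {x2..x3} (\<lambda>x. ?f x 0 * (\<i> * k * \<psi> * ?Z x 0))"
   unfolding L_def
  proof (rule half_line_flux[OF fe Z _ x])
   show "set_integrable lborel {0..} W"
    unfolding set_integrable_def W_def
    by (intro integrable_mult_indicator integrable_mult_right integrable_exp_abs) (use \<psi> in \<open>auto simp: \<beta>_def\<close>)
   fix x y assume xy: "x \<in> {x2..x3}" "0 \<le> (y::real)"
   have xs: "x \<in> {x0<..<x1}" "x \<in> {x0..x1}" using xy x by auto
   have 1: "cmod (?f x y) \<le> 2 * B" using norm_triangle_ineq[of "f x (y0 + y)" "f x (y0 - y)"] B[OF xs(1), of "y0 + y"] B[OF xs(1), of "y0 - y"] by linarith
   have e: "cmod (exp (\<i> * k * \<psi> * of_real y)) = exp (- \<beta> * \<bar>y\<bar>)" using xy by (simp add: norm_exp_eq_Re \<beta>_def)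
   have 2: "cmod (?Z x y) \<le> M * exp (- \<beta> * \<bar>y\<bar>)"
    unfolding norm_mult e by (intro mult_right_mono M xs) auto
   have 3: "cmod (?f x y * ?Z x y) \<le> 2 * B * (M * exp (- \<beta> * \<bar>y\<bar>))"
    unfolding norm_mult[of "?f x y"] using B0 by (intro mult_mono 1 2) auto
   have nn: "0 \<le> 2 * B * (M * exp (- \<beta> * \<bar>y\<bar>))" using B0 M0 by simp
   have "2 * B * (M * exp (- \<beta> * \<bar>y\<bar>)) * 1 \<le> 2 * B * (M * exp (- \<beta> * \<bar>y\<bar>)) * (1 + cmod (k * \<psi>))"
    by (intro mult_left_mono nn) auto
   also have "\<dots> = W y" by (simp add: W_def D_def)
   finally show "cmod (?f x y * ?Z x y) \<le> W y" using 3 by linarith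
   have "cmod (?f x y * (\<i> * k * \<psi> * ?Z x y)) = cmod (?f x y * ?Z x y) * cmod (k * \<psi>)" by (simp add: norm_mult)
   also have "\<dots> \<le> 2 * B * (M * exp (- \<beta> * \<bar>y\<bar>)) * cmod (k * \<psi>)" by (intro mult_right_mono 3) auto
   also have "\<dots> \<le> 2 * B * (M * exp (- \<beta> * \<bar>y\<bar>)) * (1 + cmod (k * \<psi>))" by (intro mult_left_mono nn) auto
   also have "\<dots> = W y" by (simp add: W_def D_def)
   finally show "cmod (?f x y * (\<i> * k * \<psi> * ?Z x y)) \<le> W y" .
  qed simp
  also have "(\<lambda>x. ?f x 0 * (\<i> * k * \<psi> * ?Z x 0)) = (\<lambda>x. (2 * \<i> * k * \<psi>) * (xphase k \<psi> x * f x y0))"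
   by (auto simp: algebra_simps)
  also have "integral {x2..x3} \<dots> = (2 * \<i> * k * \<psi>) * integral {x2..x3} (\<lambda>x. xphase k \<psi> x * f x y0)"
   by (rule integral_mult_right)
  also have "diffusivity k * ((2 * \<i> * k * \<psi>) * integral {x2..x3} (\<lambda>x. xphase k \<psi> x * f x y0))
    = - \<psi> * integral {x2..x3} (\<lambda>x. xphase k \<psi> x * f x y0)"
   using k0 by (simp add: diffusivity_def)
  finally show ?thesis .
 qed
 have L: "L x = xphase k \<psi> x * (LINT s|lborel. f x (y0 - s) * decaying k \<psi> s)" if xs: "x \<in> {x0<..<x1}" for x
 proof -
  have "L x = (LINT y:{0..}|lborel. xphase k \<psi> x * (?f x y * decaying k \<psi> y))"
   unfolding L_def by (rule set_lebesgue_integral_cong) (auto simp: decaying_def)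
  also have "\<dots> = xphase k \<psi> x * (LINT y:{0..}|lborel. ?f x y * decaying k \<psi> y)" by simp
  also have "(LINT y:{0..}|lborel. ?f x y * decaying k \<psi> y) = (LINT s|lborel. f x (y0 - s) * decaying k \<psi> s)"
  proof (rule fold_even_kernel)
   show "integrable lborel (\<lambda>s. f x (y0 - s) * decaying k \<psi> s)"
   proof (rule Bochner_Integration.integrable_bound)
    show "integrable lborel (\<lambda>s. B * exp (- \<beta> * \<bar>s\<bar>))"
     using \<psi> by (intro integrable_mult_right integrable_exp_abs) (simp add: \<beta>_def)
    show "AE s in lborel. norm (f x (y0 - s) * decaying k \<psi> s) \<le> norm (B * exp (- \<beta> * \<bar>s\<bar>))"
     using B[OF xs] B0 by (auto simp: norm_mult dbeta intro!: AE_I2 mult_right_mono)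
   qed (use fm[OF xs] in measurable)
  qed (simp add: decaying_def)
  finally show ?thesis .
 qed
 define d where "d = x1 - x0"
 have d: "0 < d" using x01 by (simp add: d_def)
 \<comment> \<open>both ends of the strip are approached from its interior\<close>
 define en where "en n = d / (real n + 2)" for n
 have en: "0 < en n" "en n < d" "en n \<le> d / 2" for n
 proof -
  show "0 < en n" using d by (simp add: en_def add_nonneg_pos)
  show "en n \<le> d / 2" unfolding en_def using d by (intro divide_left_mono) auto
  then show "en n < d" using d by linarith
 qed
 have ennz: "en n \<noteq> 0" for n using en(1)[of n] by simp
 have en0: "en \<longlonglongrightarrow> 0" unfolding en_def by real_asymp
 have xs: "x0 + en n \<in> {x0<..<x1}" "x1 - en n \<in> {x0<..<x1}" for n using en[of n] by (auto simp: d_def)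
 have lim: "(\<lambda>n. L (X n)) \<longlonglongrightarrow> xphase k \<psi> x * (LINT s|lborel. g (y0 - s) * decaying k \<psi> s)"
  if X: "X \<longlonglongrightarrow> x" "\<And>n. X n \<in> {x0<..<x1}" and g: "g \<in> borel_measurable borel"
   "\<And>y. y \<noteq> 0 ==> (\<lambda>n. f (X n) y) \<longlonglongrightarrow> g y" for X x g
 proof -
  have "(\<lambda>n. LINT s|lborel. f (X n) (y0 - s) * decaying k \<psi> s) \<longlonglongrightarrow> (LINT s|lborel. g (y0 - s) * decaying k \<psi> s)"
  proof (rule Bochner_Integration.integral_dominated_convergence)
   show "integrable lborel (\<lambda>s. B * exp (- \<beta> * \<bar>s\<bar>))"
    using \<psi> by (intro integrable_mult_right integrable_exp_abs) (simp add: \<beta>_def)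
   show "(\<lambda>s. g (y0 - s) * decaying k \<psi> s) \<in> borel_measurable lborel" using g(1) by measurable
   show "(\<lambda>s. f (X n) (y0 - s) * decaying k \<psi> s) \<in> borel_measurable lborel" for n using fm[OF X(2)[of n]] by measurable
   show "AE s in lborel. norm (f (X n) (y0 - s) * decaying k \<psi> s) \<le> B * exp (- \<beta> * \<bar>s\<bar>)" for n
    using B[OF X(2)[of n]] B0 by (auto simp: norm_mult dbeta intro!: AE_I2 mult_right_mono)
   show "AE s in lborel. (\<lambda>n. f (X n) (y0 - s) * decaying k \<psi> s) \<longlonglongrightarrow> g (y0 - s) * decaying k \<psi> s"
    using AE_lborel_singleton[of y0]
   proof eventually_elim
    fix s assume "s \<noteq> y0"
    then show "(\<lambda>n. f (X n) (y0 - s) * decaying k \<psi> s) \<longlonglongrightarrow> g (y0 - s) * decaying k \<psi> s"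
     by (intro tendsto_mult g(2) tendsto_const) auto
   qed
  qed
  moreover have "(\<lambda>n. xphase k \<psi> (X n)) \<longlonglongrightarrow> xphase k \<psi> x"
   using X(1) unfolding xphase_def by (intro tendsto_intros) auto
  ultimately show ?thesis unfolding L[OF X(2)] by (intro tendsto_mult)
 qed
 have "(\<lambda>n. L (x0 + en n)) \<longlonglongrightarrow> xphase k \<psi> x0 * (LINT s|lborel. f0 (y0 - s) * decaying k \<psi> s)"
 proof (rule lim[OF _ xs(1) f0(1)])
  show l: "(\<lambda>n. x0 + en n) \<longlonglongrightarrow> x0" using tendsto_add[OF tendsto_const[of x0] en0] by simp
  have "filterlim (\<lambda>n. x0 + en n) (at_right x0) sequentially"
   unfolding filterlim_at using en(1) ennz l by auto
  then show "(\<lambda>n. f (x0 + en n) y) \<longlonglongrightarrow> f0 y" if "y \<noteq> 0" for y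
   using filterlim_compose[OF f0(2)[OF that]] by blast
 qed
 moreover have "(\<lambda>n. L (x1 - en n)) \<longlonglongrightarrow> xphase k \<psi> x1 * (LINT s|lborel. f1 (y0 - s) * decaying k \<psi> s)"
 proof (rule lim[OF _ xs(2) f1(1)])
  show l: "(\<lambda>n. x1 - en n) \<longlonglongrightarrow> x1" using tendsto_diff[OF tendsto_const[of x1] en0] by simp
  have "filterlim (\<lambda>n. x1 - en n) (at_left x1) sequentially"
   unfolding filterlim_at using en(1) ennz l by auto
  then show "(\<lambda>n. f (x1 - en n) y) \<longlonglongrightarrow> f1 y" if "y \<noteq> 0" for y
   using filterlim_compose[OF f1(2)[OF that]] by blast
 qed
 ultimately have lim1: "(\<lambda>n. L (x1 - en n) - L (x0 + en n)) \<longlonglongrightarrow>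
   xphase k \<psi> x1 * (LINT s|lborel. f1 (y0 - s) * decaying k \<psi> s) - xphase k \<psi> x0 * (LINT s|lborel. f0 (y0 - s) * decaying k \<psi> s)"
  by (intro tendsto_diff)
 have cf: "continuous_on {x0<..<x1} (\<lambda>x. xphase k \<psi> x * f x y0)"
  by (intro continuous_on_mult cE strip_solution_cont_x(1)[OF f]) auto
 have mf: "(\<lambda>x. ?g x) \<in> borel_measurable borel"
  using borel_measurable_continuous_on_indicator[OF _ cf] by simp
 have bf: "norm (?g x) \<le> M * B * indicator {x0<..<x1} x" for x
  using M[of x] B[of x y0] M0 by (auto simp: indicator_def norm_mult intro!: mult_mono)
 have ib: "integrable lborel (\<lambda>x. M * B * indicator {x0<..<x1} x :: real)"
  using x01 by (intro integrable_mult_right integrable_real_indicator) (auto simp: emeasure_lborel_Ioo)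
 have "(\<lambda>n. LINT x|lborel. indicator {x0 + en n..x1 - en n} x *\<^sub>R (?g x))
   \<longlonglongrightarrow> (LINT x|lborel. ?g x)"
 proof (rule Bochner_Integration.integral_dominated_convergence[OF _ _ ib])
  show "AE x in lborel. norm (indicator {x0 + en n..x1 - en n} x *\<^sub>R (?g x))
    \<le> M * B * indicator {x0<..<x1} x" for n
  proof (rule AE_I2)
   fix x :: real
   have "norm (indicator A x *\<^sub>R z) \<le> norm z" for A :: "real set" and z :: complex by (simp add: indicator_def)
   from order_trans[OF this bf]
   show "norm (indicator {x0 + en n..x1 - en n} x *\<^sub>R (?g x))
    \<le> M * B * indicator {x0<..<x1} x" .
  qed
  show "AE x in lborel. (\<lambda>n. indicator {x0 + en n..x1 - en n} x *\<^sub>R (?g x))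
    \<longlonglongrightarrow> ?g x"
  proof (intro AE_I2 tendsto_eventually)
   fix x
   show "\<forall>\<^sub>F n in sequentially. indicator {x0 + en n..x1 - en n} x *\<^sub>R (?g x)
     = ?g x"
   proof (cases "x \<in> {x0<..<x1}")
    case True
    then have "\<forall>\<^sub>F n in sequentially. en n < x - x0" "\<forall>\<^sub>F n in sequentially. en n < x1 - x"
     using order_tendstoD(2)[OF en0] by auto
    then show ?thesis by eventually_elim auto
   qed auto
  qed
 qed (use mf in measurable)
 moreover have "(LINT x|lborel. indicator {x0 + en n..x1 - en n} x *\<^sub>R (?g x))
   = integral {x0 + en n..x1 - en n} (\<lambda>x. xphase k \<psi> x * f x y0)" for n
 proof -
  have sub: "{x0 + en n..x1 - en n} \<subseteq> {x0<..<x1}" using en[of n] by (auto simp: d_def)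
  have "set_integrable lborel {x0 + en n..x1 - en n} (\<lambda>x. xphase k \<psi> x * f x y0)"
   by (intro borel_integrable_atLeastAtMost' continuous_on_subset[OF cf sub])
  from set_borel_integral_eq_integral(2)[OF this]
  have "integral {x0 + en n..x1 - en n} (\<lambda>x. xphase k \<psi> x * f x y0)
    = (LINT x|lborel. indicator {x0 + en n..x1 - en n} x *\<^sub>R (xphase k \<psi> x * f x y0))"
   by (simp add: set_lebesgue_integral_def)
  also have "\<dots> = (LINT x|lborel. indicator {x0 + en n..x1 - en n} x *\<^sub>R (?g x))"
   using sub by (intro Bochner_Integration.integral_cong) (auto simp: indicator_def)
  finally show ?thesis by simp
 qed
 ultimately have "(\<lambda>n. integral {x0 + en n..x1 - en n} (\<lambda>x. xphase k \<psi> x * f x y0))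
   \<longlonglongrightarrow> (LINT x:{x0<..<x1}|lborel. xphase k \<psi> x * f x y0)"
  by (simp add: set_lebesgue_integral_def)
 then have "(\<lambda>n. - \<psi> * integral {x0 + en n..x1 - en n} (\<lambda>x. xphase k \<psi> x * f x y0))
   \<longlonglongrightarrow> - \<psi> * (LINT x:{x0<..<x1}|lborel. xphase k \<psi> x * f x y0)"
  by (rule tendsto_mult_left)
 moreover have "- \<psi> * integral {x0 + en n..x1 - en n} (\<lambda>x. xphase k \<psi> x * f x y0) = L (x1 - en n) - L (x0 + en n)" for n
  using flux[of "x0 + en n" "x1 - en n"] en[of n] by (simp add: d_def)
 ultimately show ?thesis using lim1 LIMSEQ_unique by simp
qed

section \<open>The y-derivative across a node\<close>

definition exp_bounded :: "real => real => (real => complex) => bool" where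
 "exp_bounded B c f \<longleftrightarrow> f \<in> borel_measurable borel \<and> (\<forall>y. cmod (f y) \<le> B * exp (c * \<bar>y\<bar>))"

text \<open>The derivative of Green's function in \<open>y\<close>.\<close>

definition dgreen :: "complex => real => real => complex" where
 "dgreen k t s = - 2 * gauss_rate k t * of_real s * green k t s"

lemma exp_bounded_nonneg: "exp_bounded B c f ==> 0 \<le> B"
 unfolding exp_bounded_def by (metis abs_zero exp_zero mult.right_neutral mult_zero_right norm_ge_zero order_trans)

context
 fixes k :: complex and t :: real
 assumes k: "0 < Im k" and t: "0 < t"
begin

lemma dgreen_measurable [measurable]: "dgreen k t \<in> borel_measurable borel"
 unfolding dgreen_def[abs_def] by measurable

lemma green_dgreen_bound:
 obtains A \<alpha> where "0 \<le> A" "0 < \<alpha>" "\<And>s. cmod (green k t s) \<le> A * exp (\<bar>s\<bar> - \<alpha> * s\<^sup>2)"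
  "\<And>s. cmod (dgreen k t s) \<le> A * exp (\<bar>s\<bar> - \<alpha> * s\<^sup>2)"
proof -
 define A0 where "A0 = sqrt (cmod (gauss_rate k t) / pi)"
 define \<alpha> where "\<alpha> = Im k / (2 * t)"
 define A where "A = A0 * (1 + 2 * cmod (gauss_rate k t))"
 have n: "cmod (green k t s) = A0 * exp (- (\<alpha> * s\<^sup>2))" for s by (simp add: norm_green[OF t] A0_def \<alpha>_def)
 have A0: "0 \<le> A0" by (simp add: A0_def)
 have e: "exp (- (\<alpha> * s\<^sup>2)) * exp \<bar>s\<bar> = exp (\<bar>s\<bar> - \<alpha> * s\<^sup>2)" for s by (simp flip: exp_add)
 show thesis
 proof (rule that)
  show "0 \<le> A" using A0 by (simp add: A_def)
  show "0 < \<alpha>" using t k by (simp add: \<alpha>_def)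
  fix s :: real
  have "A0 * exp (- (\<alpha> * s\<^sup>2)) * 1 \<le> A0 * exp (- (\<alpha> * s\<^sup>2)) * ((1 + 2 * cmod (gauss_rate k t)) * exp \<bar>s\<bar>)"
  proof (intro mult_left_mono)
   have "1 * 1 \<le> (1 + 2 * cmod (gauss_rate k t)) * exp \<bar>s\<bar>" by (intro mult_mono) auto
   then show "1 \<le> (1 + 2 * cmod (gauss_rate k t)) * exp \<bar>s\<bar>" by simp
  qed (use A0 in auto)
  also have "\<dots> = A * exp (\<bar>s\<bar> - \<alpha> * s\<^sup>2)" unfolding A_def e[symmetric] by (simp only: mult_ac)
  finally show "cmod (green k t s) \<le> A * exp (\<bar>s\<bar> - \<alpha> * s\<^sup>2)" by (simp add: n)
  have "cmod (dgreen k t s) = A0 * exp (- (\<alpha> * s\<^sup>2)) * (2 * cmod (gauss_rate k t) * \<bar>s\<bar>)"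
   by (simp add: dgreen_def norm_mult n)
  also have "\<dots> \<le> A0 * exp (- (\<alpha> * s\<^sup>2)) * ((1 + 2 * cmod (gauss_rate k t)) * exp \<bar>s\<bar>)"
   using power_le_exp[of s 1] A0 by (intro mult_left_mono mult_mono) auto
  also have "\<dots> = A * exp (\<bar>s\<bar> - \<alpha> * s\<^sup>2)" unfolding A_def e[symmetric] by (simp only: mult_ac)
  finally show "cmod (dgreen k t s) \<le> A * exp (\<bar>s\<bar> - \<alpha> * s\<^sup>2)" .
 qed
qed

text \<open>Near a fixed \<open>y\<close> the kernels are still Gaussian in the other variable.\<close>

lemma kernel_product_bound:
 assumes f: "exp_bounded B c f" and c: "0 \<le> c"
 obtains C d \<alpha> where "0 < \<alpha>" "\<And>s. cmod (green k t (y - s) * f s) \<le> C * exp (d * \<bar>s\<bar> - \<alpha> * s\<^sup>2)"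
  "\<And>s. cmod (dgreen k t (y - s) * f s) \<le> C * exp (d * \<bar>s\<bar> - \<alpha> * s\<^sup>2)"
proof -
 obtain A \<alpha> where A: "0 \<le> A" "0 < \<alpha>" and b: "\<And>s. cmod (green k t s) \<le> A * exp (\<bar>s\<bar> - \<alpha> * s\<^sup>2)"
  "\<And>s. cmod (dgreen k t s) \<le> A * exp (\<bar>s\<bar> - \<alpha> * s\<^sup>2)"
  by (rule green_dgreen_bound) (rule that)
 let ?d = "1 + c + 2 * \<alpha> * \<bar>y\<bar>"
 have main: "cmod (z * f s) \<le> (A * exp \<bar>y\<bar> * B) * exp (?d * \<bar>s\<bar> - \<alpha> * s\<^sup>2)"
  if "cmod z \<le> A * exp (\<bar>y - s\<bar> - \<alpha> * (y - s)\<^sup>2)" for z s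
 proof -
  have "y * s \<le> \<bar>y\<bar> * \<bar>s\<bar>" by (metis abs_ge_self abs_mult)
  then have "2 * \<alpha> * (y * s) \<le> 2 * \<alpha> * (\<bar>y\<bar> * \<bar>s\<bar>)" using A by (intro mult_left_mono) auto
  moreover have "0 \<le> \<alpha> * y\<^sup>2" using A by simp
  moreover have "\<alpha> * (y - s)\<^sup>2 = \<alpha> * y\<^sup>2 - 2 * \<alpha> * (y * s) + \<alpha> * s\<^sup>2" by (simp add: power2_eq_square algebra_simps)
  moreover have "\<bar>y - s\<bar> \<le> \<bar>y\<bar> + \<bar>s\<bar>" by (rule abs_triangle_ineq4)
  ultimately have "\<bar>y - s\<bar> - \<alpha> * (y - s)\<^sup>2 \<le> \<bar>y\<bar> + \<bar>s\<bar> + 2 * \<alpha> * (\<bar>y\<bar> * \<bar>s\<bar>) - \<alpha> * s\<^sup>2" by linarith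
  then have "exp (\<bar>y - s\<bar> - \<alpha> * (y - s)\<^sup>2) \<le> exp (\<bar>y\<bar> + \<bar>s\<bar> + 2 * \<alpha> * (\<bar>y\<bar> * \<bar>s\<bar>) - \<alpha> * s\<^sup>2)" by simp
  then have "A * exp (\<bar>y - s\<bar> - \<alpha> * (y - s)\<^sup>2) \<le> A * exp (\<bar>y\<bar> + \<bar>s\<bar> + 2 * \<alpha> * (\<bar>y\<bar> * \<bar>s\<bar>) - \<alpha> * s\<^sup>2)"
   using A by (intro mult_left_mono)
  then have "cmod (z * f s) \<le> (A * exp (\<bar>y\<bar> + \<bar>s\<bar> + 2 * \<alpha> * (\<bar>y\<bar> * \<bar>s\<bar>) - \<alpha> * s\<^sup>2)) * (B * exp (c * \<bar>s\<bar>))"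
   unfolding norm_mult using that f A by (intro mult_mono) (auto simp: exp_bounded_def)
  also have "\<dots> = (A * B) * exp (\<bar>y\<bar> + \<bar>s\<bar> + 2 * \<alpha> * (\<bar>y\<bar> * \<bar>s\<bar>) - \<alpha> * s\<^sup>2 + c * \<bar>s\<bar>)"
   by (simp only: exp_add mult_ac)
  also have "\<bar>y\<bar> + \<bar>s\<bar> + 2 * \<alpha> * (\<bar>y\<bar> * \<bar>s\<bar>) - \<alpha> * s\<^sup>2 + c * \<bar>s\<bar> = \<bar>y\<bar> + (?d * \<bar>s\<bar> - \<alpha> * s\<^sup>2)"
   by (simp add: algebra_simps)
  finally show ?thesis by (simp only: exp_add mult_ac)
 qed
 show thesis by (rule that[OF A(2)]) (rule main[OF b(1)], rule main[OF b(2)])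
qed

lemma kernel_product_integrable:
 assumes f: "exp_bounded B c f" and c: "0 \<le> c"
 shows "integrable lborel (\<lambda>s. green k t (y - s) * f s)" "integrable lborel (\<lambda>s. dgreen k t (y - s) * f s)"
proof -
 have [measurable]: "f \<in> borel_measurable borel" using f by (simp add: exp_bounded_def)
 obtain C d \<alpha> where *: "0 < \<alpha>" "\<And>s. cmod (green k t (y - s) * f s) \<le> C * exp (d * \<bar>s\<bar> - \<alpha> * s\<^sup>2)"
  "\<And>s. cmod (dgreen k t (y - s) * f s) \<le> C * exp (d * \<bar>s\<bar> - \<alpha> * s\<^sup>2)"
  by (rule kernel_product_bound[OF f c]) (rule that)
 show "integrable lborel (\<lambda>s. green k t (y - s) * f s)" "integrable lborel (\<lambda>s. dgreen k t (y - s) * f s)"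
  by (rule integrable_gaussian_bound[OF *(1) _ *(2)] integrable_gaussian_bound[OF *(1) _ *(3)]; measurable)+
qed

lemma heat_exp_bounded_add:
 assumes "exp_bounded B c f" "exp_bounded B' c' g" "0 \<le> c" "0 \<le> c'"
 shows "heat k t (\<lambda>y. f y + g y) = (\<lambda>y. heat k t f y + heat k t g y)"
 using kernel_product_integrable(1)[OF assms(1,3)] kernel_product_integrable(1)[OF assms(2,4)]
 by (auto simp: heat_def conv_def distrib_left)

lemma heat_scale: "heat k t (\<lambda>y. z * f y) = (\<lambda>y. z * heat k t f y)"
 by (auto simp: heat_def conv_def mult.left_commute)

lemma kernel_conv_exp_bounded:
 assumes f: "exp_bounded B c f" and c: "0 \<le> c"
 obtains B' where "exp_bounded B' c (heat k t f)" "exp_bounded B' c (conv (dgreen k t) f)"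
proof -
 obtain A \<alpha> where A: "0 \<le> A" "0 < \<alpha>" and b: "\<And>s. cmod (green k t s) \<le> A * exp (\<bar>s\<bar> - \<alpha> * s\<^sup>2)"
  "\<And>s. cmod (dgreen k t s) \<le> A * exp (\<bar>s\<bar> - \<alpha> * s\<^sup>2)"
  by (rule green_dgreen_bound) (rule that)
 note B0 = exp_bounded_nonneg[OF f]
 have [measurable]: "f \<in> borel_measurable borel" using f by (simp add: exp_bounded_def)
 let ?w = "\<lambda>y s. (A * B * exp (c * \<bar>y\<bar>)) * exp ((1 + c) * \<bar>s\<bar> - \<alpha> * s\<^sup>2)"
 define I where "I = (LINT s|lborel. exp ((1 + c) * \<bar>s\<bar> - \<alpha> * s\<^sup>2))"
 have main: "cmod (conv G f y) \<le> (A * B * I) * exp (c * \<bar>y\<bar>)"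
  if G[measurable]: "G \<in> borel_measurable borel" and bG: "\<And>s. cmod (G s) \<le> A * exp (\<bar>s\<bar> - \<alpha> * s\<^sup>2)" for G y
 proof -
  have "cmod (conv G f y) \<le> (LINT s|lborel. ?w y s)"
   unfolding conv_shift
  proof (rule norm_integral_le)
   show "integrable lborel (?w y)" by (intro integrable_mult_right integrable_gaussian_exp A)
   fix s
   have "exp (c * \<bar>y - s\<bar>) \<le> exp (c * \<bar>y\<bar> + c * \<bar>s\<bar>)"
    using mult_left_mono[OF abs_triangle_ineq4[of y s] c] by (simp add: distrib_left)
   then have "B * exp (c * \<bar>y - s\<bar>) \<le> B * exp (c * \<bar>y\<bar> + c * \<bar>s\<bar>)" using B0 by (intro mult_left_mono)
   then have "cmod (f (y - s)) \<le> B * exp (c * \<bar>y\<bar> + c * \<bar>s\<bar>)"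
    using f unfolding exp_bounded_def by (meson order_trans)
   then have "cmod (G s * f (y - s)) \<le> (A * exp (\<bar>s\<bar> - \<alpha> * s\<^sup>2)) * (B * exp (c * \<bar>y\<bar> + c * \<bar>s\<bar>))"
    unfolding norm_mult using bG A by (intro mult_mono) auto
   also have "\<dots> = (A * B) * (exp (\<bar>s\<bar> - \<alpha> * s\<^sup>2) * exp (c * \<bar>y\<bar> + c * \<bar>s\<bar>))" by (simp only: mult_ac)
   also have "exp (\<bar>s\<bar> - \<alpha> * s\<^sup>2) * exp (c * \<bar>y\<bar> + c * \<bar>s\<bar>) = exp (c * \<bar>y\<bar>) * exp ((1 + c) * \<bar>s\<bar> - \<alpha> * s\<^sup>2)"
    by (simp add: algebra_simps flip: exp_add)
   finally show "cmod (G s * f (y - s)) \<le> ?w y s" by (simp only: mult_ac)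
  qed measurable
  also have "\<dots> = (A * B * I) * exp (c * \<bar>y\<bar>)"
   unfolding integral_mult_right_zero I_def by (simp only: mult_ac)
  finally show ?thesis .
 qed
 have "exp_bounded (A * B * I) c (heat k t f)" "exp_bounded (A * B * I) c (conv (dgreen k t) f)"
  unfolding exp_bounded_def heat_def by (intro conjI allI main b; measurable)+
 then show thesis by (rule that)
qed

lemma heat_has_derivative:
 assumes f: "exp_bounded B c f" and c: "0 \<le> c"
 shows "(heat k t f has_vector_derivative conv (dgreen k t) f y) (at y)"
proof -
 have [measurable]: "f \<in> borel_measurable borel" using f by (simp add: exp_bounded_def)
 define p where "p = gauss_rate k t"
 define A where "A = csqrt (p / of_real pi)"
 have p: "0 < Re p" using k t by (simp add: p_def Re_gauss_rate)
 define \<phi> where "\<phi> s = A * exp (- p * of_real (s\<^sup>2)) * f s" for s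
 have [measurable]: "\<phi> \<in> borel_measurable borel" unfolding \<phi>_def[abs_def] by measurable
 define L where "L b = (LINT s|lborel. exp (b * of_real s) * \<phi> s)" for b
 define L' where "L' b = (LINT s|lborel. of_real s * (exp (b * of_real s) * \<phi> s))" for b
 have bound: "\<bar>s\<bar> ^ n * cmod (exp (b * of_real s) * \<phi> s) \<le> (cmod A * B * fact n) * exp ((1 + cmod b + c) * \<bar>s\<bar> - Re p * s\<^sup>2)" for b s n
 proof -
  have "exp (b * of_real s) * \<phi> s = A * (exp (b * of_real s - p * of_real (s\<^sup>2)) * f s)"
   by (simp add: \<phi>_def exp_diff exp_minus divide_inverse mult_ac)
  then have "\<bar>s\<bar> ^ n * cmod (exp (b * of_real s) * \<phi> s) = cmod A * ((\<bar>s\<bar> ^ n * cmod (exp (b * of_real s - p * of_real (s\<^sup>2)))) * cmod (f s))"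
   by (simp only: norm_mult mult_ac)
  also have "\<dots> \<le> cmod A * ((fact n * exp ((1 + cmod b) * \<bar>s\<bar> - Re p * s\<^sup>2)) * (B * exp (c * \<bar>s\<bar>)))"
   using f by (intro mult_left_mono mult_mono power_exp_quadratic_bound) (auto simp: exp_bounded_def)
  also have "\<dots> = (cmod A * B * fact n) * (exp ((1 + cmod b) * \<bar>s\<bar> - Re p * s\<^sup>2) * exp (c * \<bar>s\<bar>))" by (simp only: mult_ac)
  also have "exp ((1 + cmod b) * \<bar>s\<bar> - Re p * s\<^sup>2) * exp (c * \<bar>s\<bar>) = exp ((1 + cmod b + c) * \<bar>s\<bar> - Re p * s\<^sup>2)"
   by (simp add: algebra_simps flip: exp_add)
  finally show ?thesis .
 qed
 have ii: "integrable lborel (\<lambda>s. of_real s ^ n * (exp (b * of_real s) * \<phi> s))" for b n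
  by (rule integrable_gaussian_bound[OF p])
    (use bound[of _ n b] in \<open>auto simp: norm_mult norm_power\<close>)
 have i0: "integrable lborel (\<lambda>s. exp (b * of_real s) * \<phi> s)" and i1: "integrable lborel (\<lambda>s. of_real s * (exp (b * of_real s) * \<phi> s))" for b
  using ii[of 0 b] ii[of 1 b] by auto
 have Ld: "(L has_field_derivative L' b) (at b)" for b
  unfolding L_def[abs_def] L'_def
 proof (rule has_field_derivative_exp_integral[OF _ _ i0 i1])
  show "integrable lborel (\<lambda>s. s\<^sup>2 * exp (1 * \<bar>s\<bar>) * norm (exp (b * of_real s) * \<phi> s))"
  proof (rule integrable_gaussian_bound[OF p])
   fix s :: real
   have "exp \<bar>s\<bar> * (\<bar>s\<bar> ^ 2 * cmod (exp (b * of_real s) * \<phi> s)) \<le> exp \<bar>s\<bar> * ((cmod A * B * fact 2) * exp ((1 + cmod b + c) * \<bar>s\<bar> - Re p * s\<^sup>2))"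
    by (intro mult_left_mono bound) auto
   also have "\<dots> = (cmod A * B * fact 2) * (exp \<bar>s\<bar> * exp ((1 + cmod b + c) * \<bar>s\<bar> - Re p * s\<^sup>2))" by (simp only: mult_ac)
   also have "exp \<bar>s\<bar> * exp ((1 + cmod b + c) * \<bar>s\<bar> - Re p * s\<^sup>2) = exp ((2 + cmod b + c) * \<bar>s\<bar> - Re p * s\<^sup>2)"
    by (simp add: algebra_simps flip: exp_add)
   finally show "norm (s\<^sup>2 * exp (1 * \<bar>s\<bar>) * norm (exp (b * of_real s) * \<phi> s)) \<le> (cmod A * B * fact 2) * exp ((2 + cmod b + c) * \<bar>s\<bar> - Re p * s\<^sup>2)"
    by (simp add: mult_ac)
  qed measurable
 qed auto
 have ker: "green k t (z - s) * f s = exp (- p * of_real z ^ 2) * (exp ((2 * p * of_real z) * of_real s) * \<phi> s)" for z s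
 proof -
  have "exp (- p * of_real ((z - s)\<^sup>2)) = exp (- p * of_real z ^ 2 + ((2 * p * of_real z) * of_real s + - p * of_real (s\<^sup>2)))"
   by (rule arg_cong[where f=exp]) (simp add: power2_eq_square algebra_simps)
  then show ?thesis using t by (simp only: green_eq[OF t] p_def[symmetric] A_def[symmetric] \<phi>_def exp_add mult_ac)
 qed
 have hL: "heat k t f z = exp (- p * of_real z ^ 2) * L (2 * p * of_real z)" for z
  unfolding heat_def conv_def ker L_def by simp
 have dL: "conv (dgreen k t) f z = - 2 * p * of_real z * exp (- p * of_real z ^ 2) * L (2 * p * of_real z) + exp (- p * of_real z ^ 2) * (2 * p * L' (2 * p * of_real z))" for z
 proof -
  have e: "dgreen k t (z - s) * f s = (- 2 * p * of_real z * exp (- p * of_real z ^ 2)) * (exp ((2 * p * of_real z) * of_real s) * \<phi> s)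
    + (exp (- p * of_real z ^ 2) * (2 * p)) * (of_real s * (exp ((2 * p * of_real z) * of_real s) * \<phi> s))" for s
  proof -
   have "dgreen k t (z - s) * f s = - 2 * p * of_real (z - s) * (green k t (z - s) * f s)"
    by (simp add: dgreen_def p_def)
   then show ?thesis unfolding ker by (simp add: algebra_simps)
  qed
  show ?thesis unfolding conv_def e L_def L'_def using i0 i1 by simp
 qed
 have "((\<lambda>z. exp (- p * z ^ 2) * L (2 * p * z)) has_field_derivative
   (- 2 * p * of_real y * exp (- p * of_real y ^ 2) * L (2 * p * of_real y) + exp (- p * of_real y ^ 2) * (2 * p * L' (2 * p * of_real y)))) (at (of_real y))"
 proof (rule derivative_eq_intros DERIV_chain2[OF Ld] refl)+
 qed (simp_all add: algebra_simps)
 from has_vector_derivative_real_field[OF this]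
 show ?thesis unfolding dL[symmetric] hL[symmetric] .
qed

end

text \<open>In contrast to \<open>sgn\<close> this is nowhere zero, so that multiplication by it is an isometry.\<close>

definition sg :: "real => complex" where "sg y = (if y < 0 then - 1 else 1)"

lemma sign_factor_sg: "sign_factor sg"
 unfolding sign_factor_def sg_def[abs_def] by auto

lemma sg_measurable [measurable]: "sg \<in> borel_measurable borel"
 using sign_factor_sg by (simp add: sign_factor_def)

lemma norm_sg [simp]: "cmod (sg y) = 1" by (simp add: sg_def)

lemma integral_sg:
 fixes g :: "real => complex"
 assumes i: "integrable lborel g"
 shows "(LINT s|lborel. sg s * g s) = (LINT s:{0<..}|lborel. g s) - (LINT s:{0<..}|lborel. g (- s))"
proof -
 have s1: "set_integrable lborel {0<..} g" and s2: "set_integrable lborel {..<0} g"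
  unfolding set_integrable_def by (intro integrable_mult_indicator i; simp)+
 have m: "(LINT s:{0<..}|lborel. g (- s)) = (LINT s:{..<0}|lborel. g s)"
  unfolding set_lebesgue_integral_def
  by (subst lborel_integral_real_affine[of "-1" _ 0]) (auto simp: indicator_def intro!: Bochner_Integration.integral_cong)
 have "(LINT s|lborel. sg s * g s) = (LINT s|lborel. indicator {0<..} s *\<^sub>R g s - indicator {..<0} s *\<^sub>R g s)"
 proof (rule integral_cong_AE)
  show "AE s in lborel. sg s * g s = indicator {0<..} s *\<^sub>R g s - indicator {..<0} s *\<^sub>R g s"
   using AE_lborel_singleton[of 0] by eventually_elim (auto simp: sg_def indicator_def)
 qed (use borel_measurable_integrable[OF i] in auto)
 also have "\<dots> = (LINT s:{0<..}|lborel. g s) - (LINT s:{..<0}|lborel. g s)"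
  using s1 s2 by (simp add: set_integrable_def set_lebesgue_integral_def)
 finally show ?thesis by (simp add: m)
qed

text \<open>Differentiating across a node creates a point source of strength \<open>2 v(0)\<close>.  These sources
 are where the edge Green's functions come from.\<close>

lemma heat_sg_deriv:
 assumes k: "0 < Im k" and t: "0 < t" and c: "0 \<le> c"
  and v: "exp_bounded B c v" and v': "exp_bounded B' c v'"
  and d: "\<And>y. (v has_vector_derivative v' y) (at y)" and cv': "continuous_on UNIV v'"
 shows "((\<lambda>y. heat k t (\<lambda>y. sg y * v y) y) has_vector_derivative heat k t (\<lambda>y. sg y * v' y) y + 2 * v 0 * green k t y) (at y)"
proof -
 have sv: "exp_bounded B c (\<lambda>y. sg y * v y)" and sv': "exp_bounded B' c (\<lambda>y. sg y * v' y)"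
  using v v' by (auto simp: exp_bounded_def norm_mult)
 have cv: "continuous_on UNIV v"
  using d by (auto intro!: continuous_at_imp_continuous_on has_vector_derivative_continuous)
 define p where "p = gauss_rate k t"
 have dK: "((\<lambda>s. green k t (y - s)) has_vector_derivative - dgreen k t (y - s)) (at s)" for s
 proof -
  have "((\<lambda>w. csqrt (p / of_real pi) * exp (- p * (of_real y - w)\<^sup>2)) has_field_derivative
    2 * p * (of_real y - of_real s) * (csqrt (p / of_real pi) * exp (- p * (of_real y - of_real s)\<^sup>2))) (at (of_real s))"
   by (auto intro!: derivative_eq_intros simp: algebra_simps)
  from has_vector_derivative_real_field[OF this]
  show ?thesis by (simp add: green_eq[OF t] dgreen_def p_def)
 qed
 define F where "F s = green k t (y - s) * v s" for s
 define g where "g s = - dgreen k t (y - s) * v s + green k t (y - s) * v' s" for s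
 have dF: "(F has_vector_derivative g s) (at s)" for s
  unfolding F_def g_def using has_vector_derivative_mult[OF dK d] by (simp add: add.commute)
 have cK: "continuous_on UNIV (\<lambda>s. green k t (y - s))"
  using dK by (auto intro!: continuous_at_imp_continuous_on has_vector_derivative_continuous)
 have cg: "continuous_on UNIV g"
  unfolding g_def dgreen_def by (intro continuous_intros cK cv cv')
 note i1 = kernel_product_integrable[OF k t v c, of y] and i2 = kernel_product_integrable(1)[OF k t v' c, of y]
 have ig: "integrable lborel g" unfolding g_def[abs_def] using i1 i2 by auto
 have ig': "integrable lborel (\<lambda>s. g (- s))" using lborel_integrable_real_affine[OF ig, of "-1" 0] by simp
 obtain C e \<alpha> where al: "0 < \<alpha>" and Fb: "\<And>s. cmod (green k t (y - s) * v s) \<le> C * exp (e * \<bar>s\<bar> - \<alpha> * s\<^sup>2)"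
  by (rule kernel_product_bound[OF k t v c, of y]) (rule that)
 have lim: "((\<lambda>s. C * exp (e * \<bar>s\<bar> - \<alpha> * s\<^sup>2)) \<longlongrightarrow> 0) at_top"
 proof -
  have "((\<lambda>s. exp (e * s - \<alpha> * s\<^sup>2)) \<longlongrightarrow> 0) at_top" using al by real_asymp
  then have "((\<lambda>s. C * exp (e * s - \<alpha> * s\<^sup>2)) \<longlongrightarrow> 0) at_top" by (rule tendsto_mult_right_zero)
  moreover have "\<forall>\<^sub>F s in at_top. C * exp (e * s - \<alpha> * s\<^sup>2) = C * exp (e * \<bar>s\<bar> - \<alpha> * s\<^sup>2)"
   using eventually_ge_at_top[of 0] by eventually_elim auto
  ultimately show ?thesis by (rule Lim_transform_eventually)
 qed
 have F1: "(F \<longlongrightarrow> 0) at_top"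
  by (rule Lim_null_comparison[OF _ lim]) (use Fb in \<open>auto simp: F_def\<close>)
 have F2: "((\<lambda>s. - F (- s)) \<longlongrightarrow> 0) at_top"
  by (rule Lim_null_comparison[OF _ lim]) (use Fb[of "- _"] in \<open>auto simp: F_def\<close>)
 have p1: "(LINT s:{0<..}|lborel. g s) = - F 0"
  by (rule integral_derivative_half_line[OF dF cg _ F1])
    (use ig in \<open>auto simp: set_integrable_def intro!: integrable_mult_indicator\<close>)
 have dF': "((\<lambda>s. - F (- s)) has_vector_derivative g (- s)) (at s)" for s
 proof -
  have "((\<lambda>s. - s) has_vector_derivative (- 1)) (at s)"
   by (auto simp: has_real_derivative_iff_has_vector_derivative[symmetric] intro!: derivative_eq_intros)
  from vector_diff_chain_at[OF this dF[of "- s"]] show ?thesis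
   using has_vector_derivative_minus by (fastforce simp: o_def)
 qed
 have p2: "(LINT s:{0<..}|lborel. g (- s)) = - (- F (- 0))"
 proof (rule integral_derivative_half_line[OF dF' _ _ F2])
  show "continuous_on UNIV (\<lambda>s. g (- s))"
   by (rule continuous_on_compose2[OF cg]) (auto intro!: continuous_intros)
 qed (use ig' in \<open>auto simp: set_integrable_def intro!: integrable_mult_indicator\<close>)
 have "(LINT s|lborel. sg s * g s) = - 2 * F 0"
  using integral_sg[OF ig] p1 p2 by simp
 moreover have "(LINT s|lborel. sg s * g s) = - conv (dgreen k t) (\<lambda>y. sg y * v y) y + heat k t (\<lambda>y. sg y * v' y) y"
 proof -
  have e: "sg s * g s = - (dgreen k t (y - s) * (sg s * v s)) + green k t (y - s) * (sg s * v' s)" for s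
   by (simp add: g_def algebra_simps)
  show ?thesis
   unfolding e conv_def heat_def using kernel_product_integrable[OF k t sv c, of y] kernel_product_integrable[OF k t sv' c, of y] by simp
 qed
 ultimately have "conv (dgreen k t) (\<lambda>y. sg y * v y) y = heat k t (\<lambda>y. sg y * v' y) y + 2 * v 0 * green k t y"
  by (simp add: F_def algebra_simps)
 then show ?thesis using heat_has_derivative[OF k t sv c, of y] by simp
qed

lemma heat_exponential:
 assumes k: "0 < Im k" and t: "0 < t"
 shows "heat k t (\<lambda>y. exp (- \<i> * k * \<theta> * of_real y)) y = exp (- \<i> * k * of_real t * \<theta>\<^sup>2 / 2) * exp (- \<i> * k * \<theta> * of_real y)"
proof -
 define p where "p = gauss_rate k t"
 have p: "0 < Re p" using k t by (simp add: p_def Re_gauss_rate)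
 have p0: "p \<noteq> 0" and k0: "k \<noteq> 0" using p k by auto
 have e: "green k t s * exp (- \<i> * k * \<theta> * of_real (y - s)) = (csqrt (p / of_real pi) * exp (- \<i> * k * \<theta> * of_real y)) * exp ((\<i> * k * \<theta>) * of_real s - p * of_real (s\<^sup>2))" for s
  by (simp add: green_eq[OF t] p_def[symmetric] algebra_simps flip: exp_add)
 have "heat k t (\<lambda>y. exp (- \<i> * k * \<theta> * of_real y)) y = (csqrt (p / of_real pi) * exp (- \<i> * k * \<theta> * of_real y)) * gauss_integral p (\<i> * k * \<theta>)"
  unfolding heat_def conv_shift e gauss_integral_def by simp
 also have "\<dots> = (csqrt (p / of_real pi) * gauss_integral p 0) * exp ((\<i> * k * \<theta>)\<^sup>2 / (4 * p)) * exp (- \<i> * k * \<theta> * of_real y)"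
  unfolding gauss_integral_eq[OF p, of "\<i> * k * \<theta>"] by (simp only: mult_ac)
 also have "(\<i> * k * \<theta>)\<^sup>2 / (4 * p) = - \<i> * k * of_real t * \<theta>\<^sup>2 / 2"
  using k0 t by (simp add: p_def gauss_rate_def power2_eq_square field_simps)
 finally show ?thesis by (simp add: gauss_integral_0[OF p])
qed

section \<open>From the branched surface to the slices at the nodes\<close>

lemma strip_solution_diff:
 assumes f: "strip_solution \<kappa> x0 x1 f fx fy fyy" and g: "strip_solution \<kappa> x0 x1 g gx gy gyy"
 shows "strip_solution \<kappa> x0 x1 (\<lambda>x y. f x y - g x y) (\<lambda>x y. fx x y - gx x y) (\<lambda>x y. fy x y - gy x y) (\<lambda>x y. fyy x y - gyy x y)"
 unfolding strip_solution_def
proof (intro conjI ballI allI)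
 fix h assume "h \<in> {\<lambda>x y. f x y - g x y, \<lambda>x y. fx x y - gx x y, \<lambda>x y. fy x y - gy x y, \<lambda>x y. fyy x y - gyy x y}"
 then show "continuous_on ({x0<..<x1} \<times> UNIV) (\<lambda>p. h (fst p) (snd p))"
  by (elim insertE emptyE; simp only:; intro continuous_on_diff strip_solution_cont[OF f subset_refl] strip_solution_cont[OF g subset_refl])
next
 fix x y assume x: "x \<in> {x0<..<x1}"
 show "fx x y - gx x y = \<kappa> * (fyy x y - gyy x y)"
  using strip_solutionD(4)[OF f x] strip_solutionD(4)[OF g x] by (simp add: right_diff_distrib)
qed (intro has_vector_derivative_diff strip_solutionD[OF f] strip_solutionD[OF g]; assumption)+

lemma incident_strip_solution:
 assumes k: "k \<noteq> 0"
 obtains ux uy uyy where "strip_solution (diffusivity k) x0 x1 (incident k \<theta>) ux uy uyy"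
proof -
 have "- \<i> * k * \<theta>\<^sup>2 / 2 = diffusivity k * (- \<i> * k * \<theta>)\<^sup>2"
  using k by (simp add: diffusivity_def power2_eq_square field_simps)
 note e = exp_strip_solution[OF this, of x0 x1]
 have "(\<lambda>x y. exp (- \<i> * k * \<theta>\<^sup>2 / 2 * complex_of_real x + - \<i> * k * \<theta> * complex_of_real y)) = incident k \<theta>"
  by (auto simp: incident_def fun_eq_iff mult_ac intro!: arg_cong[where f=exp])
 with e show thesis by (metis that)
qed

definition jump :: "complex => real => complex" where
 "jump \<sigma> y = (if y < 0 then \<sigma> else 1)"

lemma jump_simps: "jump (- 1) = sg" "jump 1 = (\<lambda>y. 1)"
 by (auto simp: jump_def sg_def)

lemma sign_factor_jump: "\<sigma> = 1 \<or> \<sigma> = - 1 ==> sign_factor (jump \<sigma>)"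
 unfolding sign_factor_def jump_def[abs_def] by auto

text \<open>Used with the node at the end of a strip, where the field is known from the left.\<close>

lemma heat_continuous_left:
 assumes k: "0 < Im k" and t: "0 < t" and f: "exp_bounded B c f" and c: "0 \<le> c"
 shows "((\<lambda>x. heat k (x - x0) f y) \<longlongrightarrow> heat k t f y) (at_left (x0 + t))"
proof (rule tendsto_at_left_sequentially[where b="x0 + t / 2"])
 fix S :: "nat => real" assume S: "\<And>n. S n < x0 + t" "\<And>n. x0 + t / 2 < S n" "S \<longlonglongrightarrow> x0 + t"
 define q where "q = gauss_rate k 1"
 define A where "A = cmod (csqrt (q / of_real pi))"
 have q: "Re q = Im k / 2" by (simp add: q_def Re_gauss_rate)
 have B0: "0 \<le> B" by (rule exp_bounded_nonneg[OF f])
 have [measurable]: "f \<in> borel_measurable borel" using f by (simp add: exp_bounded_def)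
 have gm: "green k t \<in> borel_measurable borel" if "0 < t" for t
  using gauss_kernel_green[OF that k] by (auto dest: gauss_kernel_measurable)
 have T: "t / 2 < S n - x0" "S n - x0 < t" "0 < S n - x0" for n using S(1,2)[of n] t by auto
 have ng: "cmod (green k \<tau> s) = A / sqrt \<tau> * exp (- (Im k / 2) * (s\<^sup>2 / \<tau>))" if "0 < \<tau>" for \<tau> s
 proof -
  have "sqrt \<tau> \<ge> 0" using that by simp
  then show ?thesis using that unfolding green_scaling[OF that]
   by (simp add: norm_mult norm_divide A_def q_def[symmetric] norm_exp_eq_Re q)
 qed
 show "(\<lambda>n. heat k (S n - x0) f y) \<longlonglongrightarrow> heat k t f y"
  unfolding heat_def conv_shift
 proof (rule Bochner_Integration.integral_dominated_convergence)
  let ?w = "\<lambda>s. (A / sqrt (t / 2) * B * exp (c * \<bar>y\<bar>)) * exp (c * \<bar>s\<bar> - (Im k / 2 / t) * s\<^sup>2)"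
  show "integrable lborel ?w" using k t by (intro integrable_mult_right integrable_gaussian_exp) auto
  show "(\<lambda>s. green k t s * f (y - s)) \<in> borel_measurable lborel" using gm[OF t] by measurable
  show "(\<lambda>s. green k (S n - x0) s * f (y - s)) \<in> borel_measurable lborel" for n using gm[OF T(3)[of n]] by measurable
  show "AE s in lborel. (\<lambda>n. green k (S n - x0) s * f (y - s)) \<longlonglongrightarrow> green k t s * f (y - s)"
  proof (intro AE_I2 tendsto_mult tendsto_const)
   fix s :: real
   have l: "(\<lambda>n. S n - x0) \<longlonglongrightarrow> t" using tendsto_diff[OF S(3) tendsto_const[of x0]] by simp
   have "(\<lambda>n. csqrt (gauss_rate k 1 / of_real pi) / of_real (sqrt (S n - x0)) * exp (- gauss_rate k 1 * of_real (s\<^sup>2 / (S n - x0))))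
    \<longlonglongrightarrow> csqrt (gauss_rate k 1 / of_real pi) / of_real (sqrt t) * exp (- gauss_rate k 1 * of_real (s\<^sup>2 / t))"
    by (intro tendsto_intros l) (use t in auto)
   then show "(\<lambda>n. green k (S n - x0) s) \<longlonglongrightarrow> green k t s"
    using green_scaling[OF T(3)] green_scaling[OF t] by simp
  qed
  show "AE s in lborel. norm (green k (S n - x0) s * f (y - s)) \<le> ?w s" for n
  proof (rule AE_I2)
   fix s :: real
   have "A / sqrt (S n - x0) \<le> A / sqrt (t / 2)"
    using T[of n] t by (intro divide_left_mono mult_pos_pos) (auto simp: A_def)
   moreover have "exp (- (Im k / 2) * (s\<^sup>2 / (S n - x0))) \<le> exp (- (Im k / 2 / t * s\<^sup>2))"
   proof -
    have "s\<^sup>2 / t \<le> s\<^sup>2 / (S n - x0)" using T[of n] t by (intro divide_left_mono mult_pos_pos) auto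
    then have "Im k / 2 * (s\<^sup>2 / t) \<le> Im k / 2 * (s\<^sup>2 / (S n - x0))" using k by (intro mult_left_mono) auto
    then show ?thesis by simp
   qed
   ultimately have 1: "cmod (green k (S n - x0) s) \<le> A / sqrt (t / 2) * exp (- (Im k / 2 / t * s\<^sup>2))"
    unfolding ng[OF T(3)] using t by (intro mult_mono) (auto simp: A_def)
   have "exp (c * \<bar>y - s\<bar>) \<le> exp (c * \<bar>y\<bar> + c * \<bar>s\<bar>)"
    using mult_left_mono[OF abs_triangle_ineq4[of y s] c] by (simp add: distrib_left)
   then have "B * exp (c * \<bar>y - s\<bar>) \<le> B * exp (c * \<bar>y\<bar> + c * \<bar>s\<bar>)" using B0 by (intro mult_left_mono)
   then have 2: "cmod (f (y - s)) \<le> B * exp (c * \<bar>y\<bar> + c * \<bar>s\<bar>)"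
    using f unfolding exp_bounded_def by (meson order_trans)
   have "norm (green k (S n - x0) s * f (y - s)) \<le> (A / sqrt (t / 2) * exp (- (Im k / 2 / t * s\<^sup>2))) * (B * exp (c * \<bar>y\<bar> + c * \<bar>s\<bar>))"
    unfolding norm_mult using 1 2 t by (intro mult_mono) (auto simp: A_def)
   also have "\<dots> = ?w s" unfolding exp_diff_mult exp_add by (simp only: mult_ac)
   finally show "norm (green k (S n - x0) s * f (y - s)) \<le> ?w s" .
  qed
 qed
qed (use t in auto)

locale grating =
 fixes a b :: real and k \<theta> :: complex and u :: surface_fun
 assumes b0: "0 < b" and ba: "b < a" and k: "0 < Im k" and kth: "0 < Im (k * \<theta>)" and kth2: "k * \<theta>\<^sup>2 \<in> \<real>"
  and tf: "total_field a b k \<theta> u"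
begin

lemma a0: "0 < a" using b0 ba by simp
lemma k0: "k \<noteq> 0" using k by auto

lemma node_simps [simp]: "node a b 0 = 0" "node a b 1 = b" "node a b 2 = a"
 by (simp_all add: node_def)

lemma nodes_0ba: "0 \<in> range (node a b)" "b \<in> range (node a b)" "a \<in> range (node a b)"
 by (metis node_simps rangeI)+

lemma range_node:
 assumes "x \<in> range (node a b)" "0 < x" "x < a" shows "x = b"
proof -
 obtain n where n: "x = a * of_int (n div 2) + (if even n then 0 else b)" using assms by (auto simp: node_def)
 define q where "q = n div 2"
 have "q \<le> 0"
 proof (rule ccontr)
  assume "\<not> q \<le> 0"
  then have "1 \<le> real_of_int q" by simp
  then have "a * 1 \<le> a * real_of_int q" using a0 by (intro mult_left_mono) auto
  moreover have "a * real_of_int q \<le> x" unfolding n q_def using b0 by simp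
  ultimately show False using assms(3) by linarith
 qed
 moreover have "0 \<le> q"
 proof (rule ccontr)
  assume "\<not> 0 \<le> q"
  then have "real_of_int q \<le> - 1" by simp
  then have "a * real_of_int q \<le> a * (- 1)" using a0 by (intro mult_left_mono) auto
  moreover have "x \<le> a * real_of_int q + b" unfolding n q_def using b0 by simp
  ultimately show False using assms(2) ba by linarith
 qed
 ultimately show ?thesis using n assms by (auto simp: q_def split: if_splits)
qed

lemma not_node: "x \<in> {0<..<b} \<or> x \<in> {b<..<a} ==> x \<notin> range (node a b)"
 using range_node[of x] b0 ba by auto

lemma resheet_cases:
 shows "0 \<le> y ==> resheet a b f x y \<nu> = f x y \<nu>"
  and "y < 0 ==> 0 < x ==> x \<le> b ==> resheet a b f x y \<nu> = f x y (3 - \<nu>)"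
  and "b < x ==> x \<le> a ==> resheet a b f x y \<nu> = f x y \<nu>"
  and "resheet a b f 0 y \<nu> = f 0 y \<nu>"
proof -
 show "0 \<le> y ==> resheet a b f x y \<nu> = f x y \<nu>" by (simp add: resheet_def)
 have node2: "node a b (2 * m) = a * of_int m" "node a b (2 * m + 1) = a * of_int m + b" for m
  by (simp_all add: node_def)
 show "y < 0 ==> 0 < x ==> x \<le> b ==> resheet a b f x y \<nu> = f x y (3 - \<nu>)"
 proof -
  assume *: "y < 0" "0 < x" "x \<le> b"
  then have "a * of_int 0 < x \<and> x \<le> a * of_int 0 + b" by simp
  then have "\<exists>m. a * of_int m < x \<and> x \<le> a * of_int m + b" by blast
  with * show ?thesis unfolding resheet_def node2 by simp
 qed
 have no: "\<not> (a * of_int m < x \<and> x \<le> a * of_int m + b)" if "x = 0 \<or> (b < x \<and> x \<le> a)" for m :: int and x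
 proof
  assume *: "a * of_int m < x \<and> x \<le> a * of_int m + b"
  show False
  proof (cases "m \<le> 0")
   case True
   show False
   proof (cases "m = 0")
    case True then show False using * that by auto
   next
    case False
    then have "real_of_int m \<le> - 1" using True by simp
    then have "a * real_of_int m \<le> a * (- 1)" using a0 by (intro mult_left_mono) auto
    then show False using * that b0 ba by auto
   qed
  next
   case False
   then have "1 \<le> real_of_int m" by simp
   then have "a * 1 \<le> a * real_of_int m" using a0 by (intro mult_left_mono) auto
   moreover have "x \<le> a" using that a0 by auto
   ultimately show False using * by linarith
  qed
 qed
 show "b < x ==> x \<le> a ==> resheet a b f x y \<nu> = f x y \<nu>" "resheet a b f 0 y \<nu> = f 0 y \<nu>"
  using no[of x] no[of 0] by (auto simp: resheet_def node2)
qed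

lemma norm_incident: "cmod (incident k \<theta> x y) = exp (Im (k * \<theta>) * y)"
proof -
 have "Im (k * \<theta>\<^sup>2) = 0" using kth2 by (simp add: complex_is_Real_iff)
 moreover have "- \<i> * k * of_real x * \<theta>\<^sup>2 / 2 = of_real (x / 2) * (- \<i> * (k * \<theta>\<^sup>2))" by simp
 ultimately have "Re (- \<i> * k * of_real x * \<theta>\<^sup>2 / 2) = 0" by (simp only: Re_complex_of_real complex.sel) simp
 moreover have "Re (\<i> * k * \<theta> * of_real y) = - (Im (k * \<theta>) * y)" by (simp add: algebra_simps)
 ultimately show ?thesis by (simp only: incident_def norm_exp_eq_Re minus_complex.sel diff_0 minus_minus)
qed

lemma surface_cont: "surface_continuous a b u"
 using tf by (simp add: total_field_def)

lemma surface_cont_at: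
 "surface_continuous a b f ==> \<nu> \<in> {1, 2} ==> \<not> branch_point a b x y ==>
  isCont (\<lambda>p. local_rep a b f x \<nu> (fst p) (snd p)) (x, y)"
 unfolding surface_continuous_def by blast

text \<open>At branch points this is an assumption on the total field, elsewhere continuity.\<close>

lemma locally_bounded:
 obtains U M where "open U" "p \<in> U"
  "\<And>x y. (x, y) \<in> U ==> \<not> branch_point a b x y ==> cmod (u x y 1) \<le> M \<and> cmod (u x y 2) \<le> M"
proof (cases "branch_point a b (fst p) (snd p)")
 case True
 then obtain n where n: "p = (node a b n, 0)" by (auto simp: branch_point_def prod_eq_iff)
 have ex: "\<exists>K U. open U \<and> p \<in> U \<and> (\<forall>q\<in>U. q \<noteq> p \<longrightarrow> cmod (u (fst q) (snd q) \<nu>) \<le> K)" if "\<nu> \<in> {1, 2}" for \<nu>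
 proof -
  have "Bfun (\<lambda>p. u (fst p) (snd p) \<nu>) (at p)" using tf that n by (auto simp: total_field_def)
  then obtain K where "\<forall>\<^sub>F q in at p. cmod (u (fst q) (snd q) \<nu>) \<le> K" by (auto simp: Bfun_def)
  then show ?thesis unfolding eventually_at_topological by blast
 qed
 obtain K1 U1 where 1: "open U1" "p \<in> U1" "\<And>q. q \<in> U1 ==> q \<noteq> p ==> cmod (u (fst q) (snd q) 1) \<le> K1" using ex[of 1] by auto
 obtain K2 U2 where 2: "open U2" "p \<in> U2" "\<And>q. q \<in> U2 ==> q \<noteq> p ==> cmod (u (fst q) (snd q) 2) \<le> K2" using ex[of 2] by auto
 show thesis
 proof (rule that)
  show "open (U1 \<inter> U2)" "p \<in> U1 \<inter> U2" using 1 2 by auto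
  fix x y assume xy: "(x, y) \<in> U1 \<inter> U2" "\<not> branch_point a b x y"
  then have "(x, y) \<noteq> p" using True by auto
  then show "cmod (u x y 1) \<le> max K1 K2 \<and> cmod (u x y 2) \<le> max K1 K2"
   using 1(3)[of "(x, y)"] 2(3)[of "(x, y)"] xy by (auto simp: le_max_iff_disj)
 qed
next
 case False
 let ?g = "\<lambda>\<nu> q. local_rep a b u (fst p) \<nu> (fst q) (snd q)"
 have ex: "\<exists>U. open U \<and> p \<in> U \<and> (\<forall>q\<in>U. cmod (?g \<nu> q) < cmod (?g \<nu> p) + 1)" if "\<nu> \<in> {1, 2}" for \<nu>
 proof -
  have "isCont (?g \<nu>) p" using surface_cont_at[OF surface_cont that False] by simp
  then have "((\<lambda>q. cmod (?g \<nu> q)) \<longlongrightarrow> cmod (?g \<nu> p)) (nhds p)"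
   using tendsto_at_iff_tendsto_nhds[of "?g \<nu>" p] by (intro tendsto_norm) (simp add: isCont_def)
  then have "\<forall>\<^sub>F q in nhds p. cmod (?g \<nu> q) < cmod (?g \<nu> p) + 1" by (rule order_tendstoD) simp
  then show ?thesis unfolding eventually_nhds by blast
 qed
 obtain U1 where 1: "open U1" "p \<in> U1" "\<And>q. q \<in> U1 ==> cmod (?g 1 q) < cmod (?g 1 p) + 1" using ex[of 1] by auto
 obtain U2 where 2: "open U2" "p \<in> U2" "\<And>q. q \<in> U2 ==> cmod (?g 2 q) < cmod (?g 2 p) + 1" using ex[of 2] by auto
 show thesis
 proof (rule that)
  show "open (U1 \<inter> U2)" "p \<in> U1 \<inter> U2" using 1 2 by auto
  fix x y assume xy: "(x, y) \<in> U1 \<inter> U2"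
  let ?M = "cmod (?g 1 p) + 1 + (cmod (?g 2 p) + 1)"
  have "cmod (?g 1 (x, y)) < cmod (?g 1 p) + 1" "cmod (?g 2 (x, y)) < cmod (?g 2 p) + 1"
   using 1(3) 2(3) xy by blast+
  then have "cmod (?g 1 (x, y)) \<le> ?M" "cmod (?g 2 (x, y)) \<le> ?M"
   using norm_ge_zero[of "?g 1 p"] norm_ge_zero[of "?g 2 p"] by linarith+
  then show "cmod (u x y 1) \<le> ?M \<and> cmod (u x y 2) \<le> ?M"
   unfolding fst_conv snd_conv local_rep_def by (cases "fst p \<in> range (node a b) \<and> fst p < x \<and> y < 0") auto
 qed
qed

lemma bounded_on_compact:
 assumes "compact S"
 obtains M where "\<And>x y. (x, y) \<in> S ==> \<not> branch_point a b x y ==> cmod (u x y 1) \<le> M \<and> cmod (u x y 2) \<le> M"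
proof -
 have "\<forall>p. \<exists>U M. open U \<and> p \<in> U \<and> (\<forall>x y. (x, y) \<in> U \<longrightarrow> \<not> branch_point a b x y \<longrightarrow> cmod (u x y 1) \<le> M \<and> cmod (u x y 2) \<le> M)"
  by (metis locally_bounded)
 then obtain U M where U: "\<And>p. open (U p)" "\<And>p. p \<in> U p"
  "\<And>p x y. (x, y) \<in> U p ==> \<not> branch_point a b x y ==> cmod (u x y 1) \<le> M p \<and> cmod (u x y 2) \<le> M p"
  by metis
 obtain C where C: "C \<subseteq> S" "finite C" "S \<subseteq> (\<Union>p\<in>C. U p)"
  by (rule compactE_image[OF assms, of S U]) (use U in auto)
 show thesis
 proof (rule that)
  fix x y assume xy: "(x, y) \<in> S" "\<not> branch_point a b x y"
  then obtain p where p: "p \<in> C" "(x, y) \<in> U p" using C by blast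
  have "M p \<le> (\<Sum>p\<in>C. \<bar>M p\<bar>)" using member_le_sum[OF p(1), of "\<lambda>p. \<bar>M p\<bar>"] C(2) by auto
  then show "cmod (u x y 1) \<le> (\<Sum>p\<in>C. \<bar>M p\<bar>) \<and> cmod (u x y 2) \<le> (\<Sum>p\<in>C. \<bar>M p\<bar>)"
   using U(3)[OF p(2) xy(2)] by auto
 qed
qed

lemma scattered_small:
 obtains N where "1 \<le> N" "\<And>x y \<nu>. N \<le> \<bar>y\<bar> ==> \<nu> \<in> {1, 2} ==> cmod (scattered a b k \<theta> u x y \<nu>) < 1"
proof -
 have ex: "\<exists>N. \<forall>p. N \<le> \<bar>snd p\<bar> \<longrightarrow> cmod (scattered a b k \<theta> u (fst p) (snd p) \<nu>) < 1" if "\<nu> \<in> {1, 2}" for \<nu>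
 proof -
  have "((\<lambda>p. scattered a b k \<theta> u (fst p) (snd p) \<nu>) \<longlongrightarrow> 0) (filtercomap (\<lambda>p. \<bar>snd p\<bar>) at_top)"
   using tf that by (auto simp: total_field_def)
  from tendstoD[OF this, of 1] show ?thesis
   by (simp add: eventually_filtercomap_at_top_linorder)
 qed
 obtain N1 where 1: "\<And>p. N1 \<le> \<bar>snd p\<bar> ==> cmod (scattered a b k \<theta> u (fst p) (snd p) 1) < 1" using ex[of 1] by auto
 obtain N2 where 2: "\<And>p. N2 \<le> \<bar>snd p\<bar> ==> cmod (scattered a b k \<theta> u (fst p) (snd p) 2) < 1" using ex[of 2] by auto
 show thesis
  by (rule that[of "max 1 (max N1 N2)"]) (use 1[of "(_, _)"] 2[of "(_, _)"] in auto)
qed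

text \<open>The combinations of the sheets that diagonalise their exchange: crossing a cut multiplies
 \<open>comb \<sigma>\<close> by \<open>\<sigma>\<close>.\<close>

definition comb :: "complex => real => real => complex" where
 "comb \<sigma> x y = u x y 1 + \<sigma> * u x y 2"

text \<open>For large \<open>|y|\<close> the scattered field is small, and on the remaining compact part of the strip the field
 is bounded.  The incident wave, absent from parts of the sheets, is bounded there since it decays
 downwards.\<close>

lemma comb_minus_incident_bounded:
 assumes \<sigma>: "\<sigma> = 1 \<or> \<sigma> = - 1"
 obtains B where "0 \<le> B" "\<And>x y. x \<in> {0..a} ==> \<not> branch_point a b x y ==> cmod (comb \<sigma> x y - incident k \<theta> x y) \<le> B"
proof -
 have n\<sigma>: "cmod (\<sigma> * z) = cmod z" for z using \<sigma> by auto
 obtain N where N: "1 \<le> N" "\<And>x y \<nu>. N \<le> \<bar>y\<bar> ==> \<nu> \<in> {1, 2} ==> cmod (scattered a b k \<theta> u x y \<nu>) < 1"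
  by (rule scattered_small) (rule that)
 have "compact ({0..a} \<times> {-N..N})" by (intro compact_Times) auto
 then obtain M where M: "\<And>x y. (x, y) \<in> {0..a} \<times> {-N..N} ==> \<not> branch_point a b x y ==> cmod (u x y 1) \<le> M \<and> cmod (u x y 2) \<le> M"
  by (rule bounded_on_compact) (rule that)
 define B where "B = 3 + (2 * \<bar>M\<bar> + exp (Im (k * \<theta>) * N))"
 have B: "3 \<le> B" "2 * \<bar>M\<bar> + exp (Im (k * \<theta>) * N) \<le> B" by (auto simp: B_def)
 have tri: "cmod (comb \<sigma> x y - incident k \<theta> x y) \<le> cmod (u x y 1) + cmod (u x y 2) + cmod (incident k \<theta> x y)" for x y
  unfolding comb_def
  using norm_triangle_ineq4[of "u x y 1 + \<sigma> * u x y 2" "incident k \<theta> x y"] norm_triangle_ineq[of "u x y 1" "\<sigma> * u x y 2"] n\<sigma>[of "u x y 2"]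
  by linarith
 show thesis
 proof (rule that)
  show "0 \<le> B" using B(1) by simp
  fix x y assume x: "x \<in> {0..a}" and nb: "\<not> branch_point a b x y"
  consider "\<bar>y\<bar> \<le> N" | "N \<le> y" | "y \<le> - N" by linarith
  then show "cmod (comb \<sigma> x y - incident k \<theta> x y) \<le> B"
  proof cases
   case 1
   have "Im (k * \<theta>) * y \<le> Im (k * \<theta>) * N" using 1 kth by (intro mult_left_mono) auto
   then have "cmod (incident k \<theta> x y) \<le> exp (Im (k * \<theta>) * N)" by (simp add: norm_incident)
   moreover have "cmod (u x y 1) \<le> \<bar>M\<bar> \<and> cmod (u x y 2) \<le> \<bar>M\<bar>" using M[of x y] x nb 1 abs_ge_self[of M]
    by (auto simp: abs_le_iff intro: order_trans)
   ultimately show ?thesis using tri[of x y] B(2) by linarith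
  next
   case 2
   have y: "0 < y" using 2 N(1) by simp
   have s1: "cmod (u x y 1 - incident k \<theta> x y) < 1" using N(2)[of y 1 x] 2 y by (simp add: scattered_def resheet_cases(1))
   have s2: "cmod (u x y 2) < 1" using N(2)[of y 2 x] 2 y by (simp add: scattered_def resheet_cases(1))
   have "comb \<sigma> x y - incident k \<theta> x y = (u x y 1 - incident k \<theta> x y) + \<sigma> * u x y 2" by (simp add: comb_def)
   then have "cmod (comb \<sigma> x y - incident k \<theta> x y) \<le> cmod (u x y 1 - incident k \<theta> x y) + cmod (u x y 2)"
    using norm_triangle_ineq[of "u x y 1 - incident k \<theta> x y" "\<sigma> * u x y 2"] n\<sigma>[of "u x y 2"] by (simp only:)
   then show ?thesis using s1 s2 B(1) by linarith
  next
   case 3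
   have y: "y < 0" using 3 N(1) by simp
   have "cmod (resheet a b u x y 1) < 1" "cmod (resheet a b u x y 2) < 1"
    using N(2)[of y 1 x] N(2)[of y 2 x] 3 y by (auto simp: scattered_def)
   then have "cmod (u x y 1) < 1" "cmod (u x y 2) < 1" by (auto simp: resheet_def split: if_splits)
   moreover have "cmod (incident k \<theta> x y) \<le> 1" using y kth by (simp add: norm_incident mult_nonneg_nonpos)
   ultimately show ?thesis using tri[of x y] B(1) by linarith
  qed
 qed
qed

lemma comb_limits:
 assumes \<sigma>: "\<sigma> = 1 \<or> \<sigma> = - 1" and x: "x0 \<in> range (node a b)" and y: "y \<noteq> 0"
 shows "((\<lambda>x. comb \<sigma> x y) \<longlongrightarrow> jump \<sigma> y * comb \<sigma> x0 y) (at_right x0)"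
  and "((\<lambda>x. comb \<sigma> x y) \<longlongrightarrow> comb \<sigma> x0 y) (at_left x0)"
  and "isCont (comb \<sigma> x0) y"
proof -
 have nb: "\<not> branch_point a b x0 y" using y by (simp add: branch_point_def)
 have l: "((\<lambda>x. local_rep a b u x0 \<nu> x y) \<longlongrightarrow> u x0 y \<nu>) (at x0)" and c: "isCont (\<lambda>y. u x0 y \<nu>) y" if \<nu>: "\<nu> \<in> {1, 2}" for \<nu>
 proof -
  note ic = surface_cont_at[OF surface_cont \<nu> nb]
  have "isCont (\<lambda>x. (x, y)) x0" "isCont (\<lambda>y. (x0, y)) y" by (intro continuous_intros)+
  from isCont_o2[OF this(1) ic] isCont_o2[OF this(2) ic]
  show "((\<lambda>x. local_rep a b u x0 \<nu> x y) \<longlongrightarrow> u x0 y \<nu>) (at x0)" "isCont (\<lambda>y. u x0 y \<nu>) y"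
   by (auto simp: isCont_def local_rep_def)
 qed
 show "isCont (comb \<sigma> x0) y"
  unfolding comb_def[abs_def] using c[of 1] c[of 2] by (intro continuous_intros) auto
 have r: "((\<lambda>x. local_rep a b u x0 1 x y + \<sigma> * local_rep a b u x0 2 x y) \<longlongrightarrow> comb \<sigma> x0 y) (at x0)"
  unfolding comb_def by (intro tendsto_intros l) auto
 have "((\<lambda>x. local_rep a b u x0 1 x y + \<sigma> * local_rep a b u x0 2 x y) \<longlongrightarrow> comb \<sigma> x0 y) (at_left x0)"
  by (rule tendsto_within_subset[OF r]) simp
 then show "((\<lambda>x. comb \<sigma> x y) \<longlongrightarrow> comb \<sigma> x0 y) (at_left x0)"
  by (rule Lim_transform_eventually) (auto simp: eventually_at_filter local_rep_def comb_def)
 have "((\<lambda>x. jump \<sigma> y * (local_rep a b u x0 1 x y + \<sigma> * local_rep a b u x0 2 x y)) \<longlongrightarrow> jump \<sigma> y * comb \<sigma> x0 y) (at_right x0)"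
  by (intro tendsto_mult_left tendsto_within_subset[OF r]) simp
 then show "((\<lambda>x. comb \<sigma> x y) \<longlongrightarrow> jump \<sigma> y * comb \<sigma> x0 y) (at_right x0)"
  by (rule Lim_transform_eventually)
    (use \<sigma> x in \<open>auto simp: eventually_at_filter local_rep_def comb_def jump_def algebra_simps\<close>)
qed

lemma comb_strip_solution:
 assumes nn: "\<And>x. x \<in> {x0<..<x1} ==> x \<notin> range (node a b)"
 obtains fx fy fyy where "strip_solution (diffusivity k) x0 x1 (comb \<sigma>) fx fy fyy"
proof -
 have "parabolic_eq a b k u (\<lambda>x y \<nu>. 0)" using tf by (simp add: total_field_def)
 then obtain fx fy fyy where c: "surface_continuous a b fx" "surface_continuous a b fy" "surface_continuous a b fyy"
  and d0: "\<forall>x y. \<forall>\<nu>\<in>{1, 2}. \<not> branch_point a b x y \<longrightarrow>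
    ((\<lambda>x'. local_rep a b u x \<nu> x' y) has_vector_derivative fx x y \<nu>) (at x) \<and>
    ((\<lambda>y'. u x y' \<nu>) has_vector_derivative fy x y \<nu>) (at y) \<and>
    ((\<lambda>y'. fy x y' \<nu>) has_vector_derivative fyy x y \<nu>) (at y) \<and>
    fx x y \<nu> + fyy x y \<nu> / (2 * \<i> * k) = 0"
  unfolding parabolic_eq_def by (elim exE conjE) (rule that)
 have d: "((\<lambda>x'. local_rep a b u x \<nu> x' y) has_vector_derivative fx x y \<nu>) (at x) \<and>
    ((\<lambda>y'. u x y' \<nu>) has_vector_derivative fy x y \<nu>) (at y) \<and>
    ((\<lambda>y'. fy x y' \<nu>) has_vector_derivative fyy x y \<nu>) (at y) \<and>
    fx x y \<nu> + fyy x y \<nu> / (2 * \<i> * k) = 0"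
  if "\<nu> \<in> {1, 2}" "\<not> branch_point a b x y" for x y \<nu>
  using d0 that by blast
 let ?c = "\<lambda>f x y. f x y 1 + \<sigma> * f x y (2::nat)"
 have cont: "continuous_on ({x0<..<x1} \<times> UNIV) (\<lambda>p. ?c f (fst p) (snd p))" if f: "surface_continuous a b f" for f
 proof (rule continuous_at_imp_continuous_on, rule ballI)
  fix p :: "real \<times> real" assume p: "p \<in> {x0<..<x1} \<times> UNIV"
  then have np: "fst p \<notin> range (node a b)" using nn[of "fst p"] by auto
  then have "isCont (\<lambda>q. f (fst q) (snd q) \<nu>) p" if "\<nu> \<in> {1, 2}" for \<nu>
   using surface_cont_at[OF f that, of "fst p" "snd p"] by (simp add: branch_point_def local_rep_def)
  from this[of 1] this[of 2] show "isCont (\<lambda>p. ?c f (fst p) (snd p)) p" by (intro continuous_intros) auto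
 qed
 have "strip_solution (diffusivity k) x0 x1 (?c u) (?c fx) (?c fy) (?c fyy)"
  unfolding strip_solution_def
 proof (intro conjI ballI allI)
  fix h assume "h \<in> {?c u, ?c fx, ?c fy, ?c fyy}"
  then show "continuous_on ({x0<..<x1} \<times> UNIV) (\<lambda>p. h (fst p) (snd p))"
   by (elim insertE emptyE; simp only:; intro cont c surface_cont)
 next
  fix x y assume x: "x \<in> {x0<..<x1}"
  have nb: "\<not> branch_point a b x y" using nn[OF x] by (simp add: branch_point_def)
  have lr: "local_rep a b u x \<nu> x' y = u x' y \<nu>" for \<nu> x' using nn[OF x] by (simp add: local_rep_def)
  note d1 = d[of 1, OF _ nb, unfolded lr, simplified] and d2 = d[of 2, OF _ nb, unfolded lr, simplified]
  show "((\<lambda>x. ?c u x y) has_vector_derivative ?c fx x y) (at x)"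
   "((\<lambda>y. ?c u x y) has_vector_derivative ?c fy x y) (at y)"
   "((\<lambda>y. ?c fy x y) has_vector_derivative ?c fyy x y) (at y)"
   using d1 d2 by (auto intro!: has_vector_derivative_add has_vector_derivative_mult_right)
  have e: "z + w / (2 * \<i> * k) = 0 ==> z = diffusivity k * w" for z w
  proof -
   assume "z + w / (2 * \<i> * k) = 0"
   then have "w / (2 * \<i> * k) = - z" by (simp add: eq_neg_iff_add_eq_0 add.commute)
   then have "w = - z * (2 * \<i> * k)" using k0 by (simp add: nonzero_divide_eq_eq)
   then have "diffusivity k * w = - (\<i> * (z * \<i>))" using k0 by (simp add: diffusivity_def)
   then show ?thesis by (simp add: complex_eq_iff)
  qed
  show "?c fx x y = diffusivity k * ?c fyy x y"
   using e[of "fx x y 1" "fyy x y 1"] e[of "fx x y 2" "fyy x y 2"] d[of 1, OF _ nb] d[of 2, OF _ nb] by (simp add: algebra_simps)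
 qed
 then show thesis using that unfolding comb_def[abs_def] by blast
qed

definition \<mu> :: complex where "\<mu> = exp (- \<i> * k * of_real a * \<theta>\<^sup>2 / 2)"

lemma comb_floquet:
 assumes "y \<noteq> 0" shows "comb \<sigma> a y = \<mu> * comb \<sigma> 0 y"
proof -
 have "u a y \<nu> = \<mu> * u 0 y \<nu>" if "\<nu> \<in> {1, 2}" for \<nu>
 proof -
  have "\<not> branch_point a b 0 y" using assms by (simp add: branch_point_def)
  then have "resheet a b u (0 + a) y \<nu> = exp (- \<i> * k * of_real a * \<theta>\<^sup>2 / 2) * resheet a b u 0 y \<nu>"
   using tf that unfolding total_field_def by blast
  then show ?thesis using resheet_cases(3)[of a u y \<nu>] ba by (simp add: \<mu>_def resheet_cases(4))
 qed
 from this[of 1] this[of 2] show ?thesis by (simp add: comb_def algebra_simps)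
qed

end

context grating
begin

definition \<zeta> :: complex where "\<zeta> = exp (\<i> * k * of_real a * \<theta>\<^sup>2 / 2)"

lemma \<zeta>\<mu>: "\<zeta> * \<mu> = 1"
 by (simp add: \<zeta>_def \<mu>_def flip: exp_add)

lemma norm_\<zeta>: "cmod \<zeta> = 1"
proof -
 have "Im (k * \<theta>\<^sup>2) = 0" using kth2 by (simp add: complex_is_Real_iff)
 moreover have "\<i> * k * of_real a * \<theta>\<^sup>2 / 2 = of_real (a / 2) * (\<i> * (k * \<theta>\<^sup>2))" by simp
 ultimately have "Re (\<i> * k * of_real a * \<theta>\<^sup>2 / 2) = 0" by (simp only: Re_complex_of_real complex.sel) simp
 then show ?thesis by (simp add: \<zeta>_def norm_exp_eq_Re)
qed

definition E :: "real => complex" where "E y = exp (- \<i> * k * \<theta> * of_real y)"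

definition \<mu>b :: complex where "\<mu>b = exp (- \<i> * k * of_real b * \<theta>\<^sup>2 / 2)"

lemma incident_E: "incident k \<theta> x y = exp (- \<i> * k * of_real x * \<theta>\<^sup>2 / 2) * E y"
 by (simp add: incident_def E_def flip: exp_add)

lemma incident_nodes: "incident k \<theta> 0 y = E y" "incident k \<theta> b y = \<mu>b * E y" "incident k \<theta> a y = \<mu> * E y"
 by (simp_all add: incident_E \<mu>b_def \<mu>_def)

lemma E_exp_bounded: "exp_bounded 1 (Im (k * \<theta>)) E"
proof -
 have "cmod (E y) \<le> exp (Im (k * \<theta>) * \<bar>y\<bar>)" for y
  using norm_incident[of 0 y] kth by (simp add: incident_nodes mult_left_mono)
 moreover have "E \<in> borel_measurable borel" unfolding E_def[abs_def] by measurable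
 ultimately show ?thesis by (simp add: exp_bounded_def)
qed

lemma heat_E: "0 < t ==> heat k t E y = exp (- \<i> * k * of_real t * \<theta>\<^sup>2 / 2) * E y"
 using heat_exponential[OF k, of t \<theta> y] by (simp add: E_def[abs_def])

lemma heat_cong_AE:
 assumes "\<And>y. y \<noteq> 0 ==> f y = g y" "f \<in> borel_measurable borel" "g \<in> borel_measurable borel" "0 < t"
 shows "heat k t f = heat k t g"
proof
 fix y
 show "heat k t f y = heat k t g y"
  unfolding heat_def conv_def
 proof (rule integral_cong_AE)
  show "AE s in lborel. green k t (y - s) * f s = green k t (y - s) * g s"
   using AE_lborel_singleton[of 0] by eventually_elim (simp add: assms(1))
 qed (use assms in measurable)
qed

lemma comb_growth:
 assumes \<sigma>: "\<sigma> = 1 \<or> \<sigma> = - 1"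
 obtains D where "0 \<le> D"
  "\<And>x y. x \<in> {0..a} ==> \<not> branch_point a b x y ==> cmod (comb \<sigma> x y - incident k \<theta> x y) \<le> D"
  "\<And>x y. x \<in> {0..a} ==> \<not> branch_point a b x y ==> cmod (comb \<sigma> x y) \<le> (D + 1) * exp (Im (k * \<theta>) * \<bar>y\<bar>)"
proof -
 obtain D where D: "0 \<le> D" "\<And>x y. x \<in> {0..a} ==> \<not> branch_point a b x y ==> cmod (comb \<sigma> x y - incident k \<theta> x y) \<le> D"
  by (rule comb_minus_incident_bounded[OF \<sigma>]) (rule that)
 have "cmod (comb \<sigma> x y) \<le> (D + 1) * exp (Im (k * \<theta>) * \<bar>y\<bar>)" if "x \<in> {0..a}" "\<not> branch_point a b x y" for x y
 proof -
  have "cmod (comb \<sigma> x y - incident k \<theta> x y) \<le> D * 1" using D(2)[OF that] by simp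
  also have "\<dots> \<le> D * exp (Im (k * \<theta>) * \<bar>y\<bar>)" using D(1) kth by (intro mult_left_mono) auto
  finally have "cmod (comb \<sigma> x y - incident k \<theta> x y) \<le> D * exp (Im (k * \<theta>) * \<bar>y\<bar>)" .
  moreover have "cmod (incident k \<theta> x y) \<le> exp (Im (k * \<theta>) * \<bar>y\<bar>)"
   using kth by (simp add: norm_incident mult_left_mono)
  moreover have "cmod (comb \<sigma> x y) \<le> cmod (comb \<sigma> x y - incident k \<theta> x y) + cmod (incident k \<theta> x y)"
   using norm_triangle_sub[of "comb \<sigma> x y" "incident k \<theta> x y"] by linarith
  ultimately show ?thesis by (simp add: distrib_right)
 qed
 with D show thesis by (rule that)
qed

lemma strip_representation:
 assumes \<sigma>: "\<sigma> = 1 \<or> \<sigma> = - 1" and x01: "x0 < x1" and n: "x0 \<in> range (node a b)" "x1 \<in> range (node a b)"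
  and nn: "\<And>x. x \<in> {x0<..<x1} ==> x \<notin> range (node a b)" and sub: "{x0..x1} \<subseteq> {0..a}"
  and f0: "\<And>y. y \<noteq> 0 ==> f0 y = comb \<sigma> x0 y" and f0b: "exp_bounded B c f0" and c: "0 \<le> c"
 shows "x \<in> {x0<..<x1} ==> comb \<sigma> x y = heat k (x - x0) (\<lambda>y. jump \<sigma> y * f0 y) y"
  and "y \<noteq> 0 ==> comb \<sigma> x1 y = heat k (x1 - x0) (\<lambda>y. jump \<sigma> y * f0 y) y"
proof -
 obtain fx fy fyy where f: "strip_solution (diffusivity k) x0 x1 (comb \<sigma>) fx fy fyy"
  by (rule comb_strip_solution[of x0 x1 \<sigma>]) (rule nn, assumption, rule that)
 obtain D where D: "\<And>x y. x \<in> {0..a} ==> \<not> branch_point a b x y ==> cmod (comb \<sigma> x y) \<le> (D + 1) * exp (Im (k * \<theta>) * \<bar>y\<bar>)"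
  by (rule comb_growth[OF \<sigma>]) (rule that)
 have vb: "cmod (comb \<sigma> x y) \<le> (D + 1) * exp (Im (k * \<theta>) * \<bar>y\<bar>)" if "x \<in> {x0<..<x1}" for x y
  by (rule D) (use that sub nn[OF that] in \<open>force simp: branch_point_def\<close>)+
 have sf: "sign_factor (jump \<sigma>)" by (rule sign_factor_jump[OF \<sigma>])
 have [measurable]: "f0 \<in> borel_measurable borel" "jump \<sigma> \<in> borel_measurable borel"
  using f0b sign_factor_simps(1)[OF sf] by (auto simp: exp_bounded_def)
 show rep: "x \<in> {x0<..<x1} ==> comb \<sigma> x y = heat k (x - x0) (\<lambda>y. jump \<sigma> y * f0 y) y" for x y
 proof (rule heat_representation[OF k f _ vb])
  show "((\<lambda>x. comb \<sigma> x y) \<longlongrightarrow> jump \<sigma> y * f0 y) (at_right x0)" if "y \<noteq> 0" for y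
   using comb_limits(1)[OF \<sigma> n(1) that] f0[OF that] by simp
 qed (use kth in auto)
 have jb: "exp_bounded B c (\<lambda>y. jump \<sigma> y * f0 y)"
  using f0b by (auto simp: exp_bounded_def norm_mult sign_factor_simps[OF sf])
 show "comb \<sigma> x1 y = heat k (x1 - x0) (\<lambda>y. jump \<sigma> y * f0 y) y" if y: "y \<noteq> 0"
 proof (rule tendsto_unique[of "at_left x1"])
  show "((\<lambda>x. comb \<sigma> x y) \<longlongrightarrow> comb \<sigma> x1 y) (at_left x1)" by (rule comb_limits(2)[OF \<sigma> n(2) y])
  have "((\<lambda>x. heat k (x - x0) (\<lambda>y. jump \<sigma> y * f0 y) y) \<longlongrightarrow> heat k (x1 - x0) (\<lambda>y. jump \<sigma> y * f0 y) y) (at_left x1)"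
   using heat_continuous_left[OF k _ jb c, of "x1 - x0" x0 y] x01 by simp
  moreover have "\<forall>\<^sub>F x in at_left x1. heat k (x - x0) (\<lambda>y. jump \<sigma> y * f0 y) y = comb \<sigma> x y"
   using eventually_at_left_real[OF x01] by eventually_elim (use rep in auto)
  ultimately show "((\<lambda>x. comb \<sigma> x y) \<longlongrightarrow> heat k (x1 - x0) (\<lambda>y. jump \<sigma> y * f0 y) y) (at_left x1)"
   by (rule Lim_transform_eventually)
 qed simp
qed

lemma strip_flux:
 assumes \<sigma>: "\<sigma> = 1 \<or> \<sigma> = - 1" and x01: "x0 < x1" and n: "x0 \<in> range (node a b)" "x1 \<in> range (node a b)"
  and nn: "\<And>x. x \<in> {x0<..<x1} ==> x \<notin> range (node a b)" and sub: "{x0..x1} \<subseteq> {0..a}"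
  and f0: "\<And>y. y \<noteq> 0 ==> f0 y = comb \<sigma> x0 y" "f0 \<in> borel_measurable borel"
  and f1: "\<And>y. y \<noteq> 0 ==> f1 y = comb \<sigma> x1 y" "f1 \<in> borel_measurable borel"
  and \<psi>: "0 < Im (k * \<psi>)"
 shows "- \<psi> * (LINT x:{x0<..<x1}|lborel. xphase k \<psi> x * (comb \<sigma> x y0 - incident k \<theta> x y0))
   = xphase k \<psi> x1 * (LINT s|lborel. (f1 (y0 - s) - incident k \<theta> x1 (y0 - s)) * decaying k \<psi> s)
    - xphase k \<psi> x0 * (LINT s|lborel. (jump \<sigma> (y0 - s) * f0 (y0 - s) - incident k \<theta> x0 (y0 - s)) * decaying k \<psi> s)"
proof -
 obtain fx fy fyy where f: "strip_solution (diffusivity k) x0 x1 (comb \<sigma>) fx fy fyy"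
  by (rule comb_strip_solution[of x0 x1 \<sigma>]) (rule nn, assumption, rule that)
 obtain ux uy uyy where ui: "strip_solution (diffusivity k) x0 x1 (incident k \<theta>) ux uy uyy"
  by (rule incident_strip_solution[OF k0]) (rule that)
 obtain D where D: "0 \<le> D" "\<And>x y. x \<in> {0..a} ==> \<not> branch_point a b x y ==> cmod (comb \<sigma> x y - incident k \<theta> x y) \<le> D"
  by (rule comb_minus_incident_bounded[OF \<sigma>]) (rule that)
 have [measurable]: "jump \<sigma> \<in> borel_measurable borel" using sign_factor_simps(1)[OF sign_factor_jump[OF \<sigma>]] .
 have im[measurable]: "(\<lambda>y. incident k \<theta> x y) \<in> borel_measurable borel" for x unfolding incident_def by measurable
 have ic: "((\<lambda>x. incident k \<theta> x y) \<longlongrightarrow> incident k \<theta> z y) (at z within S)" for z y S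
  unfolding incident_def by (intro tendsto_intros) auto
 show ?thesis
 proof (rule strip_mode_flux[OF k strip_solution_diff[OF f ui] x01 _ _ _ _ _ \<psi>])
  show "cmod (comb \<sigma> x y - incident k \<theta> x y) \<le> D" if "x \<in> {x0<..<x1}" for x y
   using D(2)[of x y] nn[OF that] that sub by (force simp: branch_point_def)
  show "(\<lambda>y. jump \<sigma> y * f0 y - incident k \<theta> x0 y) \<in> borel_measurable borel" using f0(2) by measurable
  show "(\<lambda>y. f1 y - incident k \<theta> x1 y) \<in> borel_measurable borel" using f1(2) by measurable
  show "((\<lambda>x. comb \<sigma> x y - incident k \<theta> x y) \<longlongrightarrow> jump \<sigma> y * f0 y - incident k \<theta> x0 y) (at_right x0)" if "y \<noteq> 0" for y
   using comb_limits(1)[OF \<sigma> n(1) that] f0(1)[OF that] by (intro tendsto_diff ic) simp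
  show "((\<lambda>x. comb \<sigma> x y - incident k \<theta> x y) \<longlongrightarrow> f1 y - incident k \<theta> x1 y) (at_left x1)" if "y \<noteq> 0" for y
   using comb_limits(2)[OF \<sigma> n(2) that] f1(1)[OF that] by (intro tendsto_diff ic) simp
 qed
qed

text \<open>A slice is the value of \<open>comb \<sigma>\<close> at a node, continued to \<open>y = 0\<close> by the heat flow of the preceding strip;
 the values of the field at the branch points themselves are arbitrary.\<close>

lemma slices:
 assumes \<sigma>: "\<sigma> = 1 \<or> \<sigma> = - 1"
 obtains v0 v1 B where
  "v1 = heat k b (\<lambda>y. jump \<sigma> y * v0 y)" "v0 = (\<lambda>y. \<zeta> * heat k (a - b) (\<lambda>y. jump \<sigma> y * v1 y) y)"
  "exp_bounded B 0 (\<lambda>y. v0 y - E y)" "exp_bounded B 0 (\<lambda>y. v1 y - \<mu>b * E y)"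
  "\<And>x y. x \<in> {0<..<b} ==> comb \<sigma> x y = heat k x (\<lambda>y. jump \<sigma> y * v0 y) y"
  "\<And>x y. x \<in> {b<..<a} ==> comb \<sigma> x y = heat k (x - b) (\<lambda>y. jump \<sigma> y * v1 y) y"
  "\<And>y. y \<noteq> 0 ==> v0 y = comb \<sigma> 0 y" "\<And>y. y \<noteq> 0 ==> v1 y = comb \<sigma> b y"
proof -
 obtain D where D: "0 \<le> D" "\<And>x y. x \<in> {0..a} ==> \<not> branch_point a b x y ==> cmod (comb \<sigma> x y - incident k \<theta> x y) \<le> D"
  and DE: "\<And>x y. x \<in> {0..a} ==> \<not> branch_point a b x y ==> cmod (comb \<sigma> x y) \<le> (D + 1) * exp (Im (k * \<theta>) * \<bar>y\<bar>)"
  by (rule comb_growth[OF \<sigma>]) (rule that)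
 let ?c = "Im (k * \<theta>)"
 have c: "0 \<le> ?c" using kth by simp
 have sf: "sign_factor (jump \<sigma>)" by (rule sign_factor_jump[OF \<sigma>])
 have jm[measurable]: "jump \<sigma> \<in> borel_measurable borel" using sign_factor_simps(1)[OF sf] .
 have Em[measurable]: "E \<in> borel_measurable borel" using E_exp_bounded by (simp add: exp_bounded_def)
 have jb: "exp_bounded B c (\<lambda>y. jump \<sigma> y * f y)" if "exp_bounded B c f" for B c f
  using that by (auto simp: exp_bounded_def norm_mult sign_factor_simps[OF sf])
 define f0 where "f0 x y = (if y = 0 then E 0 else comb \<sigma> x y)" for x y
 have f0b: "exp_bounded (D + 1) ?c (f0 x)" if n: "x \<in> range (node a b)" "x \<in> {0..a}" for x
 proof -
  have m: "f0 x \<in> borel_measurable borel"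
  proof (rule borel_measurable_continuous_countable_exceptions)
   show "countable {0::real}" by simp
   have "isCont (f0 x) y" if "y \<noteq> 0" for y
   proof -
    have "\<forall>\<^sub>F z in nhds y. f0 x z = comb \<sigma> x z"
    proof (rule eventually_mono)
     show "\<forall>\<^sub>F z in nhds y. z \<in> - {0}" by (rule eventually_nhds_in_open) (use that in auto)
    qed (simp add: f0_def)
    then show ?thesis using comb_limits(3)[OF \<sigma> n(1) that] isCont_cong by blast
   qed
   then show "continuous_on (- {0}) (f0 x)" by (auto intro!: continuous_at_imp_continuous_on)
  qed
  have "cmod (f0 x y) \<le> (D + 1) * exp (?c * \<bar>y\<bar>)" for y
  proof (cases "y = 0")
   case True
   then show ?thesis using D(1) by (simp add: f0_def E_def)
  next
   case False
   then show ?thesis using DE[of x y] n by (simp add: f0_def branch_point_def)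
  qed
  with m show ?thesis by (simp add: exp_bounded_def)
 qed
 have fb0: "exp_bounded (D + 1) ?c (f0 0)" and fbb: "exp_bounded (D + 1) ?c (f0 b)"
  using f0b nodes_0ba b0 ba by auto
 have eq: "\<And>y x. y \<noteq> 0 ==> f0 x y = comb \<sigma> x y" by (simp add: f0_def)
 have nn0: "x \<in> {0<..<b} ==> x \<notin> range (node a b)" and nnb: "x \<in> {b<..<a} ==> x \<notin> range (node a b)" for x
  using not_node by auto
 have s0: "{0..b} \<subseteq> {0..a}" and sb: "{b..a} \<subseteq> {0..a}" using b0 ba by auto
 have n0: "0 \<in> range (node a b)" and nb: "b \<in> range (node a b)" and na: "a \<in> range (node a b)"
  using nodes_0ba by auto
 have R01: "comb \<sigma> x y = heat k (x - 0) (\<lambda>y. jump \<sigma> y * f0 0 y) y" if "x \<in> {0<..<b}" for x y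
  by (rule strip_representation(1)[OF \<sigma> b0 n0 nb nn0 s0 eq fb0 c that])
 have R02: "comb \<sigma> b y = heat k (b - 0) (\<lambda>y. jump \<sigma> y * f0 0 y) y" if "y \<noteq> 0" for y
  by (rule strip_representation(2)[OF \<sigma> b0 n0 nb nn0 s0 eq fb0 c that])
 have Rb1: "comb \<sigma> x y = heat k (x - b) (\<lambda>y. jump \<sigma> y * f0 b y) y" if "x \<in> {b<..<a}" for x y
  by (rule strip_representation(1)[OF \<sigma> ba nb na nnb sb eq fbb c that])
 have Rb2: "comb \<sigma> a y = heat k (a - b) (\<lambda>y. jump \<sigma> y * f0 b y) y" if "y \<noteq> 0" for y
  by (rule strip_representation(2)[OF \<sigma> ba nb na nnb sb eq fbb c that])
 define v1 where "v1 = heat k b (\<lambda>y. jump \<sigma> y * f0 0 y)"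
 define v0 where "v0 = (\<lambda>y. \<zeta> * heat k (a - b) (\<lambda>y. jump \<sigma> y * v1 y) y)"
 have v1e: "v1 y = comb \<sigma> b y" if "y \<noteq> 0" for y using R02[OF that] by (simp add: v1_def)
 obtain B1 where "exp_bounded B1 ?c (heat k b (\<lambda>y. jump \<sigma> y * f0 0 y))"
  by (rule kernel_conv_exp_bounded[OF k b0 jb[OF fb0] c]) (rule that)
 then have v1b: "exp_bounded B1 ?c v1" by (simp add: v1_def)
 have v1m[measurable]: "v1 \<in> borel_measurable borel" using v1b by (simp add: exp_bounded_def)
 have f0m[measurable]: "f0 0 \<in> borel_measurable borel" "f0 b \<in> borel_measurable borel" using fb0 fbb by (simp_all add: exp_bounded_def)
 have hb: "heat k t (\<lambda>y. jump \<sigma> y * f0 b y) = heat k t (\<lambda>y. jump \<sigma> y * v1 y)" if "0 < t" for t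
  by (rule heat_cong_AE[OF _ _ _ that]) (use v1e eq in auto)
 have v0e: "v0 y = comb \<sigma> 0 y" if "y \<noteq> 0" for y
 proof -
  have "heat k (a - b) (\<lambda>y. jump \<sigma> y * v1 y) y = comb \<sigma> a y"
   using Rb2[OF that] hb[of "a - b"] ba by simp
  then show ?thesis using comb_floquet[OF that, of \<sigma>] \<zeta>\<mu> by (simp add: v0_def flip: mult.assoc)
 qed
 obtain B0 where v0b': "exp_bounded B0 ?c (heat k (a - b) (\<lambda>y. jump \<sigma> y * v1 y))"
  by (rule kernel_conv_exp_bounded[OF k _ jb[OF v1b] c]) (use ba in auto)
 have v0m[measurable]: "v0 \<in> borel_measurable borel"
  using v0b' unfolding v0_def exp_bounded_def by (intro borel_measurable_times borel_measurable_const) blast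
 have h0: "heat k t (\<lambda>y. jump \<sigma> y * f0 0 y) = heat k t (\<lambda>y. jump \<sigma> y * v0 y)" if "0 < t" for t
  by (rule heat_cong_AE[OF _ _ _ that]) (use v0e eq in auto)
 have cv1: "isCont v1 y" for y
  unfolding v1_def using heat_has_derivative[OF k b0 jb[OF fb0] c] has_vector_derivative_continuous by blast
 have cv0: "isCont v0 y" for y
  unfolding v0_def using heat_has_derivative[OF k _ jb[OF v1b] c, of "a - b"] has_vector_derivative_continuous ba
  by (intro continuous_intros) force
 have cE: "isCont E y" for y unfolding E_def[abs_def] by (intro continuous_intros)
 \<comment> \<open>the bound at \<open>y = 0\<close> follows by continuity\<close>
 have b0': "cmod (g y) \<le> D" if cg: "\<And>y. isCont g y" and gb: "\<And>y. y \<noteq> 0 ==> cmod (g y) \<le> D" for g :: "real => complex" and y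
 proof (cases "y = 0")
  case True
  have "((\<lambda>y. cmod (g y)) \<longlongrightarrow> cmod (g 0)) (at 0)" using cg[of 0] by (intro tendsto_norm) (simp add: isCont_def)
  moreover have "\<forall>\<^sub>F y in at 0. cmod (g y) \<le> D" using gb by (auto simp: eventually_at_filter)
  ultimately have "cmod (g 0) \<le> D" by (rule tendsto_upperbound) simp
  with True show ?thesis by simp
 qed (rule gb)
 show thesis
 proof (rule that)
  show "v1 = heat k b (\<lambda>y. jump \<sigma> y * v0 y)" using h0[OF b0] by (simp add: v1_def)
  show "v0 = (\<lambda>y. \<zeta> * heat k (a - b) (\<lambda>y. jump \<sigma> y * v1 y) y)" by (rule v0_def)
  have "cmod (v0 y - E y) \<le> D" for y
  proof (rule b0')
   show "cmod (v0 y - E y) \<le> D" if "y \<noteq> 0" for y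
    using D(2)[of 0 y] that a0 by (simp add: v0e branch_point_def incident_nodes)
  qed (intro continuous_intros cv0 cE)
  then show "exp_bounded D 0 (\<lambda>y. v0 y - E y)" by (simp add: exp_bounded_def)
  have "cmod (v1 y - \<mu>b * E y) \<le> D" for y
  proof (rule b0')
   show "cmod (v1 y - \<mu>b * E y) \<le> D" if "y \<noteq> 0" for y
    using D(2)[of b y] that b0 ba by (simp add: v1e branch_point_def incident_nodes)
  qed (intro continuous_intros cv1 cE)
  then show "exp_bounded D 0 (\<lambda>y. v1 y - \<mu>b * E y)" by (simp add: exp_bounded_def)
  show "comb \<sigma> x y = heat k x (\<lambda>y. jump \<sigma> y * v0 y) y" if "x \<in> {0<..<b}" for x y
   using R01[OF that, of y] h0[of x] that by simp
  show "comb \<sigma> x y = heat k (x - b) (\<lambda>y. jump \<sigma> y * v1 y) y" if "x \<in> {b<..<a}" for x y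
   using Rb1[OF that, of y] hb[of "x - b"] that by simp
 qed (use v0e v1e in auto)
qed

end

section \<open>Edge Green's functions on the nodes\<close>

text \<open>The edge Green's function at the nodes after its own one, up to the final sign, for alternating
 strip widths \<open>t1\<close>, \<open>t2\<close>.\<close>

primrec wseq :: "complex => real => real => nat => real => complex" where
 "wseq k t1 t2 0 = green k t1"
| "wseq k t1 t2 (Suc j) = hstep k sg (if even j then t2 else t1) (wseq k t1 t2 j)"

lemma wseq_even: "wseq k t1 t2 (2 * i) = (period k sg t2 t1 ^^ i) (green k t1)"
proof (induction i)
 case (Suc i)
 have "wseq k t1 t2 (2 * Suc i) = hstep k sg t1 (hstep k sg t2 (wseq k t1 t2 (2 * i)))" by simp
 then show ?case using Suc by (simp add: period_def)
qed simp

lemma wseq_odd: "wseq k t1 t2 (2 * i + 1) = (period k sg t1 t2 ^^ i) (hstep k sg t2 (green k t1))"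
proof (induction i)
 case (Suc i)
 have "wseq k t1 t2 (2 * Suc i + 1) = hstep k sg t2 (hstep k sg t1 (wseq k t1 t2 (2 * i + 1)))" by simp
 then show ?case using Suc by (simp add: period_def)
qed simp

lemma wseq_even_Suc: "wseq k t1 t2 (2 * i + 1) = hstep k sg t2 (wseq k t1 t2 (2 * i))"
 and wseq_odd_Suc: "wseq k t1 t2 (2 * i + 2) = hstep k sg t1 (wseq k t1 t2 (2 * i + 1))"
 by simp_all

lemma conv_reflect:
 assumes G: "\<And>s. G (- s) = G s"
 shows "conv G (\<lambda>y. f (- y)) y = conv G f (- y)"
proof -
 have "conv G f (- y) = (LINT s|lborel. G (- y - s) * f s)" by (simp add: conv_def)
 also have "\<dots> = (LINT s|lborel. G (- (y - s)) * f (- s))"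
  by (subst lborel_integral_real_affine[of "-1" _ 0]) auto
 finally show ?thesis unfolding G by (simp add: conv_def)
qed

lemma sg_reflect: "y \<noteq> 0 ==> sg (- y) = - sg y"
 by (simp add: sg_def)

locale edge_sequence =
 fixes k :: complex and t1 t2 :: real and \<zeta> :: complex
 assumes k: "0 < Im k" and t1: "0 < t1" and t2: "0 < t2" and z: "cmod \<zeta> = 1" "\<zeta> \<noteq> 1"
begin

sublocale A: two_step k sg t1 t2
 by unfold_locales (auto simp: k t1 t2 sign_factor_sg)

sublocale B: two_step k sg t2 t1
 by unfold_locales (auto simp: k t1 t2 sign_factor_sg)

lemma L2_green: "0 < t ==> L2 (green k t)"
 by (intro gauss_kernel_integrable gauss_kernel_green k)

lemma L2_wseq: "L2 (wseq k t1 t2 j)"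
 by (induction j) (auto intro: L2_green t1 t2 A.L2_hstep)

lemma summable_even: "L2 h ==> summable (\<lambda>i. \<zeta> ^ i * pr (wseq k t1 t2 (2 * i)) h)"
 unfolding wseq_even by (intro B.summable_P_pow z L2_green t1)

lemma summable_odd: "L2 h ==> summable (\<lambda>i. \<zeta> ^ i * pr (wseq k t1 t2 (2 * i + 1)) h)"
 unfolding wseq_odd by (intro A.summable_P_pow z A.L2_hstep t2 L2_green t1)

definition S0 where "S0 h = (\<Sum>i. \<zeta> ^ i * pr (wseq k t1 t2 (2 * i)) h)"
definition S1 where "S1 h = (\<Sum>i. \<zeta> ^ i * pr (wseq k t1 t2 (2 * i + 1)) h)"

lemma sums_S0: "L2 h ==> (\<lambda>i. \<zeta> ^ i * pr (wseq k t1 t2 (2 * i)) h) sums S0 h"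
 unfolding S0_def by (rule summable_sums[OF summable_even])

lemma sums_S1: "L2 h ==> (\<lambda>i. \<zeta> ^ i * pr (wseq k t1 t2 (2 * i + 1)) h) sums S1 h"
 unfolding S1_def by (rule summable_sums[OF summable_odd])

text \<open>The field at a node is a pairing with the edge Green's function that runs backwards from
 this node; by the symmetry of the kernels this is the edge Green's function of the reflected
 sequence of nodes.\<close>

lemma PT_pow_sg: "(period_transpose k sg t1 t2 ^^ i) (\<lambda>y. sg y * wseq k t1 t2 0 y) = (\<lambda>y. sg y * wseq k t1 t2 (2 * i) y)"
proof (induction i)
 case (Suc i)
 have "(period_transpose k sg t1 t2 ^^ Suc i) (\<lambda>y. sg y * wseq k t1 t2 0 y) = period_transpose k sg t1 t2 (\<lambda>y. sg y * wseq k t1 t2 (2 * i) y)"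
  using Suc by simp
 also have "\<dots> = (\<lambda>y. sg y * wseq k t1 t2 (2 * Suc i) y)"
  unfolding period_transpose_def by (simp add: hstep_def)
 finally show ?case .
qed simp

lemma field_at_node:
 assumes r0: "L2 r0" and r1: "L2 r1" and q: "L2 q"
  and e1: "r1 = heat k t1 (\<lambda>y. sg y * r0 y + c0 * q y)"
  and e0: "r0 = (\<lambda>y. \<zeta> * heat k t2 (\<lambda>y. sg y * r1 y + c1 * q y) y)"
 shows "r1 0 = c0 * S0 q + \<zeta> * c1 * S1 q"
proof -
 note sg = sign_factor_sg
 let ?P = "period k sg t1 t2" and ?W = "wseq k t1 t2"
 define s where "s = heat k t2 (\<lambda>y. \<zeta> * (c0 * (sg y * heat k t1 q y) + c1 * q y))"
 have L: "L2 (heat k t1 q)" "L2 (\<lambda>y. sg y * heat k t1 q y)" "L2 (\<lambda>y. \<zeta> * (c0 * (sg y * heat k t1 q y) + c1 * q y))"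
  "L2 (\<lambda>y. sg y * r0 y)" "L2 (\<lambda>y. sg y * r1 y)"
  by (intro L2_heat L2_cmult L2_add L2_sign sg t1 k q r0 r1)+
 have Ls: "L2 s" unfolding s_def by (intro L2_heat t2 k L)
 have lin1: "r1 = (\<lambda>y. hstep k sg t1 r0 y + c0 * heat k t1 q y)"
  unfolding hstep_def by (subst e1, subst A.heat_add[OF t1 L(4) L2_cmult[OF q]]) (simp add: A.heat_cmult)
 have split: "(\<lambda>y. \<zeta> * (sg y * r1 y + c1 * q y)) = (\<lambda>y. \<zeta> * (sg y * hstep k sg t1 r0 y) + \<zeta> * (c0 * (sg y * heat k t1 q y) + c1 * q y))"
  unfolding lin1 by (simp add: algebra_simps)
 have "r0 = heat k t2 (\<lambda>y. \<zeta> * (sg y * r1 y + c1 * q y))" by (subst e0) (simp add: A.heat_cmult)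
 also have "\<dots> = (\<lambda>y. \<zeta> * ?P r0 y + s y)"
  unfolding split s_def
  by (subst A.heat_add[OF t2 L2_cmult[OF L2_sign[OF sg A.L2_hstep[OF t1 r0]]] L(3)])
    (simp add: A.heat_cmult period_def hstep_def)
 finally have fp: "r0 = (\<lambda>y. \<zeta> * ?P r0 y + s y)" .
 have h: "L2 (\<lambda>y. sg y * ?W 0 y)" by (intro L2_sign sg L2_wseq)
 from A.resolvent_pairing[OF z(1) r0 Ls h fp]
 have "(\<lambda>i. \<zeta> ^ i * pr ((?P ^^ i) s) (\<lambda>y. sg y * ?W 0 y)) sums pr r0 (\<lambda>y. sg y * ?W 0 y)" .
 moreover have "\<zeta> ^ i * pr ((?P ^^ i) s) (\<lambda>y. sg y * ?W 0 y)
   = c0 * (\<zeta> ^ Suc i * pr (?W (2 * Suc i)) q) + \<zeta> * c1 * (\<zeta> ^ i * pr (?W (2 * i + 1)) q)" for i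
 proof -
  have "pr ((?P ^^ i) s) (\<lambda>y. sg y * ?W 0 y) = pr s (\<lambda>y. sg y * ?W (2 * i) y)"
   unfolding A.pr_P_pow[OF Ls h] PT_pow_sg ..
  also have "\<dots> = pr (\<lambda>y. \<zeta> * (c0 * (sg y * heat k t1 q y) + c1 * q y)) (?W (2 * i + 1))"
   unfolding s_def wseq_even_Suc hstep_def by (intro pr_heat t2 k L L2_sign sg L2_wseq)
  also have "\<dots> = \<zeta> * (c0 * pr (\<lambda>y. sg y * heat k t1 q y) (?W (2 * i + 1)) + c1 * pr q (?W (2 * i + 1)))"
   by (simp add: pr_cmult_left pr_add_left L2_cmult L q L2_wseq del: wseq.simps)
  also have "pr (\<lambda>y. sg y * heat k t1 q y) (?W (2 * i + 1)) = pr q (?W (2 * i + 2))"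
   unfolding pr_sign wseq_odd_Suc hstep_def by (intro pr_heat t1 k q L2_sign sg L2_wseq)
  finally show ?thesis by (simp add: pr_commute[of q] algebra_simps del: wseq.simps)
 qed
 ultimately have 1: "(\<lambda>i. c0 * (\<zeta> ^ Suc i * pr (?W (2 * Suc i)) q) + \<zeta> * c1 * (\<zeta> ^ i * pr (?W (2 * i + 1)) q)) sums pr r0 (\<lambda>y. sg y * ?W 0 y)"
  by simp
 have "(\<lambda>i. \<zeta> ^ Suc i * pr (?W (2 * Suc i)) q) sums (S0 q - pr (?W 0) q)"
  using sums_S0[OF q] sums_Suc_iff[of "\<lambda>i. \<zeta> ^ i * pr (?W (2 * i)) q" "S0 q - pr (?W 0) q"] by simp
 from sums_add[OF sums_mult[OF this, of c0] sums_mult[OF sums_S1[OF q], of "\<zeta> * c1"]]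
 have 2: "pr r0 (\<lambda>y. sg y * ?W 0 y) = c0 * (S0 q - pr (?W 0) q) + \<zeta> * c1 * S1 q"
  using 1 sums_unique2 by blast
 have "r1 0 = pr (\<lambda>y. sg y * r0 y + c0 * q y) (green k t1)"
  by (subst e1) (simp add: heat_def conv_def pr_def green_def t1 mult.commute)
 also have "\<dots> = pr r0 (\<lambda>y. sg y * ?W 0 y) + c0 * pr (?W 0) q"
  by (simp add: pr_add_left L L2_cmult q L2_green t1 pr_cmult_left pr_sign pr_commute[of q])
 finally show ?thesis using 2 by (simp add: algebra_simps)
qed

text \<open>Each source starts an edge Green's function at its node, and by the resolvent identity the solution
 is the sum of these over all preceding periods.\<close>

lemma source_expansion:
 assumes p1: "L2 p1" and p0: "L2 p0" and h: "L2 h"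
  and e1: "p1 = (\<lambda>y. heat k t1 (\<lambda>y. sg y * p0 y) y + 2 * n0 * green k t1 y)"
  and e0: "p0 = (\<lambda>y. \<zeta> * (heat k t2 (\<lambda>y. sg y * p1 y) y + 2 * n1 * green k t2 y))"
 shows "pr p1 h = 2 * n0 * S0 h + 2 * \<zeta> * n1 * (\<Sum>i. \<zeta> ^ i * pr (wseq k t2 t1 (2 * i + 1)) h)"
proof -
 let ?P = "period k sg t2 t1"
 define s where "s y = 2 * \<zeta> * n1 * hstep k sg t1 (green k t2) y + 2 * n0 * green k t1 y" for y
 have LG: "L2 (green k t1)" "L2 (green k t2)" "L2 (hstep k sg t1 (green k t2))"
  by (intro L2_green t1 t2 A.L2_hstep)+
 have Ls: "L2 s" unfolding s_def[abs_def] by (intro L2_add L2_cmult LG)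
 have "heat k t1 (\<lambda>y. sg y * p0 y) = hstep k sg t1 (\<lambda>y. \<zeta> * hstep k sg t2 p1 y + 2 * \<zeta> * n1 * green k t2 y)"
  unfolding hstep_def[of k sg t1] by (subst e0) (simp add: hstep_def algebra_simps)
 also have "\<dots> = (\<lambda>y. \<zeta> * ?P p1 y + 2 * \<zeta> * n1 * hstep k sg t1 (green k t2) y)"
  by (subst A.hstep_add[OF t1 L2_cmult[OF A.L2_hstep[OF t2 p1]] L2_cmult[OF LG(2)]]) (simp add: A.hstep_cmult period_def)
 finally have fp: "p1 = (\<lambda>y. \<zeta> * ?P p1 y + s y)"
  by (subst e1) (simp add: s_def[abs_def] add.assoc)
 from B.resolvent_pairing[OF z(1) p1 Ls h fp]
 have 1: "(\<lambda>i. \<zeta> ^ i * pr ((?P ^^ i) s) h) sums pr p1 h" .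
 have Ps: "(?P ^^ i) s = (\<lambda>y. 2 * \<zeta> * n1 * wseq k t2 t1 (2 * i + 1) y + 2 * n0 * wseq k t1 t2 (2 * i) y)" for i
  unfolding s_def[abs_def] wseq_odd wseq_even
  by (subst B.P_pow_add[OF L2_cmult[OF LG(3)] L2_cmult[OF LG(1)]]) (simp add: B.P_pow_cmult)
 have LW: "L2 (wseq k t2 t1 (2 * i + 1))" for i
  unfolding wseq_odd by (intro B.L2_P_pow LG)
 have terms: "\<zeta> ^ i * pr ((?P ^^ i) s) h = 2 * \<zeta> * n1 * (\<zeta> ^ i * pr (wseq k t2 t1 (2 * i + 1)) h) + 2 * n0 * (\<zeta> ^ i * pr (wseq k t1 t2 (2 * i)) h)" for i
  unfolding Ps pr_add_left[OF L2_cmult[OF LW] L2_cmult[OF L2_wseq] h] pr_cmult_left by (simp only: distrib_left mult_ac)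
 have "summable (\<lambda>i. \<zeta> ^ i * pr (wseq k t2 t1 (2 * i + 1)) h)"
  unfolding wseq_odd by (intro B.summable_P_pow z LG h)
 from sums_add[OF sums_mult[OF summable_sums[OF this], of "2 * \<zeta> * n1"] sums_mult[OF sums_S0[OF h], of "2 * n0"]]
 show ?thesis using 1 sums_unique2 unfolding terms by (fastforce simp: add.commute)
qed

text \<open>Diffusion preserves parity and every sign factor reverses it.\<close>

lemma wseq_reflect: "wseq k t1 t2 j (- y) = (- 1) ^ j * wseq k t1 t2 j y"
proof (induction j arbitrary: y)
 case 0
 show ?case by (simp add: green_def)
next
 case (Suc j)
 define t where "t = (if even j then t2 else t1)"
 have t: "0 < t" using t1 t2 by (simp add: t_def)
 have m[measurable]: "wseq k t1 t2 j \<in> borel_measurable borel" using L2_measurable[OF L2_wseq] .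
 let ?f = "\<lambda>y. sg y * wseq k t1 t2 j y"
 have "wseq k t1 t2 (Suc j) (- y) = conv (green k t) ?f (- y)" by (simp add: hstep_def heat_def t_def)
 also have "\<dots> = conv (green k t) (\<lambda>y. ?f (- y)) y"
  by (rule conv_reflect[symmetric]) (simp add: green_def)
 also have "\<dots> = (LINT s|lborel. (- 1) ^ Suc j * (green k t (y - s) * ?f s))"
  unfolding conv_def
 proof (rule integral_cong_AE)
  show "AE s in lborel. green k t (y - s) * ?f (- s) = (- 1) ^ Suc j * (green k t (y - s) * ?f s)"
   using AE_lborel_singleton[of 0] by eventually_elim (simp add: Suc sg_reflect)
 qed measurable
 also have "\<dots> = (- 1) ^ Suc j * wseq k t1 t2 (Suc j) y" by (simp add: hstep_def heat_def t_def conv_def)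
 finally show ?case .
qed

end

text \<open>Half line exponentials, the test functions through which the directivities are read off.\<close>

definition exp_lower :: "complex => complex => real => complex" where
 "exp_lower k \<psi> y = (if y < 0 then exp (- \<i> * k * \<psi> * of_real y) else 0)"

definition exp_upper :: "complex => complex => real => complex" where
 "exp_upper k \<psi> y = (if 0 < y then exp (\<i> * k * \<psi> * of_real y) else 0)"

lemma L2_exp_half_line:
 assumes "0 < Im (k * \<psi>)"
 shows "L2 (exp_lower k \<psi>)" "L2 (exp_upper k \<psi>)"
proof -
 have m: "exp_lower k \<psi> \<in> borel_measurable borel" "exp_upper k \<psi> \<in> borel_measurable borel"
  unfolding exp_lower_def[abs_def] exp_upper_def[abs_def] by measurable
 have b: "cmod (exp_lower k \<psi> y) \<le> 1 * exp (- Im (k * \<psi>) * \<bar>y\<bar>)" "cmod (exp_upper k \<psi> y) \<le> 1 * exp (- Im (k * \<psi>) * \<bar>y\<bar>)" for y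
  by (auto simp: exp_lower_def exp_upper_def norm_exp_eq_Re algebra_simps)
 show "L2 (exp_lower k \<psi>)" by (rule L2_of_exp_bound[OF m(1) assms b(1)])
 show "L2 (exp_upper k \<psi>)" by (rule L2_of_exp_bound[OF m(2) assms b(2)])
qed

lemma exp_upper_reflect: "exp_upper k \<psi> (- y) = exp_lower k \<psi> y"
 by (simp add: exp_lower_def exp_upper_def)

lemma (in edge_sequence) pr_wseq_upper: "pr (wseq k t1 t2 j) (exp_upper k \<psi>) = (- 1) ^ j * pr (wseq k t1 t2 j) (exp_lower k \<psi>)"
proof -
 have "pr (wseq k t1 t2 j) (exp_upper k \<psi>) = (LINT y|lborel. wseq k t1 t2 j (- y) * exp_upper k \<psi> (- y))"
  unfolding pr_def by (subst lborel_integral_real_affine[of "-1" _ 0]) auto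
 then show ?thesis by (simp add: wseq_reflect exp_upper_reflect pr_def mult.assoc)
qed

lemma (in edge_sequence) S_upper:
 assumes "0 < Im (k * \<psi>)"
 shows "S0 (exp_upper k \<psi>) = S0 (exp_lower k \<psi>)" "S1 (exp_upper k \<psi>) = - S1 (exp_lower k \<psi>)"
proof -
 show "S0 (exp_upper k \<psi>) = S0 (exp_lower k \<psi>)" unfolding S0_def by (simp add: pr_wseq_upper)
 have "S1 (exp_upper k \<psi>) = (\<Sum>i. - (\<zeta> ^ i * pr (wseq k t1 t2 (2 * i + 1)) (exp_lower k \<psi>)))"
  unfolding S1_def by (simp only: pr_wseq_upper) simp
 then show "S1 (exp_upper k \<psi>) = - S1 (exp_lower k \<psi>)"
  unfolding S1_def using suminf_minus[OF summable_odd[OF L2_exp_half_line(1)[OF assms]]] by simp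
qed

section \<open>The directivities\<close>

definition strip_width :: "real => real => int => real" where
 "strip_width a b n = (if even n then b else a - b)"

lemma node_Suc: "node a b (n + 1) = node a b n + strip_width a b n"
proof (cases "even n")
 case True
 then show ?thesis by (auto simp: node_def strip_width_def elim!: evenE)
next
 case False
 then obtain m where "n = 2 * m + 1" by (auto elim: oddE)
 then show ?thesis by (simp add: node_def strip_width_def algebra_simps)
qed

lemma strip_width_alternates: "strip_width a b (n + 1 + int j) = (if even j then strip_width a b (n + 1) else strip_width a b n)"
 by (auto simp: strip_width_def)

lemma strip_width_period: "strip_width a b n + strip_width a b (n + 1) = a"
 by (simp add: strip_width_def)

lemma node_even_odd:
 "node a b (n + 1 + int (2 * i)) - node a b n = a * real i + strip_width a b n"
 "node a b (n + 1 + int (2 * i + 1)) - node a b n = a * real i + a"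
proof -
 have even: "node a b (n + 1 + int (2 * i)) - node a b n = a * real i + strip_width a b n" for i
 proof (induction i)
  case (Suc i)
  have "node a b (n + 1 + int (2 * Suc i)) = node a b ((n + 1 + int (2 * i)) + 1 + 1)" by (simp add: algebra_simps)
  also have "\<dots> = node a b (n + 1 + int (2 * i)) + (strip_width a b (n + 1 + int (2 * i)) + strip_width a b (n + 1 + int (2 * i) + 1))"
   using node_Suc[of a b "n + 1 + int (2 * i) + 1"] node_Suc[of a b "n + 1 + int (2 * i)"] by linarith
  finally show ?case using Suc by (simp only: strip_width_period) (simp add: algebra_simps)
 qed (simp add: node_Suc)
 then show "node a b (n + 1 + int (2 * i)) - node a b n = a * real i + strip_width a b n" .
 have "node a b (n + 1 + int (2 * i + 1)) = node a b ((n + 1 + int (2 * i)) + 1)" by (simp add: algebra_simps)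
 also have "\<dots> = node a b (n + 1 + int (2 * i)) + strip_width a b (n + 1 + int (2 * i))" by (rule node_Suc)
 also have "strip_width a b (n + 1 + int (2 * i)) = a - strip_width a b n"
  by (simp add: strip_width_def)
 finally show "node a b (n + 1 + int (2 * i + 1)) - node a b n = a * real i + a" using even[of i] by simp
qed

lemma xphase_add: "xphase k \<psi> (x + y) = xphase k \<psi> x * xphase k \<psi> y"
 by (simp add: xphase_def ring_distribs add_divide_distrib flip: exp_add)

lemma xphase_of_nat: "xphase k \<psi> (a * real i) = xphase k \<psi> a ^ i"
 by (induction i) (simp_all add: xphase_add distrib_left xphase_def[of k \<psi> 0] mult.commute)

context
 fixes a b :: real and k :: complex
 assumes b: "0 < b" "b < a" and k: "0 < Im k"
begin

lemma strip_width_pos: "0 < strip_width a b n"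
 using b by (simp add: strip_width_def)

lemma node_mono: "i < j ==> node a b i < node a b j"
proof (induction j rule: int_gr_induct)
 case base
 show ?case using strip_width_pos[of i] by (simp add: node_Suc)
next
 case (step j)
 then show ?case using strip_width_pos[of j] by (simp add: node_Suc)
qed

lemma node_less_iff: "node a b i < node a b j \<longleftrightarrow> i < j"
 using node_mono[of i j] node_mono[of j i] by (cases i j rule: linorder_cases) auto

lemma node_le_iff: "node a b i \<le> node a b j \<longleftrightarrow> i \<le> j"
 using node_less_iff[of j i] by linarith

lemma edge_sequence_nodes: "cmod z = 1 ==> z \<noteq> 1 ==> edge_sequence k (strip_width a b n) (strip_width a b (n + 1)) z"
 by unfold_locales (simp_all add: k strip_width_pos)

text \<open>In the integral \<open>sgn\<close> may be replaced by \<open>sg\<close>.\<close>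

lemma edge_strip_node:
 "edge_strip a b k n j (node a b (n + 1 + int j)) = wseq k (strip_width a b n) (strip_width a b (n + 1)) j"
proof (induction j)
 case 0
 show ?case by (rule ext) (simp add: node_Suc)
next
 case (Suc j)
 interpret edge_sequence k "strip_width a b n" "strip_width a b (n + 1)" "- 1"
  by (rule edge_sequence_nodes) auto
 let ?w = "wseq k (strip_width a b n) (strip_width a b (n + 1))"
 define t where "t = strip_width a b (n + 1 + int j)"
 have t: "0 < t" by (simp add: t_def strip_width_pos)
 have [measurable]: "?w j \<in> borel_measurable borel" using L2_measurable[OF L2_wseq] .
 have "node a b (n + 1 + int (Suc j)) = node a b ((n + 1 + int j) + 1)" by (simp add: algebra_simps)
 then have x: "node a b (n + 1 + int (Suc j)) - node a b (n + 1 + int j) = t"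
  using node_Suc[of a b "n + 1 + int j"] by (simp add: t_def)
 have nj: "n + int (Suc j) = n + 1 + int j" by simp
 show ?case
 proof
  fix y
  have "edge_strip a b k n (Suc j) (node a b (n + 1 + int (Suc j))) y
    = (LINT y'|lborel. of_real (sgn y') * ?w j y' * green k t (y - y'))"
   unfolding edge_strip.simps Let_def nj x Suc ..
  also have "\<dots> = (LINT y'|lborel. green k t (y - y') * (sg y' * ?w j y'))"
  proof (rule integral_cong_AE)
   show "AE y' in lborel. of_real (sgn y') * ?w j y' * green k t (y - y') = green k t (y - y') * (sg y' * ?w j y')"
    using AE_lborel_singleton[of 0] by eventually_elim (auto simp: sg_def sgn_if)
  qed measurable
  also have "\<dots> = hstep k sg t (?w j) y" by (simp add: hstep_def heat_def conv_def)
  also have "\<dots> = ?w (Suc j) y" by (simp add: t_def strip_width_alternates)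
  finally show "edge_strip a b k n (Suc j) (node a b (n + 1 + int (Suc j))) y = ?w (Suc j) y" .
 qed
qed

lemma edge_green_node:
 "edge_green a b k n (node a b (n + 1 + int j)) y 1 = wseq k (strip_width a b n) (strip_width a b (n + 1)) j y"
proof -
 have "(THE i. node a b (n + int i) < node a b (n + 1 + int j) \<and> node a b (n + 1 + int j) \<le> node a b (n + int i + 1)) = j"
  unfolding node_less_iff node_le_iff by (rule the_equality) auto
 then show ?thesis by (simp add: edge_green_def edge_strip_node node_le_iff)
qed

text \<open>Two nodes of equal parity differ by a multiple of \<open>a\<close>, and the phase over the distance \<open>a\<close> is the
 Floquet factor \<open>z\<close> for every mode.  Splitting the series by parity leaves two pairings of the power
 series of the period operator.\<close>

lemma directivity_series:
 assumes z: "cmod z = 1" "z \<noteq> 1" and \<psi>: "0 < Im (k * \<psi>)" and xz: "xphase k \<psi> a = z"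
 shows "directivity a b k n \<psi> = 1 - 2 * (xphase k \<psi> (strip_width a b n)
   * edge_sequence.S0 k (strip_width a b n) (strip_width a b (n + 1)) z (exp_lower k \<psi>)
  + z * edge_sequence.S1 k (strip_width a b n) (strip_width a b (n + 1)) z (exp_lower k \<psi>))"
proof -
 interpret edge_sequence k "strip_width a b n" "strip_width a b (n + 1)" z
  by (rule edge_sequence_nodes[OF z])
 let ?w = "wseq k (strip_width a b n) (strip_width a b (n + 1))" and ?h = "exp_lower k \<psi>"
 note h = L2_exp_half_line(1)[OF \<psi>]
 define d where "d j = node a b (n + 1 + int j) - node a b n" for j
 have int: "(LINT y:{..<0}|lborel. edge_green_right a b k n (n + 1 + int j) y * exp (- \<i> * k * \<psi> * of_real y)) = - pr (?w j) ?h" for j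
 proof -
  have "(LINT y:{..<0}|lborel. edge_green_right a b k n (n + 1 + int j) y * exp (- \<i> * k * \<psi> * of_real y))
    = (LINT y|lborel. - (?w j y * ?h y))"
   unfolding set_lebesgue_integral_def edge_green_right_def edge_green_node
   by (rule Bochner_Integration.integral_cong) (auto simp: exp_lower_def indicator_def)
  then show ?thesis by (simp add: pr_def)
 qed
 have "(\<lambda>j. xphase k \<psi> (d j) * pr (?w j) ?h) sums (xphase k \<psi> (strip_width a b n) * S0 ?h + z * S1 ?h)"
 proof (rule A.sums_even_odd)
  show "(\<lambda>i. xphase k \<psi> (d (2 * i)) * pr (?w (2 * i)) ?h) sums (xphase k \<psi> (strip_width a b n) * S0 ?h)"
   using sums_mult[OF sums_S0[OF h], of "xphase k \<psi> (strip_width a b n)"]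
   unfolding d_def node_even_odd xphase_add xphase_of_nat xz by (simp only: mult_ac)
  show "(\<lambda>i. xphase k \<psi> (d (2 * i + 1)) * pr (?w (2 * i + 1)) ?h) sums (z * S1 ?h)"
   using sums_mult[OF sums_S1[OF h], of z]
   unfolding d_def node_even_odd xphase_add xphase_of_nat xz by (simp only: mult_ac)
 qed
 from sums_unique[OF sums_minus[OF this]]
 have "(\<Sum>j. - (xphase k \<psi> (d j) * pr (?w j) ?h)) = - (xphase k \<psi> (strip_width a b n) * S0 ?h + z * S1 ?h)" by simp
 then show ?thesis
  unfolding directivity_def Let_def int by (simp add: xphase_def d_def)
qed

end

section \<open>The embedding formula\<close>

lemma conv_bounded_continuous:
 assumes K: "integrable lborel K" and f[measurable]: "f \<in> borel_measurable borel" and B: "\<And>y. cmod (f y) \<le> B"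
  and c: "\<And>y. y \<noteq> 0 ==> isCont f y"
 shows "isCont (conv K f) y"
proof (rule continuous_at_sequentiallyI)
 fix Y :: "nat => real" assume Y: "Y \<longlonglongrightarrow> y"
 have [measurable]: "K \<in> borel_measurable borel" using borel_measurable_integrable[OF K] by simp
 show "(\<lambda>n. conv K f (Y n)) \<longlonglongrightarrow> conv K f y"
  unfolding conv_shift
 proof (rule integral_dominated_convergence[where w = "\<lambda>s. B * cmod (K s)"])
  show "AE s in lborel. (\<lambda>n. K s * f (Y n - s)) \<longlonglongrightarrow> K s * f (y - s)"
   using AE_lborel_singleton[of y]
  proof eventually_elim
   case (elim s)
   then have "isCont f (y - s)" by (intro c) auto
   then show ?case by (intro tendsto_mult tendsto_const isCont_tendsto_compose[of "y - s" f] tendsto_diff Y)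
  qed
  show "AE s in lborel. norm (K s * f (Y n - s)) \<le> B * cmod (K s)" for n
   using mult_left_mono[OF B norm_ge_zero] by (intro AE_I2) (simp add: norm_mult mult.commute[of B])
 qed (use K in \<open>auto intro: integrable_norm\<close>)
qed

lemma exp_bounded_mono: "exp_bounded B 0 f ==> 0 \<le> c ==> exp_bounded B c f"
proof -
 assume f: "exp_bounded B 0 f" and c: "0 \<le> c"
 have "cmod (f y) \<le> B * exp (c * \<bar>y\<bar>)" for y
 proof -
  have "cmod (f y) \<le> B * 1" using f by (simp add: exp_bounded_def)
  also have "\<dots> \<le> B * exp (c * \<bar>y\<bar>)" using exp_bounded_nonneg[OF f] c by (intro mult_left_mono) auto
  finally show ?thesis .
 qed
 with f show ?thesis by (simp add: exp_bounded_def)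
qed

lemma exp_bounded_sg: "exp_bounded B c f ==> exp_bounded B c (\<lambda>y. sg y * f y)"
 by (auto simp: exp_bounded_def norm_mult)

lemma exp_bounded_scale: "exp_bounded B c f ==> exp_bounded (cmod z * B) c (\<lambda>y. z * f y)"
 by (auto simp: exp_bounded_def norm_mult mult.assoc mult_left_mono)

lemma exp_bounded_add:
 assumes "exp_bounded B c f" "exp_bounded B' c g"
 shows "exp_bounded (B + B') c (\<lambda>y. f y + g y)"
proof -
 have "cmod (f y + g y) \<le> (B + B') * exp (c * \<bar>y\<bar>)" for y
  using assms norm_triangle_ineq[of "f y" "g y"] unfolding exp_bounded_def distrib_right by (meson add_mono order_trans)
 then show ?thesis using assms by (simp add: exp_bounded_def borel_measurable_add)
qed

lemma exp_bounded_green: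
 assumes "0 < Im k" "0 < t"
 obtains A where "exp_bounded A 1 (green k t)"
proof -
 obtain A \<alpha> where A: "0 \<le> A" "0 < \<alpha>" and b: "\<And>s. cmod (green k t s) \<le> A * exp (\<bar>s\<bar> - \<alpha> * s\<^sup>2)"
  by (rule green_dgreen_bound[OF assms]) (rule that)
 have "cmod (green k t s) \<le> A * exp (1 * \<bar>s\<bar>)" for s
  by (rule order_trans[OF b]) (use A in \<open>auto intro!: mult_left_mono\<close>)
 moreover have "green k t \<in> borel_measurable borel"
  using gauss_kernel_green[OF assms(2,1)] by (auto dest: gauss_kernel_measurable)
 ultimately show thesis by (intro that) (auto simp: exp_bounded_def)
qed

lemma heat_bounded_C1:
 assumes k: "0 < Im k" and t: "0 < t" and f: "exp_bounded B 0 f" and c: "\<And>y. y \<noteq> 0 ==> isCont f y"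
 obtains g B' where "\<And>y. (heat k t f has_vector_derivative g y) (at y)" "continuous_on UNIV g" "exp_bounded B' 0 g"
proof -
 obtain B' where B': "exp_bounded B' 0 (conv (dgreen k t) f)"
  by (rule kernel_conv_exp_bounded[OF k t f order_refl]) (rule that)
 have one: "exp_bounded 1 0 (\<lambda>y. 1)" by (simp add: exp_bounded_def)
 have "(\<lambda>s. dgreen k t (0 - s) * 1) = (\<lambda>s. - dgreen k t s)" by (simp add: dgreen_def green_def t)
 then have "integrable lborel (\<lambda>s. - dgreen k t s)"
  using kernel_product_integrable(2)[OF k t one order_refl, of 0] by simp
 then have i: "integrable lborel (dgreen k t)" by simp
 have "isCont (conv (dgreen k t) f) y" for y
  by (rule conv_bounded_continuous[OF i _ _ c]) (use f in \<open>auto simp: exp_bounded_def\<close>)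
 then show thesis
  by (intro that[OF heat_has_derivative[OF k t f order_refl] _ B'] continuous_at_imp_continuous_on) auto
qed

context edge_sequence
begin

text \<open>Elimination of \<open>f1\<close> leaves an equation \<open>f0 = \<zeta> P f0 + s\<close> with square integrable \<open>s\<close>, which has no
 bounded solution other than the square integrable one.\<close>

lemma bounded_pair_L2:
 assumes f0: "exp_bounded B 0 f0" and g1: "exp_bounded B1 c g1" "L2 g1" and g0: "L2 g0" and c: "0 \<le> c"
  and e1: "f1 = (\<lambda>y. hstep k sg t1 f0 y + g1 y)" and e0: "f0 = (\<lambda>y. \<zeta> * (hstep k sg t2 f1 y + g0 y))"
 shows "L2 f0" "L2 f1"
proof -
 obtain B2 where "exp_bounded B2 0 (heat k t1 (\<lambda>y. sg y * f0 y))"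
  by (rule kernel_conv_exp_bounded[OF k t1 exp_bounded_sg[OF f0] order_refl]) (rule that)
 then have h1: "exp_bounded B2 0 (hstep k sg t1 f0)" by (simp add: hstep_def)
 have "(\<lambda>y. sg y * f1 y) = (\<lambda>y. sg y * hstep k sg t1 f0 y + sg y * g1 y)"
  by (simp add: e1 distrib_left)
 then have "hstep k sg t2 f1 = heat k t2 (\<lambda>y. sg y * hstep k sg t1 f0 y + sg y * g1 y)" by (simp add: hstep_def[of k sg t2])
 also have "\<dots> = (\<lambda>y. period k sg t1 t2 f0 y + hstep k sg t2 g1 y)"
  unfolding heat_exp_bounded_add[OF k t2 exp_bounded_sg[OF h1] exp_bounded_sg[OF g1(1)] order_refl c]
  by (simp add: period_def hstep_def)
 finally have eq: "f0 y = \<zeta> * period k sg t1 t2 f0 y + \<zeta> * (hstep k sg t2 g1 y + g0 y)" for y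
  by (subst e0) (simp add: algebra_simps)
 have Ls: "L2 (\<lambda>y. \<zeta> * (hstep k sg t2 g1 y + g0 y))"
  by (intro L2_cmult L2_add A.L2_hstep t2 g1 g0)
 have b: "f0 \<in> borel_measurable borel" "\<And>y. cmod (f0 y) \<le> B" using f0 by (auto simp: exp_bounded_def)
 show "L2 f0" by (rule A.bounded_resolvent_L2(1)[OF z b Ls eq])
 then show "L2 f1" unfolding e1 by (intro L2_add A.L2_hstep t1 g1)
qed

lemma S_scale: "L2 h ==> S0 (\<lambda>y. c * h y) = c * S0 h" "L2 h ==> S1 (\<lambda>y. c * h y) = c * S1 h"
proof -
 have p: "pr w (\<lambda>y. c * h y) = c * pr w h" for w by (simp add: pr_commute[of w] pr_cmult_left)
 show "L2 h ==> S0 (\<lambda>y. c * h y) = c * S0 h"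
  unfolding S0_def p by (subst suminf_mult[OF summable_even, symmetric]) (simp_all only: mult_ac)
 show "L2 h ==> S1 (\<lambda>y. c * h y) = c * S1 h"
  unfolding S1_def p by (subst suminf_mult[OF summable_odd, symmetric]) (simp_all only: mult_ac)
qed

definition edge_directivity :: "complex => complex" where
 "edge_directivity \<psi> = 1 - 2 * (xphase k \<psi> t1 * S0 (exp_lower k \<psi>) + \<zeta> * S1 (exp_lower k \<psi>))"

end

lemma pr_exp_upper_derivative:
 assumes r: "exp_bounded B 0 r" and dr: "exp_bounded B' 0 dr" and d: "\<And>y. (r has_vector_derivative dr y) (at y)"
  and cdr: "continuous_on UNIV dr" and \<psi>: "0 < Im (k * \<psi>)" and L: "L2 r" "L2 (\<lambda>y. dr y + \<i> * k * \<theta> * r y)"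
 shows "pr (\<lambda>y. dr y + \<i> * k * \<theta> * r y) (exp_upper k \<psi>) = - r 0 + \<i> * k * (\<theta> - \<psi>) * pr r (exp_upper k \<psi>)"
proof -
 let ?e = "\<lambda>y. exp (\<i> * k * \<psi> * of_real y)" and ?h = "exp_upper k \<psi>"
 note h = L2_exp_half_line(2)[OF \<psi>]
 have half: "(LINT y:{0<..}|lborel. f y * ?e y) = pr f ?h" for f
  unfolding set_lebesgue_integral_def pr_def by (rule Bochner_Integration.integral_cong) (auto simp: exp_upper_def indicator_def)
 have Ld: "L2 (\<lambda>y. dr y + \<i> * k * \<psi> * r y)"
  using L2_add[OF L(2) L2_cmult[OF L(1), of "\<i> * k * (\<psi> - \<theta>)"]] by (simp add: algebra_simps)
 have "(LINT y:{0<..}|lborel. (dr y + \<i> * k * \<psi> * r y) * ?e y) = - (r 0 * ?e 0)"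
 proof (rule integral_derivative_half_line)
  show "((\<lambda>y. r y * ?e y) has_vector_derivative (dr y + \<i> * k * \<psi> * r y) * ?e y) (at y)" for y
  proof -
   have "(?e has_vector_derivative \<i> * k * \<psi> * ?e y) (at y)"
    by (rule has_vector_derivative_real_field[where f = "\<lambda>w. exp (\<i> * k * \<psi> * w)"]) (auto intro!: derivative_eq_intros)
   from has_vector_derivative_mult[OF d this]
   show ?thesis by (rule has_vector_derivative_eq_rhs) (simp add: algebra_simps)
  qed
  have "continuous_on UNIV r" using d by (auto intro!: continuous_at_imp_continuous_on has_vector_derivative_continuous)
  then show "continuous_on UNIV (\<lambda>y. (dr y + \<i> * k * \<psi> * r y) * ?e y)" by (intro continuous_intros cdr)
  have "integrable lborel (\<lambda>y. (dr y + \<i> * k * \<psi> * r y) * ?h y)" by (rule integrable_mult_L2[OF Ld h])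
  then show "set_integrable lborel {0<..} (\<lambda>y. (dr y + \<i> * k * \<psi> * r y) * ?e y)"
   unfolding set_integrable_def
   by (rule Bochner_Integration.integrable_cong[THEN iffD1, rotated -1]) (auto simp: exp_upper_def indicator_def)
  show "((\<lambda>y. r y * ?e y) \<longlongrightarrow> 0) at_top"
  proof (rule Lim_null_comparison)
   have "cmod (r y * ?e y) \<le> B * exp (- Im (k * \<psi>) * y)" for y
   proof -
    have "cmod (?e y) = exp (- Im (k * \<psi>) * y)" by (simp add: norm_exp_eq_Re algebra_simps)
    then show ?thesis using r by (simp add: exp_bounded_def norm_mult mult_right_mono del: times_complex.sel)
   qed
   then show "\<forall>\<^sub>F y in at_top. norm (r y * ?e y) \<le> B * exp (- Im (k * \<psi>) * y)" by (intro always_eventually) blast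
   show "((\<lambda>y. B * exp (- Im (k * \<psi>) * y)) \<longlongrightarrow> 0) at_top" using \<psi> by real_asymp
  qed
 qed
 then have e: "pr (\<lambda>y. dr y + \<i> * k * \<psi> * r y) ?h = - r 0" unfolding half by simp
 have "(\<lambda>y. dr y + \<i> * k * \<theta> * r y) = (\<lambda>y. (dr y + \<i> * k * \<psi> * r y) + \<i> * k * (\<theta> - \<psi>) * r y)" by (simp add: algebra_simps)
 then show ?thesis by (simp only: pr_add_left[OF Ld L2_cmult[OF L(1)] h] e pr_cmult_left)
qed

locale scattering_pair = edge_sequence k t1 t2 \<zeta> for k t1 t2 \<zeta> +
 fixes \<theta> \<alpha>0 \<alpha>1 :: complex and v0 v1 :: "real => complex" and B :: real
 assumes kth: "0 < Im (k * \<theta>)"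
  and phase1: "\<alpha>1 * xphase k \<theta> t1 = \<alpha>0" and phase2: "\<alpha>0 * xphase k \<theta> t2 = \<zeta> * \<alpha>1"
  and v1: "v1 = heat k t1 (\<lambda>y. sg y * v0 y)" and v0: "v0 = (\<lambda>y. \<zeta> * heat k t2 (\<lambda>y. sg y * v1 y) y)"
  and bounded0: "exp_bounded B 0 (\<lambda>y. v0 y - \<alpha>0 * exp (- \<i> * k * \<theta> * of_real y))"
  and bounded1: "exp_bounded B 0 (\<lambda>y. v1 y - \<alpha>1 * exp (- \<i> * k * \<theta> * of_real y))"
begin

lemma zeta_nonzero: "\<zeta> \<noteq> 0" using z by auto

text \<open>The same field with the nodes \<open>b\<close> and \<open>a\<close> in the roles of \<open>0\<close> and \<open>b\<close>.\<close>

lemma swap: "scattering_pair k t2 t1 \<zeta> \<theta> \<alpha>1 (\<alpha>0 / \<zeta>) v1 (\<lambda>y. v0 y / \<zeta>) B"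
proof unfold_locales
 show "v1 = (\<lambda>y. \<zeta> * heat k t1 (\<lambda>y. sg y * (v0 y / \<zeta>)) y)"
  using heat_scale[OF k t1, of "1 / \<zeta>" "\<lambda>y. sg y * v0 y"] zeta_nonzero by (subst v1) simp
 show "(\<lambda>y. v0 y / \<zeta>) = heat k t2 (\<lambda>y. sg y * v1 y)" by (subst v0) (simp add: zeta_nonzero)
 have "cmod (v0 y / \<zeta> - \<alpha>0 / \<zeta> * w) = cmod (v0 y - \<alpha>0 * w)" for y w
  using z(1) by (simp add: norm_divide flip: diff_divide_distrib)
 moreover have "(\<lambda>y. (v0 y - \<alpha>0 * exp (- \<i> * k * \<theta> * of_real y)) + \<alpha>0 * exp (- \<i> * k * \<theta> * of_real y)) \<in> borel_measurable borel"
  by (rule borel_measurable_add) (use bounded0 in \<open>simp_all add: exp_bounded_def\<close>)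
 then have "v0 \<in> borel_measurable borel" by simp
 ultimately show "exp_bounded B 0 (\<lambda>y. v0 y / \<zeta> - \<alpha>0 / \<zeta> * exp (- \<i> * k * \<theta> * of_real y))"
  using bounded0 by (simp add: exp_bounded_def)
qed (use k t1 t2 z kth phase1 phase2 bounded1 zeta_nonzero in auto)

abbreviation W where "W y \<equiv> exp (- \<i> * k * \<theta> * of_real y)"
definition q where "q y = - 2 * exp_lower k \<theta> y"
definition r0 where "r0 y = v0 y - \<alpha>0 * W y"
definition r1 where "r1 y = v1 y - \<alpha>1 * W y"

lemma exp_bounded_E: "exp_bounded 1 (Im (k * \<theta>)) W"
proof -
 have "cmod (W y) \<le> exp (Im (k * \<theta>) * \<bar>y\<bar>)" for y
 proof -
  have "cmod (W y) = exp (Im (k * \<theta>) * y)" by (simp add: norm_exp_eq_Re algebra_simps)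
  then show ?thesis using kth by (simp add: mult_left_mono)
 qed
 then show ?thesis by (simp add: exp_bounded_def)
qed

lemma sg_E: "sg y * W y = W y + q y"
 by (simp add: sg_def q_def exp_lower_def)

lemma L2_q: "L2 q"
 unfolding q_def[abs_def] by (intro L2_cmult L2_exp_half_line(1) kth)

lemma exp_bounded_q: "exp_bounded 2 0 q"
proof -
 have "cmod (exp_lower k \<theta> y) \<le> 1" for y
 proof -
  have "cmod (W y) = exp (Im (k * \<theta>) * y)" by (simp add: norm_exp_eq_Re algebra_simps)
  moreover have "y < 0 ==> Im (k * \<theta>) * y \<le> 0" using mult_pos_neg[OF kth, of y] by simp
  ultimately show ?thesis by (simp add: exp_lower_def del: times_complex.sel)
 qed
 then have "cmod (q y) \<le> 2" for y using norm_mult[of "- 2" "exp_lower k \<theta> y"] by (simp add: q_def)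
 then show ?thesis using L2_measurable[OF L2_q] by (simp add: exp_bounded_def)
qed

lemma bounded_r: "exp_bounded B 0 r0" "exp_bounded B 0 r1"
 using bounded0 bounded1 by (simp_all add: r0_def[abs_def] r1_def[abs_def])

text \<open>The incident wave is an eigenfunction of the heat flow; flipping its sign below the axis adds the
 source \<open>q\<close>, which is square integrable because the wave decays downwards.\<close>

lemma flipped_heat:
 assumes t: "0 < t" and r: "exp_bounded B 0 (\<lambda>y. v y - c * W y)" and c: "c' * xphase k \<theta> t = c"
 shows "heat k t (\<lambda>y. sg y * v y) = (\<lambda>y. heat k t (\<lambda>y. sg y * (v y - c * W y) + c * q y) y + c' * W y)"
proof -
 have "(\<lambda>y. sg y * v y) = (\<lambda>y. (sg y * (v y - c * W y) + c * q y) + c * W y)"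
 proof
  fix y
  have "sg y * v y = sg y * (v y - c * W y) + c * (sg y * W y)" by (simp add: algebra_simps)
  then show "sg y * v y = (sg y * (v y - c * W y) + c * q y) + c * W y" unfolding sg_E by (simp add: algebra_simps)
 qed
 moreover have b1: "exp_bounded (B + cmod c * 2) 0 (\<lambda>y. sg y * (v y - c * W y) + c * q y)"
  by (intro exp_bounded_add exp_bounded_sg r exp_bounded_scale exp_bounded_q)
 moreover have b2: "exp_bounded (cmod c * 1) (Im (k * \<theta>)) (\<lambda>y. c * W y)" by (intro exp_bounded_scale exp_bounded_E)
 ultimately have "heat k t (\<lambda>y. sg y * v y) = (\<lambda>y. heat k t (\<lambda>y. sg y * (v y - c * W y) + c * q y) y + heat k t (\<lambda>y. c * W y) y)"
  by (simp only: heat_exp_bounded_add[OF k t b1 b2 order_refl less_imp_le[OF kth]])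
 moreover have "heat k t (\<lambda>y. c * W y) y = c' * W y" for y
 proof -
  have x: "xphase k \<theta> t * exp (- \<i> * k * of_real t * \<theta>\<^sup>2 / 2) = 1" by (simp add: xphase_def flip: exp_add)
  have "heat k t (\<lambda>y. c * W y) y = c' * (xphase k \<theta> t * exp (- \<i> * k * of_real t * \<theta>\<^sup>2 / 2)) * W y"
   using heat_exponential[OF k t, of \<theta> y] by (simp add: heat_scale[OF k t] c[symmetric])
  then show ?thesis by (simp only: x mult_1_right)
 qed
 ultimately show ?thesis by simp
qed

lemma r1_eq: "r1 = heat k t1 (\<lambda>y. sg y * r0 y + \<alpha>0 * q y)"
 and r0_eq: "r0 = (\<lambda>y. \<zeta> * heat k t2 (\<lambda>y. sg y * r1 y + \<alpha>1 * q y) y)"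
proof -
 show "r1 = heat k t1 (\<lambda>y. sg y * r0 y + \<alpha>0 * q y)"
  unfolding r1_def[abs_def] r0_def[abs_def] by (subst v1, subst flipped_heat[OF t1 bounded0 phase1]) simp
 have "\<alpha>0 / \<zeta> * xphase k \<theta> t2 = \<alpha>1" using phase2 zeta_nonzero by (simp add: field_simps)
 note f = flipped_heat[OF t2 bounded1 this]
 have "v0 y = \<zeta> * heat k t2 (\<lambda>y. sg y * r1 y + \<alpha>1 * q y) y + \<alpha>0 * W y" for y
  by (subst v0, subst f) (simp add: r1_def[abs_def] distrib_left zeta_nonzero)
 then show "r0 = (\<lambda>y. \<zeta> * heat k t2 (\<lambda>y. sg y * r1 y + \<alpha>1 * q y) y)"
  by (simp add: r0_def fun_eq_iff)
qed

lemma heat_source_split: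
 assumes "0 < t" "exp_bounded B 0 r"
 shows "heat k t (\<lambda>y. sg y * r y + c * q y) = (\<lambda>y. hstep k sg t r y + c * heat k t q y)"
 using heat_exp_bounded_add[OF k assms(1) exp_bounded_sg[OF assms(2)] exp_bounded_scale[OF exp_bounded_q, of c]]
 by (simp add: hstep_def heat_scale[OF k assms(1)])

lemma L2_r: "L2 r0" "L2 r1"
proof -
 obtain B' where B': "exp_bounded B' 0 (heat k t1 q)"
  by (rule kernel_conv_exp_bounded[OF k t1 exp_bounded_q order_refl]) (rule that)
 have e1: "r1 = (\<lambda>y. hstep k sg t1 r0 y + \<alpha>0 * heat k t1 q y)"
  by (subst r1_eq, subst heat_source_split[OF t1 bounded_r(1)]) simp
 have e0: "r0 = (\<lambda>y. \<zeta> * (hstep k sg t2 r1 y + \<alpha>1 * heat k t2 q y))"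
  by (subst r0_eq, subst heat_source_split[OF t2 bounded_r(2)]) simp
 have L: "L2 (\<lambda>y. c * heat k t q y)" if "0 < t" for c t by (intro L2_cmult L2_heat that k L2_q)
 show "L2 r0" by (rule bounded_pair_L2(1)[OF bounded_r(1) exp_bounded_scale[OF B'] L[OF t1] L[OF t2] order_refl e1 e0])
 show "L2 r1" by (rule bounded_pair_L2(2)[OF bounded_r(1) exp_bounded_scale[OF B'] L[OF t1] L[OF t2] order_refl e1 e0])
qed

text \<open>Reciprocity: up to the phase of the incident wave, the field at an edge is the directivity of the
 preceding edge in the direction \<open>\<theta>\<close>, because the strips passed backwards from the former are as wide
 as those passed forwards from the latter.\<close>

lemma v1_at_edge: "v1 0 = \<alpha>1 * edge_directivity \<theta>"
proof -
 have "r1 0 = \<alpha>0 * S0 q + \<zeta> * \<alpha>1 * S1 q"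
  by (rule field_at_node[OF L2_r L2_q r1_eq r0_eq])
 then have "r1 0 = - 2 * (\<alpha>0 * S0 (exp_lower k \<theta>) + \<zeta> * \<alpha>1 * S1 (exp_lower k \<theta>))"
  unfolding q_def[abs_def] S_scale[OF L2_exp_half_line(1)[OF kth]] by (simp add: algebra_simps)
 then show ?thesis
  by (simp add: r1_def edge_directivity_def phase1[symmetric] algebra_simps)
qed

text \<open>The operator \<open>\<partial>\<^sub>y + \<i> k \<theta>\<close> commutes with the heat flow and annihilates the incident wave; it
 does not commute with the flip \<open>sg\<close>, and the jump at \<open>y = 0\<close> produces a point source.\<close>

lemma annihilator_source:
 assumes t: "0 < t" and r: "exp_bounded B' 0 (\<lambda>y. v y - c * W y)" and dr: "exp_bounded B'' 0 dr"
  and d: "\<And>y. ((\<lambda>y. v y - c * W y) has_vector_derivative dr y) (at y)" and cdr: "continuous_on UNIV dr"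
 shows "(heat k t (\<lambda>y. sg y * v y) has_vector_derivative
   heat k t (\<lambda>y. sg y * (dr y + \<i> * k * \<theta> * (v y - c * W y))) y + 2 * v 0 * green k t y
   - \<i> * k * \<theta> * heat k t (\<lambda>y. sg y * v y) y) (at y)"
proof -
 define v' where "v' y = dr y - \<i> * k * \<theta> * c * W y" for y
 have dE: "(W has_vector_derivative - \<i> * k * \<theta> * W y) (at y)" for y
  by (rule has_vector_derivative_real_field[where f = "\<lambda>w. exp (- \<i> * k * \<theta> * w)"]) (auto intro!: derivative_eq_intros)
 have dv: "(v has_vector_derivative v' y) (at y)" for y
  using has_vector_derivative_add[OF d has_vector_derivative_mult_right[OF dE, of c], of y] by (simp add: v'_def mult_ac)
 have c: "0 \<le> Im (k * \<theta>)" using kth by simp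
 have bv: "exp_bounded (B' + cmod c * 1) (Im (k * \<theta>)) v"
  using exp_bounded_add[OF exp_bounded_mono[OF r c] exp_bounded_scale[OF exp_bounded_E, of c]] by simp
 have bv': "exp_bounded (B'' + cmod (- \<i> * k * \<theta> * c) * 1) (Im (k * \<theta>)) v'"
  using exp_bounded_add[OF exp_bounded_mono[OF dr c] exp_bounded_scale[OF exp_bounded_E, of "- \<i> * k * \<theta> * c"]]
  by (simp add: v'_def[abs_def] mult.assoc)
 have cv': "continuous_on UNIV v'" unfolding v'_def[abs_def] by (intro continuous_intros cdr)
 have "(\<lambda>y. sg y * (dr y + \<i> * k * \<theta> * (v y - c * W y))) = (\<lambda>y. sg y * v' y + \<i> * k * \<theta> * (sg y * v y))"
  by (simp add: v'_def algebra_simps)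
 then have "heat k t (\<lambda>y. sg y * (dr y + \<i> * k * \<theta> * (v y - c * W y)))
   = (\<lambda>y. heat k t (\<lambda>y. sg y * v' y) y + \<i> * k * \<theta> * heat k t (\<lambda>y. sg y * v y) y)"
  by (simp only: heat_exp_bounded_add[OF k t exp_bounded_sg[OF bv'] exp_bounded_scale[OF exp_bounded_sg[OF bv]] c c] heat_scale[OF k t])
 then show ?thesis using heat_sg_deriv[OF k t c bv bv' dv cv', of y] by simp
qed

lemma source_continuous:
 assumes r: "\<And>y. isCont r y" and y: "y \<noteq> 0"
 shows "isCont (\<lambda>y. sg y * r y + c * q y) y"
proof (cases "y < 0")
 case True
 \<comment> \<open>below the axis both terms are smooth; the jump is only at \<open>y = 0\<close>\<close>
 have "\<forall>\<^sub>F z in nhds y. z \<in> {..<0}" using True by (intro eventually_nhds_in_open) auto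
 then have "\<forall>\<^sub>F z in nhds y. sg z * r z + c * q z = - r z - 2 * (c * W z)"
  by eventually_elim (simp add: sg_def q_def exp_lower_def)
 moreover have "isCont (\<lambda>z. - r z - 2 * (c * W z)) y" by (intro continuous_intros r)
 ultimately show ?thesis by (simp only: isCont_cong)
next
 case False
 have "\<forall>\<^sub>F z in nhds y. z \<in> {0<..}" using False y by (intro eventually_nhds_in_open) auto
 then have "\<forall>\<^sub>F z in nhds y. sg z * r z + c * q z = r z"
  by eventually_elim (simp add: sg_def q_def exp_lower_def)
 with r[of y] show ?thesis by (simp only: isCont_cong)
qed

lemma isCont_r: "isCont r0 y" "isCont r1 y"
proof -
 have b: "exp_bounded (B + cmod c * 2) 0 (\<lambda>y. sg y * r y + c * q y)" if "exp_bounded B 0 r" for r c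
  by (intro exp_bounded_add exp_bounded_sg exp_bounded_scale that exp_bounded_q)
 show "isCont r1 y" unfolding r1_eq
  by (rule has_vector_derivative_continuous[OF heat_has_derivative[OF k t1 b[OF bounded_r(1)] order_refl]])
 have "isCont (heat k t2 (\<lambda>y. sg y * r1 y + \<alpha>1 * q y)) y"
  by (rule has_vector_derivative_continuous[OF heat_has_derivative[OF k t2 b[OF bounded_r(2)] order_refl]])
 then show "isCont r0 y" by (subst r0_eq) (intro continuous_intros)
qed

lemma r_C1:
 obtains dr0 dr1 B' B'' where
  "\<And>y. (r0 has_vector_derivative dr0 y) (at y)" "continuous_on UNIV dr0" "exp_bounded B' 0 dr0"
  "\<And>y. (r1 has_vector_derivative dr1 y) (at y)" "continuous_on UNIV dr1" "exp_bounded B'' 0 dr1"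
proof -
 have b: "exp_bounded (B + cmod c * 2) 0 (\<lambda>y. sg y * r y + c * q y)" if "exp_bounded B 0 r" for r c
  by (intro exp_bounded_add exp_bounded_sg exp_bounded_scale that exp_bounded_q)
 obtain g1 B1 where g1: "\<And>y. (heat k t1 (\<lambda>y. sg y * r0 y + \<alpha>0 * q y) has_vector_derivative g1 y) (at y)"
   "continuous_on UNIV g1" "exp_bounded B1 0 g1"
  by (rule heat_bounded_C1[OF k t1 b[OF bounded_r(1)] source_continuous[OF isCont_r(1)]]) (assumption, rule that)
 obtain g2 B2 where g2: "\<And>y. (heat k t2 (\<lambda>y. sg y * r1 y + \<alpha>1 * q y) has_vector_derivative g2 y) (at y)"
   "continuous_on UNIV g2" "exp_bounded B2 0 g2"
  by (rule heat_bounded_C1[OF k t2 b[OF bounded_r(2)] source_continuous[OF isCont_r(2)]]) (assumption, rule that)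
 show thesis
 proof (rule that)
  show "(r0 has_vector_derivative \<zeta> * g2 y) (at y)" for y
   by (subst r0_eq) (intro has_vector_derivative_mult_right g2(1))
  show "continuous_on UNIV (\<lambda>y. \<zeta> * g2 y)" by (intro continuous_intros g2(2))
  show "exp_bounded (cmod \<zeta> * B2) 0 (\<lambda>y. \<zeta> * g2 y)" by (rule exp_bounded_scale[OF g2(3)])
  show "(r1 has_vector_derivative g1 y) (at y)" for y by (subst r1_eq) (rule g1(1))
 qed (rule g1)+
qed

text \<open>The function \<open>(\<partial>\<^sub>y + \<i> k \<theta>) v\<close> contains no incident wave and is generated by the point sources of strength
 \<open>2 v(0)\<close> alone; integration by parts recovers the pairing of \<open>r1\<close> itself.\<close>

lemma node_relation:
 assumes \<psi>: "0 < Im (k * \<psi>)"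
 shows "\<alpha>1 + \<i> * k * (\<theta> - \<psi>) * pr r1 (exp_upper k \<psi>)
  = v1 0 + 2 * v0 0 * S0 (exp_upper k \<psi>)
   + 2 * \<zeta> * v1 0 * edge_sequence.S1 k t2 t1 \<zeta> (exp_upper k \<psi>)"
proof -
 obtain dr0 dr1 B' B'' where
  d0: "\<And>y. (r0 has_vector_derivative dr0 y) (at y)" "continuous_on UNIV dr0" "exp_bounded B' 0 dr0" and
  d1: "\<And>y. (r1 has_vector_derivative dr1 y) (at y)" "continuous_on UNIV dr1" "exp_bounded B'' 0 dr1"
  by (rule r_C1) (rule that)
 interpret swapped: edge_sequence k t2 t1 \<zeta> by unfold_locales (rule k t1 t2 z)+
 let ?h = "exp_upper k \<psi>" and ?D = "\<i> * k * \<theta>"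
 note h = L2_exp_half_line(2)[OF \<psi>]
 define p0 where "p0 y = dr0 y + ?D * r0 y" for y
 define p1 where "p1 y = dr1 y + ?D * r1 y" for y
 have dE: "(W has_vector_derivative - \<i> * k * \<theta> * W y) (at y)" for y
  by (rule has_vector_derivative_real_field[where f = "\<lambda>w. exp (- \<i> * k * \<theta> * w)"]) (auto intro!: derivative_eq_intros)
 have dv1: "(v1 has_vector_derivative dr1 y - ?D * (\<alpha>1 * W y)) (at y)" for y
  using has_vector_derivative_add[OF d1(1) has_vector_derivative_mult_right[OF dE, of \<alpha>1], of y] by (simp add: r1_def mult_ac)
 have dv0: "(v0 has_vector_derivative dr0 y - ?D * (\<alpha>0 * W y)) (at y)" for y
  using has_vector_derivative_add[OF d0(1) has_vector_derivative_mult_right[OF dE, of \<alpha>0], of y] by (simp add: r0_def mult_ac)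
 have e1: "p1 = (\<lambda>y. hstep k sg t1 p0 y + 2 * v0 0 * green k t1 y)"
 proof
  fix y
  from annihilator_source[OF t1 bounded0 d0(3) _ d0(2), of y] d0(1)
  have "(v1 has_vector_derivative hstep k sg t1 p0 y + 2 * v0 0 * green k t1 y - ?D * v1 y) (at y)"
   by (simp add: r0_def[abs_def] p0_def[abs_def] hstep_def v1[symmetric])
  from vector_derivative_unique_at[OF dv1 this]
  show "p1 y = hstep k sg t1 p0 y + 2 * v0 0 * green k t1 y" by (simp add: p1_def r1_def algebra_simps)
 qed
 have e0: "p0 = (\<lambda>y. \<zeta> * (hstep k sg t2 p1 y + 2 * v1 0 * green k t2 y))"
 proof
  fix y
  have "((\<lambda>y. \<zeta> * heat k t2 (\<lambda>y. sg y * v1 y) y) has_vector_derivative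
    \<zeta> * (hstep k sg t2 p1 y + 2 * v1 0 * green k t2 y - ?D * heat k t2 (\<lambda>y. sg y * v1 y) y)) (at y)"
   using annihilator_source[OF t2 bounded1 d1(3) _ d1(2), of y] d1(1)
   by (intro has_vector_derivative_mult_right) (simp add: r1_def[abs_def] p1_def[abs_def] hstep_def)
  then have "(v0 has_vector_derivative \<zeta> * (hstep k sg t2 p1 y + 2 * v1 0 * green k t2 y) - ?D * v0 y) (at y)"
   by (simp add: v0[symmetric] right_diff_distrib) (simp add: fun_cong[OF v0, of y] mult_ac)
  from vector_derivative_unique_at[OF dv0 this]
  show "p0 y = \<zeta> * (hstep k sg t2 p1 y + 2 * v1 0 * green k t2 y)" by (simp add: p0_def r0_def algebra_simps)
 qed
 obtain A where A: "exp_bounded A 1 (green k t1)" by (rule exp_bounded_green[OF k t1]) (rule that)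
 have b0: "exp_bounded (B' + cmod ?D * B) 0 p0" unfolding p0_def[abs_def] by (intro exp_bounded_add exp_bounded_scale d0 bounded_r)
 have Lg: "L2 (\<lambda>y. c * green k t y)" if "0 < t" for c t by (intro L2_cmult L2_green that)
 note L = bounded_pair_L2[OF b0 exp_bounded_scale[OF A] Lg[OF t1] Lg[OF t2] zero_le_one e1 e0]
 have "pr p1 ?h = 2 * v0 0 * S0 ?h + 2 * \<zeta> * v1 0 * swapped.S1 ?h"
  unfolding swapped.S1_def by (rule source_expansion[OF L(2,1) h e1[unfolded hstep_def] e0[unfolded hstep_def]])
 moreover have "pr p1 ?h = - r1 0 + \<i> * k * (\<theta> - \<psi>) * pr r1 ?h"
  unfolding p1_def[abs_def] by (rule pr_exp_upper_derivative[OF bounded_r(2) d1(3) d1(1) d1(2) \<psi> L2_r(2)]) (use L(2) in \<open>simp add: p1_def[abs_def]\<close>)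
 ultimately show ?thesis by (simp add: r1_def algebra_simps)
qed

lemma edge_directivity_upper:
 assumes "0 < Im (k * \<psi>)"
 shows "edge_directivity \<psi> = 1 - 2 * xphase k \<psi> t1 * S0 (exp_upper k \<psi>) + 2 * \<zeta> * S1 (exp_upper k \<psi>)"
 by (simp add: edge_directivity_def S_upper[OF assms] algebra_simps)

text \<open>A field depending on two directions is expressed through functions of one direction: on the right hand
 side only products of edge directivities at \<open>\<theta>\<close> and at \<open>\<psi>\<close> occur.\<close>

theorem embedding_formula:
 assumes \<psi>: "0 < Im (k * \<psi>)" and per: "xphase k \<psi> t1 * xphase k \<psi> t2 = \<zeta>"
 shows "\<alpha>0 - xphase k \<psi> t1 * \<alpha>1
   + \<i> * k * (\<theta> - \<psi>) * (pr r0 (exp_upper k \<psi>) - xphase k \<psi> t1 * pr r1 (exp_upper k \<psi>))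
  = \<alpha>0 * edge_sequence.edge_directivity k t2 t1 \<zeta> \<theta> * edge_directivity \<psi>
   - xphase k \<psi> t1 * (\<alpha>1 * edge_directivity \<theta> * edge_sequence.edge_directivity k t2 t1 \<zeta> \<psi>)"
proof -
 interpret swapped: scattering_pair k t2 t1 \<zeta> \<theta> \<alpha>1 "\<alpha>0 / \<zeta>" v1 "\<lambda>y. v0 y / \<zeta>" B by (rule swap)
 let ?h = "exp_upper k \<psi>" and ?x = "xphase k \<psi> t1" and ?y = "xphase k \<psi> t2"
 have r: "swapped.r1 = (\<lambda>y. 1 / \<zeta> * r0 y)" by (simp add: swapped.r1_def[abs_def] r0_def[abs_def] diff_divide_distrib)
 have v00: "v0 0 = \<alpha>0 * swapped.edge_directivity \<theta>" using swapped.v1_at_edge zeta_nonzero by (simp add: field_simps)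
 have "\<alpha>0 / \<zeta> + \<i> * k * (\<theta> - \<psi>) * (1 / \<zeta> * pr r0 ?h)
   = v0 0 / \<zeta> + 2 * v1 0 * swapped.S0 ?h + 2 * \<zeta> * (v0 0 / \<zeta>) * S1 ?h"
  using swapped.node_relation[OF \<psi>] unfolding r pr_cmult_left .
 from arg_cong[OF this, of "\<lambda>w. \<zeta> * w"]
 have 0: "\<alpha>0 + \<i> * k * (\<theta> - \<psi>) * pr r0 ?h = v0 0 + 2 * \<zeta> * v1 0 * swapped.S0 ?h + 2 * \<zeta> * v0 0 * S1 ?h"
  using zeta_nonzero by (simp add: distrib_left mult_ac)
 have 1: "\<alpha>1 + \<i> * k * (\<theta> - \<psi>) * pr r1 ?h = v1 0 + 2 * v0 0 * S0 ?h + 2 * \<zeta> * v1 0 * swapped.S1 ?h"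
  by (rule node_relation[OF \<psi>])
 have "\<alpha>0 - ?x * \<alpha>1 + \<i> * k * (\<theta> - \<psi>) * (pr r0 ?h - ?x * pr r1 ?h)
   = (\<alpha>0 + \<i> * k * (\<theta> - \<psi>) * pr r0 ?h) - ?x * (\<alpha>1 + \<i> * k * (\<theta> - \<psi>) * pr r1 ?h)"
  by (simp add: algebra_simps)
 also have "\<dots> = v0 0 * edge_directivity \<psi> - ?x * (v1 0 * swapped.edge_directivity \<psi>)"
  unfolding 0 1 edge_directivity_upper[OF \<psi>] swapped.edge_directivity_upper[OF \<psi>]
  by (simp add: algebra_simps per[symmetric])
 finally show ?thesis unfolding v00 v1_at_edge .
qed

end

section \<open>The flux through a horizontal line\<close>

lemma integral_exp_interval:
 fixes c :: complex
 assumes c: "c \<noteq> 0" and x: "x0 \<le> x1"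
 shows "(LINT x:{x0<..<x1}|lborel. exp (c * of_real x)) = (exp (c * of_real x1) - exp (c * of_real x0)) / c"
proof -
 have "(LINT x:{x0<..<x1}|lborel. exp (c * of_real x)) = (LINT x|lborel. indicator {x0..x1} x *\<^sub>R exp (c * of_real x))"
  unfolding set_lebesgue_integral_def
 proof (rule integral_cong_AE)
  show "AE x in lborel. indicator {x0<..<x1} x *\<^sub>R exp (c * of_real x) = indicator {x0..x1} x *\<^sub>R exp (c * of_real x)"
   using AE_lborel_singleton[of x0] AE_lborel_singleton[of x1] by eventually_elim (auto simp: indicator_def)
 qed measurable
 also have "\<dots> = exp (c * of_real x1) / c - exp (c * of_real x0) / c"
 proof (rule integral_FTC_Icc[OF x])
  show "((\<lambda>x. exp (c * of_real x) / c) has_vector_derivative exp (c * of_real y)) (at y within {x0..x1})" for y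
   by (rule has_vector_derivative_at_within, rule has_vector_derivative_real_field[where f = "\<lambda>w. exp (c * w) / c"])
     (auto intro!: derivative_eq_intros simp: c)
  show "continuous_on {x0..x1} (\<lambda>x. exp (c * complex_of_real x))" by (intro continuous_intros)
 qed
 finally show ?thesis by (simp add: diff_divide_distrib)
qed

lemma integral_exp_half_line:
 assumes c: "Re c < 0"
 shows "set_integrable lborel {0<..} (\<lambda>x. exp (c * of_real x))"
  and "(LINT x:{0<..}|lborel. exp (c * of_real x)) = - 1 / c"
proof -
 have n: "cmod (exp (c * of_real x)) = exp (Re c * x)" for x by (simp add: norm_exp_eq_Re)
 have m: "(\<lambda>x. exp (c * complex_of_real x)) \<in> borel_measurable borel" by measurable
 show i: "set_integrable lborel {0<..} (\<lambda>x. exp (c * of_real x))"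
  unfolding set_integrable_def
 proof (rule Bochner_Integration.integrable_bound[OF integrable_exp_abs[of "- Re c"]])
  show "AE x in lborel. norm (indicator {0<..} x *\<^sub>R exp (c * of_real x)) \<le> norm (exp (- (- Re c) * \<bar>x\<bar>))"
   by (intro AE_I2) (simp add: indicator_def n)
 qed (use c m in auto)
 have "(LINT x:{0<..}|lborel. exp (c * of_real x)) = - (exp (c * of_real 0) / c)"
 proof (rule integral_derivative_half_line[OF _ _ i])
  show "((\<lambda>x. exp (c * of_real x) / c) has_vector_derivative exp (c * of_real y)) (at y)" for y
   by (rule has_vector_derivative_real_field[where f = "\<lambda>w. exp (c * w) / c"]) (use c in \<open>auto intro!: derivative_eq_intros\<close>)
  show "continuous_on UNIV (\<lambda>x. exp (c * complex_of_real x))" by (intro continuous_intros)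
  show "((\<lambda>x. exp (c * complex_of_real x) / c) \<longlongrightarrow> 0) at_top"
  proof (rule Lim_null_comparison)
   show "\<forall>\<^sub>F x in at_top. norm (exp (c * of_real x) / c) \<le> exp (Re c * x) / cmod c"
    by (simp add: norm_divide n)
   have "((\<lambda>x. exp (- d * x)) \<longlongrightarrow> 0) at_top" if "0 < d" for d :: real using that by real_asymp
   from tendsto_divide_zero[OF this[of "- Re c"]] c
   show "((\<lambda>x. exp (Re c * x) / cmod c) \<longlongrightarrow> 0) at_top" by simp
  qed
 qed
 then show "(LINT x:{0<..}|lborel. exp (c * of_real x)) = - 1 / c" by simp
qed

lemma decaying_integrable:
 assumes \<psi>: "0 < Im (k * \<psi>)" and f: "exp_bounded B 0 f"
 shows "integrable lborel (\<lambda>s. f (y0 - s) * decaying k \<psi> s)"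
proof (rule Bochner_Integration.integrable_bound)
 show "integrable lborel (\<lambda>s. B * exp (- Im (k * \<psi>) * \<bar>s\<bar>))" by (intro integrable_mult_right integrable_exp_abs \<psi>)
 have [measurable]: "f \<in> borel_measurable borel" using f by (simp add: exp_bounded_def)
 show "(\<lambda>s. f (y0 - s) * decaying k \<psi> s) \<in> borel_measurable lborel" by measurable
 have "cmod (f (y0 - s) * decaying k \<psi> s) \<le> \<bar>B * exp (- Im (k * \<psi>) * \<bar>s\<bar>)\<bar>" for s
 proof -
  have "cmod (f (y0 - s)) \<le> B" using f by (simp add: exp_bounded_def)
  then have "cmod (f (y0 - s)) * exp (- Im (k * \<psi>) * \<bar>s\<bar>) \<le> B * exp (- Im (k * \<psi>) * \<bar>s\<bar>)" by (intro mult_right_mono) auto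
  then show ?thesis by (simp only: norm_mult norm_decaying)
 qed
 then show "AE s in lborel. norm (f (y0 - s) * decaying k \<psi> s) \<le> norm (B * exp (- Im (k * \<psi>) * \<bar>s\<bar>))"
  by (intro AE_I2) (simp only: real_norm_def)
qed

text \<open>Since \<open>f + sg f\<close> lives on the upper half line, where \<open>|y0 - y| = y - y0\<close>, the convolution at a
 point below the axis factorises.\<close>

lemma decaying_fold:
 assumes \<psi>: "0 < Im (k * \<psi>)" and f: "exp_bounded B 0 f" and y0: "y0 < 0"
 shows "(LINT s|lborel. f (y0 - s) * decaying k \<psi> s) + (LINT s|lborel. sg (y0 - s) * f (y0 - s) * decaying k \<psi> s)
  = 2 * exp (- \<i> * k * \<psi> * of_real y0) * pr f (exp_upper k \<psi>)"
proof -
 have m[measurable]: "f \<in> borel_measurable borel" using f by (simp add: exp_bounded_def)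
 have [measurable]: "exp_upper k \<psi> \<in> borel_measurable borel" using L2_measurable[OF L2_exp_half_line(2)[OF \<psi>]] .
 have "(LINT s|lborel. f (y0 - s) * decaying k \<psi> s) + (LINT s|lborel. sg (y0 - s) * f (y0 - s) * decaying k \<psi> s)
   = (LINT s|lborel. f (y0 - s) * decaying k \<psi> s + sg (y0 - s) * f (y0 - s) * decaying k \<psi> s)"
  using Bochner_Integration.integral_add[OF decaying_integrable[OF \<psi> f, of y0] decaying_integrable[OF \<psi> exp_bounded_sg[OF f], of y0]] by simp
 also have "\<dots> = (LINT y|lborel. f y * decaying k \<psi> (y0 - y) + sg y * f y * decaying k \<psi> (y0 - y))"
  by (subst lborel_integral_real_affine[of "-1" _ y0]) auto
 also have "\<dots> = (LINT y|lborel. 2 * exp (- \<i> * k * \<psi> * of_real y0) * (f y * exp_upper k \<psi> y))"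
 proof (rule integral_cong_AE)
  show "AE y in lborel. f y * decaying k \<psi> (y0 - y) + sg y * f y * decaying k \<psi> (y0 - y)
    = 2 * exp (- \<i> * k * \<psi> * of_real y0) * (f y * exp_upper k \<psi> y)"
   using AE_lborel_singleton[of 0]
  proof eventually_elim
   case (elim y)
   have "0 < y ==> decaying k \<psi> (y0 - y) = exp (- \<i> * k * \<psi> * of_real y0) * exp (\<i> * k * \<psi> * of_real y)"
    using y0 by (simp add: decaying_def right_diff_distrib flip: exp_add)
   with elim show ?case by (cases "y < 0") (auto simp: sg_def exp_upper_def)
  qed
 qed measurable
 finally show ?thesis by (simp add: pr_def)
qed

text \<open>The three ranges of \<open>s\<close> are those where the lower exponential vanishes, where the mode grows, and where
 it decays.\<close>

lemma decaying_exp_lower: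
 assumes \<psi>: "0 < Im (k * \<psi>)" and \<theta>: "0 < Im (k * \<theta>)" and ne: "\<theta> \<noteq> \<psi>" and y0: "y0 < 0"
 shows "(LINT s|lborel. exp_lower k \<theta> (y0 - s) * decaying k \<psi> s)
  = (exp (- \<i> * k * \<theta> * of_real y0) - exp (- \<i> * k * \<psi> * of_real y0)) / (\<i> * k * (\<theta> - \<psi>))
   - exp (- \<i> * k * \<theta> * of_real y0) / (\<i> * k * (\<theta> + \<psi>))"
proof -
 let ?E = "exp (- \<i> * k * \<theta> * of_real y0)"
 define c1 where "c1 = \<i> * k * (\<theta> - \<psi>)"
 define c2 where "c2 = \<i> * k * (\<theta> + \<psi>)"
 have k: "k \<noteq> 0" using \<psi> by auto
 have c1: "c1 \<noteq> 0" using k ne by (simp add: c1_def)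
 have c2: "Re c2 < 0" using \<psi> \<theta> by (simp add: c2_def algebra_simps)
 have i1: "integrable lborel (\<lambda>s. indicator {y0<..<0} s *\<^sub>R exp (c1 * of_real s))"
 proof -
  have "set_integrable lborel {y0..0} (\<lambda>s. exp (c1 * of_real s))"
   by (intro borel_integrable_atLeastAtMost') (intro continuous_intros)
  then have "set_integrable lborel {y0<..<0} (\<lambda>s. exp (c1 * of_real s))" by (rule set_integrable_subset) auto
  then show ?thesis by (simp add: set_integrable_def)
 qed
 note i2 = integral_exp_half_line(1)[OF c2, unfolded set_integrable_def]
 have [measurable]: "exp_lower k \<theta> \<in> borel_measurable borel" using L2_measurable[OF L2_exp_half_line(1)[OF \<theta>]] .
 have "(LINT s|lborel. exp_lower k \<theta> (y0 - s) * decaying k \<psi> s)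
   = (LINT s|lborel. ?E * (indicator {y0<..<0} s *\<^sub>R exp (c1 * of_real s) + indicator {0<..} s *\<^sub>R exp (c2 * of_real s)))"
 proof (rule integral_cong_AE)
  show "AE s in lborel. exp_lower k \<theta> (y0 - s) * decaying k \<psi> s
    = ?E * (indicator {y0<..<0} s *\<^sub>R exp (c1 * of_real s) + indicator {0<..} s *\<^sub>R exp (c2 * of_real s))"
   using AE_lborel_singleton[of 0]
  proof eventually_elim
   case (elim s)
   have E: "exp (- \<i> * k * \<theta> * of_real (y0 - s)) = ?E * exp (\<i> * k * \<theta> * of_real s)" by (simp add: algebra_simps flip: exp_add)
   consider "s \<le> y0" | "y0 < s" "s < 0" | "0 < s" using elim by linarith
   then show ?case
   proof cases
    case 1
    then show ?thesis using y0 by (simp add: exp_lower_def)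
   next
    case 2
    have "exp (\<i> * k * \<theta> * of_real s) * decaying k \<psi> s = exp (c1 * of_real s)"
     using 2 by (simp add: decaying_def c1_def algebra_simps flip: exp_add)
    with 2 show ?thesis by (simp only: exp_lower_def E) simp
   next
    case 3
    have "exp (\<i> * k * \<theta> * of_real s) * decaying k \<psi> s = exp (c2 * of_real s)"
     using 3 by (simp add: decaying_def c2_def algebra_simps flip: exp_add)
    with 3 y0 show ?thesis by (simp only: exp_lower_def E) simp
   qed
  qed
 qed measurable
 also have "\<dots> = ?E * ((LINT s:{y0<..<0}|lborel. exp (c1 * of_real s)) + (LINT s:{0<..}|lborel. exp (c2 * of_real s)))"
  unfolding set_lebesgue_integral_def using Bochner_Integration.integral_add[OF i1 i2] by simp
 also have "\<dots> = ?E * ((1 - exp (c1 * of_real y0)) / c1 - 1 / c2)"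
  using y0 by (simp add: integral_exp_interval[OF c1] integral_exp_half_line(2)[OF c2])
 also have "\<dots> = (?E - ?E * exp (c1 * of_real y0)) / c1 - ?E / c2" by (simp add: right_diff_distrib)
 also have "?E * exp (c1 * of_real y0) = exp (- \<i> * k * \<psi> * of_real y0)" by (simp add: c1_def algebra_simps flip: exp_add)
 finally show ?thesis by (simp only: c1_def c2_def)
qed

context grating
begin

lemma comb_xphase_integrable:
 assumes \<sigma>: "\<sigma> = 1 \<or> \<sigma> = - 1" and nn: "\<And>x. x \<in> {x0<..<x1} ==> x \<notin> range (node a b)" and sub: "{x0..x1} \<subseteq> {0..a}" and k\<psi>: "k * \<psi>\<^sup>2 \<in> \<real>"
 shows "set_integrable lborel {x0<..<x1} (\<lambda>x. xphase k \<psi> x * (comb \<sigma> x y - incident k \<theta> x y))"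
proof -
 obtain fx fy fyy where f: "strip_solution (diffusivity k) x0 x1 (comb \<sigma>) fx fy fyy"
  by (rule comb_strip_solution[of x0 x1 \<sigma>]) (rule nn, assumption, rule that)
 obtain D where D: "0 \<le> D" "\<And>x y. x \<in> {0..a} ==> \<not> branch_point a b x y ==> cmod (comb \<sigma> x y - incident k \<theta> x y) \<le> D"
  by (rule comb_minus_incident_bounded[OF \<sigma>]) (rule that)
 have nx: "cmod (xphase k \<psi> x) = 1" for x
 proof -
  have "\<i> * k * of_real x * \<psi>\<^sup>2 / 2 = of_real (x / 2) * (\<i> * (k * \<psi>\<^sup>2))" by simp
  moreover have "Im (k * \<psi>\<^sup>2) = 0" using k\<psi> by (simp add: complex_is_Real_iff)
  ultimately have "Re (\<i> * k * of_real x * \<psi>\<^sup>2 / 2) = 0" by (simp only: Re_complex_of_real complex.sel) simp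
  then show ?thesis by (simp add: xphase_def norm_exp_eq_Re)
 qed
 have "continuous_on {x0<..<x1} (\<lambda>x. xphase k \<psi> x * (comb \<sigma> x y - incident k \<theta> x y))"
  unfolding xphase_def incident_def by (intro continuous_intros strip_solution_cont_x(1)[OF f order_refl]) auto
 then have m: "(\<lambda>x. indicator {x0<..<x1} x *\<^sub>R (xphase k \<psi> x * (comb \<sigma> x y - incident k \<theta> x y))) \<in> borel_measurable borel"
  by (intro borel_measurable_continuous_on_indicator) auto
 show ?thesis
  unfolding set_integrable_def
 proof (rule Bochner_Integration.integrable_bound)
  show "integrable lborel (\<lambda>x. indicat_real {x0<..<x1} x * D)"
   by (intro integrable_mult_left integrable_real_indicator) (cases "x0 \<le> x1"; simp)+
  show "AE x in lborel. norm (indicator {x0<..<x1} x *\<^sub>R (xphase k \<psi> x * (comb \<sigma> x y - incident k \<theta> x y)))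
    \<le> norm (indicat_real {x0<..<x1} x * D)"
  proof (intro AE_I2)
   fix x
   show "norm (indicator {x0<..<x1} x *\<^sub>R (xphase k \<psi> x * (comb \<sigma> x y - incident k \<theta> x y)))
    \<le> norm (indicat_real {x0<..<x1} x * D)"
   proof (cases "x \<in> {x0<..<x1}")
    case True
    then have "x \<in> {0..a}" "\<not> branch_point a b x y" using sub nn[OF True] by (force simp: branch_point_def)+
    then show ?thesis using True D by (simp add: norm_mult nx)
   qed simp
  qed
 qed (use m in simp)
qed

lemma xphase_incident:
 assumes c: "k * (\<psi>\<^sup>2 - \<theta>\<^sup>2) \<noteq> 0" and x: "x0 \<le> x1"
 shows "set_integrable lborel {x0<..<x1} (\<lambda>x. xphase k \<psi> x * incident k \<theta> x y)"
  and "(LINT x:{x0<..<x1}|lborel. xphase k \<psi> x * incident k \<theta> x y)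
   = E y * 2 * (xphase k \<psi> x1 * exp (- \<i> * k * of_real x1 * \<theta>\<^sup>2 / 2) - xphase k \<psi> x0 * exp (- \<i> * k * of_real x0 * \<theta>\<^sup>2 / 2))
    / (\<i> * k * (\<psi>\<^sup>2 - \<theta>\<^sup>2))"
proof -
 define \<beta> where "\<beta> = \<i> * k * (\<psi>\<^sup>2 - \<theta>\<^sup>2) / 2"
 have l0: "\<beta> \<noteq> 0" using c by (auto simp: \<beta>_def)
 have x': "xphase k \<psi> x * exp (- \<i> * k * of_real x * \<theta>\<^sup>2 / 2) = exp (\<beta> * of_real x)" for x
  by (simp add: xphase_def \<beta>_def algebra_simps diff_divide_distrib flip: exp_add)
 have e: "xphase k \<psi> x * incident k \<theta> x y = E y * exp (\<beta> * of_real x)" for x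
  unfolding incident_E x'[symmetric] by (simp only: mult_ac)
 have "set_integrable lborel {x0..x1} (\<lambda>x. E y * exp (\<beta> * of_real x))"
  by (intro borel_integrable_atLeastAtMost') (intro continuous_intros)
 then show "set_integrable lborel {x0<..<x1} (\<lambda>x. xphase k \<psi> x * incident k \<theta> x y)"
  unfolding e by (rule set_integrable_subset) auto
 have "(LINT x:{x0<..<x1}|lborel. xphase k \<psi> x * incident k \<theta> x y) = E y * ((exp (\<beta> * of_real x1) - exp (\<beta> * of_real x0)) / \<beta>)"
  unfolding e by (simp add: integral_exp_interval[OF l0 x])
 then show "(LINT x:{x0<..<x1}|lborel. xphase k \<psi> x * incident k \<theta> x y)
   = E y * 2 * (xphase k \<psi> x1 * exp (- \<i> * k * of_real x1 * \<theta>\<^sup>2 / 2) - xphase k \<psi> x0 * exp (- \<i> * k * of_real x0 * \<theta>\<^sup>2 / 2))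
    / (\<i> * k * (\<psi>\<^sup>2 - \<theta>\<^sup>2))"
  unfolding x' by (simp add: \<beta>_def)
qed

lemma phase_relation: "xphase k \<theta> a = \<zeta>" "xphase k \<theta> b * \<mu>b = 1"
 by (simp_all add: xphase_def \<zeta>_def \<mu>b_def flip: exp_add)

lemma directivity_edges:
 assumes z: "\<zeta> \<noteq> 1" and \<psi>: "0 < Im (k * \<psi>)" and per: "xphase k \<psi> a = \<zeta>"
 shows "directivity a b k 0 \<psi> = edge_sequence.edge_directivity k b (a - b) \<zeta> \<psi>"
  and "directivity a b k 1 \<psi> = edge_sequence.edge_directivity k (a - b) b \<zeta> \<psi>"
proof -
 interpret e01: edge_sequence k b "a - b" \<zeta> by unfold_locales (use k b0 ba norm_\<zeta> z in auto)
 interpret e10: edge_sequence k "a - b" b \<zeta> by unfold_locales (use k b0 ba norm_\<zeta> z in auto)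
 show "directivity a b k 0 \<psi> = e01.edge_directivity \<psi>" "directivity a b k 1 \<psi> = e10.edge_directivity \<psi>"
  using directivity_series[OF b0 ba k norm_\<zeta> z \<psi> per, of 0] directivity_series[OF b0 ba k norm_\<zeta> z \<psi> per, of 1]
  by (simp_all add: strip_width_def e01.edge_directivity_def e10.edge_directivity_def)
qed

text \<open>The conserved current between the field and a mode of the adjoint problem, taken across the
 line \<open>y = y0\<close> over one period, and expressed through the values of the field on the upper halves
 of the nodes, where the embedding formula applies.\<close>

lemma mode_integral:
 assumes z: "\<zeta> \<noteq> 1" and \<psi>: "0 < Im (k * \<psi>)" and per: "xphase k \<psi> a = \<zeta>" and ne: "\<psi> \<noteq> \<theta>"
  and k\<psi>: "k * \<psi>\<^sup>2 \<in> \<real>" and y0: "y0 < 0"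
 shows "\<i> * k * \<psi> * (\<theta> - \<psi>) * ((LINT x:{b<..<a}|lborel. xphase k \<psi> x * comb (- 1) x y0)
   - (LINT x:{0<..<b}|lborel. xphase k \<psi> x * comb (- 1) x y0))
  = 2 * exp (- \<i> * k * \<psi> * of_real y0) * (- directivity a b k 0 \<psi> * directivity a b k 1 \<theta>
    + directivity a b k 1 \<psi> * directivity a b k 0 \<theta> * (xphase k \<psi> b * \<mu>b))"
proof -
 have m1: "(- 1 :: complex) = 1 \<or> (- 1 :: complex) = - 1" by simp
 obtain v0 v1 B where v: "v1 = heat k b (\<lambda>y. jump (- 1) y * v0 y)" "v0 = (\<lambda>y. \<zeta> * heat k (a - b) (\<lambda>y. jump (- 1) y * v1 y) y)"
  and bd: "exp_bounded B 0 (\<lambda>y. v0 y - E y)" "exp_bounded B 0 (\<lambda>y. v1 y - \<mu>b * E y)"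
  and at: "\<And>y. y \<noteq> 0 ==> v0 y = comb (- 1) 0 y" "\<And>y. y \<noteq> 0 ==> v1 y = comb (- 1) b y"
  by (rule slices[OF m1]) (rule that)
 interpret scattering_pair k b "a - b" \<zeta> \<theta> 1 \<mu>b v0 v1 B
 proof unfold_locales
  have "xphase k \<theta> b * xphase k \<theta> (a - b) = \<zeta>" by (simp add: phase_relation(1) flip: xphase_add)
  then have "\<mu>b * xphase k \<theta> b * xphase k \<theta> (a - b) = \<zeta> * \<mu>b" by (simp add: mult_ac)
  moreover show p: "\<mu>b * xphase k \<theta> b = 1" using phase_relation(2) by (simp add: mult.commute)
  ultimately show "1 * xphase k \<theta> (a - b) = \<zeta> * \<mu>b" by simp
  show "exp_bounded B 0 (\<lambda>y. v0 y - 1 * exp (- \<i> * k * \<theta> * of_real y))" using bd(1) by (simp add: E_def)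
  show "exp_bounded B 0 (\<lambda>y. v1 y - \<mu>b * exp (- \<i> * k * \<theta> * of_real y))" using bd(2) by (simp add: E_def)
 qed (use k b0 ba norm_\<zeta> z kth v in \<open>auto simp: jump_simps\<close>)
 let ?h = "exp_upper k \<psi>" and ?x = "xphase k \<psi> b" and ?P = "exp (- \<i> * k * \<psi> * of_real y0)"
 have kne: "k * (\<psi>\<^sup>2 - \<theta>\<^sup>2) \<noteq> 0" and sum_ne: "k * (\<theta> + \<psi>) \<noteq> 0"
 proof -
  have "0 < Im (k * (\<theta> + \<psi>))" using \<psi> kth by (simp add: distrib_left)
  then show s: "k * (\<theta> + \<psi>) \<noteq> 0" by (intro notI) (simp only: zero_complex.sel less_irrefl)
  have "k * (\<psi>\<^sup>2 - \<theta>\<^sup>2) = k * (\<theta> + \<psi>) * (\<psi> - \<theta>)" by (simp add: power2_eq_square algebra_simps)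
  then show "k * (\<psi>\<^sup>2 - \<theta>\<^sup>2) \<noteq> 0" using s ne by simp
 qed
 have nn0: "x \<in> {0<..<b} ==> x \<notin> range (node a b)" and nnb: "x \<in> {b<..<a} ==> x \<notin> range (node a b)" for x
  using not_node by auto
 have sub: "{0..b} \<subseteq> {0..a}" "{b..a} \<subseteq> {0..a}" using b0 ba by auto
 \<comment> \<open>the averages of the field over the lines \<open>x = 0, b, a\<close> against the decaying mode\<close>
 define \<Lambda> where "\<Lambda> f = (LINT s|lborel. f (y0 - s) * decaying k \<psi> s)" for f
 have \<Lambda>_add: "\<Lambda> (\<lambda>y. f y + g y) = \<Lambda> f + \<Lambda> g" if "exp_bounded B1 0 f" "exp_bounded B2 0 g" for f g B1 B2
  using decaying_integrable[OF \<psi> that(1)] decaying_integrable[OF \<psi> that(2)] by (simp add: \<Lambda>_def distrib_right)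
 have \<Lambda>_scale: "\<Lambda> (\<lambda>y. c * f y) = c * \<Lambda> f" for c f by (simp add: \<Lambda>_def mult.assoc)
 have \<Lambda>_fold: "\<Lambda> f + \<Lambda> (\<lambda>y. sg y * f y) = 2 * ?P * pr f ?h" if "exp_bounded B1 0 f" for f B1
  using decaying_fold[OF \<psi> that y0] by (simp add: \<Lambda>_def)
 have EE: "E y = exp (- \<i> * k * \<theta> * of_real y)" for y by (rule E_def)
 have sgE: "sg y * E y = E y + q y" for y using sg_E by (simp add: E_def)
 have r0': "r0 = (\<lambda>y. v0 y - E y)" and r1': "r1 = (\<lambda>y. v1 y - \<mu>b * E y)" by (auto simp: r0_def r1_def E_def)
 have src0: "sg y * v0 y - E y = sg y * r0 y + q y" for y
  using sgE[of y] by (simp add: r0' algebra_simps)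
 have src1: "sg y * v1 y - \<mu>b * E y = sg y * r1 y + \<mu>b * q y" for y
 proof -
  have "sg y * v1 y - \<mu>b * E y = sg y * r1 y + \<mu>b * (sg y * E y - E y)" by (simp add: r1' algebra_simps)
  then show ?thesis by (simp add: sgE)
 qed
 have vm: "v0 \<in> borel_measurable borel" "v1 \<in> borel_measurable borel"
 proof -
  have "(\<lambda>y. (v0 y - E y) + E y) \<in> borel_measurable borel" "(\<lambda>y. (v1 y - \<mu>b * E y) + \<mu>b * E y) \<in> borel_measurable borel"
   by (intro borel_measurable_add borel_measurable_times borel_measurable_const; use bd E_exp_bounded in \<open>simp add: exp_bounded_def\<close>)+
  then show "v0 \<in> borel_measurable borel" "v1 \<in> borel_measurable borel" by simp_all
 qed
 define I0 where "I0 = (LINT x:{0<..<b}|lborel. xphase k \<psi> x * (comb (- 1) x y0 - incident k \<theta> x y0))"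
 define I1 where "I1 = (LINT x:{b<..<a}|lborel. xphase k \<psi> x * (comb (- 1) x y0 - incident k \<theta> x y0))"
 have x0: "xphase k \<psi> 0 = 1" by (simp add: xphase_def)
 have flux0: "- \<psi> * I0 = ?x * \<Lambda> r1 - (\<Lambda> (\<lambda>y. sg y * r0 y) + \<Lambda> q)"
 proof -
  have "- \<psi> * I0 = ?x * (LINT s|lborel. (v1 (y0 - s) - incident k \<theta> b (y0 - s)) * decaying k \<psi> s)
    - xphase k \<psi> 0 * (LINT s|lborel. (jump (- 1) (y0 - s) * v0 (y0 - s) - incident k \<theta> 0 (y0 - s)) * decaying k \<psi> s)"
   unfolding I0_def by (rule strip_flux[OF m1 b0 nodes_0ba(1,2) nn0 sub(1) at(1) vm(1) at(2) vm(2) \<psi>])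
  then have "- \<psi> * I0 = ?x * \<Lambda> r1 - \<Lambda> (\<lambda>y. sg y * r0 y + q y)"
   by (simp add: incident_nodes jump_simps x0 src0 r1' \<Lambda>_def)
  then show ?thesis by (simp only: \<Lambda>_add[OF exp_bounded_sg[OF bounded_r(1)] exp_bounded_q])
 qed
 have flux1: "- \<psi> * I1 = \<Lambda> r0 - ?x * (\<Lambda> (\<lambda>y. sg y * r1 y) + \<mu>b * \<Lambda> q)"
 proof -
  have ata: "\<mu> * v0 y = comb (- 1) a y" if "y \<noteq> 0" for y using comb_floquet[OF that] at(1)[OF that] by simp
  have vma: "(\<lambda>y. \<mu> * v0 y) \<in> borel_measurable borel" using vm by measurable
  have "- \<psi> * I1 = xphase k \<psi> a * (LINT s|lborel. (\<mu> * v0 (y0 - s) - incident k \<theta> a (y0 - s)) * decaying k \<psi> s)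
    - ?x * (LINT s|lborel. (jump (- 1) (y0 - s) * v1 (y0 - s) - incident k \<theta> b (y0 - s)) * decaying k \<psi> s)"
   unfolding I1_def by (rule strip_flux[OF m1 ba nodes_0ba(2,3) nnb sub(2) at(2) vm(2) ata vma \<psi>])
  then have "- \<psi> * I1 = \<zeta> * \<Lambda> (\<lambda>y. \<mu> * r0 y) - ?x * \<Lambda> (\<lambda>y. sg y * r1 y + \<mu>b * q y)"
   by (simp add: incident_nodes jump_simps per src1 r0' \<Lambda>_def right_diff_distrib)
  then show ?thesis
   using \<zeta>\<mu> by (simp only: \<Lambda>_add[OF exp_bounded_sg[OF bounded_r(2)] exp_bounded_scale[OF exp_bounded_q]] \<Lambda>_scale mult.assoc[symmetric] mult_1_left)
 qed
 define X where "X = pr r0 ?h - ?x * pr r1 ?h"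
 have "\<psi> * (I1 - I0) = (- \<psi> * I0) - (- \<psi> * I1)" by (simp add: algebra_simps)
 also have "\<dots> = ?x * (\<Lambda> r1 + \<Lambda> (\<lambda>y. sg y * r1 y)) - (\<Lambda> r0 + \<Lambda> (\<lambda>y. sg y * r0 y)) - (1 - ?x * \<mu>b) * \<Lambda> q"
  unfolding flux0 flux1 by (simp add: algebra_simps)
 also have "\<dots> = - 2 * ?P * X - (1 - ?x * \<mu>b) * \<Lambda> q"
  unfolding \<Lambda>_fold[OF bounded_r(1)] \<Lambda>_fold[OF bounded_r(2)] X_def by (simp add: algebra_simps)
 finally have II: "\<psi> * (I1 - I0) = - 2 * ?P * X - (1 - ?x * \<mu>b) * \<Lambda> q" .
 have Lq: "\<Lambda> q = - 2 * ((E y0 - ?P) / (\<i> * k * (\<theta> - \<psi>)) - E y0 / (\<i> * k * (\<theta> + \<psi>)))"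
  using decaying_exp_lower[OF \<psi> kth ne[symmetric] y0] \<Lambda>_scale[of "- 2" "exp_lower k \<theta>"]
  unfolding \<Lambda>_def by (simp only: q_def EE)
 \<comment> \<open>the contributions of the incident wave itself\<close>
 have xa: "xphase k \<psi> a * exp (- \<i> * k * of_real a * \<theta>\<^sup>2 / 2) = 1" using \<zeta>\<mu> by (simp add: per \<mu>_def)
 have xb: "xphase k \<psi> b * exp (- \<i> * k * of_real b * \<theta>\<^sup>2 / 2) = ?x * \<mu>b" by (simp add: \<mu>b_def)
 have split: "(LINT x:{x0<..<x1}|lborel. xphase k \<psi> x * comb (- 1) x y0)
   = (LINT x:{x0<..<x1}|lborel. xphase k \<psi> x * (comb (- 1) x y0 - incident k \<theta> x y0))
    + (LINT x:{x0<..<x1}|lborel. xphase k \<psi> x * incident k \<theta> x y0)"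
  if "x0 \<le> x1" "\<And>x. x \<in> {x0<..<x1} ==> x \<notin> range (node a b)" "{x0..x1} \<subseteq> {0..a}" for x0 x1
  using set_integral_add(2)[OF comb_xphase_integrable[OF m1 that(2,3) k\<psi>, of y0] xphase_incident(1)[OF kne that(1), of y0]]
  by (simp add: distrib_left[symmetric] right_diff_distrib)
 define U where "U = E y0 * 2 * (1 - ?x * \<mu>b) / (\<i> * k * (\<psi>\<^sup>2 - \<theta>\<^sup>2))"
 have U0: "(LINT x:{0<..<b}|lborel. xphase k \<psi> x * incident k \<theta> x y0) = - U"
 proof -
  have e0: "exp (- \<i> * k * of_real 0 * \<theta>\<^sup>2 / 2) = 1" by simp
  have "e * 2 * (w - 1 * 1) / d = - (e * 2 * (1 - w) / d)" for e w d :: complex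
   unfolding minus_divide_left by (rule arg_cong[where f = "\<lambda>z. z / d"]) (simp add: algebra_simps)
  then show ?thesis unfolding xphase_incident(2)[OF kne less_imp_le[OF b0]] xb x0 e0 U_def .
 qed
 have U1: "(LINT x:{b<..<a}|lborel. xphase k \<psi> x * incident k \<theta> x y0) = U"
  unfolding xphase_incident(2)[OF kne less_imp_le[OF ba]] xb xa U_def ..
 have S0: "(LINT x:{0<..<b}|lborel. xphase k \<psi> x * comb (- 1) x y0) = I0 - U"
  by (subst split[OF less_imp_le[OF b0] nn0 sub(1)]) (assumption, simp add: U0 I0_def)
 have S1: "(LINT x:{b<..<a}|lborel. xphase k \<psi> x * comb (- 1) x y0) = I1 + U"
  by (subst split[OF less_imp_le[OF ba] nnb sub(2)]) (assumption, simp add: U1 I1_def)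
 have kd: "k * (\<theta> - \<psi>) \<noteq> 0" using kne ne by auto
 have alg: "\<i> * k * (\<theta> - \<psi>) * (2 * \<psi> * U - (1 - ?x * \<mu>b) * \<Lambda> q) = - 2 * ?P * (1 - ?x * \<mu>b)"
 proof -
  have "\<i> * k * (\<theta> - \<psi>) * (2 * \<psi> * (e * 2 * w / (\<i> * k * (\<psi>\<^sup>2 - \<theta>\<^sup>2))) - w * (- 2 * ((e - p) / (\<i> * k * (\<theta> - \<psi>)) - e / (\<i> * k * (\<theta> + \<psi>)))))
    = - 2 * p * w" for e w p
  proof -
   have f: "\<psi>\<^sup>2 - \<theta>\<^sup>2 = - ((\<theta> - \<psi>) * (\<theta> + \<psi>))" by (simp add: power2_eq_square algebra_simps)
   have nz: "k \<noteq> 0" "\<theta> - \<psi> \<noteq> 0" "\<theta> + \<psi> \<noteq> 0" using kd sum_ne by auto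
   have "(\<theta> - \<psi>) + 2 * \<psi> = \<theta> + \<psi>" by simp
   show ?thesis unfolding f using nz by (simp add: divide_simps) (simp add: algebra_simps)
  qed
  then show ?thesis unfolding U_def Lq .
 qed
 have emb: "1 - ?x * \<mu>b + \<i> * k * (\<theta> - \<psi>) * X
   = directivity a b k 1 \<theta> * directivity a b k 0 \<psi> - ?x * (\<mu>b * directivity a b k 0 \<theta> * directivity a b k 1 \<psi>)"
 proof -
  have "?x * xphase k \<psi> (a - b) = \<zeta>" by (simp add: per flip: xphase_add)
  from embedding_formula[OF \<psi> this] show ?thesis
   by (simp only: X_def directivity_edges[OF z(2) \<psi> per] directivity_edges[OF z(2) kth phase_relation(1)] mult_1_left)
 qed
 have "\<i> * k * \<psi> * (\<theta> - \<psi>) * ((I1 + U) - (I0 - U))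
   = \<i> * k * (\<theta> - \<psi>) * (\<psi> * (I1 - I0)) + \<i> * k * (\<theta> - \<psi>) * (2 * \<psi> * U)" by (simp add: algebra_simps)
 also have "\<dots> = - 2 * ?P * (\<i> * k * (\<theta> - \<psi>) * X) + \<i> * k * (\<theta> - \<psi>) * (2 * \<psi> * U - (1 - ?x * \<mu>b) * \<Lambda> q)"
  unfolding II by (simp only: right_diff_distrib mult_ac) simp
 also have "\<dots> = - 2 * ?P * (1 - ?x * \<mu>b + \<i> * k * (\<theta> - \<psi>) * X)" unfolding alg by (simp add: algebra_simps)
 finally show ?thesis unfolding S0 S1 emb by (simp add: algebra_simps)
qed

end

section \<open>The modes\<close>

text \<open>From \<open>k \<theta>\<^sup>2 = \<rho> > 0\<close> follow \<open>k = \<rho> / \<theta>\<^sup>2\<close> and \<open>k \<theta> = \<rho> / \<theta>\<close>, so \<open>Im k > 0\<close> and \<open>Re \<theta> > 0\<close> force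
 \<open>Im \<theta> < 0\<close>, that is \<open>Im (k \<theta>) > 0\<close>.\<close>

lemma incident_angle:
 assumes k: "0 < Im k" and \<theta>: "0 < Re \<theta>" and r: "k * \<theta>\<^sup>2 \<in> \<real>" "0 < Re (k * \<theta>\<^sup>2)"
 shows "0 < Im (k * \<theta>)"
proof -
 define \<rho> where "\<rho> = Re (k * \<theta>\<^sup>2)"
 have \<rho>: "k * \<theta>\<^sup>2 = of_real \<rho>" "0 < \<rho>" using r by (auto simp: \<rho>_def complex_is_Real_iff complex_eq_iff)
 have t0: "\<theta> \<noteq> 0" using \<theta> by auto
 define N where "N = (cmod \<theta>)\<^sup>2"
 have N: "0 < N" using t0 by (simp add: N_def)
 have c: "\<theta> * cnj \<theta> = of_real N" by (simp only: N_def complex_norm_square)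
 have kt: "k * \<theta> * of_real N = of_real \<rho> * cnj \<theta>"
 proof -
  have "k * \<theta> * of_real N = k * \<theta>\<^sup>2 * cnj \<theta>" by (simp add: c[symmetric] power2_eq_square)
  then show ?thesis by (simp only: \<rho>)
 qed
 have i1: "Im (k * \<theta>) * N = - \<rho> * Im \<theta>" using arg_cong[OF kt, of Im] by simp
 have "k * of_real N * of_real N = of_real \<rho> * (cnj \<theta>)\<^sup>2"
 proof -
  have "k * of_real N * of_real N = (k * \<theta> * of_real N) * cnj \<theta>" by (simp add: c[symmetric] mult_ac)
  then show ?thesis by (simp only: kt) (simp add: power2_eq_square)
 qed
 from arg_cong[OF this, of Im] have "Im k * N * N = - (\<rho> * 2 * Re \<theta>) * Im \<theta>" by (simp add: power2_eq_square)
 moreover have "0 < Im k * N * N" using k N by simp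
 ultimately have "0 < - (\<rho> * 2 * Re \<theta>) * Im \<theta>" by simp
 then have "Im \<theta> < 0" using \<rho>(2) \<theta> by (simp add: zero_less_mult_iff mult_less_0_iff)
 then have "0 < Im (k * \<theta>) * N" unfolding i1 using \<rho>(2) by (simp add: mult_pos_neg)
 then show ?thesis using N by (simp only: zero_less_mult_pos2)
qed

context grating
begin

lemma psi_square: "(psi a k \<theta> m)\<^sup>2 = \<theta>\<^sup>2 + 4 * of_real pi * of_int m / (k * of_real a)"
 by (simp add: psi_def Let_def)

lemma k_psi_square: "k * (psi a k \<theta> m)\<^sup>2 = k * \<theta>\<^sup>2 + of_real (4 * pi * of_int m / a)"
 using k0 a0 by (simp add: psi_square field_simps)

lemma k_psi_square_real: "k * (psi a k \<theta> m)\<^sup>2 \<in> \<real>"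
 unfolding k_psi_square by (intro Reals_add kth2 Reals_of_real)

lemma xphase_psi: "xphase k (psi a k \<theta> m) x = exp (\<i> * of_real x * (k * \<theta>\<^sup>2) / 2) * exp (\<i> * of_real (2 * pi * of_int m / a * x))"
proof -
 have "xphase k (psi a k \<theta> m) x = exp (\<i> * of_real x * (k * (psi a k \<theta> m)\<^sup>2) / 2)" by (simp add: xphase_def mult_ac)
 also have "\<dots> = exp (\<i> * of_real x * (k * \<theta>\<^sup>2) / 2 + \<i> * of_real (2 * pi * of_int m / a * x))"
  unfolding k_psi_square using a0 by (simp add: field_simps)
 finally show ?thesis by (simp add: exp_add)
qed

lemma xphase_psi_period: "xphase k (psi a k \<theta> m) a = \<zeta>"
proof -
 have "exp (\<i> * of_real (2 * pi * of_int m / a * a)) = exp ((2 * of_int m * pi) * \<i>)" using a0 by (simp add: mult_ac)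
 also have "\<dots> = 1" by (rule exp_integer_2pi[OF Ints_of_int])
 finally show ?thesis unfolding xphase_psi \<zeta>_def by (simp add: mult_ac)
qed

text \<open>The number \<open>k \<psi>\<^sup>2\<close> is real and \<open>k\<close> is not; so \<open>k \<psi>\<close> could only be real for \<open>\<psi> = 0\<close>, and the choice of
 the branch does the rest.\<close>

lemma psi_decays:
 assumes "psi a k \<theta> m \<noteq> 0"
 shows "0 < Im (k * psi a k \<theta> m)"
proof (rule ccontr)
 assume neg: "\<not> 0 < Im (k * psi a k \<theta> m)"
 then have "Im (k * psi a k \<theta> m) = 0" unfolding psi_def Let_def by (auto split: if_splits)
 then have "k * psi a k \<theta> m \<in> \<real>" by (simp add: complex_is_Real_iff)
 from Reals_mult[OF this this] have "(k * psi a k \<theta> m) * (k * psi a k \<theta> m) \<in> \<real>" .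
 moreover have "(k * psi a k \<theta> m) * (k * psi a k \<theta> m) = k * (k * (psi a k \<theta> m)\<^sup>2)" by (simp add: power2_eq_square)
 moreover obtain r where r: "k * (psi a k \<theta> m)\<^sup>2 = of_real r" using k_psi_square_real Reals_cases by blast
 ultimately have "Im k * r = 0" by (simp add: complex_is_Real_iff)
 then have "k * (psi a k \<theta> m)\<^sup>2 = 0" using k r by simp
 then show False using k0 assms by simp
qed

lemma psi_neq: "m \<noteq> 0 ==> psi a k \<theta> m \<noteq> \<theta>"
 using psi_square[of m] a0 k0 by auto

text \<open>If the Floquet factor were 1, one of the modes would be at its cut off.\<close>

lemma zeta_neq_1:
 assumes "\<And>m. psi a k \<theta> m \<noteq> 0"
 shows "\<zeta> \<noteq> 1"
proof
 assume "\<zeta> = 1"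
 then obtain j where j: "\<i> * k * of_real a * \<theta>\<^sup>2 / 2 = of_real (of_int (2 * j) * pi) * \<i>"
  unfolding \<zeta>_def exp_eq_1 by (metis (no_types, lifting) complex_eq_iff exp_eq_1 mult.commute mult_1_right Re_i_times Im_i_times complex_of_real_i Re_complex_of_real Im_complex_of_real minus_zero)
 then have "k * \<theta>\<^sup>2 * of_real a = of_real (4 * pi * of_int j)" by (simp add: field_simps)
 then have "k * \<theta>\<^sup>2 = of_real (4 * pi * of_int j / a)" using a0 by (simp add: field_simps)
 then have "k * (psi a k \<theta> (- j))\<^sup>2 = 0" unfolding k_psi_square by simp
 then show False using assms k0 by simp
qed

text \<open>For fixed \<open>y\<close> the Floquet expansion is a Fourier series in \<open>x\<close>, which converges absolutely because a
 sum over all integers does.  In the sheets of the expansion the two values are interchanged for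
 \<open>0 < x < b\<close>; this produces the factor \<open>\<tau>\<close> in front of the first integral.\<close>

lemma fourier_coefficient:
 assumes T: "transmission_coefficients a b k \<theta> u T" and \<tau>: "\<tau> = 1 \<or> \<tau> = - 1" and y: "y < 0"
 shows "of_real a * (T 1 n + \<tau> * T 2 n) * exp (- \<i> * k * psi a k \<theta> n * of_real y)
  = \<tau> * (LINT x:{0<..<b}|lborel. xphase k (psi a k \<theta> n) x * comb \<tau> x y)
   + (LINT x:{b<..<a}|lborel. xphase k (psi a k \<theta> n) x * comb \<tau> x y)"
proof -
 define c where "c m = (T 1 m + \<tau> * T 2 m) * exp (- \<i> * k * psi a k \<theta> m * of_real y)" for m
 define S where "S x = resheet a b u x y 1 + \<tau> * resheet a b u x y 2" for x
 define e where "e m x = exp (\<i> * of_real (2 * pi * of_int m / a * x))" for m :: int and x :: real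
 have ne: "cmod (e m x) = 1" for m x by (simp add: e_def)
 have ec: "continuous_on A (e m)" for A m unfolding e_def by (intro continuous_intros)
 have em[measurable]: "e m \<in> borel_measurable borel" for m unfolding e_def by measurable
 let ?n = "psi a k \<theta> n"
 have hs: "((\<lambda>m. c m * (xphase k ?n x * exp (- \<i> * k * of_real x * (psi a k \<theta> m)\<^sup>2 / 2))) has_sum xphase k ?n x * S x) UNIV" for x
 proof -
  have "((\<lambda>m. T \<nu> m * exp (- \<i> * k * of_real x * (psi a k \<theta> m)\<^sup>2 / 2 - \<i> * k * psi a k \<theta> m * of_real y))
    has_sum resheet a b u x y \<nu>) UNIV" if "\<nu> \<in> {1, 2}" for \<nu>
   using T that y unfolding transmission_coefficients_def scattered_def by auto
  from has_sum_cmult_right[OF has_sum_add[OF this[of 1] has_sum_cmult_right[OF this[of 2], of \<tau>]], of "xphase k ?n x"]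
  have "((\<lambda>m. xphase k ?n x * (T 1 m * exp (- \<i> * k * of_real x * (psi a k \<theta> m)\<^sup>2 / 2 - \<i> * k * psi a k \<theta> m * of_real y)
    + \<tau> * (T 2 m * exp (- \<i> * k * of_real x * (psi a k \<theta> m)\<^sup>2 / 2 - \<i> * k * psi a k \<theta> m * of_real y)))) has_sum xphase k ?n x * S x) UNIV"
   by (simp add: S_def)
  moreover have "exp (- \<i> * k * of_real x * (psi a k \<theta> m)\<^sup>2 / 2 - \<i> * k * psi a k \<theta> m * of_real y)
    = exp (- \<i> * k * of_real x * (psi a k \<theta> m)\<^sup>2 / 2) * exp (- \<i> * k * psi a k \<theta> m * of_real y)" for m
   by (simp flip: exp_add)
  ultimately show ?thesis by (simp only: c_def distrib_right distrib_left mult_ac)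
 qed
 have ph: "xphase k ?n x * exp (- \<i> * k * of_real x * (psi a k \<theta> m)\<^sup>2 / 2) = e (n - m) x" for m x
 proof -
  have "exp (- \<i> * k * of_real x * (psi a k \<theta> m)\<^sup>2 / 2) = inverse (xphase k (psi a k \<theta> m) x)"
   by (simp add: xphase_def flip: exp_minus)
  moreover have "e n x = e m x * e (n - m) x"
   by (simp add: e_def ring_distribs diff_divide_distrib flip: exp_add)
  moreover obtain K where K: "K \<noteq> 0" "\<And>j. xphase k (psi a k \<theta> j) x = K * e j x"
   using xphase_psi[of _ x] by (metis e_def exp_not_eq_zero)
  moreover have "e m x \<noteq> 0" by (simp add: e_def)
  ultimately show ?thesis by (simp add: K(2) field_simps)
 qed
 note hs = hs[unfolded ph]
 have bij: "bij_betw int_decode UNIV UNIV" by (rule bij_int_decode)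
 \<comment> \<open>the modes are enumerated in order to integrate term by term\<close>
 define f where "f i x = indicator {0<..<a} x *\<^sub>R (c (int_decode i) * e (n - int_decode i) x)" for i x
 have fs: "(\<lambda>i. c (int_decode i) * e (n - int_decode i) x) sums (xphase k ?n x * S x)" for x
  using has_sum_imp_sums[of "\<lambda>i. c (int_decode i) * e (n - int_decode i) x"] has_sum_reindex_bij_betw[OF bij, of "\<lambda>m. c m * e (n - m) x"] hs by blast
 have sc: "summable (\<lambda>i. cmod (c (int_decode i)))"
 proof -
  have "(\<lambda>m. c m * e (n - m) 0) summable_on UNIV" using hs[of 0] by (auto simp: summable_on_def)
  then have "(\<lambda>m. cmod (c m * e (n - m) 0)) summable_on UNIV" by (simp only: summable_on_iff_abs_summable_on_complex)
  then have "(\<lambda>m. cmod (c m)) summable_on UNIV" by (simp add: norm_mult ne)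
  then have "(\<lambda>i. cmod (c (int_decode i))) summable_on UNIV" using summable_on_reindex_bij_betw[OF bij, of "\<lambda>m. cmod (c m)"] by simp
  then show ?thesis by (rule summable_on_imp_summable)
 qed
 have fi: "integrable lborel (f i)" for i
 proof -
  have "set_integrable lborel {0..a} (\<lambda>x. c (int_decode i) * e (n - int_decode i) x)"
   by (intro borel_integrable_atLeastAtMost' continuous_intros ec)
  then have "set_integrable lborel {0<..<a} (\<lambda>x. c (int_decode i) * e (n - int_decode i) x)" by (rule set_integrable_subset) auto
  then show ?thesis by (simp add: set_integrable_def f_def[abs_def])
 qed
 have nf: "norm (f i x) = indicator {0<..<a} x * cmod (c (int_decode i))" for i x
  by (simp add: f_def norm_mult ne)
 have A: "AE x in lborel. summable (\<lambda>i. norm (f i x))" unfolding nf by (intro AE_I2 summable_mult sc)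
 have I: "summable (\<lambda>i. LINT x|lborel. norm (f i x))"
  unfolding nf using a0 sc by (simp add: summable_mult)
 have suf: "(\<Sum>i. f i x) = indicator {0<..<a} x *\<^sub>R (xphase k ?n x * S x)" for x
  using sums_unique[OF sums_scaleR_right[OF fs[of x], of "indicator {0<..<a} x"]] by (simp add: f_def)
 note si = sums_integral[OF fi A I, unfolded suf] and ii = integrable_suminf[OF fi A I, unfolded suf]
 have int0: "(LINT x|lborel. f i x) = (if int_decode i = n then of_real a * c n else 0)" for i
 proof (cases "int_decode i = n")
  case True
  then show ?thesis using a0 by (simp add: f_def e_def scaleR_conv_of_real)
 next
  case False
  define w where "w = \<i> * of_real (2 * pi * of_int (n - int_decode i) / a)"
  have w0: "w \<noteq> 0" using False a0 by (simp add: w_def)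
  have e: "e (n - int_decode i) x = exp (w * of_real x)" for x by (simp add: e_def w_def mult_ac)
  have "(LINT x|lborel. f i x) = c (int_decode i) * (LINT x:{0<..<a}|lborel. exp (w * of_real x))"
   unfolding f_def e set_lebesgue_integral_def by (simp add: mult.left_commute flip: mult_scaleR_right)
  also have "exp (w * of_real a) = exp ((2 * of_int (n - int_decode i) * pi) * \<i>)" using a0 by (simp add: w_def mult_ac)
  then have "exp (w * of_real a) = 1" by (simp only: exp_integer_2pi[OF Ints_of_int])
  then have "(LINT x:{0<..<a}|lborel. exp (w * of_real x)) = 0" using integral_exp_interval[OF w0 less_imp_le[OF a0]] by simp
  finally show ?thesis using False by simp
 qed
 have "(\<lambda>i. LINT x|lborel. f i x) sums (of_real a * c n)"
 proof -
  have "int_decode i = n \<longleftrightarrow> i = int_encode n" for i by auto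
  then show ?thesis unfolding int0 using sums_single[of "int_encode n" "\<lambda>i. of_real a * c n"] by (simp only:)
 qed
 then have eq: "of_real a * c n = (LINT x:{0<..<a}|lborel. xphase k ?n x * S x)"
  using si sums_unique2 unfolding set_lebesgue_integral_def by blast
 have sii: "set_integrable lborel {0<..<a} (\<lambda>x. xphase k ?n x * S x)" using ii by (simp add: set_integrable_def)
 have "(LINT x:{0<..<a}|lborel. xphase k ?n x * S x) = (LINT x:{0<..<b} \<union> {b<..<a}|lborel. xphase k ?n x * S x)"
  unfolding set_lebesgue_integral_def
 proof (rule integral_cong_AE)
  show "AE x in lborel. indicator {0<..<a} x *\<^sub>R (xphase k ?n x * S x) = indicator ({0<..<b} \<union> {b<..<a}) x *\<^sub>R (xphase k ?n x * S x)"
   using AE_lborel_singleton[of b] by eventually_elim (use b0 ba in \<open>auto simp: indicator_def\<close>)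
  have "set_integrable lborel ({0<..<b} \<union> {b<..<a}) (\<lambda>x. xphase k ?n x * S x)"
   by (rule set_integrable_subset[OF sii]) (use b0 ba in auto)
  then show "(\<lambda>x. indicator ({0<..<b} \<union> {b<..<a}) x *\<^sub>R (xphase k ?n x * S x)) \<in> borel_measurable lborel"
   unfolding set_integrable_def by (rule borel_measurable_integrable)
 qed (rule borel_measurable_integrable[OF ii])
 also have "\<dots> = (LINT x:{0<..<b}|lborel. xphase k ?n x * S x) + (LINT x:{b<..<a}|lborel. xphase k ?n x * S x)"
  by (rule set_integral_Un) (use b0 ba in \<open>auto intro!: set_integrable_subset[OF sii]\<close>)
 also have "(LINT x:{0<..<b}|lborel. xphase k ?n x * S x) = (LINT x:{0<..<b}|lborel. \<tau> * (xphase k ?n x * comb \<tau> x y))"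
 proof (rule set_lebesgue_integral_cong)
  show "\<forall>x. x \<in> {0<..<b} \<longrightarrow> xphase k ?n x * S x = \<tau> * (xphase k ?n x * comb \<tau> x y)"
   using \<tau> y by (auto simp: S_def comb_def resheet_cases(2) algebra_simps)
 qed simp
 also have "(LINT x:{b<..<a}|lborel. xphase k ?n x * S x) = (LINT x:{b<..<a}|lborel. xphase k ?n x * comb \<tau> x y)"
  by (rule set_lebesgue_integral_cong) (auto simp: S_def comb_def resheet_cases(3))
 finally show ?thesis using eq by (simp add: c_def mult.assoc)
qed

text \<open>The sum over the sheets does not notice the branch points, so it solves the recursion of the nodes
 without sign changes.  Its deviation from the incident wave is a bounded solution without sources,
 and these vanish because \<open>1 - \<zeta> P\<close> is bounded below.\<close>

lemma comb_sum_incident: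
 assumes z: "\<zeta> \<noteq> 1" and x: "x \<in> {0<..<b} \<or> x \<in> {b<..<a}"
 shows "comb 1 x y = incident k \<theta> x y"
proof -
 have p1: "(1 :: complex) = 1 \<or> (1 :: complex) = - 1" by simp
 obtain v0 v1 B where v: "v1 = heat k b (\<lambda>y. jump 1 y * v0 y)" "v0 = (\<lambda>y. \<zeta> * heat k (a - b) (\<lambda>y. jump 1 y * v1 y) y)"
  and bd: "exp_bounded B 0 (\<lambda>y. v0 y - E y)" "exp_bounded B 0 (\<lambda>y. v1 y - \<mu>b * E y)"
  and c: "\<And>x y. x \<in> {0<..<b} ==> comb 1 x y = heat k x (\<lambda>y. jump 1 y * v0 y) y"
   "\<And>x y. x \<in> {b<..<a} ==> comb 1 x y = heat k (x - b) (\<lambda>y. jump 1 y * v1 y) y"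
  by (rule slices[OF p1]) (rule that)
 note j = jump_simps
 define r where "r y = v0 y - E y" for y
 have rb: "exp_bounded B 0 r" using bd(1) by (simp add: r_def[abs_def])
 have ab: "0 < a - b" using ba by simp
 have c0: "0 \<le> Im (k * \<theta>)" using kth by simp
 have v0r: "v0 = (\<lambda>y. r y + E y)" by (simp add: r_def)
 have hv: "heat k t v0 = (\<lambda>y. heat k t r y + exp (- \<i> * k * of_real t * \<theta>\<^sup>2 / 2) * E y)" if "0 < t" for t
  unfolding v0r by (subst heat_exp_bounded_add[OF k that rb E_exp_bounded order_refl c0]) (simp add: heat_E that)
 have v1r: "v1 = (\<lambda>y. heat k b r y + \<mu>b * E y)" using v(1) hv[OF b0] by (simp add: j \<mu>b_def)
 obtain B' where hb: "exp_bounded B' 0 (heat k b r)" by (rule kernel_conv_exp_bounded[OF k b0 rb order_refl]) (rule that)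
 have bE: "exp_bounded (cmod \<mu>b * 1) (Im (k * \<theta>)) (\<lambda>y. \<mu>b * E y)" by (rule exp_bounded_scale[OF E_exp_bounded])
 have mm: "\<zeta> * (\<mu>b * exp (- \<i> * k * of_real (a - b) * \<theta>\<^sup>2 / 2)) = 1"
  by (simp add: \<zeta>_def \<mu>b_def algebra_simps diff_divide_distrib flip: exp_add)
 have hv1: "heat k t v1 = (\<lambda>y. heat k t (heat k b r) y + \<mu>b * exp (- \<i> * k * of_real t * \<theta>\<^sup>2 / 2) * E y)" if "0 < t" for t
  unfolding v1r by (subst heat_exp_bounded_add[OF k that hb bE order_refl c0]) (simp add: heat_scale[OF k that] heat_E that mult.assoc)
 interpret plain: two_step k "\<lambda>y. 1" b "a - b"
  using sign_factor_jump[OF p1] by unfold_locales (use k b0 ab in \<open>auto simp: j\<close>)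
 have req: "r y = \<zeta> * period k (\<lambda>y. 1) b (a - b) r y + 0" for y
 proof -
  have "r y + E y = v0 y" by (simp add: r_def)
  also have "v0 y = \<zeta> * heat k (a - b) v1 y" by (subst v(2)) (simp add: j)
  also have "\<dots> = \<zeta> * heat k (a - b) (heat k b r) y + \<zeta> * (\<mu>b * exp (- \<i> * k * of_real (a - b) * \<theta>\<^sup>2 / 2)) * E y"
   unfolding hv1[OF ab] by (simp only: distrib_left mult.assoc)
  finally show ?thesis unfolding mm by (simp add: period_def hstep_def)
 qed
 have rm: "r \<in> borel_measurable borel" and rB: "\<And>y. cmod (r y) \<le> B" using rb by (auto simp: exp_bounded_def)
 have L0: "L2 (\<lambda>y. 0)" and n0: "nsq (\<lambda>y. 0) = 0" by (simp_all add: L2_def nsq_def)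
 have Lr: "L2 r" by (rule plain.bounded_resolvent_L2(1)[OF norm_\<zeta> z rm rB L0 req])
 have nr: "nsq r = 0" by (rule plain.bounded_resolvent_L2(2)[OF norm_\<zeta> z rm rB L0 req n0])
 have "AE y in lborel. r y = 0"
  using Lr nr integral_nonneg_eq_0_iff_AE[of lborel "\<lambda>y. (cmod (r y))\<^sup>2"] by (simp add: L2_def nsq_def)
 then have hr: "heat k t r = (\<lambda>y. 0)" for t
  unfolding heat_def conv_def by (intro ext integral_eq_zero_AE) (auto elim: eventually_mono)
 from x show ?thesis
 proof
  assume x: "x \<in> {0<..<b}"
  then show ?thesis using c(1)[OF x, of y] hv[of x] by (simp add: j hr incident_E)
 next
  assume x: "x \<in> {b<..<a}"
  have h0: "heat k t (\<lambda>y. 0) y = 0" for t y by (simp add: heat_def conv_def)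
  have "\<mu>b * exp (- \<i> * k * of_real (x - b) * \<theta>\<^sup>2 / 2) = exp (- \<i> * k * of_real x * \<theta>\<^sup>2 / 2)"
   by (simp add: \<mu>b_def algebra_simps diff_divide_distrib flip: exp_add)
  then show ?thesis using x c(2)[OF x, of y] hv1[of "x - b"] by (simp add: j hr h0 incident_E)
 qed
qed

text \<open>Half the difference of the sheets carries \<open>T 1 n\<close>, because their sum carries nothing for \<open>n \<noteq> 0\<close>.\<close>

lemma transmission_formula:
 assumes T: "transmission_coefficients a b k \<theta> u T" and p0: "\<And>m. psi a k \<theta> m \<noteq> 0" and n: "n \<noteq> 0"
 defines "\<psi> \<equiv> psi a k \<theta> n"
 shows "T 2 n = - T 1 n"
  and "\<i> * k * of_real a * \<psi> * (\<theta> - \<psi>) * T 1 n = - directivity a b k 0 \<psi> * directivity a b k 1 \<theta>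
    + directivity a b k 1 \<psi> * directivity a b k 0 \<theta> * (xphase k \<psi> b * \<mu>b)"
proof -
 have z: "\<zeta> \<noteq> 1" by (rule zeta_neq_1[OF p0])
 have \<psi>: "0 < Im (k * \<psi>)" unfolding \<psi>_def by (rule psi_decays[OF p0])
 have ne: "\<psi> \<noteq> \<theta>" unfolding \<psi>_def by (rule psi_neq[OF n])
 have per: "xphase k \<psi> a = \<zeta>" unfolding \<psi>_def by (rule xphase_psi_period)
 have kr: "k * \<psi>\<^sup>2 \<in> \<real>" unfolding \<psi>_def by (rule k_psi_square_real)
 have kne: "k * (\<psi>\<^sup>2 - \<theta>\<^sup>2) \<noteq> 0" unfolding \<psi>_def psi_square using n a0 k0 by simp
 let ?y = "- 1 :: real" and ?P = "exp (- \<i> * k * \<psi> * of_real (- 1))"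
 have P0: "?P \<noteq> 0" by simp
 have "of_real a * (T 1 n + 1 * T 2 n) * ?P
   = 1 * (LINT x:{0<..<b}|lborel. xphase k \<psi> x * comb 1 x ?y) + (LINT x:{b<..<a}|lborel. xphase k \<psi> x * comb 1 x ?y)"
  unfolding \<psi>_def by (rule fourier_coefficient[OF T]) auto
 also have "(LINT x:{0<..<b}|lborel. xphase k \<psi> x * comb 1 x ?y) = (LINT x:{0<..<b}|lborel. xphase k \<psi> x * incident k \<theta> x ?y)"
  by (rule set_lebesgue_integral_cong) (auto simp: comb_sum_incident[OF z])
 also have "(LINT x:{b<..<a}|lborel. xphase k \<psi> x * comb 1 x ?y) = (LINT x:{b<..<a}|lborel. xphase k \<psi> x * incident k \<theta> x ?y)"
  by (rule set_lebesgue_integral_cong) (auto simp: comb_sum_incident[OF z])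
 finally have "of_real a * (T 1 n + T 2 n) * ?P
   = E ?y * 2 * (xphase k \<psi> a * \<mu> - xphase k \<psi> 0) / (\<i> * k * (\<psi>\<^sup>2 - \<theta>\<^sup>2))"
  unfolding xphase_incident(2)[OF kne less_imp_le[OF b0]] xphase_incident(2)[OF kne less_imp_le[OF ba]]
  by (simp add: \<mu>_def add_divide_distrib[symmetric] distrib_left[symmetric])
 also have "\<dots> = 0" using \<zeta>\<mu> by (simp add: per) (simp add: xphase_def)
 finally have s: "T 1 n + T 2 n = 0" using a0 by simp
 then show t2: "T 2 n = - T 1 n" by (simp add: eq_neg_iff_add_eq_0 add.commute)
 have "of_real a * (T 1 n + (- 1) * T 2 n) * ?P
   = (- 1) * (LINT x:{0<..<b}|lborel. xphase k \<psi> x * comb (- 1) x ?y) + (LINT x:{b<..<a}|lborel. xphase k \<psi> x * comb (- 1) x ?y)"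
  unfolding \<psi>_def by (rule fourier_coefficient[OF T]) auto
 then have F: "(LINT x:{b<..<a}|lborel. xphase k \<psi> x * comb (- 1) x ?y) - (LINT x:{0<..<b}|lborel. xphase k \<psi> x * comb (- 1) x ?y)
   = of_real a * (2 * T 1 n) * ?P" using t2 by (simp add: algebra_simps)
 define Q where "Q = - directivity a b k 0 \<psi> * directivity a b k 1 \<theta> + directivity a b k 1 \<psi> * directivity a b k 0 \<theta> * (xphase k \<psi> b * \<mu>b)"
 have "\<i> * k * \<psi> * (\<theta> - \<psi>) * (of_real a * (2 * T 1 n) * ?P) = 2 * ?P * Q"
  unfolding F[symmetric] Q_def by (rule mode_integral[OF z \<psi> per ne kr]) simp
 then have "(2 * ?P) * (\<i> * k * of_real a * \<psi> * (\<theta> - \<psi>) * T 1 n) = (2 * ?P) * Q" by (simp only: mult_ac)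
 then have "\<i> * k * of_real a * \<psi> * (\<theta> - \<psi>) * T 1 n = Q" using P0 by (simp only: mult_cancel_left) simp
 then show "\<i> * k * of_real a * \<psi> * (\<theta> - \<psi>) * T 1 n = - directivity a b k 0 \<psi> * directivity a b k 1 \<theta>
    + directivity a b k 1 \<psi> * directivity a b k 0 \<theta> * (xphase k \<psi> b * \<mu>b)" by (simp only: Q_def)
qed

end

theorem proposition5:
  fixes a b :: real and k \<theta> :: complex
    and u :: surface_fun and T :: "nat => int => complex" and n :: int
  assumes "0 < b" and "b < a"
    and "0 < Re k" and "0 < Im k"
    and "0 < Re \<theta>" and "k * \<theta>\<^sup>2 \<in> \<real>" and "0 < Re (k * \<theta>\<^sup>2)"
    and "\<And>m. psi a k \<theta> m \<noteq> 0"
    and "total_field a b k \<theta> u"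
    and "transmission_coefficients a b k \<theta> u T"
    and "n \<noteq> 0"
  shows "T 1 n =
      (- directivity a b k 0 (psi a k \<theta> n) * directivity a b k 1 \<theta>
       + directivity a b k 1 (psi a k \<theta> n) * directivity a b k 0 \<theta>
         * exp (\<i> * k * of_real b * ((psi a k \<theta> n)\<^sup>2 - \<theta>\<^sup>2) / 2))
      / (\<i> * k * of_real a * psi a k \<theta> n * (\<theta> - psi a k \<theta> n))
    \<and> T 2 n = - T 1 n"
proof -
  interpret grating a b k \<theta> u
    by unfold_locales (use assms incident_angle in blast)+
  let ?\<psi> = "psi a k \<theta> n"
  have nz: "\<i> * k * of_real a * ?\<psi> * (\<theta> - ?\<psi>) \<noteq> 0" using k0 a0 assms(8) psi_neq[OF assms(11)] by auto
  have ph: "xphase k ?\<psi> b * \<mu>b = exp (\<i> * k * of_real b * (?\<psi>\<^sup>2 - \<theta>\<^sup>2) / 2)"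
    by (simp add: xphase_def \<mu>b_def algebra_simps diff_divide_distrib flip: exp_add)
  note tr = transmission_formula[OF assms(10,8,11)]
  from tr(2) have "T 1 n = (- directivity a b k 0 ?\<psi> * directivity a b k 1 \<theta>
       + directivity a b k 1 ?\<psi> * directivity a b k 0 \<theta> * (xphase k ?\<psi> b * \<mu>b)) / (\<i> * k * of_real a * ?\<psi> * (\<theta> - ?\<psi>))"
    by (subst nonzero_eq_divide_eq[OF nz]) (simp only: mult.commute[of "T 1 n"])
  then show ?thesis unfolding ph using tr(1) by blast
qed

end
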